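(* Let $0<\alpha\le 1$, $T\ge 16$, $H>0$ and $0<\varepsilon\le 1$. Then $$\int_T^{T+H}|\zeta(\sigma+it,\alpha)|\,dt \gg \min\left(H,\left(\frac{H}{200}\right)^{\frac{7}{6H\varepsilon}}\right)$$ whenever $\sigma\ge 1-\frac{\pi H(1-\varepsilon)}{4\log\log T}$, with an implied constant independent of $T,H,\sigma,\varepsilon,\alpha$. Furthermore the same estimate holds when $\zeta(\sigma+it,\alpha)$ is replaced by the Lerch zeta-function $\phi(\alpha,\beta,\sigma+it)$, for any $0<\alpha,\beta\le 1$.
   Context: The Hurwitz zeta-function is $\zeta(s,\alpha)=\sum_{n=0}^\infty (n+\alpha)^{-s}$ for $\Re(s)>1$, extended meromorphically to $\mathbb{C}$ (with only a pole at $s=1$). The Lerch zeta-function is $\phi(\alpha,\beta,s)=\sum_{n=0}^\infty e^{2\pi i n\beta}(n+\alpha)^{-s}$ (one of the two parameters being the shift and the other the frequency; both range over $(0,1]$), extended analytically/meromorphically to $\mathbb{C}$. *)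

theory Defs
  imports "HOL-Complex_Analysis.Complex_Analysis"
begin

text \<open>
  Meromorphic continuation of \<open>f\<close> from \<open>A\<close> to the whole plane. The library predicate
  \<^const>\<open>nicely_meromorphic_on\<close> makes the function analytic away from its poles and
  normalises its value at every pole to \<open>0\<close>, so that the continuation is unique as a total
  function whenever \<open>A\<close> is open and nonempty.
\<close>
definition meromorphic_extension :: "(complex \<Rightarrow> complex) \<Rightarrow> complex set \<Rightarrow> complex \<Rightarrow> complex" where
  "meromorphic_extension f A =
     (THE F. F nicely_meromorphic_on UNIV \<and> (\<forall>s\<in>A. F s = f s))"

definition hurwitz_zeta :: "complex \<Rightarrow> real \<Rightarrow> complex" where
  "hurwitz_zeta s \<alpha> =
     meromorphic_extension (\<lambda>z. \<Sum>n. of_real (real n + \<alpha>) powr (- z)) {z. Re z > 1} s"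

text \<open>The first parameter is the shift, the second one the frequency.\<close>
definition lerch_phi :: "real \<Rightarrow> real \<Rightarrow> complex \<Rightarrow> complex" where
  "lerch_phi \<alpha> \<beta> s =
     meromorphic_extension
       (\<lambda>z. \<Sum>n. exp (2 * of_real pi * \<i> * of_nat n * of_real \<beta>) * of_real (real n + \<alpha>) powr (- z))
       {z. Re z > 1} s"

end

theory Submission
  imports Defs
begin

text \<open>
  For both functions the integral is at least \<open>c H exp (- C / min H 1)\<close> as soon as
  \<open>\<sigma> \<ge> 1 - \<pi> H / (4 log log T)\<close>, and \<open>(H/200)\<close> to the power \<open>7/(6 H \<epsilon>)\<close> is smaller than that up to a constant,
  because \<open>log (200/H)\<close> is unbounded as \<open>H\<close> tends to \<open>0\<close>. The Hurwitz zeta-function is the Lerch zeta-function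
  with frequency \<open>1\<close>, so only the latter is studied.

  Normalise the Dirichlet series to have constant term \<open>1\<close> and average it twice over vertical segments of length
  \<open>H/100\<close>. The result is bounded on \<open>Re s > 1\<close>, and the maximum principle on a disc segment shows that it cannot
  be very small on a whole segment of length comparable with \<open>min H 1\<close>. For \<open>0 \<le> \<sigma> \<le> 1\<close> the lower
  bound is carried from \<open>Re s > 1\<close> to \<open>Re s = \<sigma>\<close> by the two constants theorem on a rectangle of height
  proportional to \<open>H\<close>; the growth on the horizontal sides is beaten by a factor \<open>exp (- A cos (\<omega> z))\<close>, which is possible
  precisely when \<open>\<omega> H\<close> exceeds a multiple of \<open>log log T\<close>. Uniformity in the parameters needs an
  approximation of the function by the first terms of both sides of its functional equation: if one of the two dual terms exceeds
  a fixed power of \<open>T\<close> then it dominates, and otherwise the growth is polynomial. For \<open>\<sigma> < 0\<close> the functional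
  equation leads back to Dirichlet series, of which a shifted difference is taken to remove the leading term of the wrong one.
\<close>

section \<open>Integrals over a half-line\<close>

text \<open>Uniformity in \<alpha> and \<beta> is the main obstacle: \<alpha>^(-s) is unbounded as
  \<alpha> tends to 0, and so are the leading dual terms as \<beta> tends to 0 or 1, so no growth
  bound in T alone can hold. The factor \<alpha>^s removes the former; the latter are compared with
  a power of T. The right side of the rectangle is only about H / log log T away from Re s = 1.
  Bounding the series by the reciprocal of that distance would bring log log T into the result. Two
  averages over length h give terms of order 1 / (n (h log n)^2) on Re s = 1, with a convergent sum,
  at the price 1 / h^2; a single one would leave 1 / (n log n). The constant \<pi>/4 comes from the
  shape of the rectangle. With x = \<pi> H / (4 log log T) its half-width is at most 8x/15, and
  \<omega> is fixed by \<omega> 8x/15 = \<pi>/3, so that the cosine stays positive. Then cosh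
  (\<omega> d) reaches the size of log T once the half-height d is at least 2H/5, which fits into an
  interval of length H. The continuation is made explicit by an integral over a line Re z = c; its
  independence of c permits c -> 0, which yields the functional equation.\<close>

lemma integrable_on_halfline_dominated:
  fixes f :: "real \<Rightarrow> complex"
  assumes "continuous_on {0<..} f" "\<And>y. y > 0 \<Longrightarrow> norm (f y) \<le> g y" "g integrable_on {0<..}"
  shows "f integrable_on {0<..}"
proof (rule measurable_bounded_by_integrable_imp_integrable)
  show "f \<in> borel_measurable (lebesgue_on {0<..})"
    using assms(1) by (intro continuous_imp_measurable_on_sets_lebesgue) auto
qed (use assms in auto)

text \<open>The substitution t = \<delta> y in Euler's integral. The value is needed for the single
  terms of the dual series, the integrability for majorants of the form y^p exp (-\<delta>
  y).\<close>

lemma Gamma_integral_scaled: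
  fixes w :: complex and \<delta> :: real
  assumes "Re w > 0" "\<delta> > 0"
  shows "((\<lambda>y. of_real y powr (w - 1) * exp (- of_real (\<delta> * y))) has_integral
            Gamma w * of_real \<delta> powr (- w)) {0<..}"
    and "(\<lambda>y. of_real y powr (w - 1) * exp (- of_real (\<delta> * y))) absolutely_integrable_on {0<..}"
proof -
  let ?f = "\<lambda>t. complex_of_real t powr (w - 1) / of_real (exp t)"
  have im: "(\<lambda>x. \<delta> * x) ` {0<..} = {0<..}"
  proof
    show "{0<..} \<subseteq> (\<lambda>x. \<delta> * x) ` {0<..}"
    proof
      fix x :: real assume "x \<in> {0<..}"
      thus "x \<in> (\<lambda>x. \<delta> * x) ` {0<..}"
        using assms by (intro image_eqI[of _ _ "x / \<delta>"]) auto
    qed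
  qed (use assms in auto)
  have "?f absolutely_integrable_on {0<..}"
    using absolutely_integrable_Gamma_integral'[OF assms(1)] .
  moreover have "integral {0<..} ?f = Gamma w"
    using Gamma_integral_complex'[OF assms(1)] by (rule integral_unique)
  ultimately have AB: "(\<lambda>x. \<bar>\<delta>\<bar> *\<^sub>R ?f (\<delta> * x)) absolutely_integrable_on {0<..} \<and>
       integral {0<..} (\<lambda>x. \<bar>\<delta>\<bar> *\<^sub>R ?f (\<delta> * x)) = Gamma w"
    by (subst has_absolute_integral_change_of_variables_real)
       (use assms in \<open>auto simp: im inj_on_def intro!: derivative_eq_intros\<close>)
  have eq: "\<bar>\<delta>\<bar> *\<^sub>R ?f (\<delta> * x) = of_real \<delta> powr w *
         (of_real x powr (w - 1) * exp (- of_real (\<delta> * x)))" if "x > 0" for x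
  proof -
    have "of_real (\<delta> * x) powr (w - 1) = of_real \<delta> powr (w - 1) * of_real x powr (w - 1)"
      using assms that by (simp add: powr_times_real)
    moreover have "of_real \<delta> powr w = of_real \<delta> * of_real \<delta> powr (w - 1)"
      using assms by (simp add: powr_diff)
    ultimately show ?thesis
      using assms that by (simp add: scaleR_conv_of_real exp_minus field_simps flip: exp_of_real)
  qed
  have A: "(\<lambda>x. of_real \<delta> powr w * (of_real x powr (w - 1) * exp (- of_real (\<delta> * x))))
        absolutely_integrable_on {0<..}"
    by (rule absolutely_integrable_spike[OF conjunct1[OF AB], of "{}"]) (auto simp only: eq greaterThan_iff negligible_empty Diff_empty)
  have "integral {0<..} (\<lambda>x. of_real \<delta> powr w * (of_real x powr (w - 1) * exp (- of_real (\<delta> * x)))) =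
          integral {0<..} (\<lambda>x. \<bar>\<delta>\<bar> *\<^sub>R ?f (\<delta> * x))"
    by (rule integral_cong) (simp only: eq greaterThan_iff)
  hence B: "integral {0<..} (\<lambda>x. of_real \<delta> powr w * (of_real x powr (w - 1) * exp (- of_real (\<delta> * x)))) = Gamma w"
    using AB by simp
  have nz: "of_real \<delta> powr w \<noteq> (0::complex)" using assms by simp
  have "(\<lambda>x. of_real \<delta> powr (-w) * (of_real \<delta> powr w * (of_real x powr (w - 1) * exp (- of_real (\<delta> * x)))))
        absolutely_integrable_on {0<..}"
    by (rule set_integrable_mult_right) (rule A)
  thus C: "(\<lambda>y. of_real y powr (w - 1) * exp (- of_real (\<delta> * y))) absolutely_integrable_on {0<..}"
    using nz by (simp add: powr_minus)
  have "of_real \<delta> powr w * integral {0<..} (\<lambda>y. of_real y powr (w - 1) * exp (- of_real (\<delta> * y))) = Gamma w"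
    using B by simp
  hence "integral {0<..} (\<lambda>y. of_real y powr (w - 1) * exp (- of_real (\<delta> * y))) = Gamma w * of_real \<delta> powr (- w)"
    using nz by (simp add: powr_minus field_simps)
  with C show "((\<lambda>y. of_real y powr (w - 1) * exp (- of_real (\<delta> * y))) has_integral
            Gamma w * of_real \<delta> powr (- w)) {0<..}"
    by (auto simp: absolutely_integrable_on_def has_integral_iff)
qed

lemma integrable_powr_exp:
  fixes p \<delta> :: real
  assumes "p > -1" "\<delta> > 0"
  shows "(\<lambda>y. y powr p * exp (- \<delta> * y)) integrable_on {0<..}"
proof -
  have "(\<lambda>y. of_real y powr (of_real (p + 1) - 1) * exp (- of_real (\<delta> * y)) :: complex) absolutely_integrable_on {0<..}"
    by (rule Gamma_integral_scaled(2)) (use assms in auto)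
  hence "(\<lambda>y. norm (of_real y powr (of_real (p + 1) - 1) * exp (- of_real (\<delta> * y)) :: complex)) integrable_on {0<..}"
    by (simp add: absolutely_integrable_on_def)
  moreover have "norm (of_real y powr (of_real (p + 1) - 1) * exp (- of_real (\<delta> * y)) :: complex)
      = y powr p * exp (- \<delta> * y)" if "y \<in> {0<..}" for y
    using that by (simp add: norm_mult norm_powr_real_powr)
  ultimately show ?thesis
    using integrable_cong by (metis (no_types, lifting))
qed

lemma one_plus_powr_le:
  fixes y p :: real assumes "y \<ge> 0" "p \<ge> 0"
  shows "(1 + y) powr p \<le> 2 powr p * (1 + y powr p)"
proof (cases "y \<le> 1")
  case True
  have "(1 + y) powr p \<le> 2 powr p" using True assms by (intro powr_mono2) auto
  also have "\<dots> \<le> 2 powr p * (1 + y powr p)" by (simp add: algebra_simps)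
  finally show ?thesis .
next
  case False
  have "(1 + y) powr p \<le> (2 * y) powr p" using False assms by (intro powr_mono2) auto
  also have "\<dots> = 2 powr p * y powr p" using False by (simp add: powr_mult)
  also have "\<dots> \<le> 2 powr p * (1 + y powr p)" by (simp add: algebra_simps)
  finally show ?thesis .
qed

lemma integrable_one_plus_powr_exp:
  fixes p \<delta> :: real
  assumes "p \<ge> 0" "\<delta> > 0"
  shows "(\<lambda>y. (1 + y) powr p * exp (- \<delta> * y)) integrable_on {0<..}"
proof -
  have "(\<lambda>y. 2 powr p * (y powr 0 * exp (- \<delta> * y) + y powr p * exp (- \<delta> * y))) integrable_on {0<..}"
    using assms by (intro integrable_on_mult_right integrable_add integrable_powr_exp) auto
  hence I: "(\<lambda>y. 2 powr p * (y powr 0 * exp (- \<delta> * y) + y powr p * exp (- \<delta> * y))) integrable_on {0<..}" .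
  show ?thesis
  proof (rule measurable_bounded_by_integrable_imp_integrable[OF _ I])
    show "(\<lambda>y. (1 + y) powr p * exp (- \<delta> * y)) \<in> borel_measurable (lebesgue_on {0<..})"
      by (intro continuous_imp_measurable_on_sets_lebesgue) (auto intro!: continuous_intros)
    fix y :: real assume y: "y \<in> {0<..}"
    have "(1 + y) powr p * exp (- \<delta> * y) \<le> (2 powr p * (1 + y powr p)) * exp (- \<delta> * y)"
      using y assms by (intro mult_right_mono one_plus_powr_le) auto
    thus "norm ((1 + y) powr p * exp (- \<delta> * y)) \<le> 2 powr p * (y powr 0 * exp (- \<delta> * y) + y powr p * exp (- \<delta> * y))"
      using y by (simp add: algebra_simps)
  qed auto
qed

text \<open>Since \<open>l\<close> grows at most logarithmically, exp (-s l(y)) is at most a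
  constant times (1 + y)^|s|, and the exponential decay of \<kappa> wins for every s; hence the
  integral is entire. The intended case is \<open>Ln\<close> on a vertical half-line for
  \<open>l\<close> and the Abel-Plana kernel for \<kappa>.\<close>

lemma holomorphic_exp_integral:
  fixes l \<kappa> :: "real \<Rightarrow> complex" and B C \<delta> :: real
  assumes cl: "continuous_on {0..} l" and ck: "continuous_on {0..} \<kappa>"
    and k: "\<And>y. y \<ge> 0 \<Longrightarrow> norm (\<kappa> y) \<le> C * exp (- \<delta> * y)" and \<delta>: "\<delta> > 0"
    and l: "\<And>y. y \<ge> 0 \<Longrightarrow> norm (l y) \<le> B + ln (1 + y)"
  shows "(\<lambda>y. exp (- s * l y) * \<kappa> y) integrable_on {0<..}"
    and "(\<lambda>s. integral {0<..} (\<lambda>y. exp (- s * l y) * \<kappa> y)) holomorphic_on UNIV"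
proof -
  have C: "C \<ge> 0" using order_trans[OF norm_ge_zero k[of 0]] by simp
  have B: "B \<ge> 0" using order_trans[OF norm_ge_zero l[of 0]] by simp
  define g where "g R y = exp (R * B) * C * ((1 + y) powr R * exp (- \<delta> * y))" for R y :: real
  have bound: "norm (exp (- s * l y) * \<kappa> y) \<le> g R y" if "norm s \<le> R" "y \<ge> 0" for s R y
  proof -
    have "Re (- s * l y) \<le> norm (- s * l y)" by (rule complex_Re_le_cmod)
    also have "\<dots> = norm s * norm (l y)" by (simp add: norm_mult)
    also have "\<dots> \<le> R * (B + ln (1 + y))"
      using that l[of y] by (intro mult_mono) (auto intro: order_trans[OF norm_ge_zero])
    finally have "norm (exp (- s * l y)) \<le> exp (R * (B + ln (1 + y)))"
      by simp
    also have "\<dots> = exp (R * B) * (1 + y) powr R"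
      using that by (simp add: powr_def exp_add algebra_simps)
    finally have 1: "norm (exp (- s * l y)) \<le> exp (R * B) * (1 + y) powr R" .
    show ?thesis
      unfolding g_def norm_mult using mult_mono[OF 1 k[OF that(2)]] by (simp add: mult_ac)
  qed
  have gint: "g R integrable_on {0<..}" if "R \<ge> 0" for R
    unfolding g_def[abs_def] using that \<delta> by (intro integrable_on_mult_right integrable_one_plus_powr_exp) auto
  have sub: "continuous_on {0<..} (\<lambda>y. exp (- s * l y) * \<kappa> y)" for s
    using cl ck by (intro continuous_intros) (auto elim: continuous_on_subset)
  show int: "(\<lambda>y. exp (- s * l y) * \<kappa> y) integrable_on {0<..}" for s
    using bound[of s "norm s"] gint[of "norm s"] sub[of s]
    by (intro integrable_on_halfline_dominated) auto
  have seg: "(\<lambda>y. exp (- s * l y) * \<kappa> y) integrable_on {0..real n}" for s n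
    using cl ck by (intro integrable_continuous_interval continuous_intros) (auto elim: continuous_on_subset)
  show "(\<lambda>s. integral {0<..} (\<lambda>y. exp (- s * l y) * \<kappa> y)) holomorphic_on UNIV"
  proof (rule holomorphic_uniform_sequence[where f = "\<lambda>n s. integral {0..real n} (\<lambda>y. exp (- s * l y) * \<kappa> y)"])
    fix n :: nat
    have "(\<lambda>s. integral (cbox 0 (real n)) (\<lambda>y. exp (- s * l y) * \<kappa> y)) holomorphic_on UNIV"
    proof (rule leibniz_rule_holomorphic[where fx = "\<lambda>s y. - l y * exp (- s * l y) * \<kappa> y"])
      show "continuous_on (UNIV \<times> cbox 0 (real n)) (\<lambda>(x, t). - l t * exp (- x * l t) * \<kappa> t)"
        unfolding case_prod_unfold
        by (intro continuous_intros continuous_on_compose2[OF cl] continuous_on_compose2[OF ck]) auto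
    qed (use seg in \<open>auto intro!: derivative_eq_intros\<close>)
    thus "(\<lambda>s. integral {0..real n} (\<lambda>y. exp (- s * l y) * \<kappa> y)) holomorphic_on UNIV" by simp
  next
    fix s0 :: complex
    \<comment> \<open>\<open>R\<close> bounds |s| on the unit disc about \<open>s0\<close>, so
      \<open>g R\<close> is one majorant for the whole disc, and its tails give uniform convergence
      of the truncated integrals.\<close>
    define R where "R = norm s0 + 1"
    have R: "R \<ge> 0" by (simp add: R_def)
    have gseg: "g R integrable_on {0..real n}" for n
      unfolding g_def by (intro integrable_continuous_interval continuous_intros) auto
    have lim: "(\<lambda>n. integral {0<..} (\<lambda>y. if y \<in> {0..real n} then g R y else 0)) \<longlonglongrightarrow> integral {0<..} (g R)"
    proof (rule dominated_convergence(2)[of _ _ "g R"])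
      fix k :: nat
      have "(g R) integrable_on ({0..real k} \<inter> {0<..})"
        by (rule integrable_spike_set[OF gseg[of k]]) 
           (auto intro: negligible_subset[of "{0}"])
      thus "(\<lambda>y. if y \<in> {0..real k} then g R y else 0) integrable_on {0<..}"
        by (subst integrable_restrict_Int) (simp add: Int_commute)
      show "norm (if y \<in> {0..real k} then g R y else 0) \<le> g R y" if "y \<in> {0<..}" for y
        using C by (auto simp: g_def)
    next
      fix y :: real assume "y \<in> {0<..}"
      have "eventually (\<lambda>k. y \<le> real k) sequentially"
        using eventually_ge_at_top[of "nat \<lceil>y\<rceil>"] by eventually_elim linarith
      thus "(\<lambda>k. if y \<in> {0..real k} then g R y else 0) \<longlonglongrightarrow> g R y"
        by (intro tendsto_eventually; elim eventually_mono) (use \<open>y \<in> {0<..}\<close> in auto)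
    qed (use gint[OF R] in auto)
    have diff: "integral {0<..} f - integral {0..real n} f = integral {0<..} (\<lambda>y. f y - (if y \<in> {0..real n} then f y else 0))"
      if "f integrable_on {0<..}" "f integrable_on {0..real n}" for f :: "real \<Rightarrow> 'b::euclidean_space" and n
    proof -
      have 1: "f integrable_on ({0..real n} \<inter> {0<..})"
        by (rule integrable_spike_set[OF that(2)]) (auto intro: negligible_subset[of "{0}"])
      have "integral {0..real n} f = integral ({0..real n} \<inter> {0<..}) f"
        by (rule integral_spike_set) (auto intro: negligible_subset[of "{0}"])
      also have "\<dots> = integral {0<..} (\<lambda>y. if y \<in> {0..real n} then f y else 0)"
        by (subst integral_restrict_Int) (simp add: Int_commute)
      finally have 2: "integral {0..real n} f = \<dots>" .
      have 3: "(\<lambda>y. if y \<in> {0..real n} then f y else 0) integrable_on {0<..}"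
        using 1 by (subst integrable_restrict_Int) (simp add: Int_commute)
      show ?thesis unfolding 2
        by (rule Henstock_Kurzweil_Integration.integral_diff[OF that(1) 3, symmetric])
    qed
    have tail: "norm (integral {0<..} (\<lambda>y. exp (- s * l y) * \<kappa> y) - integral {0..real n} (\<lambda>y. exp (- s * l y) * \<kappa> y))
             \<le> integral {0<..} (g R) - integral {0..real n} (g R)" if "norm s \<le> R" for s n
    proof -
      let ?f = "\<lambda>y. exp (- s * l y) * \<kappa> y"
      have res: "(\<lambda>y. if y \<in> {0..real n} then f y else 0) integrable_on {0<..}"
        if "f integrable_on {0..real n}" for f :: "real \<Rightarrow> 'b::euclidean_space"
      proof -
        have "f integrable_on ({0..real n} \<inter> {0<..})"
          by (rule integrable_spike_set[OF that]) (auto intro: negligible_subset[of "{0}"])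
        thus ?thesis by (subst integrable_restrict_Int) (simp add: Int_commute)
      qed
      show ?thesis
        unfolding diff[OF int seg] diff[OF gint[OF R] gseg]
      proof (rule integral_norm_bound_integral)
        show "(\<lambda>y. ?f y - (if y \<in> {0..real n} then ?f y else 0)) integrable_on {0<..}"
          by (intro integrable_diff int res seg)
        show "(\<lambda>y. g R y - (if y \<in> {0..real n} then g R y else 0)) integrable_on {0<..}"
          by (intro integrable_diff gint[OF R] res gseg)
      qed (use bound[OF that] in auto)
    qed
    have "uniform_limit (cball s0 1) (\<lambda>n s. integral {0..real n} (\<lambda>y. exp (- s * l y) * \<kappa> y))
            (\<lambda>s. integral {0<..} (\<lambda>y. exp (- s * l y) * \<kappa> y)) sequentially"
    proof (rule uniform_limitI)
      fix e :: real assume e: "e > 0"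
      have "(\<lambda>n. integral {0..real n} (g R)) \<longlonglongrightarrow> integral {0<..} (g R)"
      proof -
        have "integral {0..real n} (g R) = integral {0<..} (\<lambda>y. if y \<in> {0..real n} then g R y else 0)" for n
        proof -
          have "integral {0..real n} (g R) = integral ({0..real n} \<inter> {0<..}) (g R)"
            by (rule integral_spike_set) (auto intro: negligible_subset[of "{0}"])
          thus ?thesis by (subst integral_restrict_Int) (simp add: Int_commute)
        qed
        thus ?thesis using lim by simp
      qed
      hence "eventually (\<lambda>n. dist (integral {0..real n} (g R)) (integral {0<..} (g R)) < e) sequentially"
        using e by (rule tendstoD)
      thus "\<forall>\<^sub>F n in sequentially. \<forall>s\<in>cball s0 1. dist (integral {0..real n} (\<lambda>y. exp (- s * l y) * \<kappa> y))
               (integral {0<..} (\<lambda>y. exp (- s * l y) * \<kappa> y)) < e"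
      proof eventually_elim
        case (elim n)
        show ?case
        proof
          fix s assume s: "s \<in> cball s0 1"
          have "norm s \<le> norm s0 + norm (s - s0)" using norm_triangle_ineq[of s0 "s - s0"] by simp
          hence "norm s \<le> R" using s by (simp add: R_def dist_norm norm_minus_commute)
          from tail[OF this, of n] elim show "dist (integral {0..real n} (\<lambda>y. exp (- s * l y) * \<kappa> y))
               (integral {0<..} (\<lambda>y. exp (- s * l y) * \<kappa> y)) < e"
            by (simp add: dist_norm norm_minus_commute)
        qed
      qed
    qed
    thus "\<exists>d>0. cball s0 d \<subseteq> UNIV \<and> uniform_limit (cball s0 d) (\<lambda>n s. integral {0..real n} (\<lambda>y. exp (- s * l y) * \<kappa> y))
            (\<lambda>s. integral {0<..} (\<lambda>y. exp (- s * l y) * \<kappa> y)) sequentially"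
      by (intro exI[of _ 1]) auto
  qed auto
qed

section \<open>The Abel-Plana kernel\<close>

definition ee :: "complex \<Rightarrow> complex" where
  "ee z = exp (2 * of_real pi * \<i> * z)"

lemma norm_ee [simp]: "norm (ee z) = exp (- 2 * pi * Im z)"
  by (simp add: ee_def)

lemma ee_add: "ee (z + w) = ee z * ee w"
  by (simp add: ee_def ring_distribs exp_add)

lemma ee_0 [simp]: "ee 0 = 1" by (simp add: ee_def)

lemma ee_minus: "ee (- z) = inverse (ee z)"
  by (simp add: ee_def exp_minus)

lemma ee_nonzero [simp]: "ee z \<noteq> 0" by (simp add: ee_def)

lemma ee_of_nat [simp]: "ee (of_nat n) = 1"
  using exp_integer_2pi[of "of_nat n"] by (simp add: ee_def mult_ac)

lemma ee_holomorphic [holomorphic_intros]: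
  "f holomorphic_on A \<Longrightarrow> (\<lambda>z. ee (f z)) holomorphic_on A"
  unfolding ee_def by (intro holomorphic_intros)

lemma ee_continuous [continuous_intros]:
  "continuous_on A f \<Longrightarrow> continuous_on A (\<lambda>z. ee (f z))"
  unfolding ee_def by (intro continuous_intros)

lemma ee_eq_1_iff: "ee z = 1 \<longleftrightarrow> Im z = 0 \<and> Re z \<in> \<int>"
proof -
  have "ee z = 1 \<longleftrightarrow> Im z = 0 \<and> (\<exists>n::int. 2 * pi * Re z = of_int (2 * n) * pi)"
    by (simp add: ee_def exp_eq_1)
  also have "(\<exists>n::int. 2 * pi * Re z = of_int (2 * n) * pi) \<longleftrightarrow> Re z \<in> \<int>"
    by (auto simp: Ints_def)
  finally show ?thesis .
qed

text \<open>For Im w > 0 this is the geometric series of \<open>ee ((j + \<gamma>) * w)\<close> over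
  j >= 0. Its poles are simple and lie at the integers, with residues
  \<open>- ee (\<gamma> * n) / (2 * pi * \<i>)\<close>, so contour integrals against it produce sums
  with frequency \<gamma>.\<close>

definition ap_kernel :: "real \<Rightarrow> complex \<Rightarrow> complex" where
  "ap_kernel \<gamma> w = ee (of_real \<gamma> * w) / (1 - ee w)"

lemma norm_one_minus_ee_ge: "norm (1 - ee w) \<ge> \<bar>1 - exp (- 2 * pi * Im w)\<bar>"
  using norm_triangle_ineq3[of 1 "ee w"] by simp

lemma exp_2pi_bound: "exp (- 2 * pi) \<le> (1/2 :: real)"
proof -
  have "exp (- 2 * pi) \<le> exp (- 1 :: real)" using pi_gt3 by simp
  also have "\<dots> \<le> 1/2" using exp_ge_add_one_self[of 1] by (simp add: exp_minus field_simps)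
  finally show ?thesis .
qed

lemma norm_ap_kernel_upper:
  assumes "Im w \<ge> 1"
  shows "norm (ap_kernel \<gamma> w) \<le> 2 * exp (- 2 * pi * \<gamma> * Im w)"
proof -
  have "exp (- 2 * pi * Im w) \<le> exp (- 2 * pi)" using assms pi_gt_zero by simp
  with exp_2pi_bound have "exp (- 2 * pi * Im w) \<le> 1/2" by linarith
  hence "norm (1 - ee w) \<ge> 1/2" using norm_one_minus_ee_ge[of w] by linarith
  hence "exp (- 2 * pi * \<gamma> * Im w) / norm (1 - ee w) \<le> exp (- 2 * pi * \<gamma> * Im w) / (1/2)"
    by (intro divide_left_mono) auto
  thus ?thesis by (simp add: ap_kernel_def norm_divide mult_ac)
qed

text \<open>Numerator and denominator are divided by \<open>ee w\<close>. This moves the kernel from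
  the lower to the upper half-plane at the price of the complementary frequency, which is how 1 -
  \<beta> enters the functional equation.\<close>

lemma ap_kernel_reflect:
  assumes "ee w \<noteq> 1"
  shows "ap_kernel \<gamma> w = - ap_kernel (1 - \<gamma>) (- w)"
proof -
  have *: "ee (of_real (1 - \<gamma>) * (- w)) = ee (of_real \<gamma> * w) / ee w"
    using ee_add[of "of_real \<gamma> * w" "- w"] by (simp add: ee_minus algebra_simps divide_inverse)
  have ne: "ee w - 1 \<noteq> 0" "1 - ee w \<noteq> 0" using assms by auto
  have "- ap_kernel (1 - \<gamma>) (- w) = - (ee (of_real \<gamma> * w) / ee w / (1 - inverse (ee w)))"
    unfolding ap_kernel_def * by (simp add: ee_minus)
  also have "1 - inverse (ee w) = (ee w - 1) / ee w" by (simp add: field_simps)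
  also have "- (ee (of_real \<gamma> * w) / ee w / ((ee w - 1) / ee w)) = ap_kernel \<gamma> w"
    using ne unfolding ap_kernel_def by (simp add: divide_simps) (simp add: algebra_simps)
  finally show ?thesis ..
qed

lemma norm_ap_kernel_le:
  assumes "\<bar>Im w\<bar> \<ge> 1" "0 \<le> \<gamma>" "\<gamma> \<le> 1"
  shows "norm (ap_kernel \<gamma> w) \<le> 2"
proof (cases "Im w \<ge> 1")
  case True
  have "exp (- 2 * pi * \<gamma> * Im w) \<le> exp 0"
    using assms True by (subst exp_le_cancel_iff) simp
  with norm_ap_kernel_upper[OF True, of \<gamma>] show ?thesis unfolding exp_zero by linarith
next
  case False
  hence *: "Im (- w) \<ge> 1" using assms by auto
  have "ee w \<noteq> 1" using * by (auto simp: ee_eq_1_iff)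
  have "exp (- 2 * pi * (1 - \<gamma>) * Im (- w)) \<le> exp 0"
    using assms * by (subst exp_le_cancel_iff) (simp add: mult_nonneg_nonpos)
  moreover have "norm (ap_kernel \<gamma> w) = norm (ap_kernel (1 - \<gamma>) (- w))"
    by (subst ap_kernel_reflect[OF \<open>ee w \<noteq> 1\<close>]) (simp only: norm_minus_cancel)
  ultimately show ?thesis using norm_ap_kernel_upper[OF *, of "1 - \<gamma>"] unfolding exp_zero by linarith
qed

lemma ap_kernel_plus_1: "ap_kernel \<gamma> (w + 1) = ee (of_real \<gamma>) * ap_kernel \<gamma> w"
  using ee_of_nat[of 1] by (simp add: ap_kernel_def ee_add ring_distribs del: ee_of_nat)

section \<open>Summation by integrals over vertical lines\<close>

lemma integral_halfline_limit:
  fixes h :: "real \<Rightarrow> complex"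
  assumes cont: "continuous_on {0..} h" and le: "\<And>y. y > 0 \<Longrightarrow> norm (h y) \<le> g y"
    and g: "g integrable_on {0<..}"
  shows "(\<lambda>n. integral {0..real n} h) \<longlonglongrightarrow> integral {0<..} h"
proof -
  have seg: "h integrable_on {0..real n}" for n
    by (intro integrable_continuous_interval continuous_on_subset[OF cont]) auto
  have seg': "h integrable_on ({0..real n} \<inter> {0<..})" for n
    by (rule integrable_spike_set[OF seg[of n]]) (auto intro: negligible_subset[of "{0}"])
  have eq: "integral {0..real n} h = integral {0<..} (\<lambda>y. if y \<in> {0..real n} then h y else 0)" for n
  proof -
    have "integral {0..real n} h = integral ({0..real n} \<inter> {0<..}) h"
      by (rule integral_spike_set) (auto intro: negligible_subset[of "{0}"])
    thus ?thesis by (subst integral_restrict_Int) (simp add: Int_commute)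
  qed
  show ?thesis unfolding eq
  proof (rule dominated_convergence(2)[of _ _ g])
    show "(\<lambda>y. if y \<in> {0..real n} then h y else 0) integrable_on {0<..}" for n
      using seg'[of n] by (subst integrable_restrict_Int) (simp add: Int_commute)
    show "norm (if y \<in> {0..real n} then h y else 0) \<le> g y" if "y \<in> {0<..}" for n y
      using that le[of y] by (auto intro: order_trans[OF norm_ge_zero])
  next
    fix y :: real assume y: "y \<in> {0<..}"
    have "eventually (\<lambda>k. y \<le> real k) sequentially"
      using eventually_ge_at_top[of "nat \<lceil>y\<rceil>"] by eventually_elim linarith
    thus "(\<lambda>k. if y \<in> {0..real k} then h y else 0) \<longlonglongrightarrow> h y"
      by (intro tendsto_eventually; elim eventually_mono) (use y in auto)
  qed (use g in auto)
qed

lemma integrable_one_plus_powr_neg: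
  fixes \<sigma> :: real
  assumes "\<sigma> > 1"
  shows "(\<lambda>y. (1 + y) powr (- \<sigma>)) integrable_on {0<..}"
proof -
  have "(\<lambda>x::real. x powr (- \<sigma>)) absolutely_integrable_on {1<..}"
  proof (rule nonnegative_absolutely_integrable_1)
    have "(\<lambda>x::real. x powr (- \<sigma>)) integrable_on {1..}"
      using has_integral_powr_to_inf[of "-\<sigma>" 1] assms by (auto simp: integrable_on_def)
    thus "(\<lambda>x::real. x powr (- \<sigma>)) integrable_on {1<..}"
      by (rule integrable_spike_set) (auto intro: negligible_subset[of "{1}"])
  qed auto
  hence A: "(\<lambda>x::real. x powr (- \<sigma>)) absolutely_integrable_on {1<..}" .
  have im: "(\<lambda>y. 1 + y) ` {0<..} = {1::real<..}"
  proof
    show "{1<..} \<subseteq> (\<lambda>y. 1 + y) ` {0::real<..}"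
    proof
      fix x :: real assume "x \<in> {1<..}"
      thus "x \<in> (\<lambda>y. 1 + y) ` {0<..}" by (intro image_eqI[of _ _ "x - 1"]) auto
    qed
  qed auto
  have "((\<lambda>y. \<bar>1\<bar> *\<^sub>R ((1 + y) powr (- \<sigma>))) absolutely_integrable_on {0<..} \<and>
      integral {0<..} (\<lambda>y. \<bar>1\<bar> *\<^sub>R ((1 + y) powr (- \<sigma>))) = integral {1<..} (\<lambda>x. x powr (- \<sigma>))) \<longleftrightarrow>
      ((\<lambda>x. x powr (- \<sigma>)) absolutely_integrable_on ((\<lambda>y. 1 + y) ` {0<..}) \<and>
       integral ((\<lambda>y. 1 + y) ` {0<..}) (\<lambda>x. x powr (- \<sigma>)) = integral {1<..} (\<lambda>x. x powr (- \<sigma>)))"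
  proof (rule has_absolute_integral_change_of_variables_real)
    show "((\<lambda>y. 1 + y) has_field_derivative 1) (at x within {0<..})" for x :: real
      by (rule derivative_eq_intros refl | simp)+
  qed auto
  hence "(\<lambda>y. \<bar>1\<bar> *\<^sub>R ((1 + y) powr (- \<sigma>))) absolutely_integrable_on {0<..}"
    unfolding im using A by blast
  thus ?thesis using set_lebesgue_integral_eq_integral(1) by fastforce
qed

lemma residue_ap_kernel:
  assumes "open S" "of_real a \<in> S" "\<psi> holomorphic_on S"
  shows "residue (\<lambda>z. \<psi> z * ap_kernel \<gamma> (z - of_real a)) (of_real a) = \<psi> (of_real a) / (- 2 * of_real pi * \<i>)"
proof (rule residue_simple'[where s = "S \<inter> ball (of_real a) 1"])
  show "(\<lambda>w. \<psi> w * ap_kernel \<gamma> (w - complex_of_real a)) holomorphic_on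
          S \<inter> ball (complex_of_real a) 1 - {complex_of_real a}"
  proof -
    have "ee (w - of_real a) \<noteq> 1" if "w \<in> S \<inter> ball (complex_of_real a) 1 - {complex_of_real a}" for w
    proof
      assume "ee (w - of_real a) = 1"
      hence *: "Im w = 0" "Re w - a \<in> \<int>" by (auto simp: ee_eq_1_iff)
      have "\<bar>Re w - a\<bar> < 1"
        using that abs_Re_le_cmod[of "w - of_real a"] by (auto simp: dist_norm norm_minus_commute)
      with *(2) have "Re w - a = 0" by (metis Ints_nonzero_abs_less1)
      with * have "w = of_real a" by (simp add: complex_eq_iff)
      with that show False by simp
    qed
    thus ?thesis unfolding ap_kernel_def
      by (intro holomorphic_intros) (use assms in \<open>auto elim: holomorphic_on_subset\<close>)
  qed
  have "((\<lambda>w. (1 - ee (w - of_real a)) / (w - of_real a)) \<longlongrightarrow> - 2 * of_real pi * \<i>) (at (of_real a))"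
  proof -
    have "((\<lambda>z. 1 - ee (z - of_real a)) has_field_derivative (- 2 * of_real pi * \<i>)) (at (of_real a))"
      unfolding ee_def by (auto intro!: derivative_eq_intros)
    thus ?thesis by (simp add: has_field_derivative_iff)
  qed
  moreover have "isCont \<psi> (of_real a)"
    using assms holomorphic_on_imp_continuous_on continuous_on_eq_continuous_at by blast
  hence "isCont (\<lambda>w. \<psi> w * ee (of_real \<gamma> * (w - of_real a))) (of_real a)"
    unfolding ee_def by (intro continuous_intros)
  hence "((\<lambda>w. \<psi> w * ee (of_real \<gamma> * (w - of_real a))) \<longlongrightarrow> \<psi> (of_real a) * ee (of_real \<gamma> * (of_real a - of_real a))) (at (of_real a))"
    by (simp add: isCont_def)
  ultimately have "((\<lambda>w. \<psi> w * ee (of_real \<gamma> * (w - of_real a)) / ((1 - ee (w - of_real a)) / (w - of_real a))) \<longlongrightarrow>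
        \<psi> (of_real a) * ee (of_real \<gamma> * (of_real a - of_real a)) / (- 2 * of_real pi * \<i>)) (at (of_real a))"
    by (intro tendsto_divide) auto
  thus "((\<lambda>w. \<psi> w * ap_kernel \<gamma> (w - of_real a) * (w - of_real a)) \<longlongrightarrow> \<psi> (of_real a) / (- 2 * of_real pi * \<i>)) (at (of_real a))"
    by (simp add: ap_kernel_def mult_ac)
qed (use assms in auto)

text \<open>No pole lies on the line, so compactness covers |Im w| <= 1; beyond that the kernel is
  at most 2. The constant deteriorates as x approaches an integer, so the limit c -> 0 relies on
  \<open>kernel_denominator_bound\<close> instead.\<close>

lemma ap_kernel_line_bound:
  assumes "0 \<le> \<gamma>" "\<gamma> \<le> 1" "x \<notin> \<int>"
  obtains C where "C \<ge> 0" "\<And>y. norm (ap_kernel \<gamma> (Complex x y)) \<le> C"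
proof -
  have ne: "ee (Complex x y) \<noteq> 1" for y using assms by (auto simp: ee_eq_1_iff)
  have cont: "continuous_on {-1..1} (\<lambda>y. ap_kernel \<gamma> (Complex x y))"
    unfolding ap_kernel_def using ne by (intro continuous_intros) auto
  have "compact ((\<lambda>y. ap_kernel \<gamma> (Complex x y)) ` {-1..1})"
    by (rule compact_continuous_image[OF cont]) auto
  hence "bounded ((\<lambda>y. ap_kernel \<gamma> (Complex x y)) ` {-1..1})" by (rule compact_imp_bounded)
  then obtain B where B: "\<And>y. y \<in> {-1..1} \<Longrightarrow> norm (ap_kernel \<gamma> (Complex x y)) \<le> B"
    by (force simp: bounded_iff)
  have "norm (ap_kernel \<gamma> (Complex x y)) \<le> max 2 B" for y
    using B[of y] norm_ap_kernel_le[of "Complex x y" \<gamma>] assms by fastforce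
  thus ?thesis by (intro that[of "max 2 B"]) auto
qed

text \<open>The two halves of the integral over Re z = c, both parametrised by y > 0. They are kept
  apart because the lower half is later rewritten by \<open>ap_kernel_reflect\<close>.\<close>

definition ap_upper :: "real \<Rightarrow> real \<Rightarrow> (complex \<Rightarrow> complex) \<Rightarrow> real \<Rightarrow> complex" where
  "ap_upper \<gamma> a \<psi> c = integral {0<..} (\<lambda>y. \<psi> (Complex c y) * ap_kernel \<gamma> (Complex c y - of_real a))"

definition ap_lower :: "real \<Rightarrow> real \<Rightarrow> (complex \<Rightarrow> complex) \<Rightarrow> real \<Rightarrow> complex" where
  "ap_lower \<gamma> a \<psi> c = integral {0<..} (\<lambda>y. \<psi> (Complex c (-y)) * ap_kernel \<gamma> (Complex c (-y) - of_real a))"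

lemma ap_line_limit:
  assumes hol: "\<psi> holomorphic_on {z. Re z > 0}" and c: "c > 0" "c - a \<notin> \<int>"
    and g: "0 \<le> \<gamma>" "\<gamma> \<le> 1" and \<sigma>: "\<sigma> > 1"
    and bd: "\<And>y. norm (\<psi> (Complex c y)) \<le> M * (1 + \<bar>y\<bar>) powr (- \<sigma>)"
  shows "(\<lambda>n. integral {- real n..real n} (\<lambda>y. \<psi> (Complex c y) * ap_kernel \<gamma> (Complex c y - of_real a)))
           \<longlonglongrightarrow> ap_upper \<gamma> a \<psi> c + ap_lower \<gamma> a \<psi> c"
proof -
  let ?h = "\<lambda>y. \<psi> (Complex c y) * ap_kernel \<gamma> (Complex c y - of_real a)"
  obtain C where C: "C \<ge> 0" "\<And>y. norm (ap_kernel \<gamma> (Complex (c - a) y)) \<le> C"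
    using ap_kernel_line_bound[OF g c(2)] by blast
  have eqc: "Complex c y - of_real a = Complex (c - a) y" for y by (simp add: complex_eq_iff)
  have ne: "ee (Complex (c - a) y) \<noteq> 1" for y using c by (auto simp: ee_eq_1_iff)
  have cont: "continuous_on UNIV ?h"
  proof -
    have "continuous_on UNIV (\<lambda>y. \<psi> (Complex c y))"
      by (rule continuous_on_compose2[OF holomorphic_on_imp_continuous_on[OF hol]])
         (use c in \<open>auto intro!: continuous_intros\<close>)
    thus ?thesis unfolding eqc ap_kernel_def using ne by (intro continuous_intros) auto
  qed
  have cont': "continuous_on A (\<lambda>y. ?h (- y))" for A
    by (rule continuous_on_compose2[OF cont]) (auto intro!: continuous_intros)
  have hb: "norm (?h y) \<le> C * M * (1 + \<bar>y\<bar>) powr (- \<sigma>)" for y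
    using mult_mono[OF bd[of y] C(2)[of y]] C(1) order_trans[OF norm_ge_zero bd[of y]]
    unfolding eqc norm_mult by (simp add: mult_ac)
  have gi: "(\<lambda>y. C * M * (1 + y) powr (- \<sigma>)) integrable_on {0<..}"
    by (intro integrable_on_mult_right integrable_one_plus_powr_neg \<sigma>)
  have "(\<lambda>n. integral {0..real n} ?h) \<longlonglongrightarrow> ap_upper \<gamma> a \<psi> c"
    unfolding ap_upper_def
  proof (rule integral_halfline_limit[OF _ _ gi])
    fix y :: real assume "y > 0"
    thus "norm (?h y) \<le> C * M * (1 + y) powr - \<sigma>" using hb[of y] by (simp only: abs_of_pos)
  next
    show "continuous_on {0..} ?h" using cont continuous_on_subset by blast
  qed
  moreover have "(\<lambda>n. integral {0..real n} (\<lambda>y. ?h (- y))) \<longlonglongrightarrow> ap_lower \<gamma> a \<psi> c"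
    unfolding ap_lower_def
  proof (rule integral_halfline_limit[OF _ _ gi])
    fix y :: real assume "y > 0"
    thus "norm (?h (- y)) \<le> C * M * (1 + y) powr - \<sigma>" using hb[of "-y"] by (simp only: abs_minus_cancel abs_of_pos)
  qed (rule cont')
  moreover have "integral {- real n..real n} ?h = integral {0..real n} ?h + integral {0..real n} (\<lambda>y. ?h (- y))" for n
  proof -
    have "integral {- real n..real n} ?h = integral {- real n..0} ?h + integral {0..real n} ?h"
      by (rule Henstock_Kurzweil_Integration.integral_combine[symmetric])
         (auto intro!: integrable_continuous_interval continuous_on_subset[OF cont])
    also have "integral {- real n..0} ?h = integral {0..real n} (\<lambda>y. ?h (- y))"
      using Henstock_Kurzweil_Integration.integral_reflect_real[of "real n" 0 "\<lambda>y. ?h (- y)"] by simp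
    finally show ?thesis by (simp add: add.commute)
  qed
  ultimately show ?thesis by (simp add: tendsto_add)
qed

text \<open>The residue theorem on the rectangle between the two lines, with a as its only pole. As
  the height grows, the horizontal sides disappear because \<psi> tends to 0 there and the kernel
  stays bounded.\<close>

lemma ap_strip_shift:
  assumes hol: "\<psi> holomorphic_on {z. Re z > 0}" and c: "0 < c" "c < a" "a < c + 1" and a: "a \<le> 1"
    and g: "0 \<le> \<gamma>" "\<gamma> \<le> 1" and \<sigma>: "\<sigma> > 1"
    and bd: "\<And>z. Re z \<ge> c \<Longrightarrow> norm (\<psi> z) \<le> M * (1 + \<bar>Im z\<bar>) powr (- \<sigma>)"
  shows "\<i> * (ap_upper \<gamma> a \<psi> c + ap_lower \<gamma> a \<psi> c)
       - \<i> * (ap_upper \<gamma> a \<psi> (c + 1) + ap_lower \<gamma> a \<psi> (c + 1)) = \<psi> (of_real a)"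
proof -
  let ?F = "\<lambda>z. \<psi> z * ap_kernel \<gamma> (z - of_real a)"
  define I where "I c n = integral {- real n..real n} (\<lambda>y. ?F (Complex c y))" for c n
  \<comment> \<open>The neighbouring poles a - 1 and a + 1 lie outside this strip; for a - 1 this is
    the hypothesis a <= 1.\<close>
  define S where "S = {z. 0 < Re z} \<inter> {z. Re z < a + 1}"
  have S: "open S" "convex S" "connected S"
    unfolding S_def by (auto intro!: open_Int open_halfspace_Re_gt open_halfspace_Re_lt convex_Int
        convex_halfspace_Re_gt convex_halfspace_Re_lt convex_connected)
  have nint: "c - a \<notin> \<int>" "c + 1 - a \<notin> \<int>"
  proof -
    show "c - a \<notin> \<int>" using Ints_nonzero_abs_less1[of "c - a"] c by auto
    show "c + 1 - a \<notin> \<int>" using Ints_nonzero_abs_less1[of "c + 1 - a"] c by auto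
  qed
  have bd': "norm (\<psi> (Complex d y)) \<le> M * (1 + \<bar>y\<bar>) powr (- \<sigma>)" if "d \<ge> c" for d y
    using bd[of "Complex d y"] that by simp
  have lim1: "(\<lambda>n. I c n) \<longlonglongrightarrow> ap_upper \<gamma> a \<psi> c + ap_lower \<gamma> a \<psi> c"
    unfolding I_def using c by (intro ap_line_limit[OF hol _ nint(1) g \<sigma> bd'[OF order_refl]]) linarith
  have lim2: "(\<lambda>n. I (c + 1) n) \<longlonglongrightarrow> ap_upper \<gamma> a \<psi> (c + 1) + ap_lower \<gamma> a \<psi> (c + 1)"
    unfolding I_def using c by (intro ap_line_limit[OF hol _ nint(2) g \<sigma> bd']) linarith+
  have Fhol: "?F holomorphic_on S - {of_real a}"
  proof -
    have "ee (w - of_real a) \<noteq> 1" if "w \<in> S - {of_real a}" for w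
    proof
      assume "ee (w - of_real a) = 1"
      hence *: "Im w = 0" "Re w - a \<in> \<int>" by (auto simp: ee_eq_1_iff)
      have "\<bar>Re w - a\<bar> < 1" using that a by (auto simp: S_def)
      with *(2) have "Re w - a = 0" by (metis Ints_nonzero_abs_less1)
      with * have "w = of_real a" by (simp add: complex_eq_iff)
      with that show False by simp
    qed
    thus ?thesis unfolding ap_kernel_def
      by (intro holomorphic_intros) (auto intro: holomorphic_on_subset[OF hol] simp: S_def)
  qed
  \<comment> \<open>The difference consists of the two horizontal sides, each of length 1, on which
    the kernel is at most 2 because n >= 1.\<close>
  have key: "norm (\<i> * I (c + 1) n - \<i> * I c n + \<psi> (of_real a)) \<le> 4 * \<bar>M\<bar> * (1 + real n) powr (- \<sigma>)"
    if n: "n \<ge> 1" for n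
  proof -
    define Y where "Y = real n"
    have Y: "Y \<ge> 1" using n by (simp add: Y_def)
    define a1 a2 a3 a4 where "a1 = Complex c (- Y)" "a2 = Complex (c + 1) (- Y)" "a3 = Complex (c + 1) Y" "a4 = Complex c Y"
    have box: "of_real a \<in> box a1 a3" using c Y by (auto simp: a1_a2_a3_a4_def in_box_complex_iff)
    have sub: "cbox a1 a3 \<subseteq> S" using c by (auto simp: a1_a2_a3_a4_def in_cbox_complex_iff S_def)
    have le: "Re a1 \<le> Re a3" "Im a1 \<le> Im a3" "Re a1 < Re a3" "Im a1 < Im a3" using Y by (auto simp: a1_a2_a3_a4_def)
    have img: "path_image (rectpath a1 a3) \<subseteq> S - {of_real a}"
      using path_image_rectpath_subset_cbox[OF le(1,2)] sub path_image_rectpath_cbox_minus_box[OF le(1,2)] box by auto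
    have "contour_integral (rectpath a1 a3) ?F = 2 * pi * \<i> *
             (\<Sum>p\<in>{of_real a}. winding_number (rectpath a1 a3) p * residue ?F p)"
    proof (rule Residue_theorem[OF S(1,3) _ Fhol])
      show "\<forall>z. z \<notin> S \<longrightarrow> winding_number (rectpath a1 a3) z = 0"
        using winding_number_rectpath_outside[OF le(1,2)] sub by auto
    qed (use img in auto)
    also have "\<dots> = 2 * pi * \<i> * (\<psi> (of_real a) / (- 2 * of_real pi * \<i>))"
    proof -
      have "residue ?F (of_real a) = \<psi> (of_real a) / (- 2 * of_real pi * \<i>)"
        by (rule residue_ap_kernel[OF S(1)]) (use c in \<open>auto simp: S_def intro: holomorphic_on_subset[OF hol]\<close>)
      thus ?thesis using winding_number_rectpath[OF box] by simp
    qed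
    finally have 1: "contour_integral (rectpath a1 a3) ?F = - \<psi> (of_real a)" by simp
    have cont: "continuous_on (path_image (rectpath a1 a3)) ?F"
      using holomorphic_on_imp_continuous_on[OF Fhol] img by (rule continuous_on_subset)
    have lp: "rectpath a1 a3 = linepath a1 a2 +++ linepath a2 a3 +++ linepath a3 a4 +++ linepath a4 a1"
      by (simp add: rectpath_def Let_def a1_a2_a3_a4_def)
    have segs: "closed_segment a1 a2 \<subseteq> path_image (rectpath a1 a3)" "closed_segment a2 a3 \<subseteq> path_image (rectpath a1 a3)"
       "closed_segment a3 a4 \<subseteq> path_image (rectpath a1 a3)" "closed_segment a4 a1 \<subseteq> path_image (rectpath a1 a3)"
      unfolding lp by (auto simp: path_image_join)
    have ci: "?F contour_integrable_on linepath a1 a2" "?F contour_integrable_on linepath a2 a3"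
       "?F contour_integrable_on linepath a3 a4" "?F contour_integrable_on linepath a4 a1"
      by (rule contour_integrable_continuous_linepath, rule continuous_on_subset[OF cont], rule segs)+
    have 2: "contour_integral (rectpath a1 a3) ?F = contour_integral (linepath a1 a2) ?F + contour_integral (linepath a2 a3) ?F
         + contour_integral (linepath a3 a4) ?F + contour_integral (linepath a4 a1) ?F"
      unfolding lp using ci by (simp add: contour_integrable_join)
    have 3: "contour_integral (linepath a2 a3) ?F = \<i> * I (c + 1) n"
      unfolding I_def Y_def[symmetric] by (rule contour_integral_linepath_same_Re) (use Y in \<open>auto simp: a1_a2_a3_a4_def\<close>)
    have "contour_integral (linepath a1 a4) ?F = \<i> * I c n"
      unfolding I_def Y_def[symmetric] by (rule contour_integral_linepath_same_Re) (use Y in \<open>auto simp: a1_a2_a3_a4_def\<close>)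
    moreover have "contour_integral (linepath a4 a1) ?F = - contour_integral (linepath a1 a4) ?F"
      using contour_integral_reversepath[of "linepath a1 a4" ?F] by simp
    ultimately have 4: "contour_integral (linepath a4 a1) ?F = - (\<i> * I c n)" by simp
    have hor: "norm (?F z) \<le> 2 * \<bar>M\<bar> * (1 + Y) powr (- \<sigma>)" if "Re z \<ge> c" "\<bar>Im z\<bar> = Y" for z
    proof -
      have "norm (\<psi> z) \<le> \<bar>M\<bar> * (1 + Y) powr (- \<sigma>)"
        using bd[OF that(1)] that(2) by (smt (verit) mult_right_mono powr_ge_zero)
      moreover have "norm (ap_kernel \<gamma> (z - of_real a)) \<le> 2"
        by (rule norm_ap_kernel_le) (use that Y g in auto)
      ultimately have "norm (\<psi> z) * norm (ap_kernel \<gamma> (z - of_real a)) \<le> \<bar>M\<bar> * (1 + Y) powr (- \<sigma>) * 2"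
        by (intro mult_mono) auto
      thus ?thesis by (simp add: norm_mult mult_ac)
    qed
    have 5: "norm (contour_integral (linepath a1 a2) ?F) \<le> 2 * \<bar>M\<bar> * (1 + Y) powr (- \<sigma>) * norm (a2 - a1)"
    proof (rule contour_integral_bound_linepath[OF ci(1)])
      fix z assume "z \<in> closed_segment a1 a2"
      then obtain t where t: "0 \<le> t" "t \<le> 1" "z = (1 - t) *\<^sub>R a1 + t *\<^sub>R a2" by (auto simp: in_segment)
      have "Re z = c + t" "Im z = - Y" unfolding t(3) by (simp_all add: a1_a2_a3_a4_def algebra_simps)
      thus "norm (?F z) \<le> 2 * \<bar>M\<bar> * (1 + Y) powr (- \<sigma>)" using t Y by (intro hor) auto
    qed auto
    have 6: "norm (contour_integral (linepath a3 a4) ?F) \<le> 2 * \<bar>M\<bar> * (1 + Y) powr (- \<sigma>) * norm (a4 - a3)"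
    proof (rule contour_integral_bound_linepath[OF ci(3)])
      fix z assume "z \<in> closed_segment a3 a4"
      then obtain t where t: "0 \<le> t" "t \<le> 1" "z = (1 - t) *\<^sub>R a3 + t *\<^sub>R a4" by (auto simp: in_segment)
      have "Re z = c + (1 - t)" "Im z = Y" unfolding t(3) by (simp_all add: a1_a2_a3_a4_def algebra_simps)
      thus "norm (?F z) \<le> 2 * \<bar>M\<bar> * (1 + Y) powr (- \<sigma>)" using t Y by (intro hor) auto
    qed auto
    have neg_tri: "norm (- (A + B)) \<le> norm A + norm B" for A B :: complex
      by (subst norm_minus_cancel) (rule norm_triangle_ineq)
    have n1: "norm (a2 - a1) = 1" "norm (a4 - a3) = 1"
      by (simp_all add: a1_a2_a3_a4_def cmod_def)
    have "\<i> * I (c + 1) n - \<i> * I c n + \<psi> (of_real a) =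
         - (contour_integral (linepath a1 a2) ?F + contour_integral (linepath a3 a4) ?F)"
      using 1 2 3 4 by (simp add: algebra_simps)
    hence "norm (\<i> * I (c + 1) n - \<i> * I c n + \<psi> (of_real a)) \<le>
         norm (contour_integral (linepath a1 a2) ?F) + norm (contour_integral (linepath a3 a4) ?F)"
      using neg_tri by presburger
    also have "\<dots> \<le> 2 * \<bar>M\<bar> * (1 + Y) powr (- \<sigma>) + 2 * \<bar>M\<bar> * (1 + Y) powr (- \<sigma>)"
      by (rule add_mono[OF 5[unfolded n1 mult_1_right] 6[unfolded n1 mult_1_right]])
    also have "\<dots> = 4 * \<bar>M\<bar> * (1 + Y) powr (- \<sigma>)" by simp
    finally show ?thesis unfolding Y_def .
  qed
  have "(\<lambda>n. \<i> * I (c + 1) n - \<i> * I c n + \<psi> (of_real a)) \<longlonglongrightarrow> 0"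
  proof (rule Lim_null_comparison)
    show "\<forall>\<^sub>F n in sequentially. norm (\<i> * I (c + 1) n - \<i> * I c n + \<psi> (of_real a)) \<le> 4 * \<bar>M\<bar> * (1 + real n) powr (- \<sigma>)"
      using eventually_ge_at_top[of 1] by eventually_elim (rule key)
    have "filterlim (\<lambda>n. 1 + real n) at_top sequentially"
      by (rule filterlim_tendsto_add_at_top[OF tendsto_const filterlim_real_sequentially])
    hence "(\<lambda>n. (1 + real n) powr (- \<sigma>)) \<longlonglongrightarrow> 0"
      using \<sigma> by (intro tendsto_neg_powr) auto
    hence "(\<lambda>n. 4 * \<bar>M\<bar> * (1 + real n) powr (- \<sigma>)) \<longlonglongrightarrow> 4 * \<bar>M\<bar> * 0" by (rule tendsto_mult_left)
    thus "(\<lambda>n. 4 * \<bar>M\<bar> * (1 + real n) powr (- \<sigma>)) \<longlonglongrightarrow> 0" by simp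
  qed
  moreover have "(\<lambda>n. \<i> * I (c + 1) n - \<i> * I c n + \<psi> (of_real a)) \<longlonglongrightarrow>
       \<i> * (ap_upper \<gamma> a \<psi> (c + 1) + ap_lower \<gamma> a \<psi> (c + 1)) - \<i> * (ap_upper \<gamma> a \<psi> c + ap_lower \<gamma> a \<psi> c) + \<psi> (of_real a)"
    by (intro tendsto_intros lim1 lim2)
  ultimately have "\<i> * (ap_upper \<gamma> a \<psi> (c + 1) + ap_lower \<gamma> a \<psi> (c + 1)) - \<i> * (ap_upper \<gamma> a \<psi> c + ap_lower \<gamma> a \<psi> c) + \<psi> (of_real a) = 0"
    using LIMSEQ_unique by blast
  thus ?thesis by (simp add: algebra_simps)
qed

section \<open>Continuation of the Lerch zeta-function\<close>

lemma norm_powr_complex: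
  assumes "z \<noteq> 0"
  shows "norm (z powr w) = norm z powr Re w * exp (- Im w * Im (Ln z))"
proof -
  have "norm (z powr w) = exp (Re (w * Ln z))" using assms by (simp add: powr_def)
  also have "\<dots> = norm z powr Re w * exp (- Im w * Im (Ln z))"
    using assms by (simp add: Re_Ln powr_def flip: exp_add)
  finally show ?thesis .
qed

lemma norm_powr_right_half_plane:
  assumes "z \<noteq> 0" "Re z \<ge> 0"
  shows "norm (z powr (- s)) \<le> norm z powr (- Re s) * exp (pi / 2 * \<bar>Im s\<bar>)"
proof -
  have "\<bar>Im (Ln z)\<bar> \<le> pi / 2" using assms Re_Ln_pos_le by blast
  hence "\<bar>Im s * Im (Ln z)\<bar> \<le> \<bar>Im s\<bar> * (pi / 2)" unfolding abs_mult by (intro mult_left_mono) auto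
  hence "- Im (- s) * Im (Ln z) \<le> pi / 2 * \<bar>Im s\<bar>" by (simp add: mult_ac)
  hence "exp (- Im (- s) * Im (Ln z)) \<le> exp (pi / 2 * \<bar>Im s\<bar>)" by simp
  thus ?thesis unfolding norm_powr_complex[OF assms(1)] by (intro mult_mono) auto
qed

lemma norm_powr_line_bound:
  assumes "0 < c" "c \<le> 1" "Re z \<ge> c" "Re s \<ge> 0"
  shows "norm (z powr (- s)) \<le> (c / 2) powr (- Re s) * exp (pi / 2 * \<bar>Im s\<bar>) * (1 + \<bar>Im z\<bar>) powr (- Re s)"
proof -
  have z: "z \<noteq> 0" using assms by auto
  have "norm z \<ge> c" "norm z \<ge> \<bar>Im z\<bar>"
    using assms abs_Re_le_cmod[of z] abs_Im_le_cmod[of z] by auto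
  hence "norm z \<ge> c / 2 + \<bar>Im z\<bar> / 2" by linarith
  moreover have "c / 2 * \<bar>Im z\<bar> \<le> \<bar>Im z\<bar> / 2" using assms by (simp add: mult_left_le_one_le)
  ultimately have "c / 2 * (1 + \<bar>Im z\<bar>) \<le> norm z" by (simp add: algebra_simps)
  hence "norm z powr (- Re s) \<le> (c / 2 * (1 + \<bar>Im z\<bar>)) powr (- Re s)"
    using assms by (intro powr_mono2') auto
  also have "\<dots> = (c / 2) powr (- Re s) * (1 + \<bar>Im z\<bar>) powr (- Re s)"
    using assms by (subst powr_mult) auto
  finally have "norm z powr (- Re s) * exp (pi / 2 * \<bar>Im s\<bar>) \<le>
      (c / 2) powr (- Re s) * (1 + \<bar>Im z\<bar>) powr (- Re s) * exp (pi / 2 * \<bar>Im s\<bar>)"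
    by (rule mult_right_mono) simp
  moreover have "norm (z powr (- s)) \<le> norm z powr (- Re s) * exp (pi / 2 * \<bar>Im s\<bar>)"
    using norm_powr_right_half_plane[OF z, of s] assms by linarith
  ultimately show ?thesis by (simp only: mult_ac)
qed

text \<open>Moving the line by 1 multiplies the kernel by \<open>ee \<gamma>\<close> and replaces z
  by z + 1. If the line is kept fixed and the function is shifted instead,
  \<open>ap_strip_shift\<close> becomes the recurrence G n - ee \<gamma> G (n + 1) = (n + a)^(-s).
  It telescopes, and G n tends to 0 by dominated convergence.\<close>

lemma abel_plana_sums:
  assumes c: "0 < c" "c < a" and a: "a \<le> 1" and g: "0 \<le> \<gamma>" "\<gamma> \<le> 1" and s: "Re s > 1"
  shows "(\<lambda>n. ee (of_real \<gamma>) ^ n * of_real (real n + a) powr (- s)) sums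
           (\<i> * (ap_upper \<gamma> a (\<lambda>z. z powr (- s)) c + ap_lower \<gamma> a (\<lambda>z. z powr (- s)) c))"
proof -
  define \<psi> where "\<psi> n z = (z + of_nat n) powr (- s)" for n and z :: complex
  define G where "G n = \<i> * (ap_upper \<gamma> a (\<psi> n) c + ap_lower \<gamma> a (\<psi> n) c)" for n
  define M where "M = (c / 2) powr (- Re s) * exp (pi / 2 * \<bar>Im s\<bar>)"
  have bd: "norm (\<psi> n z) \<le> M * (1 + \<bar>Im z\<bar>) powr (- Re s)" if "Re z \<ge> c" for z n
    using norm_powr_line_bound[of c "z + of_nat n" s] c a s that by (auto simp: \<psi>_def M_def)
  have hol: "\<psi> n holomorphic_on {z. Re z > 0}" for n
    unfolding \<psi>_def by (intro holomorphic_intros) (auto simp: complex_nonpos_Reals_iff)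
  have step: "G n - ee (of_real \<gamma>) * G (Suc n) = of_real (real n + a) powr (- s)" for n
  proof -
    have "ap_upper \<gamma> a (\<psi> n) (c + 1) = integral {0<..} (\<lambda>y. ee (of_real \<gamma>) *
             (\<psi> (Suc n) (Complex c y) * ap_kernel \<gamma> (Complex c y - of_real a)))"
      unfolding ap_upper_def
    proof (rule integral_cong)
      fix y :: real
      have "\<psi> n (Complex (c + 1) y) = \<psi> (Suc n) (Complex c y)"
        unfolding \<psi>_def by (rule arg_cong[where f = "\<lambda>z. z powr (- s)"]) (simp add: complex_eq_iff)
      moreover have "Complex (c + 1) y - of_real a = (Complex c y - of_real a) + 1"
        by (simp add: complex_eq_iff)
      ultimately show "\<psi> n (Complex (c + 1) y) * ap_kernel \<gamma> (Complex (c + 1) y - of_real a) =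
          ee (of_real \<gamma>) * (\<psi> (Suc n) (Complex c y) * ap_kernel \<gamma> (Complex c y - of_real a))"
        by (simp only: ap_kernel_plus_1 mult_ac)
    qed
    hence 1: "ap_upper \<gamma> a (\<psi> n) (c + 1) = ee (of_real \<gamma>) * ap_upper \<gamma> a (\<psi> (Suc n)) c"
      by (simp add: ap_upper_def)
    have "ap_lower \<gamma> a (\<psi> n) (c + 1) = integral {0<..} (\<lambda>y. ee (of_real \<gamma>) *
             (\<psi> (Suc n) (Complex c (-y)) * ap_kernel \<gamma> (Complex c (-y) - of_real a)))"
      unfolding ap_lower_def
    proof (rule integral_cong)
      fix y :: real
      have "\<psi> n (Complex (c + 1) (-y)) = \<psi> (Suc n) (Complex c (-y))"
        unfolding \<psi>_def by (rule arg_cong[where f = "\<lambda>z. z powr (- s)"]) (simp add: complex_eq_iff)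
      moreover have "Complex (c + 1) (-y) - of_real a = (Complex c (-y) - of_real a) + 1"
        by (simp add: complex_eq_iff)
      ultimately show "\<psi> n (Complex (c + 1) (-y)) * ap_kernel \<gamma> (Complex (c + 1) (-y) - of_real a) =
          ee (of_real \<gamma>) * (\<psi> (Suc n) (Complex c (-y)) * ap_kernel \<gamma> (Complex c (-y) - of_real a))"
        by (simp only: ap_kernel_plus_1 mult_ac)
    qed
    hence 2: "ap_lower \<gamma> a (\<psi> n) (c + 1) = ee (of_real \<gamma>) * ap_lower \<gamma> a (\<psi> (Suc n)) c"
      by (simp add: ap_lower_def)
    have "\<psi> n (of_real a) = \<i> * (ap_upper \<gamma> a (\<psi> n) c + ap_lower \<gamma> a (\<psi> n) c)
       - \<i> * (ap_upper \<gamma> a (\<psi> n) (c + 1) + ap_lower \<gamma> a (\<psi> n) (c + 1))"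
      by (rule ap_strip_shift[OF hol _ _ _ _ g s bd, symmetric]) (use c a in auto)
    thus ?thesis unfolding 1 2 by (simp add: G_def \<psi>_def algebra_simps)
  qed
  have part: "(\<Sum>k<n. ee (of_real \<gamma>) ^ k * of_real (real k + a) powr (- s)) = G 0 - ee (of_real \<gamma>) ^ n * G n" for n
  proof (induction n)
    case (Suc n)
    show ?case unfolding sum.lessThan_Suc Suc step[of n, symmetric] by (simp add: algebra_simps)
  qed simp
  obtain C where C: "C \<ge> 0" "\<And>y. norm (ap_kernel \<gamma> (Complex (c - a) y)) \<le> C"
  proof -
    have "c - a \<notin> \<int>" using Ints_nonzero_abs_less1[of "c - a"] c a by auto
    thus ?thesis using ap_kernel_line_bound[OF g] that by blast
  qed
  have eqc: "Complex c y - of_real a = Complex (c - a) y" for y by (simp add: complex_eq_iff)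
  have ne: "ee (Complex (c - a) y) \<noteq> 1" for y
    using Ints_nonzero_abs_less1[of "c - a"] c a by (auto simp: ee_eq_1_iff)
  have gi: "(\<lambda>y. C * M * (1 + y) powr (- Re s)) integrable_on {0<..}"
    by (intro integrable_on_mult_right integrable_one_plus_powr_neg s)
  have lim0: "(\<lambda>n. \<psi> n z) \<longlonglongrightarrow> 0" if "Re z > 0" for z
  proof (rule Lim_null_comparison)
    show "\<forall>\<^sub>F n in sequentially. norm (\<psi> n z) \<le> exp (pi / 2 * \<bar>Im s\<bar>) * real n powr (- Re s)"
      using eventually_ge_at_top[of 1]
    proof eventually_elim
      case (elim n)
      have nz: "z + of_nat n \<noteq> 0" "Re (z + of_nat n) \<ge> 0" using that by (auto simp: complex_eq_iff)
      have "norm (z + of_nat n) \<ge> real n" using that abs_Re_le_cmod[of "z + of_nat n"] by simp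
      hence "norm (z + of_nat n) powr (- Re s) \<le> real n powr (- Re s)"
        using elim s by (intro powr_mono2') auto
      hence "norm (z + of_nat n) powr (- Re s) * exp (pi / 2 * \<bar>Im s\<bar>) \<le> real n powr (- Re s) * exp (pi / 2 * \<bar>Im s\<bar>)"
        by (rule mult_right_mono) simp
      from order_trans[OF norm_powr_right_half_plane[OF nz, of s] this]
      show ?case unfolding \<psi>_def by (simp only: mult_ac)
    qed
    have "(\<lambda>n. real n powr (- Re s)) \<longlonglongrightarrow> 0"
      using s by (intro tendsto_neg_powr filterlim_real_sequentially) auto
    thus "(\<lambda>n. exp (pi / 2 * \<bar>Im s\<bar>) * real n powr (- Re s)) \<longlonglongrightarrow> 0"
      by (rule tendsto_mult_right_zero)
  qed
  \<comment> \<open>The sign e = 1 gives the upper half-line, e = -1 the lower one.\<close>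
  have conv: "(\<lambda>n. integral {0<..} (\<lambda>y. \<psi> n (Complex c (e * y)) * ap_kernel \<gamma> (Complex c (e * y) - of_real a))) \<longlonglongrightarrow>
         integral {0<..} (\<lambda>y::real. 0)" if e: "\<bar>e\<bar> = 1" for e :: real
  proof (rule dominated_convergence(2)[where h = "\<lambda>y. C * M * (1 + y) powr (- Re s)"])
    show "(\<lambda>y. C * M * (1 + y) powr (- Re s)) integrable_on {0<..}" by (rule gi)
    have bb: "norm (\<psi> k (Complex c (e * y)) * ap_kernel \<gamma> (Complex c (e * y) - of_real a)) \<le> C * M * (1 + y) powr (- Re s)"
      if "y > 0" for k y
    proof -
      have "norm (\<psi> k (Complex c (e * y))) \<le> M * (1 + y) powr (- Re s)"
        using bd[of "Complex c (e * y)" k] e that by (simp add: abs_mult)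
      from mult_mono[OF this C(2)[of "e * y"]] C(1) order_trans[OF norm_ge_zero this]
      show ?thesis unfolding eqc norm_mult by (simp add: mult_ac)
    qed
    show "(\<lambda>y. \<psi> k (Complex c (e * y)) * ap_kernel \<gamma> (Complex c (e * y) - of_real a)) integrable_on {0<..}" for k
    proof (rule integrable_on_halfline_dominated[OF _ bb gi])
      have "continuous_on {0<..} (\<lambda>y. \<psi> k (Complex c (e * y)))"
        by (rule continuous_on_compose2[OF holomorphic_on_imp_continuous_on[OF hol]])
           (use c in \<open>auto intro!: continuous_intros\<close>)
      thus "continuous_on {0<..} (\<lambda>y. \<psi> k (Complex c (e * y)) * ap_kernel \<gamma> (Complex c (e * y) - of_real a))"
        unfolding eqc ap_kernel_def using ne by (intro continuous_intros) auto
    qed auto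
    show "norm (\<psi> k (Complex c (e * y)) * ap_kernel \<gamma> (Complex c (e * y) - of_real a)) \<le> C * M * (1 + y) powr (- Re s)"
      if "y \<in> {0<..}" for k y using bb that by auto
    show "(\<lambda>k. \<psi> k (Complex c (e * y)) * ap_kernel \<gamma> (Complex c (e * y) - of_real a)) \<longlonglongrightarrow> 0" for y
      using c by (intro tendsto_mult_left_zero lim0) auto
  qed
  have "(\<lambda>n. G n) \<longlonglongrightarrow> \<i> * (0 + 0)"
    unfolding G_def ap_upper_def ap_lower_def
    using conv[of 1] conv[of "-1"] by (intro tendsto_intros) auto
  hence "(\<lambda>n. G n) \<longlonglongrightarrow> 0" by simp
  hence "(\<lambda>n. ee (of_real \<gamma>) ^ n * G n) \<longlonglongrightarrow> 0"
    by (rule Lim_null_comparison[rotated, OF tendsto_norm_zero]) (simp add: norm_mult norm_power)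
  hence "(\<lambda>n. G 0 - ee (of_real \<gamma>) ^ n * G n) \<longlonglongrightarrow> G 0 - 0" by (intro tendsto_intros)
  thus ?thesis unfolding sums_def part by (simp add: G_def \<psi>_def[abs_def])
qed

text \<open>The least positive frequency congruent to \<open>- \<beta>\<close> modulo \<open>1\<close>.\<close>
definition dual_freq :: "real \<Rightarrow> real" where
  "dual_freq \<beta> = (if \<beta> = 1 then 1 else 1 - \<beta>)"

text \<open>The lower half-line is already reflected, so both kernels are evaluated in the upper
  half-plane with a positive frequency. They decay exponentially there, which makes the expression
  entire in s. For \<beta> = 1 the reflection would give frequency 0 instead;
  \<open>dual_freq\<close> replaces it by 1, and the difference is the pole term of
  \<open>lerch_cont\<close>.\<close>

definition lerch_line :: "real \<Rightarrow> real \<Rightarrow> real \<Rightarrow> complex \<Rightarrow> complex" where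
  "lerch_line a \<beta> c s = \<i> *
     (integral {0<..} (\<lambda>y. Complex c y powr (- s) * ap_kernel \<beta> (Complex (c - a) y)) -
      integral {0<..} (\<lambda>y. Complex c (- y) powr (- s) * ap_kernel (dual_freq \<beta>) (Complex (a - c) y)))"

lemma dual_freq_pos: "0 < \<beta> \<Longrightarrow> \<beta> \<le> 1 \<Longrightarrow> 0 < dual_freq \<beta>" "0 < \<beta> \<Longrightarrow> \<beta> \<le> 1 \<Longrightarrow> dual_freq \<beta> \<le> 1"
  by (auto simp: dual_freq_def)

lemma ap_kernel_half_line_bound:
  assumes "0 \<le> \<gamma>" "\<gamma> \<le> 1" "x \<notin> \<int>"
  obtains C where "C \<ge> 0" "\<And>y. y \<ge> 0 \<Longrightarrow> norm (ap_kernel \<gamma> (Complex x y)) \<le> C * exp (- (2 * pi * \<gamma>) * y)"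
proof -
  obtain B where B: "B \<ge> 0" "\<And>y. norm (ap_kernel \<gamma> (Complex x y)) \<le> B"
    using ap_kernel_line_bound[OF assms] by blast
  define C where "C = max 2 (B * exp (2 * pi * \<gamma>))"
  have "norm (ap_kernel \<gamma> (Complex x y)) \<le> C * exp (- (2 * pi * \<gamma>) * y)" if "y \<ge> 0" for y
  proof (cases "y \<ge> 1")
    case True
    have "2 * exp (- 2 * pi * \<gamma> * y) \<le> C * exp (- 2 * pi * \<gamma> * y)" by (intro mult_right_mono) (auto simp: C_def)
    moreover have "norm (ap_kernel \<gamma> (Complex x y)) \<le> 2 * exp (- 2 * pi * \<gamma> * y)"
      using norm_ap_kernel_upper[of "Complex x y" \<gamma>] True by simp
    moreover have "- 2 * pi * \<gamma> * y = - (2 * pi * \<gamma>) * y" by simp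
    ultimately show ?thesis by (metis order_trans)
  next
    case False
    have "1 \<le> exp (2 * pi * \<gamma>) * exp (- (2 * pi * \<gamma>) * y)"
      using False assms by (simp flip: exp_add) (simp add: mult_left_le)
    hence "B * 1 \<le> B * (exp (2 * pi * \<gamma>) * exp (- (2 * pi * \<gamma>) * y))" using B by (intro mult_left_mono)
    also have "\<dots> \<le> C * exp (- (2 * pi * \<gamma>) * y)"
      unfolding C_def mult.assoc[symmetric] by (intro mult_right_mono) auto
    finally show ?thesis using B(2)[of y] by simp
  qed
  thus ?thesis by (intro that[of C]) (auto simp: C_def)
qed

lemma Ln_line_bound:
  assumes "0 < c" "c \<le> 1" "y \<ge> 0" "\<bar>e\<bar> = (1::real)"
  shows "norm (Ln (Complex c (e * y))) \<le> \<bar>ln c\<bar> + pi / 2 + ln (1 + y)"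
proof -
  let ?z = "Complex c (e * y)"
  have z: "?z \<noteq> 0" using assms by (auto simp: complex_eq_iff)
  have 1: "norm ?z \<ge> c" using abs_Re_le_cmod[of ?z] by simp
  have 2: "norm ?z \<le> 1 + y" using cmod_le[of ?z] assms by (simp add: abs_mult)
  have "\<bar>ln (norm ?z)\<bar> \<le> \<bar>ln c\<bar> + ln (1 + y)"
  proof -
    have "ln c \<le> ln (norm ?z)" "ln (norm ?z) \<le> ln (1 + y)" "ln (1 + y) \<ge> 0"
      using 1 2 assms z by (auto simp del: complex_norm)
    thus ?thesis by linarith
  qed
  moreover have "\<bar>Im (Ln ?z)\<bar> \<le> pi / 2" using z assms Re_Ln_pos_le[of ?z] by simp
  moreover have "norm (Ln ?z) \<le> \<bar>Re (Ln ?z)\<bar> + \<bar>Im (Ln ?z)\<bar>" by (rule cmod_le)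
  ultimately show ?thesis using z by simp
qed

text \<open>The sign \<open>e\<close> selects the half-line for the power; the kernel is taken on
  the upper one in either case and decays like exp (-2 \<pi> \<gamma> y), so that \<gamma> > 0 gives
  convergence for all s.\<close>

lemma line_part:
  assumes c: "0 < c" "c \<le> 1" and \<gamma>: "0 < \<gamma>" "\<gamma> \<le> 1" and x: "x \<notin> \<int>" and e: "\<bar>e\<bar> = (1::real)"
  shows "(\<lambda>y. Complex c (e * y) powr (- s) * ap_kernel \<gamma> (Complex x y)) integrable_on {0<..}"
    and "(\<lambda>s. integral {0<..} (\<lambda>y. Complex c (e * y) powr (- s) * ap_kernel \<gamma> (Complex x y))) holomorphic_on UNIV"
proof -
  have eq: "Complex c (e * y) powr (- s) = exp (- s * Ln (Complex c (e * y)))" for y s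
    using c by (auto simp: powr_def complex_eq_iff)
  have ne: "ee (Complex x y) \<noteq> 1" for y using x by (auto simp: ee_eq_1_iff)
  obtain C where C: "C \<ge> 0" "\<And>y. y \<ge> 0 \<Longrightarrow> norm (ap_kernel \<gamma> (Complex x y)) \<le> C * exp (- (2 * pi * \<gamma>) * y)"
    using ap_kernel_half_line_bound[of \<gamma> x] \<gamma> x by auto
  have c1: "continuous_on {0..} (\<lambda>y. Ln (Complex c (e * y)))"
    using c by (intro continuous_intros) (auto simp: complex_nonpos_Reals_iff)
  have c2: "continuous_on {0..} (\<lambda>y. ap_kernel \<gamma> (Complex x y))"
    unfolding ap_kernel_def using ne by (intro continuous_intros) auto
  note H = holomorphic_exp_integral[OF c1 c2 C(2) _ Ln_line_bound[OF c _ e]]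
  show "(\<lambda>y. Complex c (e * y) powr (- s) * ap_kernel \<gamma> (Complex x y)) integrable_on {0<..}"
    unfolding eq by (rule H(1)) (use \<gamma> in auto)
  show "(\<lambda>s. integral {0<..} (\<lambda>y. Complex c (e * y) powr (- s) * ap_kernel \<gamma> (Complex x y))) holomorphic_on UNIV"
    unfolding eq by (rule H(2)) (use \<gamma> in auto)
qed

lemma lerch_line_holomorphic:
  assumes "0 < c" "c < a" "a \<le> 1" "0 < \<beta>" "\<beta> \<le> 1"
  shows "lerch_line a \<beta> c holomorphic_on UNIV"
proof -
  have nint: "c - a \<notin> \<int>" "a - c \<notin> \<int>"
    using Ints_nonzero_abs_less1[of "c - a"] Ints_nonzero_abs_less1[of "a - c"] assms by auto
  have "(\<lambda>s. \<i> * (integral {0<..} (\<lambda>y. Complex c (1 * y) powr (- s) * ap_kernel \<beta> (Complex (c - a) y)) -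
      integral {0<..} (\<lambda>y. Complex c ((-1) * y) powr (- s) * ap_kernel (dual_freq \<beta>) (Complex (a - c) y)))) holomorphic_on UNIV"
    by (intro holomorphic_intros line_part) (use assms nint dual_freq_pos in auto)
  thus ?thesis by (simp add: lerch_line_def[abs_def])
qed

text \<open>The source of the pole at s = 1: this is what frequency 0 leaves over on the lower
  half-line. The primitive vanishes at infinity since Re s > 1.\<close>

lemma integral_powr_lower_line:
  assumes c: "0 < c" "c \<le> 1" and s: "Re s > 1"
  shows "((\<lambda>y. Complex c (- y) powr (- s)) has_integral (of_real c powr (1 - s) / (\<i> * (1 - s)))) {0<..}"
proof -
  let ?h = "\<lambda>y. Complex c (- y) powr (- s)"
  let ?A = "\<lambda>y. Complex c (- y) powr (1 - s) / (- \<i> * (1 - s))"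
  have s1: "1 - s \<noteq> 0" using s by auto
  define M where "M = (c / 2) powr (- Re s) * exp (pi / 2 * \<bar>Im s\<bar>)"
  have cont: "continuous_on A ?h" for A
    using c by (intro continuous_intros) (auto simp: complex_nonpos_Reals_iff complex_eq_iff)
  have bd: "norm (?h y) \<le> M * (1 + y) powr (- Re s)" if "y > 0" for y
    using norm_powr_line_bound[of c "Complex c (- y)" s] c s that by (simp add: M_def)
  have gi: "(\<lambda>y. M * (1 + y) powr (- Re s)) integrable_on {0<..}"
    by (intro integrable_on_mult_right integrable_one_plus_powr_neg s)
  have int: "?h integrable_on {0<..}"
    by (rule integrable_on_halfline_dominated[OF cont bd gi])
  have seg: "integral {0..real n} ?h = ?A (real n) - ?A 0" for n
  proof (rule integral_unique, rule fundamental_theorem_of_calculus)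
    fix y :: real assume "y \<in> {0..real n}"
    have eq: "Complex c (- y) = of_real c - \<i> * of_real y" for y by (simp add: complex_eq_iff)
    have np: "of_real c - \<i> * of_real y \<notin> \<real>\<^sub>\<le>\<^sub>0" using c by (auto simp: complex_nonpos_Reals_iff)
    have "((\<lambda>z. (of_real c - \<i> * z) powr (1 - s) / (- \<i> * (1 - s))) has_field_derivative
              (of_real c - \<i> * of_real y) powr (- s)) (at (of_real y))"
    proof -
      have d1: "((\<lambda>z. of_real c - \<i> * z) has_field_derivative (- \<i>)) (at (of_real y))"
        by (auto intro!: derivative_eq_intros)
      have "((\<lambda>z. (of_real c - \<i> * z) powr (1 - s)) has_field_derivative
           ((1 - s) * (of_real c - \<i> * of_real y) powr (1 - s - 1) * (- \<i>))) (at (of_real y))"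
        by (rule DERIV_chain2[OF has_field_derivative_powr[OF np] d1])
      from DERIV_cdivide[OF this, of "- \<i> * (1 - s)"] s1 show ?thesis by simp
    qed
    from has_vector_derivative_real_field[OF this]
    show "(?A has_vector_derivative ?h y) (at y within {0..real n})"
      unfolding eq by simp
  qed auto
  have lim: "(\<lambda>n. integral {0..real n} ?h) \<longlonglongrightarrow> integral {0<..} ?h"
    by (rule integral_halfline_limit[OF cont bd gi])
  have "(\<lambda>n. ?A (real n)) \<longlonglongrightarrow> 0"
  proof (rule Lim_null_comparison)
    define K where "K = (c / 2) powr (1 - Re s) * exp (pi / 2 * \<bar>Im s\<bar>) / norm (1 - s)"
    show "\<forall>\<^sub>F n in sequentially. norm (?A (real n)) \<le> K * (1 + real n) powr (1 - Re s)"
    proof (rule always_eventually, rule allI)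
      fix n :: nat
      have "norm (Complex c (- real n) powr (- (s - 1))) \<le>
         (c / 2) powr (1 - Re s) * exp (pi / 2 * \<bar>Im s\<bar>) * (1 + real n) powr (1 - Re s)"
        using norm_powr_line_bound[of c "Complex c (- real n)" "s - 1"] c s by simp
      hence "norm (Complex c (- real n) powr (1 - s)) / norm (1 - s) \<le>
          (c / 2) powr (1 - Re s) * exp (pi / 2 * \<bar>Im s\<bar>) * (1 + real n) powr (1 - Re s) / norm (1 - s)"
        by (intro divide_right_mono) auto
      thus "norm (?A (real n)) \<le> K * (1 + real n) powr (1 - Re s)"
        by (simp add: norm_divide norm_mult K_def)
    qed
    have "filterlim (\<lambda>n. 1 + real n) at_top sequentially"
      by (rule filterlim_tendsto_add_at_top[OF tendsto_const filterlim_real_sequentially])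
    hence "(\<lambda>n. (1 + real n) powr (1 - Re s)) \<longlonglongrightarrow> 0"
      using s by (intro tendsto_neg_powr) auto
    thus "(\<lambda>n. K * (1 + real n) powr (1 - Re s)) \<longlonglongrightarrow> 0"
      by (rule tendsto_mult_right_zero)
  qed
  hence "(\<lambda>n. integral {0..real n} ?h) \<longlonglongrightarrow> 0 - ?A 0"
    unfolding seg by (intro tendsto_intros)
  with lim have "integral {0<..} ?h = 0 - ?A 0" using LIMSEQ_unique by blast
  also have "\<dots> = of_real c powr (1 - s) / (\<i> * (1 - s))"
    using s1 by (simp add: complex_of_real_def field_simps)
  finally show ?thesis using int by (simp add: has_integral_iff)
qed

text \<open>For \<beta> = 1 and s = 1 the division by 0 yields 0, so the value at the pole is that
  of \<open>lerch_line\<close> and not the normalised value 0. Hence the passage through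
  \<open>remove_sings\<close> and the restriction s \<noteq> 1 in the identification with
  \<open>lerch_phi\<close>.\<close>

definition lerch_cont :: "real \<Rightarrow> real \<Rightarrow> real \<Rightarrow> complex \<Rightarrow> complex" where
  "lerch_cont a \<beta> c s = lerch_line a \<beta> c s + (if \<beta> = 1 then of_real c powr (1 - s) / (s - 1) else 0)"

lemma lerch_cont_sums:
  assumes c: "0 < c" "c < a" "a \<le> 1" and \<beta>: "0 < \<beta>" "\<beta> \<le> 1" and s: "Re s > 1"
  shows "(\<lambda>n. ee (of_real \<beta>) ^ n * of_real (real n + a) powr (- s)) sums lerch_cont a \<beta> c s"
proof -
  have nint: "c - a \<notin> \<int>" "a - c \<notin> \<int>"
    using Ints_nonzero_abs_less1[of "c - a"] Ints_nonzero_abs_less1[of "a - c"] c by auto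
  let ?\<psi> = "\<lambda>z::complex. z powr (- s)"
  let ?L = "integral {0<..} (\<lambda>y. Complex c (- y) powr (- s) * ap_kernel (dual_freq \<beta>) (Complex (a - c) y))"
  have up: "ap_upper \<beta> a ?\<psi> c = integral {0<..} (\<lambda>y. Complex c y powr (- s) * ap_kernel \<beta> (Complex (c - a) y))"
    unfolding ap_upper_def
  proof (rule integral_cong)
    fix y :: real
    have "Complex c y - of_real a = Complex (c - a) y" by (simp add: complex_eq_iff)
    thus "Complex c y powr - s * ap_kernel \<beta> (Complex c y - of_real a) =
        Complex c y powr - s * ap_kernel \<beta> (Complex (c - a) y)" by simp
  qed
  have refl: "ap_kernel \<beta> (Complex c (-y) - of_real a) = - ap_kernel (1 - \<beta>) (Complex (a - c) y)" for y
  proof -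
    have e: "Complex c (- y) - of_real a = - Complex (a - c) y" by (simp add: complex_eq_iff)
    have "ee (- Complex (a - c) y) \<noteq> 1" using nint by (auto simp: ee_eq_1_iff)
    from ap_kernel_reflect[OF this, of \<beta>] show ?thesis unfolding e by simp
  qed
  have int: "(\<lambda>y. Complex c (- y) powr (- s) * ap_kernel (dual_freq \<beta>) (Complex (a - c) y)) integrable_on {0<..}"
    using line_part(1)[of c "dual_freq \<beta>" "a - c" "-1" s] c \<beta> nint dual_freq_pos[OF \<beta>] by simp
  have low: "ap_lower \<beta> a ?\<psi> c = - ?L - (if \<beta> = 1 then of_real c powr (1 - s) / (\<i> * (1 - s)) else 0)"
  proof (cases "\<beta> = 1")
    case False
    have "ap_lower \<beta> a ?\<psi> c = integral {0<..} (\<lambda>y. - (Complex c (- y) powr (- s) * ap_kernel (dual_freq \<beta>) (Complex (a - c) y)))"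
      unfolding ap_lower_def refl using False by (intro integral_cong) (simp add: dual_freq_def)
    thus ?thesis using False by simp
  next
    case True
    \<comment> \<open>Frequency 0 gives no decay. Splitting off the constant 1 leaves the kernel of
      frequency 1, and the constant integrates to the pole term.\<close>
    have k0: "ap_kernel 0 (Complex (a - c) y) = ap_kernel 1 (Complex (a - c) y) + 1" for y
    proof -
      have "ee (Complex (a - c) y) \<noteq> 1" using nint by (auto simp: ee_eq_1_iff)
      thus ?thesis by (simp add: ap_kernel_def field_simps)
    qed
    note I = integral_powr_lower_line[OF c(1) _ s]
    have "ap_lower \<beta> a ?\<psi> c = integral {0<..} (\<lambda>y. - (Complex c (- y) powr (- s) * ap_kernel (dual_freq \<beta>) (Complex (a - c) y))
            - Complex c (- y) powr (- s))"
      unfolding ap_lower_def refl using True by (intro integral_cong) (simp add: dual_freq_def k0 algebra_simps)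
    also have "\<dots> = - ?L - integral {0<..} (\<lambda>y. Complex c (- y) powr (- s))"
      using int I c
      by (subst Henstock_Kurzweil_Integration.integral_diff) (auto simp: integrable_neg_iff has_integral_iff)
    also have "integral {0<..} (\<lambda>y. Complex c (- y) powr (- s)) = of_real c powr (1 - s) / (\<i> * (1 - s))"
      using I c by (simp add: has_integral_iff)
    finally show ?thesis using True by simp
  qed
  have "\<i> * (ap_upper \<beta> a ?\<psi> c + ap_lower \<beta> a ?\<psi> c) = lerch_cont a \<beta> c s"
  proof -
    have "s \<noteq> 1" using s by auto
    hence e1: "x / (\<i> * (1 - s)) = \<i> * (x / (s - 1))" for x
      by (simp add: divide_simps)
    show ?thesis unfolding up low e1 lerch_cont_def lerch_line_def
      by (cases "\<beta> = 1") (simp_all add: ring_distribs flip: mult.assoc)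
  qed
  thus ?thesis using abel_plana_sums[of c a \<beta> s] c \<beta> s by simp
qed

section \<open>Uniqueness of the continuation and its identification\<close>

lemma nicely_meromorphic_eqI:
  assumes f: "f nicely_meromorphic_on UNIV" and g: "g nicely_meromorphic_on UNIV"
    and A: "open A" "z0 \<in> A" "\<And>z. z \<in> A \<Longrightarrow> f z = g z"
  shows "f = g"
proof
  fix z
  have fm: "f meromorphic_on UNIV" and gm: "g meromorphic_on UNIV"
    using f g by (auto simp: nicely_meromorphic_on_def)
  have dm: "(\<lambda>z. f z - g z) meromorphic_on UNIV" by (intro meromorphic_intros fm gm)
  let ?d = "remove_sings (\<lambda>z. f z - g z)"
  have dn: "?d nicely_meromorphic_on UNIV" by (rule remove_sings_nicely_meromorphic[OF dm])
  have "eventually (\<lambda>z. f z - g z = 0) (at z0)"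
    using A by (auto simp: eventually_at_topological)
  moreover have ev: "eventually (\<lambda>z. ?d z = f z - g z) (at z)" for z
    using dm by (intro eventually_remove_sings_eq_at) (auto intro: meromorphic_on_isolated_singularity meromorphic_on_subset)
  ultimately have "eventually (\<lambda>z. ?d z = 0) (at z0)"
    by (smt (verit) eventually_elim2 ev)
  hence "frequently (\<lambda>z. ?d z = 0) (at z0)"
    by (intro eventually_frequently) auto
  from frequently_eq_meromorphic_imp_constant[OF this dn] have d0: "?d w = 0" for w by auto
  have fg: "eventually (\<lambda>w. f w = g w) (at z)" using ev[of z] d0 by simp
  \<comment> \<open>So far f and g agree in punctured neighbourhoods only. The normalisation decides
    the value at the point: 0 at a common pole, the common limit otherwise.\<close>
  have "(is_pole f z \<and> f z = 0) \<or> f \<midarrow>z\<rightarrow> f z" "(is_pole g z \<and> g z = 0) \<or> g \<midarrow>z\<rightarrow> g z"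
    using f g by (auto simp: nicely_meromorphic_on_def)
  moreover have "is_pole f z \<longleftrightarrow> is_pole g z" by (rule is_pole_cong[OF fg refl])
  moreover have "f \<midarrow>z\<rightarrow> w \<longleftrightarrow> g \<midarrow>z\<rightarrow> w" for w by (rule tendsto_cong[OF fg])
  ultimately show "f z = g z"
    by (metis LIM_unique at_neq_bot is_pole_def not_tendsto_and_filterlim_at_infinity)
qed

text \<open>By uniqueness any explicit continuation of the series is the meromorphic extension. In
  particular the right side does not depend on c: later c = a/2 serves for growth estimates and c ->
  0 for the functional equation.\<close>

lemma lerch_phi_eq_lerch_cont:
  assumes c: "0 < c" "c < a" "a \<le> 1" and \<beta>: "0 < \<beta>" "\<beta> \<le> 1" and s: "s \<noteq> 1"
  shows "lerch_phi a \<beta> s = lerch_cont a \<beta> c s"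
proof -
  let ?f = "\<lambda>z. \<Sum>n. exp (2 * of_real pi * \<i> * of_nat n * of_real \<beta>) * of_real (real n + a) powr (- z)"
  let ?A = "{z. Re z > 1}"
  define F where "F = remove_sings (lerch_cont a \<beta> c)"
  have Lhol: "lerch_line a \<beta> c holomorphic_on UNIV" by (rule lerch_line_holomorphic[OF c \<beta>])
  have an: "lerch_cont a \<beta> c analytic_on {z}" if "z \<noteq> 1" for z
  proof -
    have "lerch_line a \<beta> c holomorphic_on (- {1})" by (rule holomorphic_on_subset[OF Lhol]) auto
    moreover have "(\<lambda>s. if \<beta> = 1 then of_real c powr (1 - s) / (s - 1) else 0) holomorphic_on (- {1 :: complex})"
      using c by (cases "\<beta> = 1") (auto intro!: holomorphic_intros)
    ultimately have "lerch_cont a \<beta> c holomorphic_on (- {1})"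
      unfolding lerch_cont_def[abs_def] by (intro holomorphic_intros)
    hence "lerch_cont a \<beta> c analytic_on (- {1})" by (subst analytic_on_open) auto
    thus ?thesis by (rule analytic_on_subset) (use that in auto)
  qed
  have mero: "lerch_cont a \<beta> c meromorphic_on UNIV"
  proof -
    have "lerch_line a \<beta> c meromorphic_on UNIV"
      using Lhol by (intro analytic_on_imp_meromorphic_on) (simp add: analytic_on_open)
    moreover have "(\<lambda>s. if \<beta> = 1 then of_real c powr (1 - s) / (s - 1) else 0) meromorphic_on (UNIV :: complex set)"
    proof (cases "\<beta> = 1")
      case True
      have "(\<lambda>s. of_real c powr (1 - s)) meromorphic_on (UNIV :: complex set)"
        using c by (intro analytic_on_imp_meromorphic_on) (auto simp: analytic_on_open intro!: holomorphic_intros)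
      thus ?thesis using True by (auto intro!: meromorphic_intros)
    qed auto
    ultimately show ?thesis unfolding lerch_cont_def[abs_def] by (intro meromorphic_intros)
  qed
  have Fn: "F nicely_meromorphic_on UNIV" unfolding F_def by (rule remove_sings_nicely_meromorphic[OF mero])
  have Fs: "F z = lerch_cont a \<beta> c z" if "z \<noteq> 1" for z
    unfolding F_def using an[OF that] by simp
  have FA: "F z = ?f z" if "z \<in> ?A" for z
  proof -
    have z: "Re z > 1" "z \<noteq> 1" using that by auto
    have "exp (2 * of_real pi * \<i> * of_nat n * of_real \<beta>) = ee (of_real \<beta>) ^ n" for n
      by (simp add: ee_def mult_ac flip: exp_of_nat_mult)
    thus ?thesis using lerch_cont_sums[OF c \<beta> z(1)] Fs[OF z(2)] by (simp add: sums_iff)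
  qed
  have "(THE F. F nicely_meromorphic_on UNIV \<and> (\<forall>s\<in>?A. F s = ?f s)) = F"
  proof (rule the_equality)
    fix G assume G: "G nicely_meromorphic_on UNIV \<and> (\<forall>s\<in>?A. G s = ?f s)"
    show "G = F"
    proof (rule nicely_meromorphic_eqI[of _ _ ?A 2])
      show "open ?A" by (rule open_halfspace_Re_gt)
    qed (use G Fn FA in auto)
  qed (use Fn FA in auto)
  thus ?thesis using Fs[OF s] by (simp add: lerch_phi_def meromorphic_extension_def)
qed

text \<open>exp (2 \<pi> \<i> n) = 1, so both names denote the extension of the same
  function.\<close>

lemma hurwitz_zeta_eq_lerch_phi: "hurwitz_zeta s a = lerch_phi a 1 s"
proof -
  have "exp (2 * of_real pi * \<i> * of_nat n * of_real 1) = (1 :: complex)" for n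
    using ee_of_nat[of n] by (simp add: ee_def)
  thus ?thesis by (simp add: hurwitz_zeta_def lerch_phi_def)
qed

lemma lerch_phi_holomorphic:
  assumes a: "0 < a" "a \<le> 1" and \<beta>: "0 < \<beta>" "\<beta> \<le> 1"
  shows "lerch_phi a \<beta> holomorphic_on - {1}"
proof -
  have L: "lerch_line a \<beta> (a / 2) holomorphic_on UNIV" by (rule lerch_line_holomorphic) (use assms in auto)
  have "lerch_line a \<beta> (a / 2) holomorphic_on (- {1})" by (rule holomorphic_on_subset[OF L]) auto
  moreover have "(\<lambda>s. if \<beta> = 1 then of_real (a / 2) powr (1 - s) / (s - 1) else 0) holomorphic_on (- {1 :: complex})"
    using a by (cases "\<beta> = 1") (auto intro!: holomorphic_intros)
  ultimately have "lerch_cont a \<beta> (a / 2) holomorphic_on (- {1})"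
    unfolding lerch_cont_def[abs_def] by (intro holomorphic_intros)
  also have "?this \<longleftrightarrow> ?thesis"
    by (rule holomorphic_cong) (use lerch_phi_eq_lerch_cont[of "a / 2" a \<beta>] assms in auto)
  finally show ?thesis .
qed

lemma lerch_phi_sums:
  assumes a: "0 < a" "a \<le> 1" and \<beta>: "0 < \<beta>" "\<beta> \<le> 1" and s: "Re s > 1"
  shows "(\<lambda>n. ee (of_real \<beta>) ^ n * of_real (real n + a) powr (- s)) sums lerch_phi a \<beta> s"
proof -
  have "s \<noteq> 1" using s by auto
  thus ?thesis using lerch_phi_eq_lerch_cont[of "a / 2" a \<beta> s] lerch_cont_sums[of "a / 2" a \<beta> s] assms by simp
qed

section \<open>The functional equation\<close>

lemma sin_ge_half:
  assumes "0 \<le> x" "x \<le> pi / 2"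
  shows "sin x \<ge> x / 2"
proof (cases "x \<le> pi / 3")
  case True
  show ?thesis
  proof (cases "x = 0")
    case False
    hence "x > 0" using assms by simp
    from MVT2[OF this, of sin cos] obtain z where z: "0 < z" "z < x" "sin x - sin 0 = (x - 0) * cos z"
      by (auto simp: DERIV_sin)
    have "cos z \<ge> cos (pi / 3)" using z True pi_gt_zero by (intro cos_monotone_0_pi_le) auto
    hence "cos z \<ge> 1 / 2" by (simp add: cos_60)
    hence "x * (1 / 2) \<le> x * cos z" using assms by (intro mult_left_mono) auto
    thus ?thesis using z by simp
  qed auto
next
  case False
  have "sin x \<ge> sin (pi / 3)" using False assms by (intro sin_monotone_2pi_le) auto
  hence "sin x \<ge> sqrt 3 / 2" by (simp add: sin_60)
  moreover have "sqrt 3 \<ge> 1.7" by (rule real_le_rsqrt) (simp add: power2_eq_square)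
  moreover have "x \<le> 1.7" using assms pi_less_4 pi_approx by simp
  ultimately show ?thesis by linarith
qed

text \<open>With r^2 = |ee w| and \<theta> = \<pi> Re w one has |1 - ee w|^2 = (1 - r^2)^2 + 4 r^2
  (sin \<theta>)^2; the second summand is kept.\<close>

lemma norm_one_minus_ee_ge_sin:
  "norm (1 - ee w) \<ge> 2 * exp (- pi * Im w) * \<bar>sin (pi * Re w)\<bar>"
proof (rule power2_le_imp_le)
  define r \<theta> where "r = exp (- pi * Im w)" and "\<theta> = pi * Re w"
  have r2: "exp (- 2 * pi * Im w) = r ^ 2" by (simp add: r_def flip: exp_double)
  have e: "ee w = of_real (r ^ 2) * cis (2 * \<theta>)"
  proof -
    have "2 * of_real pi * \<i> * w = of_real (- 2 * pi * Im w) + \<i> * of_real (2 * \<theta>)"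
      by (simp add: complex_eq_iff \<theta>_def)
    thus ?thesis by (simp only: ee_def exp_add exp_of_real cis_conv_exp r2[symmetric])
  qed
  have sc: "sin (2 * \<theta>) ^ 2 + cos (2 * \<theta>) ^ 2 = 1" by simp
  have "(norm (1 - ee w))\<^sup>2 = (1 - r ^ 2 * cos (2 * \<theta>)) ^ 2 + (r ^ 2 * sin (2 * \<theta>)) ^ 2"
    unfolding e cmod_power2 by simp
  also have "\<dots> = (1 - r ^ 2) ^ 2 + 2 * r ^ 2 * (1 - cos (2 * \<theta>))"
    using sc by algebra
  also have "1 - cos (2 * \<theta>) = 2 * sin \<theta> ^ 2" by (simp add: cos_double_sin)
  finally have "(norm (1 - ee w))\<^sup>2 \<ge> (2 * r * \<bar>sin \<theta>\<bar>) ^ 2" by (simp add: power_mult_distrib)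
  thus "(2 * exp (- pi * Im w) * \<bar>sin (pi * Re w)\<bar>)\<^sup>2 \<le> (norm (1 - ee w))\<^sup>2"
    by (simp add: r_def \<theta>_def)
qed auto

lemma one_minus_exp_ge:
  assumes "y > 0"
  shows "1 - exp (- 2 * pi * y) \<ge> min y 1 / 2"
proof -
  define m where "m = min y 1"
  have m: "0 < m" "m \<le> y" "m \<le> 1" using assms by (auto simp: m_def)
  have "exp (- 2 * pi * y) \<le> exp (- m)"
    using m pi_gt3 mult_mono[of 1 "2 * pi" m y] by simp
  also have "\<dots> \<le> 1 / (1 + m)" using exp_ge_add_one_self[of m] m by (simp add: exp_minus divide_simps)
  also have "\<dots> \<le> 1 - m / 2" using m mult_left_le[of m m] by (simp add: field_simps)
  finally show ?thesis unfolding m_def[symmetric] by linarith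
qed

text \<open>a - c lies between c and 1 - c, hence at distance at least c from the integers. A bound
  proportional to c is what the limit c -> 0 asks for, because near y = 0 the modulus of z is
  controlled by c + y.\<close>

lemma kernel_denominator_bound:
  assumes "0 < c" "c \<le> a / 2" "a \<le> 1" "\<bar>e\<bar> = 1"
  shows "norm (1 - ee (Complex (e * (c - a)) y)) \<ge> 2 * exp (- pi * y) * c"
proof -
  define v where "v = a - c"
  have v: "c \<le> v" "c \<le> 1 - v" using assms by (auto simp: v_def)
  have "sin (pi * v) \<ge> c"
  proof (cases "v \<le> 1 / 2")
    case True
    have "sin (pi * v) \<ge> pi * v / 2" by (rule sin_ge_half) (use True v assms in auto)
    moreover have "pi * v \<ge> 2 * c" using pi_gt3 v assms by (intro mult_mono) auto
    ultimately show ?thesis by linarith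
  next
    case False
    have "sin (pi * v) = sin (pi * (1 - v))" by (simp add: algebra_simps sin_diff)
    moreover have "sin (pi * (1 - v)) \<ge> pi * (1 - v) / 2" by (rule sin_ge_half) (use False v assms in auto)
    moreover have "pi * (1 - v) \<ge> 2 * c" using pi_gt3 v assms by (intro mult_mono) auto
    ultimately show ?thesis by linarith
  qed
  moreover have "\<bar>sin (pi * (e * (c - a)))\<bar> = \<bar>sin (pi * v)\<bar>"
  proof -
    have "e = 1 \<or> e = -1" using assms by linarith
    moreover have "pi * (c - a) = - (pi * v)" by (simp add: v_def algebra_simps)
    moreover have "pi * (a - c) = pi * v" by (simp add: v_def)
    ultimately show ?thesis by auto
  qed
  ultimately have "\<bar>sin (pi * (e * (c - a)))\<bar> \<ge> c" by linarith
  hence "2 * exp (- pi * y) * c \<le> 2 * exp (- pi * y) * \<bar>sin (pi * (e * (c - a)))\<bar>" by (intro mult_left_mono) auto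
  also have "\<dots> \<le> norm (1 - ee (Complex (e * (c - a)) y))"
    using norm_one_minus_ee_ge_sin[of "Complex (e * (c - a)) y"] by simp
  finally show ?thesis .
qed

lemma imaginary_powr:
  assumes "y > 0" "\<bar>e\<bar> = (1::real)"
  shows "Complex 0 (e * y) powr (- s) = of_real y powr (- s) * exp (- of_real e * \<i> * of_real pi * s / 2)"
proof -
  have e: "e = 1 \<or> e = -1" using assms by linarith
  have "Ln (Complex 0 (e * y)) = of_real (ln y) + of_real e * \<i> * of_real pi / 2"
  proof -
    have "Complex 0 (e * y) = of_real y * (of_real e * \<i>)" by (simp add: complex_eq_iff)
    moreover have "Ln (of_real y * (of_real e * \<i>)) = of_real (ln y) + Ln (of_real e * \<i>)"
      using assms by (subst Ln_times_of_real) (auto simp: Ln_of_real)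
    moreover have "Ln (of_real e * \<i>) = of_real e * \<i> * of_real pi / 2" using e by auto
    ultimately show ?thesis by simp
  qed
  moreover have "Complex 0 (e * y) \<noteq> 0" using assms by (auto simp: complex_eq_iff)
  ultimately show ?thesis using assms
    by (simp add: powr_def Ln_of_real ring_distribs exp_add mult_ac flip: exp_add)
qed

text \<open>Dominated convergence as the line tends to the imaginary axis. The critical place is y
  near 0, where for a = 1 the limiting kernel has a pole. A bound of the denominator by y and one by
  c combine to \<delta> |z|, and with \<tau> = -Re s > 0 the quotient is at most |z|^(\<tau> - 1) /
  \<delta>, which has an integrable majorant.\<close>

lemma line_part_limit:
  assumes a: "0 < a" "a \<le> 1" and \<gamma>: "0 < \<gamma>" "\<gamma> \<le> 1" and e: "\<bar>e\<bar> = (1::real)" and s: "Re s < 0"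
    and c: "\<And>n. 0 < c n" "\<And>n. c n \<le> a / 2" "c \<longlonglongrightarrow> 0"
  shows "(\<lambda>n. integral {0<..} (\<lambda>y. Complex (c n) (e * y) powr (- s) * ap_kernel \<gamma> (Complex (e * (c n - a)) y)))
     \<longlonglongrightarrow> integral {0<..} (\<lambda>y. Complex 0 (e * y) powr (- s) * ap_kernel \<gamma> (Complex (- e * a) y))"
proof -
  define \<tau> where "\<tau> = - Re s"
  have \<tau>: "\<tau> > 0" using s by (simp add: \<tau>_def)
  define E where "E = exp (pi / 2 * \<bar>Im s\<bar>)"
  \<comment> \<open>Half of the smaller of the constants in the bounds by c and by y. For y <= 1 the
    sum \<delta> c + \<delta> y is then at most the mean of the two lower bounds.\<close>
  define \<delta> where "\<delta> = min (2 * exp (- pi)) (1 / 2) / 2"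
  have \<delta>: "\<delta> > 0" "\<delta> \<le> 1 / 2" by (auto simp: \<delta>_def)
  define g where "g y = E / \<delta> * ((1 + y) powr \<tau> * exp (- (2 * pi * \<gamma>) * y) + y powr (\<tau> - 1) * exp (- (2 * pi * \<gamma>) * y))" for y
  show ?thesis
  proof (rule dominated_convergence(2)[where h = g])
    have nint: "e * (c n - a) \<notin> \<int>" for n
    proof -
      have "\<bar>e * (c n - a)\<bar> < 1" "e * (c n - a) \<noteq> 0" using c(1,2)[of n] a e by (auto simp: abs_mult)
      thus ?thesis by (metis Ints_nonzero_abs_less1)
    qed
    show "(\<lambda>y. Complex (c n) (e * y) powr (- s) * ap_kernel \<gamma> (Complex (e * (c n - a)) y)) integrable_on {0<..}" for n
    proof -
      have "c n \<le> 1" using c(2)[of n] a by simp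
      from line_part(1)[OF c(1)[of n] this \<gamma> nint e] show ?thesis .
    qed
    show "g integrable_on {0<..}"
      unfolding g_def[abs_def] using \<tau> \<gamma>
      by (intro integrable_on_mult_right integrable_add integrable_one_plus_powr_exp integrable_powr_exp) auto
    fix y :: real assume "y \<in> {0<..}"
    hence y: "y > 0" by simp
    show "norm (Complex (c n) (e * y) powr (- s) * ap_kernel \<gamma> (Complex (e * (c n - a)) y)) \<le> g y" for n
    proof -
      define z where "z = Complex (c n) (e * y)"
      define w where "w = Complex (e * (c n - a)) y"
      have z: "z \<noteq> 0" "Re z \<ge> 0" using c(1)[of n] by (auto simp: z_def complex_eq_iff)
      have cn: "0 < c n" "c n \<le> 1 / 2" using c(1,2)[of n] a by auto
      have zy: "norm z \<ge> y" using abs_Im_le_cmod[of z] e y by (simp add: z_def abs_mult)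
      have zcy: "norm z \<le> c n + y" using cmod_le[of z] e y cn by (simp add: z_def abs_mult)
      have p: "norm (z powr (- s)) \<le> norm z powr \<tau> * E"
        using norm_powr_right_half_plane[OF z, of s] by (simp add: \<tau>_def E_def)
      have num: "norm (ee (of_real \<gamma> * w)) = exp (- (2 * pi * \<gamma>) * y)" by (simp add: w_def)
      have d1: "norm (1 - ee w) \<ge> min y 1 / 2"
        using norm_one_minus_ee_ge[of w] one_minus_exp_ge[OF y] y by (simp add: w_def)
      have main: "norm z powr \<tau> / norm (1 - ee w) \<le> ((1 + y) powr \<tau> + y powr (\<tau> - 1)) / \<delta>"
      proof (cases "y \<ge> 1")
        case True
        hence "norm (1 - ee w) \<ge> \<delta>" using d1 \<delta> by simp
        moreover have "norm z powr \<tau> \<le> (1 + y) powr \<tau> + y powr (\<tau> - 1)"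
        proof -
          have "norm z powr \<tau> \<le> (1 + y) powr \<tau>" using zcy cn \<tau> by (intro powr_mono2) auto
          thus ?thesis by (simp add: add_increasing2)
        qed
        ultimately show ?thesis using \<delta> y by (intro frac_le) auto
      next
        case False
        have "2 * exp (- pi) * c n \<le> 2 * exp (- pi * y) * c n" using False cn by (intro mult_right_mono) auto
        also have "\<dots> \<le> norm (1 - ee w)"
          unfolding w_def by (rule kernel_denominator_bound[OF c(1) c(2) a(2) e])
        finally have d2: "norm (1 - ee w) \<ge> 2 * exp (- pi) * c n" .
        have "\<delta> * c n \<le> exp (- pi) * c n" using cn by (intro mult_right_mono) (auto simp: \<delta>_def)
        moreover have "\<delta> * y \<le> 1 / 4 * y" using y by (intro mult_right_mono) (auto simp: \<delta>_def)
        moreover have "\<delta> * norm z \<le> \<delta> * (c n + y)" using zcy \<delta> by (intro mult_left_mono) auto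
        ultimately have "\<delta> * norm z \<le> norm (1 - ee w)"
          using d1 d2 False by (simp add: ring_distribs)
        hence "norm z powr \<tau> / norm (1 - ee w) \<le> norm z powr \<tau> / (\<delta> * norm z)"
          using \<delta> z d1 y by (intro divide_left_mono mult_pos_pos) auto
        also have "\<dots> = norm z powr (\<tau> - 1) / \<delta>" using z by (simp add: powr_diff)
        also have "norm z powr (\<tau> - 1) \<le> (1 + y) powr \<tau> + y powr (\<tau> - 1)"
        proof (cases "\<tau> \<ge> 1")
          case True
          have "norm z powr (\<tau> - 1) \<le> (1 + y) powr (\<tau> - 1)" using True zcy cn by (intro powr_mono2) auto
          also have "\<dots> \<le> (1 + y) powr \<tau>" using y by (intro powr_mono) auto
          finally show ?thesis by (simp add: add_increasing2)
        next
          case False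
          have "norm z powr (\<tau> - 1) \<le> y powr (\<tau> - 1)" using False zy y by (intro powr_mono2') auto
          thus ?thesis by (simp add: add_increasing)
        qed
        finally show ?thesis using \<delta> by (simp add: divide_right_mono)
      qed
      have "norm (z powr (- s) * ap_kernel \<gamma> w) \<le> (norm z powr \<tau> * E) * (exp (- (2 * pi * \<gamma>) * y) / norm (1 - ee w))"
        unfolding norm_mult ap_kernel_def norm_divide num by (rule mult_right_mono[OF p]) auto
      also have "\<dots> = (norm z powr \<tau> / norm (1 - ee w)) * (E * exp (- (2 * pi * \<gamma>) * y))" by simp
      also have "\<dots> \<le> (((1 + y) powr \<tau> + y powr (\<tau> - 1)) / \<delta>) * (E * exp (- (2 * pi * \<gamma>) * y))"
        by (rule mult_right_mono[OF main]) (auto simp: E_def)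
      also have "\<dots> = g y" by (simp add: g_def field_simps)
      finally show ?thesis by (simp add: z_def w_def)
    qed
    show "(\<lambda>n. Complex (c n) (e * y) powr (- s) * ap_kernel \<gamma> (Complex (e * (c n - a)) y)) \<longlonglongrightarrow>
         Complex 0 (e * y) powr (- s) * ap_kernel \<gamma> (Complex (- e * a) y)"
    proof (intro tendsto_mult)
      have "(\<lambda>n. Complex (c n) (e * y)) \<longlonglongrightarrow> Complex 0 (e * y)" by (intro tendsto_intros c)
      moreover have "Complex 0 (e * y) \<notin> \<real>\<^sub>\<le>\<^sub>0" using y e by (auto simp: complex_nonpos_Reals_iff)
      ultimately show "(\<lambda>n. Complex (c n) (e * y) powr (- s)) \<longlonglongrightarrow> Complex 0 (e * y) powr (- s)"
        by (intro tendsto_powr_complex tendsto_const) 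
      have "ee (Complex (- e * a) y) \<noteq> 1" using y by (auto simp: ee_eq_1_iff)
      moreover have "(\<lambda>n. Complex (e * (c n - a)) y) \<longlonglongrightarrow> Complex (e * (0 - a)) y" by (intro tendsto_intros c)
      hence "(\<lambda>n. Complex (e * (c n - a)) y) \<longlonglongrightarrow> Complex (- e * a) y" by simp
      moreover have "isCont (ap_kernel \<gamma>) w" if "ee w \<noteq> 1" for w
        using that unfolding ap_kernel_def ee_def by (intro continuous_intros) auto
      ultimately show "(\<lambda>n. ap_kernel \<gamma> (Complex (e * (c n - a)) y)) \<longlonglongrightarrow> ap_kernel \<gamma> (Complex (- e * a) y)"
        using isCont_tendsto_compose by blast
    qed
  qed
qed

text \<open>On the imaginary axis the kernel is a geometric series of exponentials in y, each
  integrated by Euler's integral. Partial sums are dominated through 1 / (1 - exp (-2 \<pi> y)) <= 2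
  (1 + 1/y), and the factor y^(-Re s) makes this integrable at 0 because Re s < 0.\<close>

lemma imaginary_axis_integral_sums:
  assumes \<gamma>: "0 < \<gamma>" and e: "\<bar>e\<bar> = (1::real)" and s: "Re s < 0"
  shows "(\<lambda>j. Gamma (1 - s) * exp (- of_real e * \<i> * of_real pi * s / 2) *
              (of_real (2 * pi * (real j + \<gamma>)) powr (s - 1) * ee (- of_real (e * ((real j + \<gamma>) * a)))))
         sums integral {0<..} (\<lambda>y. Complex 0 (e * y) powr (- s) * ap_kernel \<gamma> (Complex (- e * a) y))"
proof -
  define \<tau> where "\<tau> = - Re s"
  have \<tau>: "\<tau> > 0" using s by (simp add: \<tau>_def)
  define E where "E = exp (pi / 2 * \<bar>Im s\<bar>)"
  define P where "P = exp (- of_real e * \<i> * of_real pi * s / 2)"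
  define t where "t j y = (of_real y powr (- s) * P) * ee (of_real (\<gamma> + real j) * Complex (- e * a) y)" for j y
  define g where "g y = 2 * E * (y powr \<tau> * exp (- (2 * pi * \<gamma>) * y) + y powr (\<tau> - 1) * exp (- (2 * pi * \<gamma>) * y))" for y
  have P: "norm P \<le> E"
  proof -
    have "Re (- of_real e * \<i> * of_real pi * s / 2) = e * (pi * Im s / 2)" by simp
    also have "\<dots> \<le> \<bar>e * (pi * Im s / 2)\<bar>" by simp
    also have "\<dots> = pi / 2 * \<bar>Im s\<bar>" using e by (simp add: abs_mult)
    finally show ?thesis by (simp add: P_def E_def)
  qed
  have ti: "(t j has_integral (Gamma (1 - s) * P *
              (of_real (2 * pi * (real j + \<gamma>)) powr (s - 1) * ee (- of_real (e * ((real j + \<gamma>) * a)))))) {0<..}" for j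
  proof -
    have "((\<lambda>y. (P * ee (- of_real (e * ((real j + \<gamma>) * a)))) * (of_real y powr ((1 - s) - 1) * exp (- of_real ((2 * pi * (real j + \<gamma>)) * y)))) has_integral
            (P * ee (- of_real (e * ((real j + \<gamma>) * a)))) * (Gamma (1 - s) * of_real (2 * pi * (real j + \<gamma>)) powr (- (1 - s)))) {0<..}"
      by (intro has_integral_mult_right Gamma_integral_scaled(1)) (use s \<gamma> in auto)
    moreover have "t j = (\<lambda>y. (P * ee (- of_real (e * ((real j + \<gamma>) * a)))) * (of_real y powr ((1 - s) - 1) * exp (- of_real ((2 * pi * (real j + \<gamma>)) * y))))"
    proof (rule ext)
      fix y :: real
      have "of_real (\<gamma> + real j) * Complex (- e * a) y = - of_real (e * ((real j + \<gamma>) * a)) + \<i> * of_real ((real j + \<gamma>) * y)"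
        by (simp add: complex_eq_iff algebra_simps)
      moreover have "ee (\<i> * of_real ((real j + \<gamma>) * y)) = exp (- of_real ((2 * pi * (real j + \<gamma>)) * y))"
        by (simp add: ee_def mult_ac)
      ultimately have "ee (of_real (\<gamma> + real j) * Complex (- e * a) y) =
          ee (- of_real (e * ((real j + \<gamma>) * a))) * exp (- of_real ((2 * pi * (real j + \<gamma>)) * y))"
        by (simp only: ee_add)
      thus "t j y = (P * ee (- of_real (e * ((real j + \<gamma>) * a)))) * (of_real y powr ((1 - s) - 1) * exp (- of_real ((2 * pi * (real j + \<gamma>)) * y)))"
        by (simp only: t_def) simp
    qed
    ultimately show ?thesis by (simp add: mult_ac)
  qed
  have tnorm: "norm (t j y) \<le> y powr \<tau> * E * exp (- (2 * pi * \<gamma>) * y) * exp (- (2 * pi) * y) ^ j" if "y > 0" for j y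
  proof -
    have "norm (of_real y powr (- s)) = y powr \<tau>"
      using that by (subst norm_powr_complex) (auto simp: \<tau>_def Ln_of_real)
    moreover have "norm (ee (of_real (\<gamma> + real j) * Complex (- e * a) y)) = exp (- (2 * pi * \<gamma>) * y) * exp (- (2 * pi) * y) ^ j"
      by (simp add: algebra_simps flip: exp_of_nat_mult exp_add)
    ultimately have "norm (t j y) = (y powr \<tau> * norm P) * (exp (- (2 * pi * \<gamma>) * y) * exp (- (2 * pi) * y) ^ j)"
      unfolding t_def norm_mult by simp
    also have "\<dots> \<le> (y powr \<tau> * E) * (exp (- (2 * pi * \<gamma>) * y) * exp (- (2 * pi) * y) ^ j)"
      using P by (intro mult_right_mono mult_left_mono) auto
    finally show ?thesis by (simp only: mult.assoc)
  qed
  have sm: "(\<Sum>j<n. norm (t j y)) \<le> g y" if y: "y > 0" for n y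
  proof -
    let ?q = "exp (- (2 * pi) * y)"
    have q: "0 < ?q" "?q < 1" using y by auto
    have "(\<Sum>j<n. norm (t j y)) \<le> (\<Sum>j<n. y powr \<tau> * E * exp (- (2 * pi * \<gamma>) * y) * ?q ^ j)"
      by (intro sum_mono tnorm y)
    also have "\<dots> = y powr \<tau> * E * exp (- (2 * pi * \<gamma>) * y) * (\<Sum>j<n. ?q ^ j)" by (simp add: sum_distrib_left)
    also have "(\<Sum>j<n. ?q ^ j) \<le> 1 / (1 - ?q)"
      using q sum_le_suminf[of "\<lambda>j. ?q ^ j" "{..<n}"] by (auto simp: suminf_geometric summable_geometric)
    also have "1 / (1 - ?q) \<le> 1 / (min y 1 / 2)"
      using one_minus_exp_ge[OF y] y q by (intro divide_left_mono) auto
    also have "\<dots> \<le> 2 * (1 + 1 / y)" using y by (auto simp: min_def field_simps)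
    finally have "(\<Sum>j<n. norm (t j y)) \<le> y powr \<tau> * E * exp (- (2 * pi * \<gamma>) * y) * (2 * (1 + 1 / y))"
      by (simp add: mult_left_mono E_def)
    also have "\<dots> = g y" using y by (simp add: g_def powr_diff field_simps)
    finally show ?thesis .
  qed
  have gi: "g integrable_on {0<..}"
    unfolding g_def[abs_def] using \<tau> \<gamma>
    by (intro integrable_on_mult_right integrable_add integrable_powr_exp) auto
  have "(\<lambda>n. integral {0<..} (\<lambda>y. \<Sum>j<n. t j y)) \<longlonglongrightarrow>
           integral {0<..} (\<lambda>y. Complex 0 (e * y) powr (- s) * ap_kernel \<gamma> (Complex (- e * a) y))"
  proof (rule dominated_convergence(2)[where h = g])
    show "(\<lambda>y. \<Sum>j<n. t j y) integrable_on {0<..}" for n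
      using ti by (intro integrable_sum) (auto simp: integrable_on_def)
    show "norm (\<Sum>j<n. t j y) \<le> g y" if "y \<in> {0<..}" for n y
      using sm[of y n] that norm_sum[of "\<lambda>j. t j y" "{..<n}"] by simp
    fix y :: real assume "y \<in> {0<..}"
    hence y: "y > 0" by simp
    let ?w = "Complex (- e * a) y"
    have "norm (ee ?w) < 1" using y by simp
    from geometric_sums[OF this] have "(\<lambda>j. Complex 0 (e * y) powr (- s) * ee (of_real \<gamma> * ?w) * ee ?w ^ j) sums
         (Complex 0 (e * y) powr (- s) * ee (of_real \<gamma> * ?w) * (1 / (1 - ee ?w)))"
      by (rule sums_mult)
    moreover have "ee ?w ^ j = ee (of_real (real j) * ?w)" for j
      by (simp add: ee_def mult_ac flip: exp_of_nat_mult)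
    ultimately have "(\<lambda>j. t j y) sums (Complex 0 (e * y) powr (- s) * ap_kernel \<gamma> ?w)"
      using imaginary_powr[OF y e, of s]
      by (simp add: t_def P_def ap_kernel_def ee_add ring_distribs mult_ac)
    thus "(\<lambda>n. \<Sum>j<n. t j y) \<longlonglongrightarrow> Complex 0 (e * y) powr (- s) * ap_kernel \<gamma> ?w" by (simp add: sums_def)
  qed (rule gi)
  moreover have "integral {0<..} (\<lambda>y. \<Sum>j<n. t j y) = (\<Sum>j<n. Gamma (1 - s) * P *
              (of_real (2 * pi * (real j + \<gamma>)) powr (s - 1) * ee (- of_real (e * ((real j + \<gamma>) * a)))))" for n
    by (rule integral_unique, rule has_integral_sum) (use ti in auto)
  ultimately show ?thesis by (simp add: sums_def P_def)
qed

text \<open>The line Re z = c of \<open>lerch_cont\<close> is moved to the imaginary axis along c =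
  a / (2 (n + 1)). The value does not change with c, and for Re s < 0 the pole term c^(1 - s) / (s -
  1) disappears in the limit.\<close>

theorem lerch_phi_functional_equation:
  assumes a: "0 < a" "a \<le> 1" and \<beta>: "0 < \<beta>" "\<beta> \<le> 1" and s: "Re s < 0"
  shows "(\<lambda>j. Gamma (1 - s) *
     (\<i> * exp (- \<i> * of_real pi * s / 2) * (of_real (2 * pi * (real j + \<beta>)) powr (s - 1) * ee (- of_real ((real j + \<beta>) * a)))
      - \<i> * exp (\<i> * of_real pi * s / 2) * (of_real (2 * pi * (real j + dual_freq \<beta>)) powr (s - 1) * ee (of_real ((real j + dual_freq \<beta>) * a)))))
    sums lerch_phi a \<beta> s"
proof -
  define c where "c n = a / (2 * (real n + 1))" for n
  have c: "0 < c n" "c n \<le> a / 2" for n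
    using a by (auto simp: c_def field_simps)
  have ca: "c n < a" for n using c(2)[of n] a by simp
  have c0: "c \<longlonglongrightarrow> 0" unfolding c_def by real_asymp
  let ?U = "integral {0<..} (\<lambda>y. Complex 0 (1 * y) powr (- s) * ap_kernel \<beta> (Complex (- 1 * a) y))"
  let ?L = "integral {0<..} (\<lambda>y. Complex 0 ((-1) * y) powr (- s) * ap_kernel (dual_freq \<beta>) (Complex (- (-1) * a) y))"
  have s1: "s \<noteq> 1" using s by auto
  have "(\<lambda>n. lerch_line a \<beta> (c n) s) \<longlonglongrightarrow> \<i> * (?U - ?L)"
    using line_part_limit[of a \<beta> 1 s c, OF a \<beta> _ s c c0]
          line_part_limit[of a "dual_freq \<beta>" "-1" s c, OF a dual_freq_pos[OF \<beta>] _ s c c0]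
    unfolding lerch_line_def by (intro tendsto_intros) simp_all
  moreover have "(\<lambda>n. if \<beta> = 1 then of_real (c n) powr (1 - s) / (s - 1) else 0) \<longlonglongrightarrow> 0"
  proof -
    have "(\<lambda>n. of_real (c n) powr (1 - s) / (s - 1)) \<longlonglongrightarrow> (0::complex)"
    proof (rule Lim_null_comparison)
      show "\<forall>\<^sub>F n in sequentially. norm (of_real (c n) powr (1 - s) / (s - 1)) \<le> c n powr (1 - Re s) / norm (s - 1)"
      proof (rule always_eventually, rule allI)
        fix n
        show "norm (of_real (c n) powr (1 - s) / (s - 1)) \<le> c n powr (1 - Re s) / norm (s - 1)"
          using c(1)[of n] by (simp add: norm_divide norm_powr_complex)
      qed
      have "(\<lambda>n. c n powr (1 - Re s)) \<longlonglongrightarrow> 0 powr (1 - Re s)"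
        using c0 s c by (intro tendsto_powr' tendsto_const) (auto intro!: always_eventually less_imp_le)
      thus "(\<lambda>n. c n powr (1 - Re s) / norm (s - 1)) \<longlonglongrightarrow> 0"
        by (simp add: tendsto_divide_zero)
    qed
    thus ?thesis by (cases "\<beta> = 1") auto
  qed
  ultimately have lim: "(\<lambda>n. lerch_cont a \<beta> (c n) s) \<longlonglongrightarrow> \<i> * (?U - ?L) + 0"
    unfolding lerch_cont_def by (rule tendsto_add)
  have const: "lerch_cont a \<beta> (c n) s = lerch_phi a \<beta> s" for n
    by (rule lerch_phi_eq_lerch_cont[OF c(1) ca a(2) \<beta> s1, symmetric])
  have "lerch_phi a \<beta> s = \<i> * (?U - ?L) + 0"
    by (rule LIMSEQ_unique[OF tendsto_const[of _ sequentially] lim[unfolded const]])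
  hence eq: "lerch_phi a \<beta> s = \<i> * (?U - ?L)" by (simp only: add_0_right)
  have "(\<lambda>j. \<i> * (Gamma (1 - s) * exp (- of_real 1 * \<i> * of_real pi * s / 2) *
              (of_real (2 * pi * (real j + \<beta>)) powr (s - 1) * ee (- of_real (1 * ((real j + \<beta>) * a)))) -
            Gamma (1 - s) * exp (- of_real (-1) * \<i> * of_real pi * s / 2) *
              (of_real (2 * pi * (real j + dual_freq \<beta>)) powr (s - 1) * ee (- of_real ((-1) * ((real j + dual_freq \<beta>) * a))))))
         sums lerch_phi a \<beta> s"
    unfolding eq by (intro sums_mult sums_diff imaginary_axis_integral_sums) (use \<beta> dual_freq_pos s in auto)
  thus ?thesis by (simp add: algebra_simps)
qed

section \<open>Bounds for the Gamma function\<close>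

lemma norm_pochhammer_Suc: "norm (pochhammer (z::complex) (n + 1)) = (\<Prod>k\<le>n. norm (z + of_nat k))"
  by (simp add: pochhammer_prod prod_norm atLeast0LessThan lessThan_Suc_atMost)

lemma norm_Gamma_series_complex:
  "norm (Gamma_series (z::complex) n) = fact n * exp (Re z * ln (real n)) / (\<Prod>k\<le>n. norm (z + of_nat k))"
proof -
  have "norm (exp (z * of_real (ln (real n)))) = exp (Re z * ln (real n))" by simp
  thus ?thesis unfolding Gamma_series_def norm_divide norm_mult norm_pochhammer_Suc
    by simp
qed

text \<open>By the product formula |\<Gamma>(x + it)| / \<Gamma>(x) is the product of |x + k| / |x +
  k + it|, and each factor increases with x. This takes the place of Stirling's formula: exponential
  decay is transported from the line Re z = 1/2.\<close>

lemma Gamma_vertical_mono: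
  fixes x x' t :: real
  assumes "0 < x" "x \<le> x'"
  shows "norm (Gamma (Complex x t)) * Gamma x' \<le> norm (Gamma (Complex x' t)) * Gamma x"
proof (rule LIMSEQ_le)
  show "(\<lambda>n. norm (Gamma_series (Complex x t) n) * norm (Gamma_series (complex_of_real x') n)) \<longlonglongrightarrow>
          norm (Gamma (Complex x t)) * Gamma x'"
  proof -
    have "(\<lambda>n. norm (Gamma_series (Complex x t) n) * norm (Gamma_series (complex_of_real x') n)) \<longlonglongrightarrow>
          norm (Gamma (Complex x t)) * norm (Gamma (complex_of_real x'))"
      by (intro tendsto_intros Gamma_series_LIMSEQ)
    moreover have "norm (Gamma (complex_of_real x')) = Gamma x'"
      using assms Gamma_real_pos[of x'] by (simp add: Gamma_complex_of_real)
    ultimately show ?thesis by simp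
  qed
  show "(\<lambda>n. norm (Gamma_series (Complex x' t) n) * norm (Gamma_series (complex_of_real x) n)) \<longlonglongrightarrow>
          norm (Gamma (Complex x' t)) * Gamma x"
  proof -
    have "(\<lambda>n. norm (Gamma_series (Complex x' t) n) * norm (Gamma_series (complex_of_real x) n)) \<longlonglongrightarrow>
          norm (Gamma (Complex x' t)) * norm (Gamma (complex_of_real x))"
      by (intro tendsto_intros Gamma_series_LIMSEQ)
    moreover have "norm (Gamma (complex_of_real x)) = Gamma x"
      using assms Gamma_real_pos[of x] by (simp add: Gamma_complex_of_real)
    ultimately show ?thesis by simp
  qed
  have key: "norm (Complex x' t + of_nat k) * norm (complex_of_real x + of_nat k) \<le>
             norm (Complex x t + of_nat k) * norm (complex_of_real x' + of_nat k)" for k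
  proof (rule power2_le_imp_le)
    define p q where "p = x + real k" and "q = x' + real k"
    have pq: "0 < p" "p \<le> q" using assms by (auto simp: p_def q_def)
    have e: "complex_of_real x + of_nat k = of_real p" "complex_of_real x' + of_nat k = of_real q"
      "Complex x t + of_nat k = Complex p t" "Complex x' t + of_nat k = Complex q t"
      by (simp_all add: p_def q_def complex_eq_iff)
    have "t\<^sup>2 * p\<^sup>2 \<le> t\<^sup>2 * q\<^sup>2" using pq by (intro mult_left_mono power_mono) auto
    thus "(norm (Complex x' t + of_nat k) * norm (complex_of_real x + of_nat k))\<^sup>2 \<le>
          (norm (Complex x t + of_nat k) * norm (complex_of_real x' + of_nat k))\<^sup>2"
      unfolding e power_mult_distrib cmod_power2 by (simp add: algebra_simps)
  qed simp
  have pos: "norm (Complex x t + of_nat k) > 0" "norm (complex_of_real x' + of_nat k) > 0"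
     "norm (Complex x' t + of_nat k) > 0" "norm (complex_of_real x + of_nat k) > 0" for k
    using assms by (auto simp: complex_eq_iff)
  have "norm (Gamma_series (Complex x t) n) * norm (Gamma_series (complex_of_real x') n) \<le>
        norm (Gamma_series (Complex x' t) n) * norm (Gamma_series (complex_of_real x) n)" for n
  proof -
    let ?E = "fact n * exp (x * ln (real n)) * (fact n * exp (x' * ln (real n)))"
    have "norm (Gamma_series (Complex x t) n) * norm (Gamma_series (complex_of_real x') n) =
       ?E / (\<Prod>k\<le>n. norm (Complex x t + of_nat k) * norm (complex_of_real x' + of_nat k))"
      unfolding norm_Gamma_series_complex by (simp add: prod.distrib)
    also have "\<dots> \<le> ?E / (\<Prod>k\<le>n. norm (Complex x' t + of_nat k) * norm (complex_of_real x + of_nat k))"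
    proof (rule divide_left_mono)
      show "(\<Prod>k\<le>n. norm (Complex x' t + of_nat k) * norm (complex_of_real x + of_nat k)) \<le>
         (\<Prod>k\<le>n. norm (Complex x t + of_nat k) * norm (complex_of_real x' + of_nat k))"
        by (rule prod_mono) (use key in auto)
      show "0 < (\<Prod>k\<le>n. norm (Complex x t + of_nat k) * norm (complex_of_real x' + of_nat k)) *
         (\<Prod>k\<le>n. norm (Complex x' t + of_nat k) * norm (complex_of_real x + of_nat k))"
        by (intro mult_pos_pos prod_pos) (use pos in auto)
    qed auto
    also have "\<dots> = norm (Gamma_series (Complex x' t) n) * norm (Gamma_series (complex_of_real x) n)"
      unfolding norm_Gamma_series_complex by (simp add: prod.distrib mult_ac)
    finally show ?thesis .
  qed
  thus "\<exists>N. \<forall>n\<ge>N. norm (Gamma_series (Complex x t) n) * norm (Gamma_series (complex_of_real x') n) \<le>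
        norm (Gamma_series (Complex x' t) n) * norm (Gamma_series (complex_of_real x) n)" by blast
qed

lemma norm_Gamma_le_real:
  assumes "0 < x"
  shows "norm (Gamma (Complex x t)) \<le> Gamma x"
proof (rule LIMSEQ_le)
  show "(\<lambda>n. norm (Gamma_series (Complex x t) n)) \<longlonglongrightarrow> norm (Gamma (Complex x t))"
    by (intro tendsto_intros Gamma_series_LIMSEQ)
  have "(\<lambda>n. norm (Gamma_series (complex_of_real x) n)) \<longlonglongrightarrow> norm (Gamma (complex_of_real x))"
    by (intro tendsto_intros Gamma_series_LIMSEQ)
  moreover have "norm (Gamma (complex_of_real x)) = Gamma x"
    using assms Gamma_real_pos[of x] by (simp add: Gamma_complex_of_real)
  ultimately show "(\<lambda>n. norm (Gamma_series (complex_of_real x) n)) \<longlonglongrightarrow> Gamma x" by simp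
  have "norm (Gamma_series (Complex x t) n) \<le> norm (Gamma_series (complex_of_real x) n)" for n
  proof -
    have le: "norm (complex_of_real x + of_nat k) \<le> norm (Complex x t + of_nat k)" for k
    proof -
      have "complex_of_real x + of_nat k = of_real (x + real k)" by simp
      hence "norm (complex_of_real x + of_nat k) = \<bar>x + real k\<bar>" by (simp only: norm_of_real)
      thus ?thesis using abs_Re_le_cmod[of "Complex x t + of_nat k"] by simp
    qed
    have pos: "norm (Complex x t + of_nat k) > 0" "norm (complex_of_real x + of_nat k) > 0" for k
      using assms by (auto simp: complex_eq_iff)
    show ?thesis unfolding norm_Gamma_series_complex complex.sel Re_complex_of_real
      by (intro divide_left_mono prod_mono mult_pos_pos prod_pos) (use le pos in auto)
  qed
  thus "\<exists>N. \<forall>n\<ge>N. norm (Gamma_series (Complex x t) n) \<le> norm (Gamma_series (complex_of_real x) n)" by blast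
qed

text \<open>On Re z = 1/2 the map z -> 1 - z is complex conjugation, so the reflection formula gives
  the modulus exactly.\<close>

lemma norm_Gamma_half: "(norm (Gamma (Complex (1/2) t)))\<^sup>2 = pi / cosh (pi * t)"
proof -
  let ?z = "Complex (1/2) t"
  have c: "1 - ?z = cnj ?z" by (simp add: complex_eq_iff)
  have "Gamma ?z * Gamma (1 - ?z) = of_real pi / sin (of_real pi * ?z)" by (rule Gamma_reflection_complex)
  moreover have e: "of_real pi * ?z = of_real (pi / 2) + \<i> * of_real (pi * t)" by (simp add: complex_eq_iff)
  have "sin (complex_of_real (pi / 2)) = 1" "cos (complex_of_real (pi / 2)) = 0"
    by (simp_all only: sin_of_real cos_of_real sin_pi_half cos_pi_half of_real_1 of_real_0)
  hence "sin (of_real pi * ?z) = cos (\<i> * of_real (pi * t))"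
    unfolding e sin_add by simp
  moreover have "cos (\<i> * of_real (pi * t)) = of_real (cosh (pi * t))"
    by (simp add: cos_exp_eq cosh_field_def add.commute flip: exp_of_real)
  moreover have "Gamma ?z * Gamma (cnj ?z) = of_real ((norm (Gamma ?z))\<^sup>2)"
    by (simp only: cnj_Gamma[symmetric] complex_norm_square)
  ultimately have "complex_of_real ((norm (Gamma ?z))\<^sup>2) = of_real (pi / cosh (pi * t))"
    unfolding c by simp
  thus ?thesis by (simp only: of_real_eq_iff)
qed

lemma norm_Gamma_half_bounds:
  "norm (Gamma (Complex (1/2) t)) \<ge> sqrt pi * exp (- pi / 2 * \<bar>t\<bar>)"
  "norm (Gamma (Complex (1/2) t)) \<le> 3 * exp (- pi / 2 * \<bar>t\<bar>)"
proof -
  let ?e = "exp (pi * \<bar>t\<bar>)"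
  have e1: "?e \<ge> 1" by simp
  have c: "cosh (pi * t) = (?e + inverse ?e) / 2"
    by (cases "t \<ge> 0") (simp_all add: cosh_field_def exp_minus)
  have i: "inverse ?e \<le> ?e" by (subst exp_minus[symmetric]) simp
  have lo: "?e / 2 \<le> cosh (pi * t)" and hi: "cosh (pi * t) \<le> ?e" using i unfolding c by auto
  have ee: "(exp (- pi / 2 * \<bar>t\<bar>))\<^sup>2 = inverse ?e"
    by (simp only: exp_double[symmetric] exp_minus[symmetric]) simp
  show "norm (Gamma (Complex (1/2) t)) \<ge> sqrt pi * exp (- pi / 2 * \<bar>t\<bar>)"
  proof (rule power2_le_imp_le)
    show "(sqrt pi * exp (- pi / 2 * \<bar>t\<bar>))\<^sup>2 \<le> (norm (Gamma (Complex (1/2) t)))\<^sup>2"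
    proof -
      have "pi / ?e \<le> pi / cosh (pi * t)"
        by (rule divide_left_mono[OF hi]) (simp_all add: cosh_real_pos)
      moreover have "(sqrt pi)\<^sup>2 * inverse E = pi / E" for E by (simp add: divide_inverse)
      ultimately show ?thesis unfolding norm_Gamma_half power_mult_distrib ee by (simp only:)
    qed
  qed simp
  show "norm (Gamma (Complex (1/2) t)) \<le> 3 * exp (- pi / 2 * \<bar>t\<bar>)"
  proof (rule power2_le_imp_le)
    have "pi / cosh (pi * t) \<le> pi / (?e / 2)" using lo by (intro divide_left_mono) (auto simp: cosh_real_pos)
    also have "pi / (?e / 2) = 2 * pi * inverse ?e" by (simp only: divide_inverse inverse_mult_distrib inverse_inverse_eq mult_ac)
    also have "\<dots> \<le> 9 * inverse ?e" using pi_less_4 by (intro mult_right_mono) auto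
    finally have "pi / cosh (pi * t) \<le> 9 * inverse ?e" .
    moreover have "(3::real)\<^sup>2 = 9" by simp
    ultimately show "(norm (Gamma (Complex (1/2) t)))\<^sup>2 \<le> (3 * exp (- pi / 2 * \<bar>t\<bar>))\<^sup>2"
      unfolding norm_Gamma_half power_mult_distrib ee by (simp only:)
  qed simp
qed

text \<open>Monotonicity starting from the line Re z = 1/2, where the constant \<Gamma>(1/2) = sqrt
  \<pi> cancels.\<close>

lemma norm_Gamma_lower:
  assumes "x \<ge> 1/2"
  shows "norm (Gamma (Complex x t)) \<ge> Gamma x * exp (- pi / 2 * \<bar>t\<bar>)"
proof -
  have "sqrt pi * exp (- pi / 2 * \<bar>t\<bar>) * Gamma x \<le> norm (Gamma (Complex (1/2) t)) * Gamma x"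
    using norm_Gamma_half_bounds(1)[of t] Gamma_real_pos[of x] assms by (intro mult_right_mono) auto
  also have "\<dots> \<le> norm (Gamma (Complex x t)) * Gamma (1/2)"
    by (rule Gamma_vertical_mono) (use assms in auto)
  finally show ?thesis by (simp add: Gamma_one_half_real field_simps)
qed

lemma Gamma_real_bounded:
  obtains G g :: real where "G > 0" "g > 0" "\<And>x. 1/2 \<le> x \<Longrightarrow> x \<le> 5/2 \<Longrightarrow> g \<le> Gamma x \<and> Gamma x \<le> G"
proof -
  have cont: "continuous_on {1/2..5/2} (Gamma :: real \<Rightarrow> real)"
    by (intro continuous_intros) (auto elim!: nonpos_Ints_cases)
  obtain x1 where x1: "x1 \<in> {1/2..5/2}" "\<And>x. x \<in> {1/2..5/2} \<Longrightarrow> Gamma x \<le> (Gamma x1 :: real)"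
    using continuous_attains_sup[OF _ _ cont] by auto
  obtain x2 where x2: "x2 \<in> {1/2..5/2}" "\<And>x. x \<in> {1/2..5/2} \<Longrightarrow> Gamma x2 \<le> (Gamma x :: real)"
    using continuous_attains_inf[OF _ _ cont] by auto
  show ?thesis
    by (rule that[of "Gamma x1" "Gamma x2"]) (use x1 x2 in \<open>auto intro!: Gamma_real_pos\<close>)
qed

text \<open>Monotonicity towards Re z = 5/2, which two steps of \<Gamma>(z + 1) = z \<Gamma>(z)
  connect with Re z = 1/2; these steps produce the square. The range of x is that of Re (2 - s) for
  -1/2 <= Re s <= 3/2.\<close>

lemma norm_Gamma_upper:
  obtains C where "C > 0"
    "\<And>x t. 1/2 \<le> x \<Longrightarrow> x \<le> 5/2 \<Longrightarrow> norm (Gamma (Complex x t)) \<le> C * (2 + \<bar>t\<bar>)\<^sup>2 * exp (- pi / 2 * \<bar>t\<bar>)"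
proof -
  obtain G g :: real where G: "G > 0" "g > 0" "\<And>x. 1/2 \<le> x \<Longrightarrow> x \<le> 5/2 \<Longrightarrow> g \<le> Gamma x \<and> Gamma x \<le> G"
    using Gamma_real_bounded by blast
  define C where "C = 3 * G / Gamma (5/2 :: real)"
  have g52: "Gamma (5/2 :: real) > 0" by (rule Gamma_real_pos) simp
  have "norm (Gamma (Complex x t)) \<le> C * (2 + \<bar>t\<bar>)\<^sup>2 * exp (- pi / 2 * \<bar>t\<bar>)" if x: "1/2 \<le> x" "x \<le> 5/2" for x t
  proof -
    let ?h = "Complex (1/2) t"
    have nz: "?h \<notin> \<int>\<^sub>\<le>\<^sub>0" "?h + 1 \<notin> \<int>\<^sub>\<le>\<^sub>0" by (auto elim!: nonpos_Ints_cases simp: complex_eq_iff)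
    have "Complex (5/2) t = ?h + 1 + 1" by (simp add: complex_eq_iff)
    hence "Gamma (Complex (5/2) t) = (?h + 1) * (?h * Gamma ?h)"
      using Gamma_plus1[OF nz(2)] Gamma_plus1[OF nz(1)] by simp
    hence "norm (Gamma (Complex (5/2) t)) = norm (?h + 1) * norm ?h * norm (Gamma ?h)"
      by (simp add: norm_mult)
    also have "\<dots> \<le> (2 + \<bar>t\<bar>) * (2 + \<bar>t\<bar>) * (3 * exp (- pi / 2 * \<bar>t\<bar>))"
    proof (intro mult_mono norm_Gamma_half_bounds(2))
      show "norm (?h + 1) \<le> 2 + \<bar>t\<bar>" using cmod_le[of "?h + 1"] by simp
      show "norm ?h \<le> 2 + \<bar>t\<bar>" using cmod_le[of ?h] by simp
    qed auto
    finally have 1: "norm (Gamma (Complex (5/2) t)) \<le> 3 * (2 + \<bar>t\<bar>)\<^sup>2 * exp (- pi / 2 * \<bar>t\<bar>)"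
      by (simp add: power2_eq_square)
    have "norm (Gamma (Complex x t)) * Gamma (5/2) \<le> norm (Gamma (Complex (5/2) t)) * Gamma x"
      by (rule Gamma_vertical_mono) (use x in auto)
    also have "\<dots> \<le> 3 * (2 + \<bar>t\<bar>)\<^sup>2 * exp (- pi / 2 * \<bar>t\<bar>) * G"
      using 1 G(3)[OF x] G by (intro mult_mono) (auto intro: order_trans[of 0 g])
    finally show ?thesis using g52 by (simp add: C_def field_simps)
  qed
  moreover have "C > 0" using G g52 by (simp add: C_def)
  ultimately show ?thesis using that by blast
qed

text \<open>The step A -> A + 1 multiplies the quantity by A / (2 \<pi>), which is at least 1 from A
  = 7 on, so the minimum over [1, 8] serves for all A. Independence of A matters because \<sigma>
  may be arbitrarily negative.\<close>

lemma Gamma_over_power_bounded_below: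
  obtains c where "c > 0" "\<And>A::real. A \<ge> 1 \<Longrightarrow> Gamma A * (2 * pi) powr (- A) \<ge> c"
proof -
  define h where "h A = Gamma A * (2 * pi) powr (- A)" for A :: real
  have cont: "continuous_on {1..8} h"
    unfolding h_def by (intro continuous_intros) (auto elim!: nonpos_Ints_cases)
  obtain x where x: "x \<in> {1..8}" "\<And>y. y \<in> {1..8} \<Longrightarrow> h x \<le> h y"
    using continuous_attains_inf[OF _ _ cont] by auto
  have "h x > 0" using x Gamma_real_pos[of x] by (simp add: h_def)
  moreover have "h A \<ge> h x" if "A \<ge> 1" for A
  proof -
    have "h (B + real n) \<ge> h x" if "7 \<le> B" "B \<le> 8" for B n
    proof (induction n)
      case 0 thus ?case using x(2)[of B] that by simp
    next
      case (Suc n)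
      let ?C = "B + real n"
      have C: "?C \<ge> 7" using that by simp
      hence "?C \<notin> \<int>\<^sub>\<le>\<^sub>0" by (auto elim!: nonpos_Ints_cases)
      hence "Gamma (?C + 1) = ?C * Gamma ?C" by (rule Gamma_plus1)
      moreover have "(2 * pi) powr (- (?C + 1)) = (2 * pi) powr (- ?C) / (2 * pi)"
        using powr_add[of "2 * pi" "- ?C" "-1"] by (simp add: powr_minus_divide)
      ultimately have "h (?C + 1) = h ?C * (?C / (2 * pi))" by (simp add: h_def)
      moreover have "?C / (2 * pi) \<ge> 1" using C pi_approx by simp
      moreover have "h ?C > 0" using C Gamma_real_pos[of ?C] by (simp add: h_def)
      ultimately have "h ?C * 1 \<le> h (?C + 1)" by (metis mult_left_mono less_imp_le)
      thus ?case using Suc by (simp add: add_ac)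
    qed note * = this
    show ?thesis
    proof (cases "A \<le> 8")
      case False
      define n where "n = nat \<lfloor>A - 7\<rfloor>"
      have "real n = of_int \<lfloor>A - 7\<rfloor>" using False by (simp add: n_def)
      hence "7 \<le> A - real n" "A - real n \<le> 8" using floor_correct[of "A - 7"] by linarith+
      from *[OF this, of n] show ?thesis by simp
    qed (use x that in auto)
  qed
  ultimately show ?thesis using that[of "h x"] by (simp add: h_def)
qed

text \<open>The factor exp (\<delta> s^2) decays like exp (-\<delta> t^2) in the strip and beats the
  exponential growth; on the vertical sides it costs at most exp (\<delta> X^2), which tends to 1 as
  \<delta> -> 0. The growth constant \<open>M\<close> leaves no trace in the conclusion, so it may
  depend on all parameters.\<close>

lemma phragmen_lindelof_strip:
  fixes R :: "complex \<Rightarrow> complex" and B M K xl xr :: real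
  assumes hol: "R holomorphic_on U" "open U" "{s. xl \<le> Re s \<and> Re s \<le> xr} \<subseteq> U" and B: "B > 0" and K: "K \<ge> 0"
    and e1: "\<And>t. norm (R (Complex xl t)) \<le> B" and e2: "\<And>t. norm (R (Complex xr t)) \<le> B"
    and gr: "\<And>s. xl \<le> Re s \<Longrightarrow> Re s \<le> xr \<Longrightarrow> norm (R s) \<le> M * exp (K * \<bar>Im s\<bar>)"
    and s: "xl \<le> Re s" "Re s \<le> xr"
  shows "norm (R s) \<le> B"
proof -
  define X where "X = \<bar>xl\<bar> + \<bar>xr\<bar>"
  have X: "(Re z)\<^sup>2 \<le> X\<^sup>2" if "xl \<le> Re z" "Re z \<le> xr" for z
    using that unfolding X_def by (intro abs_le_square_iff[THEN iffD1]) auto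
  have ne: "norm (exp (of_real \<delta> * z ^ 2)) = exp (\<delta> * ((Re z)\<^sup>2 - (Im z)\<^sup>2))" for \<delta> z
    by (simp add: power2_eq_square)
  have key: "norm (R s) * exp (\<delta> * ((Re s)\<^sup>2 - (Im s)\<^sup>2)) \<le> B * exp (\<delta> * X\<^sup>2)" if \<delta>: "\<delta> > 0" for \<delta>
  proof -
    have "((\<lambda>Y. \<bar>M\<bar> * exp (K * Y + \<delta> * (X\<^sup>2 - Y\<^sup>2))) \<longlongrightarrow> 0) at_top"
      using \<delta> by real_asymp
    hence "eventually (\<lambda>Y. \<bar>M\<bar> * exp (K * Y + \<delta> * (X\<^sup>2 - Y\<^sup>2)) < B) at_top"
      using B by (rule order_tendstoD)
    hence "eventually (\<lambda>Y. \<bar>M\<bar> * exp (K * Y + \<delta> * (X\<^sup>2 - Y\<^sup>2)) < B \<and> Y > \<bar>Im s\<bar>) at_top"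
      by (intro eventually_conj eventually_gt_at_top)
    then obtain Y where Y: "\<bar>M\<bar> * exp (K * Y + \<delta> * (X\<^sup>2 - Y\<^sup>2)) < B" "Y > \<bar>Im s\<bar>"
      by (auto simp: eventually_at_top_linorder)
    let ?S = "cbox (Complex xl (- Y)) (Complex xr Y)"
    let ?F = "\<lambda>z. R z * exp (of_real \<delta> * z ^ 2)"
    have sub: "?S \<subseteq> U" using hol(3) by (auto simp: in_cbox_complex_iff)
    have Fh: "?F holomorphic_on U" by (intro holomorphic_intros hol(1))
    have "norm (?F s) \<le> B * exp (\<delta> * X\<^sup>2)"
    proof (rule maximum_modulus_frontier[where S = ?S and f = ?F])
      show "?F holomorphic_on interior ?S" by (rule holomorphic_on_subset[OF Fh]) (use sub interior_subset in blast)
      show "continuous_on (closure ?S) ?F"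
        using holomorphic_on_imp_continuous_on[OF Fh] sub by (auto intro: continuous_on_subset)
      show "s \<in> ?S" using s Y by (auto simp: in_cbox_complex_iff)
      fix z assume "z \<in> frontier ?S"
      hence z: "z \<in> ?S" "z \<notin> box (Complex xl (- Y)) (Complex xr Y)" by (auto simp: frontier_cbox)
      hence zz: "xl \<le> Re z" "Re z \<le> xr" "- Y \<le> Im z" "Im z \<le> Y" by (auto simp: in_cbox_complex_iff)
      show "norm (?F z) \<le> B * exp (\<delta> * X\<^sup>2)"
      proof (cases "Re z = xl \<or> Re z = xr")
        case True
        have "norm (R z) \<le> B" using True e1[of "Im z"] e2[of "Im z"] by (metis complex_surj)
        moreover have "\<delta> * ((Re z)\<^sup>2 - (Im z)\<^sup>2) \<le> \<delta> * X\<^sup>2"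
          using X[OF zz(1,2)] \<delta> zero_le_power2[of "Im z"] by (intro mult_left_mono) linarith+
        ultimately show ?thesis unfolding norm_mult ne using B by (intro mult_mono) auto
      next
        case False
        hence im: "\<bar>Im z\<bar> = Y" using z zz by (auto simp: in_box_complex_iff)
        have "norm (?F z) \<le> \<bar>M\<bar> * exp (K * Y) * exp (\<delta> * (X\<^sup>2 - Y\<^sup>2))"
          unfolding norm_mult ne
        proof (rule mult_mono)
          have "norm (R z) \<le> M * exp (K * Y)" using gr[OF zz(1,2)] im by simp
          also have "\<dots> \<le> \<bar>M\<bar> * exp (K * Y)" by (intro mult_right_mono) auto
          finally show "norm (R z) \<le> \<bar>M\<bar> * exp (K * Y)" .
          have "(Im z)\<^sup>2 = Y\<^sup>2" using im by (metis power2_abs)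
          thus "exp (\<delta> * ((Re z)\<^sup>2 - (Im z)\<^sup>2)) \<le> exp (\<delta> * (X\<^sup>2 - Y\<^sup>2))"
            using X[OF zz(1,2)] \<delta> by simp
        qed auto
        also have "\<dots> = \<bar>M\<bar> * exp (K * Y + \<delta> * (X\<^sup>2 - Y\<^sup>2))" by (simp add: exp_add)
        also have "\<dots> \<le> B * 1" using Y by simp
        also have "\<dots> \<le> B * exp (\<delta> * X\<^sup>2)" using B \<delta> by (intro mult_left_mono) auto
        finally show ?thesis .
      qed
    qed auto
    thus ?thesis unfolding norm_mult ne .
  qed
  have "((\<lambda>\<delta>. norm (R s) * exp (\<delta> * ((Re s)\<^sup>2 - (Im s)\<^sup>2))) \<longlongrightarrow> norm (R s) * exp (0 * ((Re s)\<^sup>2 - (Im s)\<^sup>2))) (at_right 0)"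
    by (intro tendsto_intros)
  moreover have "((\<lambda>\<delta>. B * exp (\<delta> * X\<^sup>2)) \<longlongrightarrow> B * exp (0 * X\<^sup>2)) (at_right 0)"
    by (intro tendsto_intros)
  moreover have "eventually (\<lambda>\<delta>. norm (R s) * exp (\<delta> * ((Re s)\<^sup>2 - (Im s)\<^sup>2)) \<le> B * exp (\<delta> * X\<^sup>2)) (at_right 0)"
    using key by (auto simp: eventually_at_right_field intro: exI[of _ 1])
  ultimately have "norm (R s) * exp (0 * ((Re s)\<^sup>2 - (Im s)\<^sup>2)) \<le> B * exp (0 * X\<^sup>2)"
    by (intro tendsto_le[of "at_right (0::real)"]) auto
  thus ?thesis by simp
qed

section \<open>The leading terms of the two dual series, without the gamma factor\<close>

definition up_term :: "real \<Rightarrow> real \<Rightarrow> complex \<Rightarrow> complex" where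
  "up_term a \<beta> s = \<i> * exp (- \<i> * of_real pi * s / 2) * (of_real (2 * pi * \<beta>) powr (s - 1) * ee (- of_real (\<beta> * a)))"

text \<open>Only the leading terms can be large, the first as \<beta> tends to 0, the second as
  \<beta> tends to 1. At \<beta> = 1 the second series starts at frequency 1 and its first term is
  harmless, hence the value 0.\<close>

definition low_term :: "real \<Rightarrow> real \<Rightarrow> complex \<Rightarrow> complex" where
  "low_term a \<beta> s = (if \<beta> = 1 then 0 else
     - \<i> * exp (\<i> * of_real pi * s / 2) * (of_real (2 * pi * (1 - \<beta>)) powr (s - 1) * ee (of_real ((1 - \<beta>) * a))))"

lemma norm_exp_half: "norm (exp (- \<i> * of_real pi * s / 2)) = exp (pi / 2 * Im s)"
    "norm (exp (\<i> * of_real pi * s / 2)) = exp (- (pi / 2 * Im s))"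
  by simp_all

lemma norm_up_term:
  assumes "\<beta> > 0"
  shows "norm (up_term a \<beta> s) = exp (pi / 2 * Im s) * (2 * pi * \<beta>) powr (Re s - 1)"
proof -
  have "norm (complex_of_real (2 * pi * \<beta>) powr (s - 1)) = (2 * pi * \<beta>) powr (Re s - 1)"
    using assms by (subst norm_powr_real_powr) auto
  thus ?thesis unfolding up_term_def norm_mult norm_exp_half by simp
qed

lemma norm_low_term:
  assumes "\<beta> < 1"
  shows "norm (low_term a \<beta> s) = exp (- (pi / 2 * Im s)) * (2 * pi * (1 - \<beta>)) powr (Re s - 1)"
proof -
  have "norm (complex_of_real (2 * pi * (1 - \<beta>)) powr (s - 1)) = (2 * pi * (1 - \<beta>)) powr (Re s - 1)"
    using assms by (subst norm_powr_real_powr) auto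
  thus ?thesis using assms unfolding low_term_def norm_mult by (simp add: norm_mult)
qed

text \<open>The term of index j + 1 of either series has 2 \<pi> (j + 1 + x) >= j + 1, which bounds
  the tails uniformly in \<beta>. The factor 3 counts the two tails and, for \<beta> = 1, the first
  term of the second series, which \<open>low_term\<close> omits.\<close>

lemma lerch_phi_minus_main_terms:
  assumes a: "0 < a" "a \<le> 1" and \<beta>: "0 < \<beta>" "\<beta> \<le> 1" and s: "Re s < 0"
  shows "norm (lerch_phi a \<beta> s - Gamma (1 - s) * (up_term a \<beta> s + low_term a \<beta> s)) \<le>
           3 * norm (Gamma (1 - s)) * exp (pi / 2 * \<bar>Im s\<bar>) * (\<Sum>j. (real j + 1) powr (Re s - 1))"
proof -
  define \<gamma> where "\<gamma> = dual_freq \<beta>"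
  have \<gamma>: "\<gamma> > 0" using dual_freq_pos[OF \<beta>] by (simp add: \<gamma>_def)
  define A where "A j = \<i> * exp (- \<i> * of_real pi * s / 2) * (of_real (2 * pi * (real j + \<beta>)) powr (s - 1) * ee (- of_real ((real j + \<beta>) * a)))" for j
  define B where "B j = \<i> * exp (\<i> * of_real pi * s / 2) * (of_real (2 * pi * (real j + \<gamma>)) powr (s - 1) * ee (of_real ((real j + \<gamma>) * a)))" for j
  define E where "E = exp (pi / 2 * \<bar>Im s\<bar>)"
  define p where "p j = (real j + 1) powr (Re s - 1)" for j
  have psum: "summable p"
  proof -
    have "summable (\<lambda>j. real (j + 1) powr (Re s - 1))"
      using s by (subst summable_iff_shift) (simp add: summable_real_powr_iff)
    thus ?thesis by (simp add: p_def[abs_def] add_ac)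
  qed
  have pw: "norm (complex_of_real (2 * pi * (real j + x)) powr (s - 1)) \<le> (real i + 1) powr (Re s - 1)"
    if "x > 0" "real i + 1 \<le> 2 * pi * (real j + x)" for i j x
  proof -
    have "norm (complex_of_real (2 * pi * (real j + x)) powr (s - 1)) = (2 * pi * (real j + x)) powr (Re s - 1)"
      using that by (subst norm_powr_real_powr) auto
    also have "\<dots> \<le> (real i + 1) powr (Re s - 1)" using that s by (intro powr_mono2') auto
    finally show ?thesis .
  qed
  have E: "exp (pi / 2 * Im s) \<le> E" "exp (- (pi / 2 * Im s)) \<le> E"
  proof -
    have "pi / 2 * Im s \<le> pi / 2 * \<bar>Im s\<bar>" "pi / 2 * (- Im s) \<le> pi / 2 * \<bar>Im s\<bar>"
      by (intro mult_left_mono; simp)+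
    thus "exp (pi / 2 * Im s) \<le> E" "exp (- (pi / 2 * Im s)) \<le> E" by (simp_all add: E_def)
  qed
  have E0: "E \<ge> 0" by (simp add: E_def)
  have nA: "norm (A j) \<le> E * (real i + 1) powr (Re s - 1)" if "real i + 1 \<le> 2 * pi * (real j + \<beta>)" for i j
    unfolding A_def norm_mult norm_exp_half using pw[OF \<beta>(1) that] E E0
    by (auto intro!: mult_mono)
  have nB: "norm (B j) \<le> E * (real i + 1) powr (Re s - 1)" if "real i + 1 \<le> 2 * pi * (real j + \<gamma>)" for i j
    unfolding B_def norm_mult norm_exp_half using pw[OF \<gamma> that] E E0
    by (auto intro!: mult_mono)
  have big: "real j + 1 \<le> 2 * pi * (real (Suc j) + x)" if "x > 0" for x j
  proof -
    have "1 * (real j + 1) \<le> 2 * pi * (real (Suc j) + x)" using that pi_gt3 by (intro mult_mono) auto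
    thus ?thesis by simp
  qed
  have sums: "(\<lambda>j. Gamma (1 - s) * (A j - B j)) sums lerch_phi a \<beta> s"
    using lerch_phi_functional_equation[OF a \<beta> s] unfolding A_def B_def \<gamma>_def .
  have tail: "(\<lambda>j. Gamma (1 - s) * (A (Suc j) - B (Suc j))) sums (lerch_phi a \<beta> s - Gamma (1 - s) * (A 0 - B 0))"
    using sums by (subst sums_Suc_iff) simp
  have nt: "norm (Gamma (1 - s) * (A (Suc j) - B (Suc j))) \<le> norm (Gamma (1 - s)) * E * 2 * p j" for j
  proof -
    have "norm (A (Suc j) - B (Suc j)) \<le> norm (A (Suc j)) + norm (B (Suc j))" by (rule norm_triangle_ineq4)
    also have "\<dots> \<le> E * p j + E * p j"
      unfolding p_def using big[OF \<beta>(1)] big[OF \<gamma>] by (intro add_mono nA nB) auto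
    also have "E * p j + E * p j = E * (2 * p j)" by simp
    finally have "norm (Gamma (1 - s)) * norm (A (Suc j) - B (Suc j)) \<le> norm (Gamma (1 - s)) * (E * (2 * p j))"
      by (rule mult_left_mono) simp
    thus ?thesis unfolding norm_mult by (simp only: mult.assoc)
  qed
  have 1: "norm (lerch_phi a \<beta> s - Gamma (1 - s) * (A 0 - B 0)) \<le> norm (Gamma (1 - s)) * E * 2 * suminf p"
  proof -
    have sm: "summable (\<lambda>j. norm (Gamma (1 - s)) * E * 2 * p j)" by (intro summable_mult psum)
    have "norm (\<Sum>j. Gamma (1 - s) * (A (Suc j) - B (Suc j))) \<le> (\<Sum>j. norm (Gamma (1 - s)) * E * 2 * p j)"
      by (rule norm_suminf_le[OF nt sm])
    thus ?thesis using tail by (simp add: sums_iff suminf_mult psum)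
  qed
  have 2: "norm (Gamma (1 - s) * (A 0 - B 0) - Gamma (1 - s) * (up_term a \<beta> s + low_term a \<beta> s)) \<le> norm (Gamma (1 - s)) * E * suminf p"
  proof (cases "\<beta> = 1")
    case False
    hence "A 0 - B 0 = up_term a \<beta> s + low_term a \<beta> s"
      by (simp add: A_def B_def up_term_def low_term_def \<gamma>_def dual_freq_def)
    thus ?thesis using psum by (auto simp: E_def p_def intro!: mult_nonneg_nonneg suminf_nonneg)
  next
    case True
    have "A 0 = up_term a \<beta> s" by (simp add: A_def up_term_def)
    hence "Gamma (1 - s) * (A 0 - B 0) - Gamma (1 - s) * (up_term a \<beta> s + low_term a \<beta> s) = - (Gamma (1 - s) * B 0)"
      using True by (simp add: low_term_def algebra_simps)
    moreover have "norm (B 0) \<le> E * p 0"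
      unfolding p_def using True pi_gt3 by (intro nB) (simp add: \<gamma>_def dual_freq_def)
    moreover have "p 0 \<le> suminf p"
      using sum_le_suminf[OF psum, of "{0}"] by (auto simp: p_def)
    hence "E * p 0 \<le> E * suminf p" by (simp add: E_def)
    ultimately show ?thesis by (simp add: norm_mult mult.assoc mult_left_mono)
  qed
  have "norm (lerch_phi a \<beta> s - Gamma (1 - s) * (up_term a \<beta> s + low_term a \<beta> s)) \<le>
      norm (lerch_phi a \<beta> s - Gamma (1 - s) * (A 0 - B 0)) +
      norm (Gamma (1 - s) * (A 0 - B 0) - Gamma (1 - s) * (up_term a \<beta> s + low_term a \<beta> s))"
    by (rule norm_triangle_ineq[THEN order_trans[rotated]]) (simp add: algebra_simps)
  also have "\<dots> \<le> 3 * norm (Gamma (1 - s)) * E * suminf p" using 1 2 by (simp add: algebra_simps)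
  finally show ?thesis by (simp add: E_def p_def[abs_def])
qed

section \<open>Growth in the critical strip\<close>

text \<open>A qualitative bound: \<open>M\<close> depends on all parameters. It only has to license
  the use of \<open>phragmen_lindelof_strip\<close>.\<close>

lemma line_part_growth:
  assumes c: "0 < c" "c \<le> 1" and \<gamma>: "0 < \<gamma>" "\<gamma> \<le> 1" and x: "x \<notin> \<int>" and e: "\<bar>e\<bar> = (1::real)"
  obtains M where "\<And>s. -1/2 \<le> Re s \<Longrightarrow> Re s \<le> 3/2 \<Longrightarrow>
     norm (integral {0<..} (\<lambda>y. Complex c (e * y) powr (- s) * ap_kernel \<gamma> (Complex x y))) \<le> M * exp (pi / 2 * \<bar>Im s\<bar>)"
proof -
  obtain C where C: "C \<ge> 0" "\<And>y. y \<ge> 0 \<Longrightarrow> norm (ap_kernel \<gamma> (Complex x y)) \<le> C * exp (- (2 * pi * \<gamma>) * y)"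
    using ap_kernel_half_line_bound[of \<gamma> x] \<gamma> x by auto
  define g where "g y = c powr (- 3/2) * C * ((1 + y) powr (1/2) * exp (- (2 * pi * \<gamma>) * y))" for y
  have gi: "g integrable_on {0<..}"
    unfolding g_def[abs_def] using \<gamma> by (intro integrable_on_mult_right integrable_one_plus_powr_exp) auto
  show ?thesis
  proof (rule that)
    fix s :: complex assume s: "-1/2 \<le> Re s" "Re s \<le> 3/2"
    define E where "E = exp (pi / 2 * \<bar>Im s\<bar>)"
    have "norm (integral {0<..} (\<lambda>y. Complex c (e * y) powr (- s) * ap_kernel \<gamma> (Complex x y))) \<le>
            integral {0<..} (\<lambda>y. E * g y)"
    proof (rule integral_norm_bound_integral)
      show "(\<lambda>y. Complex c (e * y) powr (- s) * ap_kernel \<gamma> (Complex x y)) integrable_on {0<..}"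
        by (rule line_part(1)[OF c \<gamma> x e])
      show "(\<lambda>y. E * g y) integrable_on {0<..}" by (intro integrable_on_mult_right gi)
      fix y :: real assume "y \<in> {0<..}"
      hence y: "y > 0" by simp
      let ?z = "Complex c (e * y)"
      have z: "?z \<noteq> 0" "Re ?z \<ge> 0" using c by (auto simp: complex_eq_iff)
      have z1: "norm ?z \<ge> c" using abs_Re_le_cmod[of ?z] by simp
      have z2: "norm ?z \<le> 1 + y" using cmod_le[of ?z] c e y by (simp add: abs_mult)
      have "norm ?z powr (- Re s) \<le> c powr (- 3/2) * (1 + y) powr (1/2)"
      proof (cases "Re s \<ge> 0")
        case True
        have "norm ?z powr (- Re s) \<le> c powr (- Re s)" using True z1 c by (intro powr_mono2') auto
        also have "\<dots> \<le> c powr (- 3/2)" using c s by (intro powr_mono') auto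
        also have "\<dots> \<le> c powr (- 3/2) * (1 + y) powr (1/2)"
          using y ge_one_powr_ge_zero[of "1 + y" "1/2"] by (simp add: mult_le_cancel_left1)
        finally show ?thesis .
      next
        case False
        have "norm ?z powr (- Re s) \<le> (1 + y) powr (- Re s)" using False z2 by (intro powr_mono2) auto
        also have "\<dots> \<le> (1 + y) powr (1/2)" using s y by (intro powr_mono) auto
        also have "\<dots> \<le> c powr (- 3/2) * (1 + y) powr (1/2)"
        proof -
          have "1 \<le> c powr (- 3/2)" using powr_mono'[of "-3/2" 0 c] c by simp
          from mult_right_mono[OF this, of "(1 + y) powr (1/2)"] show ?thesis by simp
        qed
        finally show ?thesis .
      qed
      hence "norm ?z powr (- Re s) * E \<le> (c powr (- 3/2) * (1 + y) powr (1/2)) * E"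
        by (rule mult_right_mono) (simp add: E_def)
      hence "norm (?z powr (- s)) \<le> (c powr (- 3/2) * (1 + y) powr (1/2)) * E"
        using norm_powr_right_half_plane[OF z, of s] unfolding E_def by (rule order_trans[rotated])
      hence "norm (?z powr (- s)) * norm (ap_kernel \<gamma> (Complex x y)) \<le>
          ((c powr (- 3/2) * (1 + y) powr (1/2)) * E) * (C * exp (- (2 * pi * \<gamma>) * y))"
        using C y by (intro mult_mono) (auto simp: E_def)
      thus "norm (?z powr (- s) * ap_kernel \<gamma> (Complex x y)) \<le> E * g y"
        unfolding norm_mult g_def by (simp only: mult_ac)
    qed
    thus "norm (integral {0<..} (\<lambda>y. Complex c (e * y) powr (- s) * ap_kernel \<gamma> (Complex x y))) \<le>
            integral {0<..} g * exp (pi / 2 * \<bar>Im s\<bar>)"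
      by (simp add: E_def mult.commute)
  qed
qed

lemma lerch_line_growth:
  assumes "0 < c" "c < a" "a \<le> 1" "0 < \<beta>" "\<beta> \<le> 1"
  obtains M where "\<And>s. -1/2 \<le> Re s \<Longrightarrow> Re s \<le> 3/2 \<Longrightarrow> norm (lerch_line a \<beta> c s) \<le> M * exp (pi / 2 * \<bar>Im s\<bar>)"
proof -
  have nint: "c - a \<notin> \<int>" "a - c \<notin> \<int>"
    using Ints_nonzero_abs_less1[of "c - a"] Ints_nonzero_abs_less1[of "a - c"] assms by auto
  have c1: "c \<le> 1" using assms by simp
  obtain M1 where M1: "\<And>s. -1/2 \<le> Re s \<Longrightarrow> Re s \<le> 3/2 \<Longrightarrow>
     norm (integral {0<..} (\<lambda>y. Complex c (1 * y) powr (- s) * ap_kernel \<beta> (Complex (c - a) y))) \<le> M1 * exp (pi / 2 * \<bar>Im s\<bar>)"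
    using line_part_growth[OF assms(1) c1 assms(4,5) nint(1), of 1] by auto
  obtain M2 where M2: "\<And>s. -1/2 \<le> Re s \<Longrightarrow> Re s \<le> 3/2 \<Longrightarrow>
     norm (integral {0<..} (\<lambda>y. Complex c ((-1) * y) powr (- s) * ap_kernel (dual_freq \<beta>) (Complex (a - c) y))) \<le> M2 * exp (pi / 2 * \<bar>Im s\<bar>)"
    using line_part_growth[OF assms(1) c1 dual_freq_pos[OF assms(4,5)] nint(2), of "-1"] by auto
  show ?thesis
  proof (rule that[of "M1 + M2"])
    fix s assume s: "-1/2 \<le> Re s" "Re s \<le> 3/2"
    have "norm (lerch_line a \<beta> c s) \<le> norm (integral {0<..} (\<lambda>y. Complex c (1 * y) powr (- s) * ap_kernel \<beta> (Complex (c - a) y)))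
        + norm (integral {0<..} (\<lambda>y. Complex c ((-1) * y) powr (- s) * ap_kernel (dual_freq \<beta>) (Complex (a - c) y)))"
      unfolding lerch_line_def norm_mult norm_ii mult_1 mult_minus1 by (rule norm_triangle_ineq4)
    thus "norm (lerch_line a \<beta> c s) \<le> (M1 + M2) * exp (pi / 2 * \<bar>Im s\<bar>)"
      using M1[OF s] M2[OF s] unfolding ring_distribs by linarith
  qed
qed

text \<open>This is (s - 1) times the error of the approximation of \<open>lerch_phi\<close> by
  a^(-s) and the two leading dual terms. Written out with \<open>lerch_line\<close> and \<Gamma>(2 -
  s) it has no singularity at s = 1, where the pole for \<beta> = 1 and the pole of \<Gamma>(1 - s)
  are absorbed by s - 1.\<close>

definition lerch_reg :: "real \<Rightarrow> real \<Rightarrow> complex \<Rightarrow> complex" where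
  "lerch_reg a \<beta> s = (s - 1) * (lerch_line a \<beta> (a / 2) s - of_real a powr (- s))
     + (if \<beta> = 1 then of_real (a / 2) powr (1 - s) else 0)
     + Gamma (2 - s) * (up_term a \<beta> s + low_term a \<beta> s)"

lemma Gamma_2_minus:
  assumes "s \<noteq> 1" "Re s < 2"
  shows "Gamma (2 - s) = - (s - 1) * Gamma (1 - s)"
proof (cases "1 - s \<in> \<int>\<^sub>\<le>\<^sub>0")
  case True
  then obtain n where n: "1 - s = - of_nat n" by (elim nonpos_Ints_cases')
  hence "Re s = 1 + real n" by (simp add: complex_eq_iff)
  hence "n = 0" using assms by simp
  thus ?thesis using n assms by simp
next
  case False
  from Gamma_plus1[OF this] show ?thesis by (simp add: algebra_simps)
qed

lemma lerch_reg_eq: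
  assumes "0 < a" "a \<le> 1" "0 < \<beta>" "\<beta> \<le> 1" "s \<noteq> 1"
  shows "lerch_reg a \<beta> s = (s - 1) * (lerch_phi a \<beta> s - of_real a powr (- s))
            + Gamma (2 - s) * (up_term a \<beta> s + low_term a \<beta> s)"
proof -
  define Z where "Z = up_term a \<beta> s + low_term a \<beta> s"
  have "lerch_phi a \<beta> s = lerch_cont a \<beta> (a / 2) s"
    by (rule lerch_phi_eq_lerch_cont) (use assms in auto)
  moreover have "(s - 1) * lerch_cont a \<beta> (a / 2) s = (s - 1) * lerch_line a \<beta> (a / 2) s + (if \<beta> = 1 then of_real (a / 2) powr (1 - s) else 0)"
    using assms by (cases "\<beta> = 1") (simp_all add: lerch_cont_def distrib_left)
  ultimately show ?thesis unfolding lerch_reg_def Z_def[symmetric]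
    by (simp add: right_diff_distrib)
qed

lemma lerch_reg_holomorphic:
  assumes "0 < a" "a \<le> 1" "0 < \<beta>" "\<beta> \<le> 1"
  shows "lerch_reg a \<beta> holomorphic_on {s. Re s < 2}"
proof -
  have L: "lerch_line a \<beta> (a / 2) holomorphic_on {s. Re s < 2}"
    by (rule holomorphic_on_subset[OF lerch_line_holomorphic]) (use assms in auto)
  have "(\<lambda>s. if \<beta> = 1 then of_real (a / 2) powr (1 - s) else 0) holomorphic_on {s :: complex. Re s < 2}"
    using assms by (cases "\<beta> = 1") (auto intro!: holomorphic_intros)
  moreover have "(\<lambda>s. Gamma (2 - s)) holomorphic_on {s. Re s < 2}"
  proof (intro holomorphic_intros)
    fix z :: complex assume "z \<in> {s. Re s < 2}"
    thus "2 - z \<notin> \<int>\<^sub>\<le>\<^sub>0" by (auto elim!: nonpos_Ints_cases' simp: complex_eq_iff)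
  qed
  moreover have "up_term a \<beta> holomorphic_on {s. Re s < 2}"
    unfolding up_term_def[abs_def] using assms by (intro holomorphic_intros) auto
  moreover have "low_term a \<beta> holomorphic_on {s. Re s < 2}"
    unfolding low_term_def[abs_def] using assms by (cases "\<beta> = 1") (auto intro!: holomorphic_intros)
  moreover have "(\<lambda>s. of_real a powr (- s)) holomorphic_on {s. Re s < 2}"
    using assms by (auto intro!: holomorphic_intros)
  ultimately show ?thesis unfolding lerch_reg_def[abs_def] using L
    by (intro holomorphic_on_add holomorphic_on_mult holomorphic_on_diff holomorphic_on_ident holomorphic_on_const)
qed

text \<open>For Re s >= 1 the powers have a nonnegative exponent, so a small \<beta> or 1 - \<beta>
  does no harm.\<close>

lemma norm_main_terms_le:
  assumes "0 < \<beta>" "\<beta> \<le> 1" "Re s \<ge> 1" "Re s \<le> 3/2"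
  shows "norm (up_term a \<beta> s + low_term a \<beta> s) \<le> 2 * (2 * pi) * exp (pi / 2 * \<bar>Im s\<bar>)"
proof -
  have pw: "(2 * pi * x) powr (Re s - 1) \<le> 2 * pi" if "0 < x" "x \<le> 1" for x
  proof -
    have "(2 * pi * x) powr (Re s - 1) \<le> (2 * pi) powr (Re s - 1)"
      using that assms by (intro powr_mono2) (auto simp: mult_le_cancel_left1)
    also have "\<dots> \<le> (2 * pi) powr 1" using assms pi_gt3 by (intro powr_mono) auto
    finally show ?thesis by simp
  qed
  have E: "exp (pi / 2 * Im s) \<le> exp (pi / 2 * \<bar>Im s\<bar>)" "exp (- (pi / 2 * Im s)) \<le> exp (pi / 2 * \<bar>Im s\<bar>)"
  proof -
    have "pi / 2 * Im s \<le> pi / 2 * \<bar>Im s\<bar>" "pi / 2 * (- Im s) \<le> pi / 2 * \<bar>Im s\<bar>"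
      by (intro mult_left_mono; simp)+
    thus "exp (pi / 2 * Im s) \<le> exp (pi / 2 * \<bar>Im s\<bar>)" "exp (- (pi / 2 * Im s)) \<le> exp (pi / 2 * \<bar>Im s\<bar>)"
      by simp_all
  qed
  have 1: "norm (up_term a \<beta> s) \<le> exp (pi / 2 * \<bar>Im s\<bar>) * (2 * pi)"
    unfolding norm_up_term[OF assms(1)] by (intro mult_mono E pw assms) auto
  have 2: "norm (low_term a \<beta> s) \<le> exp (pi / 2 * \<bar>Im s\<bar>) * (2 * pi)"
  proof (cases "\<beta> = 1")
    case False
    hence b: "\<beta> < 1" using assms by simp
    show ?thesis unfolding norm_low_term[OF b] by (intro mult_mono E pw) (use b assms in auto)
  qed (simp add: low_term_def)
  have "norm (up_term a \<beta> s + low_term a \<beta> s) \<le> exp (pi / 2 * \<bar>Im s\<bar>) * (2 * pi) + exp (pi / 2 * \<bar>Im s\<bar>) * (2 * pi)"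
    by (rule order_trans[OF norm_triangle_ineq add_mono[OF 1 2]])
  thus ?thesis by (simp add: mult_ac)
qed

lemma powr_le_sum:
  fixes x e p q :: real
  assumes "x > 0" "p \<le> e" "e \<le> q"
  shows "x powr e \<le> x powr p + x powr q"
proof (cases "x \<ge> 1")
  case True
  hence "x powr e \<le> x powr q" using assms by (intro powr_mono) auto
  thus ?thesis by (simp add: add_increasing)
next
  case False
  hence "x powr e \<le> x powr p" using assms by (intro powr_mono') auto
  thus ?thesis by (simp add: add_increasing2)
qed

lemma exp_half_pi_abs:
  "exp (pi / 2 * t) \<le> exp (pi / 2 * \<bar>t\<bar>)" "exp (- (pi / 2 * t)) \<le> exp (pi / 2 * \<bar>t\<bar>)"
proof -
  have "pi / 2 * t \<le> pi / 2 * \<bar>t\<bar>" "pi / 2 * (- t) \<le> pi / 2 * \<bar>t\<bar>"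
    by (intro mult_left_mono; simp)+
  thus "exp (pi / 2 * t) \<le> exp (pi / 2 * \<bar>t\<bar>)" "exp (- (pi / 2 * t)) \<le> exp (pi / 2 * \<bar>t\<bar>)"
    by simp_all
qed

lemma lerch_reg_growth:
  assumes a: "0 < a" "a \<le> 1" and \<beta>: "0 < \<beta>" "\<beta> \<le> 1"
  obtains M where "\<And>s. -1/2 \<le> Re s \<Longrightarrow> Re s \<le> 3/2 \<Longrightarrow> norm (lerch_reg a \<beta> s) \<le> M * exp ((pi / 2 + 1) * \<bar>Im s\<bar>)"
proof -
  obtain M1 where M1: "\<And>s. -1/2 \<le> Re s \<Longrightarrow> Re s \<le> 3/2 \<Longrightarrow> norm (lerch_line a \<beta> (a / 2) s) \<le> M1 * exp (pi / 2 * \<bar>Im s\<bar>)"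
    using lerch_line_growth[of "a / 2" a \<beta>] assms by auto
  obtain G g :: real where G: "G > 0" "g > 0" "\<And>x. 1/2 \<le> x \<Longrightarrow> x \<le> 5/2 \<Longrightarrow> g \<le> Gamma x \<and> Gamma x \<le> G"
    using Gamma_real_bounded by blast
  define P where "P x = x powr (- 3/2) + x powr (1/2)" for x :: real
  have P: "P x \<ge> 0" for x by (simp add: P_def)
  define A where "A = a powr (- 3/2) + a powr (1/2)"
  define A2 where "A2 = (a / 2) powr (- 1/2) + (a / 2) powr (3/2)"
  define M where "M = (\<bar>M1\<bar> + A) + A2 + G * (P (2 * pi * \<beta>) + P (2 * pi * (1 - \<beta>)))"
  have A: "A \<ge> 0" "A2 \<ge> 0" by (auto simp: A_def A2_def)
  show ?thesis
  proof (rule that)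
    fix s :: complex assume s: "-1/2 \<le> Re s" "Re s \<le> 3/2"
    define t where "t = \<bar>Im s\<bar>"
    define E where "E = exp (pi / 2 * t)"
    have t: "t \<ge> 0" and E: "E \<ge> 1" by (auto simp: t_def E_def)
    \<comment> \<open>3 + t <= exp (2 + t) trades the polynomial factor for the extra 1 in the
      exponent \<pi>/2 + 1.\<close>
    have n1: "norm (s - 1) \<le> exp 2 * exp t"
    proof -
      have "norm (s - 1) \<le> \<bar>Re (s - 1)\<bar> + \<bar>Im (s - 1)\<bar>" by (rule cmod_le)
      also have "\<dots> \<le> 1 + (2 + t)" using s by (simp add: t_def)
      also have "\<dots> \<le> exp (2 + t)" by (rule exp_ge_add_one_self)
      finally show ?thesis by (simp add: exp_add)
    qed
    have e1: "1 \<le> exp 2 * exp t" using t by (simp flip: exp_add)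
    have na: "norm (of_real a powr (- s)) \<le> A * E"
    proof -
      have "norm (of_real a powr (- s)) = a powr (- Re s)" using a by (subst norm_powr_real_powr) auto
      also have "\<dots> \<le> A" unfolding A_def using a s by (intro powr_le_sum) auto
      also have "\<dots> \<le> A * E" using A E by (simp add: mult_le_cancel_left1)
      finally show ?thesis .
    qed
    have na2: "norm (if \<beta> = 1 then of_real (a / 2) powr (1 - s) else 0) \<le> A2 * E"
    proof -
      have "norm (of_real (a / 2) powr (1 - s)) = (a / 2) powr (1 - Re s)" using a by (subst norm_powr_real_powr) auto
      also have "\<dots> \<le> A2" unfolding A2_def using a s by (intro powr_le_sum) auto
      also have "\<dots> \<le> A2 * E" using A E by (simp add: mult_le_cancel_left1)
      finally show ?thesis using A E by auto
    qed
    have nu: "norm (up_term a \<beta> s) \<le> P (2 * pi * \<beta>) * E"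
    proof -
      have "exp (pi / 2 * Im s) * (2 * pi * \<beta>) powr (Re s - 1) \<le> E * P (2 * pi * \<beta>)"
        unfolding P_def E_def t_def using s \<beta> exp_half_pi_abs[of "Im s"]
        by (intro mult_mono powr_le_sum) auto
      thus ?thesis unfolding norm_up_term[OF \<beta>(1)] by (simp only: mult_ac)
    qed
    have nl: "norm (low_term a \<beta> s) \<le> P (2 * pi * (1 - \<beta>)) * E"
    proof (cases "\<beta> = 1")
      case True thus ?thesis using P E by (simp add: low_term_def)
    next
      case False
      hence b: "\<beta> < 1" using \<beta> by simp
      have "exp (- (pi / 2 * Im s)) * (2 * pi * (1 - \<beta>)) powr (Re s - 1) \<le> E * P (2 * pi * (1 - \<beta>))"
        unfolding P_def E_def t_def using s b exp_half_pi_abs[of "Im s"]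
        by (intro mult_mono powr_le_sum) auto
      thus ?thesis unfolding norm_low_term[OF b] by (simp only: mult_ac)
    qed
    have ng: "norm (Gamma (2 - s)) \<le> G"
    proof -
      have e: "2 - s = Complex (2 - Re s) (- Im s)" by (simp add: complex_eq_iff)
      have "norm (Gamma (2 - s)) \<le> Gamma (2 - Re s)" unfolding e by (rule norm_Gamma_le_real) (use s in auto)
      also have "\<dots> \<le> G" using G(3)[of "2 - Re s"] s by auto
      finally show ?thesis .
    qed
    have T1: "norm ((s - 1) * (lerch_line a \<beta> (a / 2) s - of_real a powr (- s))) \<le> (exp 2 * exp t) * ((\<bar>M1\<bar> + A) * E)"
    proof -
      have "M1 * E \<le> \<bar>M1\<bar> * E" using E by (intro mult_right_mono) auto
      hence "norm (lerch_line a \<beta> (a / 2) s) \<le> \<bar>M1\<bar> * E" using M1[OF s] unfolding E_def t_def by linarith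
      hence "norm (lerch_line a \<beta> (a / 2) s - of_real a powr (- s)) \<le> (\<bar>M1\<bar> + A) * E"
        using norm_triangle_ineq4[of "lerch_line a \<beta> (a / 2) s" "of_real a powr (- s)"] na unfolding ring_distribs by linarith
      thus ?thesis unfolding norm_mult using n1 by (intro mult_mono) auto
    qed
    have T2: "norm (if \<beta> = 1 then of_real (a / 2) powr (1 - s) else 0) \<le> (exp 2 * exp t) * (A2 * E)"
      using mult_mono[OF e1 na2] A E by simp
    have T3: "norm (Gamma (2 - s) * (up_term a \<beta> s + low_term a \<beta> s)) \<le> (exp 2 * exp t) * ((G * (P (2 * pi * \<beta>) + P (2 * pi * (1 - \<beta>)))) * E)"
    proof -
      have "norm (up_term a \<beta> s + low_term a \<beta> s) \<le> (P (2 * pi * \<beta>) + P (2 * pi * (1 - \<beta>))) * E"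
        using norm_triangle_ineq[of "up_term a \<beta> s" "low_term a \<beta> s"] nu nl unfolding ring_distribs by linarith
      hence *: "norm (Gamma (2 - s) * (up_term a \<beta> s + low_term a \<beta> s)) \<le> G * ((P (2 * pi * \<beta>) + P (2 * pi * (1 - \<beta>))) * E)"
        unfolding norm_mult using ng G by (intro mult_mono) auto
      have "0 \<le> G * ((P (2 * pi * \<beta>) + P (2 * pi * (1 - \<beta>))) * E)" using G P E by simp
      from mult_mono[OF e1 * _ norm_ge_zero] show ?thesis by (simp add: mult.assoc)
    qed
    have "norm (lerch_reg a \<beta> s) \<le> (exp 2 * exp t) * ((\<bar>M1\<bar> + A) * E) + (exp 2 * exp t) * (A2 * E)
        + (exp 2 * exp t) * ((G * (P (2 * pi * \<beta>) + P (2 * pi * (1 - \<beta>)))) * E)"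
      unfolding lerch_reg_def by (rule order_trans[OF norm_triangle_ineq add_mono[OF order_trans[OF norm_triangle_ineq add_mono[OF T1 T2]] T3]])
    also have "\<dots> = (exp 2 * M) * (E * exp t)" unfolding M_def by (simp add: algebra_simps)
    also have "E * exp t = exp ((pi / 2 + 1) * t)" by (simp add: E_def ring_distribs flip: exp_add)
    finally show "norm (lerch_reg a \<beta> s) \<le> (exp 2 * M) * exp ((pi / 2 + 1) * \<bar>Im s\<bar>)" unfolding t_def .
  qed
qed

text \<open>An approximate functional equation with one term from each of the three series. On Re s
  = -1/2 the error is a dual tail and a^(-s), of modulus at most 1; on Re s = 3/2 it is a tail of
  the series itself and dual terms with positive exponent. Both are bounded uniformly in a and
  \<beta>, up to powers of |Im s|, and the strip between them is interpolated.\<close>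

theorem lerch_phi_strip_bound:
  obtains C where "C > 0"
    "\<And>a \<beta> s. 0 < a \<Longrightarrow> a \<le> 1 \<Longrightarrow> 0 < \<beta> \<Longrightarrow> \<beta> \<le> 1 \<Longrightarrow> -1/2 \<le> Re s \<Longrightarrow> Re s \<le> 3/2 \<Longrightarrow> \<bar>Im s\<bar> \<ge> 1 \<Longrightarrow>
       norm (lerch_phi a \<beta> s - of_real a powr (- s) - Gamma (1 - s) * (up_term a \<beta> s + low_term a \<beta> s)) \<le> C * (2 + \<bar>Im s\<bar>)\<^sup>2"
proof -
  obtain C0 where C0: "C0 > 0"
    "\<And>x t. 1/2 \<le> x \<Longrightarrow> x \<le> 5/2 \<Longrightarrow> norm (Gamma (Complex x t)) \<le> C0 * (2 + \<bar>t\<bar>)\<^sup>2 * exp (- pi / 2 * \<bar>t\<bar>)"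
    using norm_Gamma_upper by blast
  define p where "p j = (real j + 1) powr (- 3/2)" for j
  define S where "S = suminf p"
  have psum: "summable p"
  proof -
    have "summable (\<lambda>j. real (j + 1) powr (- 3/2))"
      by (subst summable_iff_shift) (simp add: summable_real_powr_iff)
    thus ?thesis by (simp add: p_def[abs_def] add_ac)
  qed
  have S: "S \<ge> 0" unfolding S_def by (rule suminf_nonneg[OF psum]) (simp add: p_def)
  \<comment> \<open>Four times the sum of the constants for the two edges; the 4 stems from |s - 4|
    >= (2 + |Im s|) / 2.\<close>
  define B where "B = 4 * ((3 * C0 * S + 1) + (S + 12 * pi))"
  have B: "B > 0"
  proof -
    have "3 * C0 * S \<ge> 0" using C0 S by simp
    hence "3 * C0 * S + 1 > 0" by (rule add_nonneg_pos) simp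
    moreover have "S + 12 * pi > 0" using S by (rule add_nonneg_pos) simp
    ultimately show ?thesis unfolding B_def by (rule mult_pos_pos[OF _ add_pos_pos, rotated]) simp
  qed
  \<comment> \<open>(s - 4)^2 has no zero in the strip and turns quadratic growth on the edges into
    boundedness.\<close>
  have main: "norm (lerch_reg a \<beta> s / (s - 4)\<^sup>2) \<le> B"
    if a: "0 < a" "a \<le> 1" and \<beta>: "0 < \<beta>" "\<beta> \<le> 1" and s: "-1/2 \<le> Re s" "Re s \<le> 3/2" for a \<beta> s
  proof -
    obtain M where M: "\<And>s. -1/2 \<le> Re s \<Longrightarrow> Re s \<le> 3/2 \<Longrightarrow> norm (lerch_reg a \<beta> s) \<le> M * exp ((pi / 2 + 1) * \<bar>Im s\<bar>)"
      using lerch_reg_growth[OF a \<beta>] by blast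
    have n4: "norm (z - 4) \<ge> (2 + \<bar>Im z\<bar>) / 2" "norm (z - 4) \<ge> 1" if "Re z \<le> 3/2" for z
      using abs_Re_le_cmod[of "z - 4"] abs_Im_le_cmod[of "z - 4"] that by auto
    have div: "norm (w / (z - 4)\<^sup>2) \<le> B" if "Re z \<le> 3/2" "norm w \<le> B / 4 * (2 + \<bar>Im z\<bar>)\<^sup>2" for w z
    proof -
      have "((2 + \<bar>Im z\<bar>) / 2)\<^sup>2 \<le> (norm (z - 4))\<^sup>2" using n4(1)[OF that(1)] by (intro power_mono) auto
      hence "B * ((2 + \<bar>Im z\<bar>) / 2)\<^sup>2 \<le> B * (norm (z - 4))\<^sup>2" using B by (intro mult_left_mono) auto
      hence "norm w \<le> B * (norm (z - 4))\<^sup>2" using that(2) by (simp add: power_divide)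
      moreover have "(norm (z - 4))\<^sup>2 > 0" using n4(2)[OF that(1)] by (intro zero_less_power) linarith
      ultimately show ?thesis by (simp add: norm_divide norm_power divide_le_eq)
    qed
    show ?thesis
    proof (rule phragmen_lindelof_strip[where R = "\<lambda>s. lerch_reg a \<beta> s / (s - 4)\<^sup>2" and U = "{s. Re s < 2}" and xl = "-1/2" and xr = "3/2" and K = "pi / 2 + 1" and M = M])
      show "(\<lambda>s. lerch_reg a \<beta> s / (s - 4)\<^sup>2) holomorphic_on {s. Re s < 2}"
        by (intro holomorphic_intros lerch_reg_holomorphic a \<beta>) auto
      show "open {s. Re s < 2}" by (rule open_halfspace_Re_lt)
    next
      fix t :: real
      let ?s = "Complex (-1/2) t"
      have s1: "?s \<noteq> 1" "Re ?s < 0" "Re ?s < 2" by (auto simp: complex_eq_iff)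
      define Z where "Z = up_term a \<beta> ?s + low_term a \<beta> ?s"
      define E where "E = exp (pi / 2 * \<bar>t\<bar>)"
      have eq: "lerch_reg a \<beta> ?s = (?s - 1) * (lerch_phi a \<beta> ?s - Gamma (1 - ?s) * Z) - (?s - 1) * of_real a powr (- ?s)"
        unfolding lerch_reg_eq[OF a \<beta> s1(1)] Gamma_2_minus[OF s1(1,3)] Z_def by algebra
      have 1: "norm ((?s - 1) * (lerch_phi a \<beta> ?s - Gamma (1 - ?s) * Z)) \<le> 3 * C0 * S * (2 + \<bar>t\<bar>)\<^sup>2"
      proof -
        have "norm (lerch_phi a \<beta> ?s - Gamma (1 - ?s) * Z) \<le> 3 * norm (Gamma (1 - ?s)) * E * S"
          using lerch_phi_minus_main_terms[OF a \<beta> s1(2)] unfolding Z_def E_def S_def p_def[abs_def] by simp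
        hence "norm (?s - 1) * norm (lerch_phi a \<beta> ?s - Gamma (1 - ?s) * Z) \<le> norm (?s - 1) * (3 * norm (Gamma (1 - ?s)) * E * S)"
          by (rule mult_left_mono) simp
        also have "\<dots> = 3 * S * (norm (Gamma (2 - ?s)) * E)"
          unfolding Gamma_2_minus[OF s1(1,3)] norm_mult norm_minus_cancel by (simp only: mult_ac)
        also have "\<dots> \<le> 3 * S * (C0 * (2 + \<bar>t\<bar>)\<^sup>2)"
        proof -
          have e: "2 - ?s = Complex (5/2) (- t)" by (simp add: complex_eq_iff)
          have "norm (Gamma (2 - ?s)) \<le> C0 * (2 + \<bar>t\<bar>)\<^sup>2 * exp (- pi / 2 * \<bar>t\<bar>)"
            using C0(2)[of "5/2" "- t"] unfolding e by simp
          hence "norm (Gamma (2 - ?s)) * E \<le> C0 * (2 + \<bar>t\<bar>)\<^sup>2 * exp (- pi / 2 * \<bar>t\<bar>) * E"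
            by (rule mult_right_mono) (simp add: E_def)
          also have "exp (- pi / 2 * \<bar>t\<bar>) * E = 1" by (simp add: E_def flip: exp_add)
          hence "C0 * (2 + \<bar>t\<bar>)\<^sup>2 * exp (- pi / 2 * \<bar>t\<bar>) * E = C0 * (2 + \<bar>t\<bar>)\<^sup>2" by (simp only: mult.assoc mult_1_right)
          finally show ?thesis using S by (intro mult_left_mono) auto
        qed
        finally show ?thesis unfolding norm_mult by (simp only: mult_ac)
      qed
      have 2: "norm ((?s - 1) * of_real a powr (- ?s)) \<le> 1 * (2 + \<bar>t\<bar>)\<^sup>2"
      proof -
        have "norm (of_real a powr (- ?s)) = a powr (1/2)" using a by (subst norm_powr_real_powr) auto
        also have "\<dots> \<le> 1" using a by (intro powr_le1) auto
        finally have n: "norm (of_real a powr (- ?s)) \<le> 1" .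
        have "norm (?s - 1) \<le> 2 + \<bar>t\<bar>" using cmod_le[of "?s - 1"] by simp
        also have "\<dots> \<le> (2 + \<bar>t\<bar>)\<^sup>2" by (rule self_le_power) auto
        finally have "norm (?s - 1) * norm (of_real a powr (- ?s)) \<le> (2 + \<bar>t\<bar>)\<^sup>2 * 1" using n by (intro mult_mono) auto
        thus ?thesis unfolding norm_mult by simp
      qed
      have "norm (lerch_reg a \<beta> ?s) \<le> 3 * C0 * S * (2 + \<bar>t\<bar>)\<^sup>2 + 1 * (2 + \<bar>t\<bar>)\<^sup>2"
        unfolding eq by (rule order_trans[OF norm_triangle_ineq4 add_mono[OF 1 2]])
      also have "\<dots> \<le> B / 4 * (2 + \<bar>Im ?s\<bar>)\<^sup>2"
      proof -
        have "3 * C0 * S + 1 \<le> B / 4" using S pi_gt_zero by (simp add: B_def)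
        from mult_right_mono[OF this, of "(2 + \<bar>t\<bar>)\<^sup>2"] show ?thesis by (simp add: ring_distribs)
      qed
      finally show "norm (lerch_reg a \<beta> ?s / (?s - 4)\<^sup>2) \<le> B" by (intro div) auto
    next
      fix t :: real
      let ?s = "Complex (3/2) t"
      have s1: "?s \<noteq> 1" "Re ?s > 1" by (auto simp: complex_eq_iff)
      define E where "E = exp (pi / 2 * \<bar>t\<bar>)"
      have 1: "norm ((?s - 1) * (lerch_phi a \<beta> ?s - of_real a powr (- ?s))) \<le> S * (2 + \<bar>t\<bar>)\<^sup>2"
      proof -
        have "(\<lambda>n. ee (of_real \<beta>) ^ Suc n * of_real (real (Suc n) + a) powr (- ?s)) sums
             (lerch_phi a \<beta> ?s - ee (of_real \<beta>) ^ 0 * of_real (real 0 + a) powr (- ?s))"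
          using lerch_phi_sums[OF a \<beta> s1(2)] by (subst sums_Suc_iff) simp
        hence sm: "(\<lambda>n. ee (of_real \<beta>) ^ Suc n * of_real (real (Suc n) + a) powr (- ?s)) sums
             (lerch_phi a \<beta> ?s - of_real a powr (- ?s))" by simp
        have "norm (ee (of_real \<beta>) ^ Suc n * of_real (real (Suc n) + a) powr (- ?s)) \<le> p n" for n
        proof -
          have "norm (of_real (real (Suc n) + a) powr (- ?s)) = (real (Suc n) + a) powr (- 3/2)"
            using a by (subst norm_powr_real_powr) auto
          also have "\<dots> \<le> p n" unfolding p_def using a by (intro powr_mono2') auto
          finally show ?thesis by (simp add: norm_mult norm_power)
        qed
        from norm_suminf_le[OF this psum] have n: "norm (lerch_phi a \<beta> ?s - of_real a powr (- ?s)) \<le> S"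
          using sm unfolding S_def by (simp add: sums_iff)
        have "norm (?s - 1) \<le> 2 + \<bar>t\<bar>" using cmod_le[of "?s - 1"] by simp
        also have "\<dots> \<le> (2 + \<bar>t\<bar>)\<^sup>2" by (rule self_le_power) auto
        finally have "norm (?s - 1) * norm (lerch_phi a \<beta> ?s - of_real a powr (- ?s)) \<le> (2 + \<bar>t\<bar>)\<^sup>2 * S" using n by (intro mult_mono) auto
        thus ?thesis unfolding norm_mult by (simp only: mult_ac)
      qed
      have 2: "norm (Gamma (2 - ?s) * (up_term a \<beta> ?s + low_term a \<beta> ?s)) \<le> 12 * pi * (2 + \<bar>t\<bar>)\<^sup>2"
      proof -
        have e: "2 - ?s = Complex (1/2) (- t)" by (simp add: complex_eq_iff)
        have g: "norm (Gamma (2 - ?s)) \<le> 3 * exp (- pi / 2 * \<bar>t\<bar>)"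
          using norm_Gamma_half_bounds(2)[of "- t"] unfolding e by simp
        have z: "norm (up_term a \<beta> ?s + low_term a \<beta> ?s) \<le> 2 * (2 * pi) * E"
          using norm_main_terms_le[OF \<beta>, of ?s a] by (simp add: E_def)
        have "norm (Gamma (2 - ?s)) * norm (up_term a \<beta> ?s + low_term a \<beta> ?s) \<le> (3 * exp (- pi / 2 * \<bar>t\<bar>)) * (2 * (2 * pi) * E)"
          by (rule mult_mono[OF g z]) auto
        also have "\<dots> = 12 * pi * (exp (- pi / 2 * \<bar>t\<bar>) * E)" by simp
        also have "exp (- pi / 2 * \<bar>t\<bar>) * E = 1" by (simp add: E_def flip: exp_add)
        also have "12 * pi * 1 \<le> 12 * pi * (2 + \<bar>t\<bar>)\<^sup>2" by (intro mult_left_mono one_le_power) auto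
        finally show ?thesis unfolding norm_mult .
      qed
      have "norm (lerch_reg a \<beta> ?s) \<le> S * (2 + \<bar>t\<bar>)\<^sup>2 + 12 * pi * (2 + \<bar>t\<bar>)\<^sup>2"
        unfolding lerch_reg_eq[OF a \<beta> s1(1)] by (rule order_trans[OF norm_triangle_ineq add_mono[OF 1 2]])
      also have "\<dots> \<le> B / 4 * (2 + \<bar>Im ?s\<bar>)\<^sup>2"
      proof -
        have "S + 12 * pi \<le> B / 4" using S C0 by (simp add: B_def)
        from mult_right_mono[OF this, of "(2 + \<bar>t\<bar>)\<^sup>2"] show ?thesis by (simp add: ring_distribs)
      qed
      finally show "norm (lerch_reg a \<beta> ?s / (?s - 4)\<^sup>2) \<le> B" by (intro div) auto
    next
      fix z :: complex assume z: "-1/2 \<le> Re z" "Re z \<le> 3/2"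
      have "norm (lerch_reg a \<beta> z / (z - 4)\<^sup>2) = norm (lerch_reg a \<beta> z) / (norm (z - 4))\<^sup>2" by (simp add: norm_divide norm_power)
      also have "\<dots> \<le> norm (lerch_reg a \<beta> z) / 1"
        using n4(2)[OF z(2)] one_le_power[OF n4(2)[OF z(2)], of 2] by (intro divide_left_mono) auto
      also have "\<dots> \<le> M * exp ((pi / 2 + 1) * \<bar>Im z\<bar>)" using M[OF z] by simp
      finally show "norm (lerch_reg a \<beta> z / (z - 4)\<^sup>2) \<le> M * exp ((pi / 2 + 1) * \<bar>Im z\<bar>)" .
    qed (use B s in auto)
  qed
  show ?thesis
  \<comment> \<open>|s - 4| <= 3 (2 + |Im s|) gives the 9, and |Im s| >= 1 allows the factor s - 1
    of \<open>lerch_reg\<close> to be dropped.\<close>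
  proof (rule that[of "9 * B"])
    show "9 * B > 0" using B by simp
    fix a \<beta> :: real and s :: complex assume a: "0 < a" "a \<le> 1" and \<beta>: "0 < \<beta>" "\<beta> \<le> 1" and s: "-1/2 \<le> Re s" "Re s \<le> 3/2" and t: "\<bar>Im s\<bar> \<ge> 1"
    define W where "W = lerch_phi a \<beta> s - of_real a powr (- s) - Gamma (1 - s) * (up_term a \<beta> s + low_term a \<beta> s)"
    have s1: "s \<noteq> 1" "Re s < 2" using s t by auto
    have eq: "lerch_reg a \<beta> s = (s - 1) * W"
      unfolding lerch_reg_eq[OF a \<beta> s1(1)] Gamma_2_minus[OF s1] W_def by algebra
    have n4: "norm (s - 4) > 0" using s abs_Re_le_cmod[of "s - 4"] by auto
    have "norm W \<le> norm (s - 1) * norm W" using abs_Im_le_cmod[of "s - 1"] t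
      by (simp add: mult_le_cancel_right1)
    also have "\<dots> = norm (lerch_reg a \<beta> s)" by (simp add: eq norm_mult)
    also have "\<dots> \<le> B * (norm (s - 4))\<^sup>2"
      using main[OF a \<beta> s] n4 by (simp add: norm_divide norm_power divide_le_eq)
    also have "\<dots> \<le> B * (3 * (2 + \<bar>Im s\<bar>))\<^sup>2"
      using B cmod_le[of "s - 4"] s by (intro mult_left_mono power_mono) auto
    also have "\<dots> = 9 * B * (2 + \<bar>Im s\<bar>)\<^sup>2" unfolding power_mult_distrib by simp
    finally show "norm W \<le> 9 * B * (2 + \<bar>Im s\<bar>)\<^sup>2" .
  qed
qed

text \<open>The bounds for \<Gamma>(2 - s), whose argument has real part in [1/2, 5/2], are divided
  by |s - 1|, which lies between 1 and 2 + |Im s|.\<close>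

lemma norm_Gamma_reflected_bounds:
  obtains c C where "c > 0" "C > 0"
    "\<And>s. -1/2 \<le> Re s \<Longrightarrow> Re s \<le> 3/2 \<Longrightarrow> \<bar>Im s\<bar> \<ge> 1 \<Longrightarrow>
       c / (2 + \<bar>Im s\<bar>) * exp (- pi / 2 * \<bar>Im s\<bar>) \<le> norm (Gamma (1 - s)) \<and>
       norm (Gamma (1 - s)) \<le> C * (2 + \<bar>Im s\<bar>)\<^sup>2 * exp (- pi / 2 * \<bar>Im s\<bar>)"
proof -
  obtain C where C: "C > 0"
    "\<And>x t. 1/2 \<le> x \<Longrightarrow> x \<le> 5/2 \<Longrightarrow> norm (Gamma (Complex x t)) \<le> C * (2 + \<bar>t\<bar>)\<^sup>2 * exp (- pi / 2 * \<bar>t\<bar>)"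
    using norm_Gamma_upper by blast
  obtain G g :: real where G: "G > 0" "g > 0" "\<And>x. 1/2 \<le> x \<Longrightarrow> x \<le> 5/2 \<Longrightarrow> g \<le> Gamma x \<and> Gamma x \<le> G"
    using Gamma_real_bounded by blast
  show ?thesis
  proof (rule that[OF G(2) C(1)])
    fix s :: complex assume s: "-1/2 \<le> Re s" "Re s \<le> 3/2" and t: "\<bar>Im s\<bar> \<ge> 1"
    define e where "e = exp (- pi / 2 * \<bar>Im s\<bar>)"
    have e0: "e > 0" by (simp add: e_def)
    have s1: "s \<noteq> 1" "Re s < 2" using s t by auto
    have eq: "norm (Gamma (2 - s)) = norm (s - 1) * norm (Gamma (1 - s))"
      unfolding Gamma_2_minus[OF s1] norm_mult by (simp only: norm_minus_cancel)
    have e: "2 - s = Complex (2 - Re s) (- Im s)" by (simp add: complex_eq_iff)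
    have lo: "g * e \<le> norm (Gamma (2 - s))"
    proof -
      have "g * e \<le> Gamma (2 - Re s) * e" using G(3)[of "2 - Re s"] s e0 by (intro mult_right_mono) auto
      also have "\<dots> \<le> norm (Gamma (2 - s))"
        using norm_Gamma_lower[of "2 - Re s" "- Im s"] s unfolding e e_def by simp
      finally show ?thesis .
    qed
    have hi: "norm (Gamma (2 - s)) \<le> C * (2 + \<bar>Im s\<bar>)\<^sup>2 * e"
      using C(2)[of "2 - Re s" "- Im s"] s unfolding e e_def by simp
    have n1: "norm (s - 1) \<ge> 1" using abs_Im_le_cmod[of "s - 1"] t by simp
    have n2: "norm (s - 1) \<le> 2 + \<bar>Im s\<bar>" using cmod_le[of "s - 1"] s by simp
    have "g * e \<le> (2 + \<bar>Im s\<bar>) * norm (Gamma (1 - s))"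
      using lo mult_right_mono[OF n2 norm_ge_zero[of "Gamma (1 - s)"]] unfolding eq by linarith
    hence "g / (2 + \<bar>Im s\<bar>) * e \<le> norm (Gamma (1 - s))" by (simp add: field_simps)
    moreover have "norm (Gamma (1 - s)) \<le> norm (s - 1) * norm (Gamma (1 - s))"
      using n1 by (simp add: mult_le_cancel_right1)
    hence "norm (Gamma (1 - s)) \<le> C * (2 + \<bar>Im s\<bar>)\<^sup>2 * e" using hi unfolding eq by linarith
    ultimately show "g / (2 + \<bar>Im s\<bar>) * exp (- pi / 2 * \<bar>Im s\<bar>) \<le> norm (Gamma (1 - s)) \<and>
       norm (Gamma (1 - s)) \<le> C * (2 + \<bar>Im s\<bar>)\<^sup>2 * exp (- pi / 2 * \<bar>Im s\<bar>)"
      unfolding e_def by simp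
  qed
qed

section \<open>Two applications of the maximum principle\<close>

lemma arctan_ge_half:
  fixes y :: real
  assumes "0 \<le> y" "y \<le> 1"
  shows "arctan y \<ge> y / 2"
proof (cases "y = 0")
  case False
  hence "0 < y" using assms by simp
  from MVT2[OF this, of arctan "\<lambda>x. inverse (1 + x\<^sup>2)"] obtain z where
    z: "0 < z" "z < y" "arctan y - arctan 0 = (y - 0) * inverse (1 + z\<^sup>2)"
    by (auto simp: DERIV_arctan)
  have "z\<^sup>2 \<le> 1" using z assms by (intro power_le_one) auto
  moreover have "0 < 1 + z\<^sup>2" by (rule add_pos_nonneg) simp_all
  ultimately have "inverse (1 + z\<^sup>2) \<ge> inverse 2" using le_imp_inverse_le[of "1 + z\<^sup>2" 2] by linarith
  hence "y * inverse 2 \<le> y * inverse (1 + z\<^sup>2)" using assms by (intro mult_left_mono) auto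
  moreover have "arctan y = y * inverse (1 + z\<^sup>2)" using z(3) by simp
  ultimately show ?thesis by simp
qed auto

lemma Im_Ln_times_of_real: "z \<noteq> 0 \<Longrightarrow> r > 0 \<Longrightarrow> Im (Ln (of_real r * z)) = Im (Ln z)"
  by (subst Ln_times_of_real) (auto simp: Ln_of_real)

text \<open>
  The maximum principle on a disc segment whose chord has length about \<open>2 q\<close>. The weight
  \<open>exp (- \<i> \<mu> Ln w)\<close> with \<open>w = (z + \<i> q) / (z - \<i> q)\<close> has modulus \<open>exp (\<mu> \<phi>)\<close>, where \<open>\<phi>\<close> is the angle
  under which the chord is seen from \<open>z\<close>; it is constant on the arc. The factor \<open>z\<^sup>2 + q\<^sup>2\<close>
  has modulus \<open>2 R Re z\<close> on the arc and so absorbs the pole of the bound for \<open>F\<close>.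
\<close>
lemma half_plane_segment_lower_bound:
  fixes F :: "complex \<Rightarrow> complex" and B c0 q x t0 :: real
  assumes q: "0 < q" "q \<le> 1" and x: "x > 1" and B: "B > 0" and c0: "c0 > 0"
    and hol: "F holomorphic_on {s. 1 < Re s \<and> \<bar>Im s - t0\<bar> < 11}"
    and up: "\<And>s. 1 < Re s \<Longrightarrow> \<bar>Im s - t0\<bar> < 11 \<Longrightarrow> norm (F s) \<le> B * (1 + 1 / (Re s - 1))"
    and lo: "\<And>s. 10 \<le> Re s \<Longrightarrow> \<bar>Im s - t0\<bar> < 11 \<Longrightarrow> c0 \<le> norm (F s)"
  shows "\<exists>y. \<bar>y\<bar> \<le> 2 * q \<and> norm (F (Complex x (t0 + y))) \<ge> c0 * exp (- (100 * B / c0 * pi) / q)"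
proof (rule ccontr)
  assume contr: "\<not> ?thesis"
  define lam where "lam = 100 * B / c0"
  have lam: "lam > 0" using B c0 by (simp add: lam_def)
  have small: "norm (F (Complex x (t0 + y))) \<le> c0 * exp (- (lam * pi) / q)" if "\<bar>y\<bar> \<le> 2 * q" for y
  proof -
    have "\<not> (\<bar>y\<bar> \<le> 2 * q \<and> c0 * exp (- (100 * B / c0 * pi) / q) \<le> norm (F (Complex x (t0 + y))))"
      using contr by blast
    thus ?thesis using that unfolding lam_def by linarith
  qed
  \<comment> \<open>The chord lies on Re s = p = x - \<delta>, so its end points, where Ln (w s) is
    singular, stay off the closed region. \<delta> <= x - 1 keeps p >= 1, and \<delta> <= q^2/10
    gives y^2 <= q^2 + 20 \<delta> <= (2q)^2 on the part of the region with Re s = x.\<close>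
  define \<delta> where "\<delta> = min (x - 1) (q\<^sup>2 / 10)"
  have \<delta>: "\<delta> > 0" "\<delta> \<le> x - 1" "\<delta> \<le> q\<^sup>2 / 10"
    using q x unfolding \<delta>_def by (simp_all add: min_def)
  define p where "p = x - \<delta>"
  have p: "p \<ge> 1" "p < x" using \<delta> by (auto simp: p_def)
  define o0 where "o0 = Complex p t0"
  \<comment> \<open>The circle about o0 + 10 passes through the end points of the chord, o0 + \<i> q
    and o0 - \<i> q.\<close>
  define R where "R = sqrt (100 + q\<^sup>2)"
  have q2: "q\<^sup>2 \<le> 1" using q by (intro power_le_one) auto
  have R2: "R\<^sup>2 = 100 + q\<^sup>2" by (simp add: R_def add_nonneg_nonneg)
  have R: "10 < R" "R < 11"
  proof -
    show "10 < R" unfolding R_def using q by (intro real_less_rsqrt) auto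
    show "R < 11" unfolding R_def using q2 by (intro real_less_lsqrt) auto
  qed
  define w where "w s = (s - o0 + \<i> * q) / (s - o0 - \<i> * q)" for s
  \<comment> \<open>On Re s = x the weight is at most exp (\<mu> \<pi>), which cancels the assumed
    smallness of F exactly; on the arc \<mu> \<theta> >= lam/20 = 5 B / c0.\<close>
  define \<mu> where "\<mu> = lam / q"
  have \<mu>: "\<mu> > 0" using lam q by (simp add: \<mu>_def)
  define \<theta> where "\<theta> = Im (Ln (Complex 10 q))"
  define G where "G s = F s * ((s - o0)\<^sup>2 + q\<^sup>2) * exp (- \<i> * \<mu> * Ln (w s))" for s
  define V where "V = {s. p < Re s \<and> \<bar>Im s - t0\<bar> < 11}"
  define S where "S = ball (o0 + 10) R \<inter> {s. x < Re s}"
  have z: "s - o0 = Complex (Re s - p) (Im s - t0)" for s by (simp add: o0_def complex_eq_iff)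
  have weq: "w s = of_real (1 / (norm (s - o0 - \<i> * q))\<^sup>2) *
        Complex ((Re s - p)\<^sup>2 + (Im s - t0)\<^sup>2 - q\<^sup>2) (2 * q * (Re s - p))"
    if "Re s > p" for s
  proof -
    define a where "a = s - o0 - \<i> * q"
    have a0: "a \<noteq> 0" using that by (auto simp: a_def o0_def complex_eq_iff)
    have "w s = (s - o0 + \<i> * q) / a" by (simp add: w_def a_def)
    also have "\<dots> = (s - o0 + \<i> * q) * cnj a / (a * cnj a)" using a0 by simp
    also have "a * cnj a = of_real ((norm a)\<^sup>2)" by (simp only: complex_norm_square)
    also have "(s - o0 + \<i> * q) * cnj a = Complex ((Re s - p)\<^sup>2 + (Im s - t0)\<^sup>2 - q\<^sup>2) (2 * q * (Re s - p))"
      unfolding a_def z by (simp add: complex_eq_iff power2_eq_square algebra_simps)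
    finally show ?thesis by (simp add: a_def)
  qed
  have den: "norm (s - o0 - \<i> * q) > 0" if "Re s > p" for s
    using that by (auto simp: o0_def complex_eq_iff)
  have Lnw: "Im (Ln (w s)) = Im (Ln (Complex ((Re s - p)\<^sup>2 + (Im s - t0)\<^sup>2 - q\<^sup>2) (2 * q * (Re s - p))))" if "Re s > p" for s
  proof -
    have "Complex ((Re s - p)\<^sup>2 + (Im s - t0)\<^sup>2 - q\<^sup>2) (2 * q * (Re s - p)) \<noteq> 0" using that q by (auto simp: complex_eq_iff)
    moreover have "1 / (norm (s - o0 - \<i> * q))\<^sup>2 > 0" using den[OF that] by simp
    ultimately show ?thesis unfolding weq[OF that] by (intro Im_Ln_times_of_real)
  qed
  have wn: "w s \<notin> \<real>\<^sub>\<le>\<^sub>0" if "Re s > p" for s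
  proof -
    have "Im (w s) > 0" unfolding weq[OF that] using that q den[OF that] by simp
    thus ?thesis by (auto simp: complex_nonpos_Reals_iff)
  qed
  have normK: "norm (exp (- \<i> * \<mu> * Ln (w s))) = exp (\<mu> * Im (Ln (w s)))" for s
    by simp
  have Ghol: "G holomorphic_on V"
  proof -
    have "F holomorphic_on V" by (rule holomorphic_on_subset[OF hol]) (use p in \<open>auto simp: V_def\<close>)
    moreover have "w holomorphic_on V" unfolding w_def
      by (intro holomorphic_intros) (auto simp: V_def o0_def complex_eq_iff)
    ultimately show ?thesis unfolding G_def[abs_def]
      by (intro holomorphic_intros) (use wn in \<open>auto simp: V_def\<close>)
  qed
  have closS: "closure S \<subseteq> cball (o0 + 10) R \<inter> {s. x \<le> Re s}"
  proof (rule closure_minimal)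
    show "closed (cball (o0 + 10) R \<inter> {s. x \<le> Re s})"
      by (intro closed_Int closed_cball closed_halfspace_Re_ge)
  qed (auto simp: S_def)
  have SV: "closure S \<subseteq> V"
  proof
    fix s assume "s \<in> closure S"
    hence s: "dist (o0 + 10) s \<le> R" "x \<le> Re s" using closS by auto
    have "\<bar>Im (s - (o0 + 10))\<bar> \<le> norm (s - (o0 + 10))" by (rule abs_Im_le_cmod)
    also have "\<dots> \<le> R" using s by (simp add: dist_norm norm_minus_commute)
    finally show "s \<in> V" using s p R by (simp add: V_def o0_def)
  qed
  have openS: "open S" unfolding S_def by (intro open_Int open_ball open_halfspace_Re_gt)
  define s0 where "s0 = o0 + 10"
  have s0: "s0 \<in> S" "Re s0 = p + 10" "Im s0 = t0"
  proof -
    have "\<delta> < 10" using \<delta>(3) q2 by simp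
    thus "s0 \<in> S" using R by (simp add: S_def s0_def o0_def p_def)
  qed (simp_all add: s0_def o0_def)
  have \<theta>: "\<theta> \<ge> q / 20"
  proof -
    have "\<theta> = arctan (q / 10)" unfolding \<theta>_def by (subst Im_Ln_eq) (auto simp: complex_eq_iff)
    thus ?thesis using arctan_ge_half[of "q / 10"] q by simp
  qed
  define X where "X = exp (\<mu> * \<theta>)"
  have X: "X \<ge> 1 + 5 * B / c0"
  proof -
    have "\<mu> * \<theta> \<ge> \<mu> * (q / 20)" using \<theta> \<mu> by (intro mult_left_mono) auto
    also have "\<mu> * (q / 20) = 5 * B / c0" using q by (simp add: \<mu>_def lam_def)
    finally have "exp (5 * B / c0) \<le> exp (\<mu> * \<theta>)" by simp
    from order_trans[OF exp_ge_add_one_self this] show ?thesis by (simp only: X_def)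
  qed
  \<comment> \<open>6 c0 bounds G on the straight part of the boundary; on the arc 484 = 2 * 11 * 22
    comes from R < 11 and u + 1 <= 22.\<close>
  define M where "M = max (6 * c0) (484 * B * X)"
  have "norm (G s0) \<le> M"
  proof (rule maximum_modulus_frontier[where S = S and f = G])
    show "G holomorphic_on interior S"
      using Ghol SV openS closure_subset by (auto simp: interior_open intro: holomorphic_on_subset)
    show "continuous_on (closure S) G"
      by (rule continuous_on_subset[OF holomorphic_on_imp_continuous_on[OF Ghol] SV])
    show "bounded S" unfolding S_def by (rule bounded_subset[OF bounded_ball]) auto
    fix s assume "s \<in> frontier S"
    hence sc: "s \<in> closure S" "s \<notin> S" using openS by (auto simp: frontier_def interior_open)
    hence s: "dist (o0 + 10) s \<le> R" "x \<le> Re s" using closS by auto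
    have sV: "s \<in> V" using sc SV by auto
    define u y where "u = Re s - p" and "y = Im s - t0"
    have u: "u \<ge> \<delta>" "u > 0" using s \<delta> by (auto simp: u_def p_def)
    have dist2: "(dist (o0 + 10) s)\<^sup>2 = (u - 10)\<^sup>2 + y\<^sup>2"
    proof -
      have "o0 + 10 - s = Complex (10 - u) (- y)" by (simp add: o0_def u_def y_def complex_eq_iff)
      thus ?thesis by (simp add: dist_norm cmod_power2 power2_commute)
    qed
    have zz: "s - o0 = Complex u y" by (simp add: z u_def y_def)
    have nz: "(norm ((s - o0)\<^sup>2 + q\<^sup>2))\<^sup>2 = (u\<^sup>2 + y\<^sup>2 - q\<^sup>2)\<^sup>2 + 4 * q\<^sup>2 * u\<^sup>2"
    proof -
      have "(Complex u y)\<^sup>2 + complex_of_real q ^ 2 = Complex (u\<^sup>2 - y\<^sup>2 + q\<^sup>2) (2 * u * y)"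
        by (simp add: complex_eq_iff power2_eq_square)
      hence "(norm ((s - o0)\<^sup>2 + q\<^sup>2))\<^sup>2 = (u\<^sup>2 - y\<^sup>2 + q\<^sup>2)\<^sup>2 + (2 * u * y)\<^sup>2"
        unfolding zz by (simp only: cmod_power2 complex.sel of_real_power)
      thus ?thesis by algebra
    qed
    have Im\<mu>: "Im (Ln (w s)) \<le> pi" by (rule Im_Ln_le_pi) (use wn[of s] u in \<open>auto simp: u_def\<close>)
    show "norm (G s) \<le> M"
    proof (cases "dist (o0 + 10) s = R")
      case True
      \<comment> \<open>The equation of the circle in the coordinates u, y; the constant angle and
        the modulus of the quadratic factor both follow from it.\<close>
      have e20: "u\<^sup>2 + y\<^sup>2 - q\<^sup>2 = 20 * u"
        using dist2 unfolding True R2 by (simp add: power2_eq_square algebra_simps)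
      have "(norm ((s - o0)\<^sup>2 + q\<^sup>2))\<^sup>2 = (2 * R * u)\<^sup>2"
        unfolding nz e20 power_mult_distrib R2 by (simp add: algebra_simps)
      hence n2: "norm ((s - o0)\<^sup>2 + q\<^sup>2) = 2 * R * u" using R u by (simp add: power2_eq_iff_nonneg)
      have Lw: "Im (Ln (w s)) = \<theta>"
      proof -
        have "Complex (20 * u) (2 * q * u) = of_real (2 * u) * Complex 10 q" by (simp add: complex_eq_iff)
        moreover have "Im (Ln (of_real (2 * u) * Complex 10 q)) = \<theta>"
          unfolding \<theta>_def using u by (intro Im_Ln_times_of_real) (auto simp: complex_eq_iff)
        moreover have "Im (Ln (w s)) = Im (Ln (Complex (20 * u) (2 * q * u)))"
          using Lnw[of s] u e20 unfolding u_def y_def by simp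
        ultimately show ?thesis by simp
      qed
      have uR: "u \<le> 21"
      proof -
        have "(u - 10)\<^sup>2 \<le> (u - 10)\<^sup>2 + y\<^sup>2" by simp
        hence "\<bar>u - 10\<bar>\<^sup>2 \<le> R\<^sup>2" unfolding power2_abs using dist2 unfolding True by (simp only:)
        hence "\<bar>u - 10\<bar> \<le> R" by (rule power2_le_imp_le) (use R in simp)
        thus ?thesis using R by simp
      qed
      have "norm (F s) \<le> B * (1 + 1 / (Re s - 1))" by (rule up) (use sV p in \<open>auto simp: V_def\<close>)
      also have "\<dots> \<le> B * (1 + 1 / u)" using B u p by (intro mult_left_mono add_left_mono divide_left_mono) (auto simp: u_def)
      finally have "norm (F s) * norm ((s - o0)\<^sup>2 + q\<^sup>2) \<le> B * (1 + 1 / u) * (2 * R * u)"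
        unfolding n2 using R u by (intro mult_right_mono) auto
      also have "\<dots> = 2 * B * R * (u + 1)" using u by (simp add: field_simps)
      also have "\<dots> \<le> 2 * B * 11 * 22" using B R uR u by (intro mult_mono) auto
      finally have "norm (F s) * norm ((s - o0)\<^sup>2 + q\<^sup>2) * X \<le> 484 * B * X"
        by (intro mult_right_mono) (auto simp: X_def)
      thus ?thesis unfolding G_def norm_mult normK Lw M_def X_def by (rule max.coboundedI2)
    next
      case False
      hence "Re s = x" using sc s by (auto simp: S_def dist_commute)
      have uy: "u = \<delta>" using \<open>Re s = x\<close> by (simp add: u_def p_def)
      have "(u - 10)\<^sup>2 + y\<^sup>2 \<le> R\<^sup>2" unfolding dist2[symmetric] using s R by (intro power_mono) auto
      hence "y\<^sup>2 \<le> q\<^sup>2 + 20 * \<delta> - \<delta>\<^sup>2" unfolding R2 uy by (simp add: power2_eq_square algebra_simps)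
      also have "\<dots> \<le> (2 * q)\<^sup>2"       proof -
        have "(2 * q)\<^sup>2 = 4 * q\<^sup>2" by (simp add: power_mult_distrib)
        thus ?thesis using \<delta>(3) zero_le_power2[of \<delta>] zero_le_power2[of q] by linarith
      qed
      finally have y2: "y\<^sup>2 \<le> (2 * q)\<^sup>2" .
      hence "\<bar>y\<bar>\<^sup>2 \<le> (2 * q)\<^sup>2" by (simp only: power2_abs)
      hence y: "\<bar>y\<bar> \<le> 2 * q" by (rule power2_le_imp_le) (use q in simp)
      have "s = Complex x (t0 + y)" using \<open>Re s = x\<close> by (simp add: complex_eq_iff y_def)
      hence Fs: "norm (F s) \<le> c0 * exp (- (lam * pi) / q)" using small[OF y] by simp
      have "norm ((s - o0)\<^sup>2 + q\<^sup>2) \<le> (norm (s - o0))\<^sup>2 + q\<^sup>2"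
        by (rule order_trans[OF norm_triangle_ineq]) (simp add: norm_power norm_mult)
      also have "(norm (s - o0))\<^sup>2 = \<delta>\<^sup>2 + y\<^sup>2" unfolding zz by (simp add: cmod_power2 uy)
      also have "\<delta>\<^sup>2 + y\<^sup>2 + q\<^sup>2 \<le> 1 + 4 + 1"
      proof (intro add_mono)
        show "\<delta>\<^sup>2 \<le> 1" using \<delta> q2 by (intro power_le_one) auto
        show "y\<^sup>2 \<le> 4" using y2 q2 by (simp add: power_mult_distrib)
      qed (rule q2)
      finally have n2: "norm ((s - o0)\<^sup>2 + q\<^sup>2) \<le> 6" by simp
      have "\<mu> * Im (Ln (w s)) \<le> lam * pi / q" using mult_left_mono[OF Im\<mu>, of \<mu>] \<mu> by (simp add: \<mu>_def)
      hence nK: "norm (exp (- \<i> * \<mu> * Ln (w s))) \<le> exp (lam * pi / q)" unfolding normK by simp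
      have "norm (G s) \<le> (c0 * exp (- (lam * pi) / q) * 6) * exp (lam * pi / q)"
        unfolding G_def norm_mult using Fs n2 nK c0 by (intro mult_mono) auto
      also have "\<dots> = c0 * 6 * (exp (- (lam * pi) / q) * exp (lam * pi / q))" by (simp only: mult_ac)
      also have "exp (- (lam * pi) / q) * exp (lam * pi / q) = 1" by (simp flip: exp_add)
      finally show ?thesis by (simp add: M_def mult.commute)
    qed
  qed (use s0 in auto)
  moreover have "norm (G s0) \<ge> c0 * 100 * (X * X)"
  proof -
    \<comment> \<open>The centre sees the chord under twice the angle seen from the arc. The weight
      is therefore X^2 at the centre against X on the arc, and c0 X > 5 B makes this
      decisive.\<close>
    have Lw: "Im (Ln (w s0)) = 2 * \<theta>"
    proof -
      have "Im (Ln (w s0)) = Im (Ln (Complex (100 - q\<^sup>2) (20 * q)))"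
        using Lnw[of s0] s0 by simp
      also have "Complex (100 - q\<^sup>2) (20 * q) = Complex 10 q * Complex 10 q"
        by (simp add: complex_eq_iff power2_eq_square)
      also have "Ln (Complex 10 q * Complex 10 q) = Ln (Complex 10 q) + Ln (Complex 10 q)"
      proof (rule Ln_times_simple)
        have "\<bar>Im (Ln (Complex 10 q))\<bar> < pi / 2" by (rule Re_Ln_pos_lt_imp) simp
        thus "- pi < Im (Ln (Complex 10 q)) + Im (Ln (Complex 10 q))"
             "Im (Ln (Complex 10 q)) + Im (Ln (Complex 10 q)) \<le> pi" by linarith+
      qed (auto simp: complex_eq_iff)
      finally show ?thesis by (simp add: \<theta>_def)
    qed
    have "s0 - o0 = of_real 10" by (simp add: s0_def)
    hence "(s0 - o0)\<^sup>2 + q\<^sup>2 = of_real (100 + q\<^sup>2)" by simp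
    hence "norm ((s0 - o0)\<^sup>2 + q\<^sup>2) = 100 + q\<^sup>2" by (simp only: norm_of_real) (simp add: add_nonneg_nonneg)
    hence n: "norm ((s0 - o0)\<^sup>2 + q\<^sup>2) \<ge> 100" by simp
    have Fs: "c0 \<le> norm (F s0)" by (rule lo) (use s0 p in auto)
    have "exp (\<mu> * (2 * \<theta>)) = X * X" by (simp add: X_def flip: exp_add)
    thus ?thesis unfolding G_def norm_mult normK Lw using Fs n c0
      by (intro mult_mono) (auto simp: X_def)
  qed
  ultimately have fin: "c0 * 100 * (X * X) \<le> M" by linarith
  have X1: "X \<ge> 1" "c0 * X \<ge> c0 + 5 * B"
  proof -
    show "X \<ge> 1" using X B c0 by (smt (verit) divide_pos_pos)
    have "c0 * X \<ge> c0 * (1 + 5 * B / c0)" using X c0 by (intro mult_left_mono) auto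
    moreover have "c0 * (1 + 5 * B / c0) = c0 + 5 * B" using c0 by (simp add: distrib_left)
    ultimately show "c0 * X \<ge> c0 + 5 * B" by simp
  qed
  have "6 * c0 < c0 * 100 * (X * X)"
    using X1(1) c0 mult_mono[of 1 X 1 X] by simp
  moreover have "484 * B * X < c0 * 100 * (X * X)"
  proof -
    have "484 * B < 100 * (c0 * X)" using X1(2) B c0 by linarith
    hence "(484 * B) * X < 100 * (c0 * X) * X" using X1(1) by (intro mult_strict_right_mono) auto
    thus ?thesis by (simp add: mult_ac)
  qed
  ultimately show False using fin unfolding M_def le_max_iff_disj by (meson not_le)
qed

section \<open>The two constants theorem on a rectangle\<close>

lemma sinh_le_mult_cosh:
  fixes y :: real
  assumes "0 \<le> y"
  shows "sinh y \<le> y * cosh y"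
proof (cases "y = 0")
  case False
  hence "0 < y" using assms by simp
  have "(sinh has_real_derivative cosh x) (at x)" for x :: real by (auto intro!: derivative_eq_intros)
  from MVT2[OF \<open>0 < y\<close> this] obtain z where
    z: "0 < z" "z < y" "sinh y - sinh 0 = (y - 0) * cosh z" by auto
  have "cosh z \<le> cosh y" using z by (subst cosh_real_nonneg_le_iff) auto
  hence "y * cosh z \<le> y * cosh y" using assms by (intro mult_left_mono) auto
  thus ?thesis using z by simp
qed auto

lemma sinh_ge_self:
  fixes y :: real
  assumes "0 \<le> y"
  shows "y \<le> sinh y"
proof (cases "y = 0")
  case False
  hence "0 < y" using assms by simp
  have "(sinh has_real_derivative cosh x) (at x)" for x :: real by (auto intro!: derivative_eq_intros)
  from MVT2[OF \<open>0 < y\<close> this] obtain z where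
    z: "0 < z" "z < y" "sinh y - sinh 0 = (y - 0) * cosh z" by auto
  have "y * 1 \<le> y * cosh z" using assms cosh_real_ge_1[of z] by (intro mult_left_mono) auto
  thus ?thesis using z by simp
qed auto

lemma Re_sinh_complex: "Re (sinh z) = sinh (Re z) * cos (Im z)"
  by (simp add: sinh_field_def Re_exp field_simps)

lemma Re_cos_complex: "Re (cos z) = cos (Re z) * cosh (Im z)"
  by (simp add: Re_cos cosh_field_def)

text \<open>
  The two weights have different tasks: \<open>exp (- A cos (\<omega> z))\<close> decays doubly exponentially along
  the rectangle and beats the polynomial growth \<open>P T\<^sup>K\<close> on the horizontal sides, while
  \<open>exp (\<nu> sinh (\<pi> (r - z) / (2 d)))\<close> is unimodular on all sides but the left one and larger
  inside, as required by the two constants theorem.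
\<close>
lemma rectangle_left_side_lower_bound:
  fixes F :: "complex \<Rightarrow> complex" and a d T K B P y0 \<sigma> e0 :: real
  assumes a: "0 < a" "a \<le> 2 * d" and T: "T \<ge> 16" and K: "K \<ge> 0" and B: "B \<ge> 1" and P: "P \<ge> 1"
    and \<omega>: "5 * pi / (8 * a) * d \<ge> ln (ln T)" and \<sigma>: "1 - a \<le> \<sigma>" "\<sigma> \<le> 1"
    and hol: "F holomorphic_on U" "open U" "cbox (Complex \<sigma> (y0 - d)) (Complex (1 + a / 15) (y0 + d)) \<subseteq> U"
    and right: "\<And>y. \<bar>y - y0\<bar> \<le> d \<Longrightarrow> norm (F (Complex (1 + a / 15) y)) \<le> B"
    and hor: "\<And>s. \<sigma> \<le> Re s \<Longrightarrow> Re s \<le> 1 + a / 15 \<Longrightarrow> \<bar>Im s - y0\<bar> = d \<Longrightarrow> norm (F s) \<le> P * T powr K"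
    and mid: "norm (F (Complex (1 + a / 30) y0)) \<ge> e0" and e0: "0 < e0" "e0 \<le> 1"
  shows "\<exists>y. \<bar>y - y0\<bar> \<le> d \<and>
           norm (F (Complex \<sigma> y)) \<ge> exp (- (32 * cosh 4) * (4 * K + ln (2 * (P + B) / e0)))"
proof (rule ccontr)
  assume contr: "\<not> ?thesis"
  have d: "d > 0" using a by simp
  define M where "M = exp (- (32 * cosh 4) * (4 * K + ln (2 * (P + B) / e0)))"
  have left: "norm (F (Complex \<sigma> y)) < M" if "\<bar>y - y0\<bar> \<le> d" for y
  proof -
    have "\<not> (\<bar>y - y0\<bar> \<le> d \<and> M \<le> norm (F (Complex \<sigma> y)))" using contr unfolding M_def by blast
    thus ?thesis using that by linarith
  qed
  define r where "r = 1 + a / 15"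
  \<comment> \<open>The midpoint of [1 - a, 1 + a/15]. The half-width of this interval is 8a/15, and
    \<open>om\<close> times it is \<pi>/3, which keeps the cosine at least 1/2.\<close>
  define \<xi> where "\<xi> = 1 - 7 * a / 15"
  define om where "om = 5 * pi / (8 * a)"
  \<comment> \<open>With this \<open>v\<close> the factor cos (v (y - y0)) vanishes on the
    horizontal sides.\<close>
  define v where "v = pi / (2 * d)"
  have om: "om > 0" and v: "v > 0" using a d by (auto simp: om_def v_def)
  \<comment> \<open>The values of sinh at the inner point 1 + a/30 and at the leftmost possible
    abscissa 1 - a. The arguments have ratio 32, and a <= 2 d keeps the larger one below 4; hence
    the factor 32 cosh 4.\<close>
  define v0 v1 where "v0 = sinh (v * (a / 30))" and "v1 = sinh (v * (16 * a / 15))"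
  have va: "v * (16 * a / 15) \<le> 4"
  proof -
    have "v * (16 * a / 15) \<le> v * (16 * (2 * d) / 15)" using v a by (intro mult_left_mono) auto
    also have "\<dots> = 16 * pi / 15" using d by (simp add: v_def)
    also have "\<dots> \<le> 4" using pi_approx by simp
    finally show ?thesis .
  qed
  have v0: "v0 > 0" using v a by (simp add: v0_def)
  have v1: "v1 \<le> (32 * cosh 4) * v0"
  proof -
    have "v1 \<le> (v * (16 * a / 15)) * cosh (v * (16 * a / 15))"
      unfolding v1_def by (rule sinh_le_mult_cosh) (use v a in auto)
    also have "\<dots> \<le> (v * (16 * a / 15)) * cosh 4"
      using va v a by (intro mult_left_mono) (auto simp: cosh_real_nonneg_le_iff)
    also have "\<dots> = (32 * cosh 4) * (v * (a / 30))" by simp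
    also have "\<dots> \<le> (32 * cosh 4) * v0"
      unfolding v0_def using v a by (intro mult_left_mono sinh_ge_self) auto
    finally show ?thesis .
  qed
  \<comment> \<open>On the horizontal sides the cosine is at least 1/2 and cosh at least (ln T)/2,
    so that 4 K yields the factor T^(-K).\<close>
  define A where "A = 4 * K"
  \<comment> \<open>At the inner point the cosine weight may lose exp (-A). Q makes up for this loss
    and lifts e0 to 2 (P + B), twice the bound on the boundary.\<close>
  define Q where "Q = A + ln (2 * (P + B) / e0)"
  have PB: "2 * (P + B) / e0 \<ge> 1" using P B e0 by (simp add: field_simps)
  have Q: "Q \<ge> 0" using K PB by (simp add: Q_def A_def)
  define \<nu> where "\<nu> = Q / v0"
  have \<nu>: "\<nu> \<ge> 0" using Q v0 by (simp add: \<nu>_def)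
  define z where "z s = s - \<i> * of_real y0" for s :: complex
  define k where "k s = of_real \<nu> * sinh (of_real v * (of_real r - z s)) - of_real A * cos (of_real om * (z s - of_real \<xi>))" for s :: complex
  have Rek: "Re (k s) = \<nu> * (sinh (v * (r - Re s)) * cos (v * (Im s - y0))) -
        A * (cos (om * (Re s - \<xi>)) * cosh (om * (Im s - y0)))" for s
    by (simp add: k_def z_def Re_sinh_complex Re_cos_complex)
       (metis cos_minus minus_diff_eq mult_minus_right)
  define G where "G s = F s * exp (k s)" for s
  define S where "S = cbox (Complex \<sigma> (y0 - d)) (Complex r (y0 + d))"
  define s0 where "s0 = Complex (1 + a / 30) y0"
  have nG: "norm (G s) = norm (F s) * exp (Re (k s))" for s by (simp add: G_def norm_mult)
  have SU: "S \<subseteq> U" using hol(3) by (simp add: S_def r_def)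
  have Ghol: "G holomorphic_on U"
    unfolding G_def[abs_def] k_def[abs_def] z_def sinh_field_def by (intro holomorphic_intros hol(1)) auto
  have cosx: "cos (om * (x - \<xi>)) \<ge> 1 / 2" if "\<sigma> \<le> x" "x \<le> r" for x
  proof -
    have "\<bar>x - \<xi>\<bar> \<le> 8 * a / 15" using that \<sigma> a unfolding \<xi>_def r_def by linarith
    hence "om * \<bar>x - \<xi>\<bar> \<le> om * (8 * a / 15)" using om by (intro mult_left_mono) auto
    also have "om * (8 * a / 15) = pi / 3" using a by (simp add: om_def)
    finally have "\<bar>om * (x - \<xi>)\<bar> \<le> pi / 3" using om by (simp add: abs_mult)
    hence "cos \<bar>om * (x - \<xi>)\<bar> \<ge> cos (pi / 3)" using pi_gt_zero by (intro cos_monotone_0_pi_le) auto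
    thus ?thesis by (simp add: cos_60)
  qed
  have cosA: "A * (cos (om * (x - \<xi>)) * cosh y) \<ge> 0" if "\<sigma> \<le> x" "x \<le> r" for x y
    using cosx[OF that] K by (intro mult_nonneg_nonneg) (auto simp: A_def)
  have "norm (G s0) \<le> P + B"
  proof (rule maximum_modulus_frontier[where S = S and f = G])
    show "G holomorphic_on interior S" by (rule holomorphic_on_subset[OF Ghol]) (use SU interior_subset in blast)
    show "continuous_on (closure S) G"
      using holomorphic_on_imp_continuous_on[OF Ghol] SU by (auto simp: S_def intro: continuous_on_subset)
    show "bounded S" by (simp add: S_def)
    show "s0 \<in> S" using \<sigma> a d by (auto simp: S_def s0_def r_def in_cbox_complex_iff)
    fix s assume "s \<in> frontier S"
    hence s: "s \<in> S" "s \<notin> box (Complex \<sigma> (y0 - d)) (Complex r (y0 + d))" by (auto simp: S_def frontier_cbox)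
    hence ss: "\<sigma> \<le> Re s" "Re s \<le> r" "y0 - d \<le> Im s" "Im s \<le> y0 + d" by (auto simp: S_def in_cbox_complex_iff)
    have yy: "\<bar>Im s - y0\<bar> \<le> d" using ss by auto
    consider "\<bar>Im s - y0\<bar> = d" | "Re s = r" "\<bar>Im s - y0\<bar> < d" | "Re s = \<sigma>" "\<bar>Im s - y0\<bar> < d"
      using s ss by (auto simp: in_box_complex_iff) linarith+
    thus "norm (G s) \<le> P + B"
    proof cases
      case 1
      have c0: "cos (v * (Im s - y0)) = 0"
      proof -
        have "v * d = pi / 2" using d by (simp add: v_def)
        moreover have "Im s - y0 = d \<or> Im s - y0 = - d" using 1 by linarith
        ultimately have "v * (Im s - y0) = pi / 2 \<or> v * (Im s - y0) = - (pi / 2)"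
          by (elim disjE) simp_all
        thus ?thesis by (elim disjE) (simp_all only: cos_minus cos_pi_half)
      qed
      have "cosh (om * (Im s - y0)) \<ge> ln T / 2"
      proof -
        have c1: "cosh (om * (Im s - y0)) = cosh (om * d)" using 1 om by (metis abs_mult abs_of_pos cosh_real_abs)
        have "cosh (om * d) \<ge> exp (om * d) / 2" by (simp add: cosh_field_def)
        moreover have "exp (om * d) \<ge> exp (ln (ln T))" using \<omega> by (simp add: om_def)
        moreover have "exp (ln (ln T)) = ln T" using T by simp
        ultimately show ?thesis unfolding c1 by linarith
      qed
      hence "cos (om * (Re s - \<xi>)) * cosh (om * (Im s - y0)) \<ge> 1 / 2 * (ln T / 2)"
        using cosx[OF ss(1,2)] T by (intro mult_mono) auto
      hence "A * (cos (om * (Re s - \<xi>)) * cosh (om * (Im s - y0))) \<ge> A * (1 / 2 * (ln T / 2))"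
        using K by (intro mult_left_mono) (auto simp: A_def)
      hence "Re (k s) \<le> - (K * ln T)" unfolding Rek c0 A_def by simp
      hence e: "exp (Re (k s)) \<le> exp (- (K * ln T))" by simp
      have "norm (G s) \<le> (P * T powr K) * exp (- (K * ln T))"
        unfolding nG using hor[OF ss(1) _ 1] ss e P by (intro mult_mono) (auto simp: r_def)
      also have "\<dots> = P" using T by (simp add: powr_def flip: exp_add)
      finally show ?thesis using B by simp
    next
      case 2
      have "Re (k s) \<le> 0" unfolding Rek using cosA[OF ss(1,2)] 2 by simp
      hence "norm (G s) \<le> norm (F s) * 1" unfolding nG by (intro mult_left_mono) auto
      also have "norm (F s) \<le> B" using right[OF yy] 2 by (metis complex_surj r_def)
      finally show ?thesis using P by simp
    next
      case 3
      have "sinh (v * (r - \<sigma>)) \<le> v1" unfolding v1_def using v \<sigma> by (simp add: r_def)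
      moreover have "0 \<le> sinh (v * (r - \<sigma>))" using v \<sigma> a by (simp add: r_def)
      ultimately have "sinh (v * (r - \<sigma>)) * cos (v * (Im s - y0)) \<le> v1"
        by (smt (verit) cos_le_one mult_left_le)
      hence "\<nu> * (sinh (v * (r - \<sigma>)) * cos (v * (Im s - y0))) \<le> \<nu> * v1" using \<nu> by (intro mult_left_mono)
      also have "\<dots> \<le> \<nu> * ((32 * cosh 4) * v0)" using v1 \<nu> by (intro mult_left_mono)
      also have "\<dots> = (32 * cosh 4) * Q" using v0 by (simp add: \<nu>_def)
      finally have "Re (k s) \<le> (32 * cosh 4) * Q"
        unfolding Rek using cosA[OF ss(1,2), of "om * (Im s - y0)"] 3 by simp
      hence "exp (Re (k s)) \<le> exp ((32 * cosh 4) * Q)" by simp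
      moreover have "norm (F s) \<le> M" using left[OF yy] 3 by (metis complex_surj less_imp_le)
      ultimately have "norm (G s) \<le> M * exp ((32 * cosh 4) * Q)"
        unfolding nG by (intro mult_mono) (auto simp: M_def)
      also have "\<dots> = 1" by (simp add: M_def Q_def A_def flip: exp_add)
      finally show ?thesis using P B by simp
    qed
  qed
  moreover have "norm (G s0) \<ge> 2 * (P + B)"
  proof -
    have "Re (k s0) = \<nu> * v0 - A * cos (om * (1 + a / 30 - \<xi>))"
      unfolding Rek by (simp add: s0_def v0_def r_def)
    moreover have "A * cos (om * (1 + a / 30 - \<xi>)) \<le> A * 1" using K by (intro mult_left_mono) (auto simp: A_def)
    moreover have "\<nu> * v0 = Q" using v0 by (simp add: \<nu>_def)
    ultimately have "Re (k s0) \<ge> ln (2 * (P + B) / e0)" by (simp add: Q_def)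
    hence "exp (Re (k s0)) \<ge> exp (ln (2 * (P + B) / e0))" by simp
    also have "exp (ln (2 * (P + B) / e0)) = 2 * (P + B) / e0" using PB by simp
    finally have "e0 * (2 * (P + B) / e0) \<le> norm (F s0) * exp (Re (k s0))"
      using mid e0 P B by (intro mult_mono) (auto simp: s0_def)
    thus ?thesis unfolding nG using e0 by simp
  qed
  ultimately have "2 * (P + B) \<le> P + B" by (rule order_trans[rotated])
  thus False using P B by simp
qed

section \<open>Vertical averages\<close>

text \<open>Each averaging multiplies the coefficient of \<open>exp (- l s)\<close> by \<open>O(1 / (h l))\<close>; after two of them the
  Dirichlet series of the Lerch zeta-function converges absolutely on the line \<open>Re s = 1\<close>.\<close>
definition vavg :: "real \<Rightarrow> (complex \<Rightarrow> complex) \<Rightarrow> complex \<Rightarrow> complex" where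
  "vavg h g s = integral {0..h} (\<lambda>u. g (s + \<i> * of_real u)) / of_real h"

lemma vavg_holomorphic:
  assumes h: "h > 0" and g: "g holomorphic_on U" "open U" and V: "open V" "convex V"
    and sub: "\<And>s u. s \<in> V \<Longrightarrow> 0 \<le> u \<Longrightarrow> u \<le> h \<Longrightarrow> s + \<i> * of_real u \<in> U"
  shows "vavg h g holomorphic_on V"
proof -
  have cont: "continuous_on U g" "continuous_on U (deriv g)"
    using g by (auto intro!: holomorphic_on_imp_continuous_on holomorphic_deriv)
  have "(\<lambda>s. integral (cbox 0 h) (\<lambda>u. g (s + \<i> * of_real u))) holomorphic_on V"
  proof (rule leibniz_rule_holomorphic[where fx = "\<lambda>s u. deriv g (s + \<i> * of_real u)"])
    fix s and u :: real assume "s \<in> V" "u \<in> cbox 0 h"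
    hence "s + \<i> * of_real u \<in> U" using sub by auto
    hence "(g has_field_derivative deriv g (s + \<i> * of_real u)) (at (s + \<i> * of_real u))"
      using g by (simp add: holomorphic_derivI)
    moreover have "((\<lambda>s. s + \<i> * of_real u) has_field_derivative 1) (at s within V)"
      by (auto intro!: derivative_eq_intros)
    ultimately have "((\<lambda>s. g (s + \<i> * of_real u)) has_field_derivative deriv g (s + \<i> * of_real u) * 1) (at s within V)"
      by (rule DERIV_chain2[where f = g])
    thus "((\<lambda>s. g (s + \<i> * of_real u)) has_field_derivative deriv g (s + \<i> * of_real u)) (at s within V)"
      by simp
  next
    fix s assume "s \<in> V"
    thus "(\<lambda>u. g (s + \<i> * of_real u)) integrable_on cbox 0 h"
      by (intro integrable_continuous continuous_on_compose2[OF cont(1)] continuous_intros) (use sub in auto)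
  next
    show "continuous_on (V \<times> cbox 0 h) (\<lambda>(s, u). deriv g (s + \<i> * of_real u))"
      unfolding case_prod_unfold
      by (intro continuous_on_compose2[OF cont(2)] continuous_intros) (use sub in auto)
  qed fact
  thus ?thesis unfolding vavg_def[abs_def] using h by (auto intro!: holomorphic_intros)
qed

lemma norm_vavg_le:
  assumes h: "h > 0" and cont: "continuous_on {0..h} (\<lambda>u. g (s + \<i> * of_real u))"
    and le: "\<And>u. 0 \<le> u \<Longrightarrow> u \<le> h \<Longrightarrow> norm (g (s + \<i> * of_real u)) \<le> M"
  shows "norm (vavg h g s) \<le> M"
proof -
  have "norm (integral {0..h} (\<lambda>u. g (s + \<i> * of_real u))) \<le> M * (h - 0)"
    by (rule integral_bound) (use h cont le in auto)
  thus ?thesis using h by (simp add: vavg_def norm_divide divide_le_eq)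
qed

lemma vavg_diff_const:
  assumes h: "h > 0" and cont: "continuous_on {0..h} (\<lambda>u. g (s + \<i> * of_real u))"
  shows "vavg h g s - w = vavg h (\<lambda>s. g s - w) s"
proof -
  have "integral {0..h} (\<lambda>u. g (s + \<i> * of_real u) - w) = integral {0..h} (\<lambda>u. g (s + \<i> * of_real u)) - integral {0..h} (\<lambda>u. w)"
    using cont by (intro Henstock_Kurzweil_Integration.integral_diff integrable_continuous_interval) auto
  thus ?thesis using h by (simp add: vavg_def field_simps scaleR_conv_of_real)
qed

text \<open>The passage from a pointwise lower bound for an average to one for the mean value; it
  costs no more than the factor 1/h.\<close>

lemma norm_vavg_le_integral:
  assumes h: "h > 0" and cont: "continuous_on {a..b} (\<lambda>t. g (Complex \<sigma> t))"
    and sub: "a \<le> y" "y + h \<le> b"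
  shows "norm (vavg h g (Complex \<sigma> y)) \<le> integral {a..b} (\<lambda>t. norm (g (Complex \<sigma> t))) / h"
proof -
  have eq: "Complex \<sigma> y + \<i> * of_real u = Complex \<sigma> (y + u)" for u by (simp add: complex_eq_iff)
  have c1: "continuous_on {0..h} (\<lambda>u. g (Complex \<sigma> (y + u)))"
    by (rule continuous_on_compose2[OF cont, of _ "\<lambda>u. y + u"]) (use sub in \<open>auto intro!: continuous_intros\<close>)
  have "norm (integral {0..h} (\<lambda>u. g (Complex \<sigma> (y + u)))) \<le> integral {0..h} (\<lambda>u. norm (g (Complex \<sigma> (y + u))))"
    by (intro integral_norm_bound_integral integrable_continuous_interval c1 continuous_intros) auto
  also have "\<dots> = integral {y..y + h} (\<lambda>t. norm (g (Complex \<sigma> t)))"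
  proof (rule integral_unique)
    have "(\<lambda>t. norm (g (Complex \<sigma> t))) integrable_on {y..y + h}"
      using sub by (intro integrable_continuous_interval continuous_on_norm continuous_on_subset[OF cont]) auto
    hence "((\<lambda>t. norm (g (Complex \<sigma> t))) has_integral integral {y..y + h} (\<lambda>t. norm (g (Complex \<sigma> t)))) {0 + y..h + y}"
      by (simp add: add.commute integrable_integral)
    thus "((\<lambda>u. norm (g (Complex \<sigma> (y + u)))) has_integral integral {y..y + h} (\<lambda>t. norm (g (Complex \<sigma> t)))) {0..h}"
      by (subst (asm) has_integral_shift_Icc_real[symmetric]) (simp add: o_def)
  qed
  also have "\<dots> \<le> integral {a..b} (\<lambda>t. norm (g (Complex \<sigma> t)))"
    by (rule integral_subset_le)
       (use sub h in \<open>auto intro!: integrable_continuous_interval continuous_on_norm continuous_on_subset[OF cont]\<close>)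
  finally show ?thesis unfolding vavg_def eq using h by (simp add: norm_divide divide_right_mono)
qed

lemma summable_over_n_ln_square: "summable (\<lambda>n. 1 / (real (n + 2) * (ln (real (n + 2)))\<^sup>2))"
proof -
  \<comment> \<open>At n = 0 and n = 1 the formula would give 0; the value 4 keeps f decreasing, as
    the condensation test demands.\<close>
  define f where "f n = (if n < 2 then 4 else 1 / (real n * (ln (real n))\<^sup>2))" for n
  have "summable f \<longleftrightarrow> summable (\<lambda>n. 2 ^ n * f (2 ^ n))"
  proof (rule condensation_test)
    fix m :: nat assume m: "0 < m"
    show "f (Suc m) \<le> f m"
    proof (cases "m = 1")
      case True
      have "exp (1 / 2 :: real) \<le> 1 + 1 / 2 + (1 / 2)\<^sup>2" by (rule exp_bound) auto
      hence "exp (1 / 2 :: real) \<le> 2" by (simp add: power_divide)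
      hence "ln (2 :: real) \<ge> 1 / 2" by (subst ln_ge_iff) auto
      hence "(ln (2 :: real))\<^sup>2 \<ge> (1 / 2)\<^sup>2" by (intro power_mono) auto
      hence "1 \<le> 4 * (ln (2 :: real))\<^sup>2" by (simp add: power_divide)
      thus ?thesis using True by (simp add: f_def field_simps)
    next
      case False
      with m have m2: "m \<ge> 2" by simp
      have "real m * (ln (real m))\<^sup>2 \<le> real (Suc m) * (ln (real (Suc m)))\<^sup>2"
        using m2 by (intro mult_mono power_mono) auto
      thus ?thesis using m2 by (simp add: f_def) (intro divide_left_mono mult_pos_pos zero_less_power, auto)
    qed
  qed (auto simp: f_def)
  moreover have "summable (\<lambda>n. 2 ^ n * f (2 ^ n))"
  proof -
    have "summable (\<lambda>n. (1 / (ln 2)\<^sup>2) * (1 / real (n + 1) ^ 2))"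
    proof (intro summable_mult)
      have "summable (\<lambda>n. inverse (real (Suc n) ^ 2))"
        using inverse_power_summable[of 2, where ?'a = real] by (subst summable_Suc_iff) simp
      thus "summable (\<lambda>n. 1 / real (n + 1) ^ 2)" by (simp only: inverse_eq_divide Suc_eq_plus1)
    qed
    hence "summable (\<lambda>n. 2 ^ Suc n * f (2 ^ Suc n))"
    proof (rule summable_comparison_test'[where N = 0])
      fix n :: nat
      have "ln (2 ^ Suc n :: real) = real (n + 1) * ln 2" using ln_realpow[of 2 "Suc n"] by simp
      moreover have "\<not> (2 ^ Suc n < (2 :: nat))" by simp
      ultimately have "2 ^ Suc n * f (2 ^ Suc n) = (1 / (ln 2)\<^sup>2) * (1 / real (n + 1) ^ 2)"
        by (simp add: f_def power_mult_distrib)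
      thus "norm (2 ^ Suc n * f (2 ^ Suc n)) \<le> (1 / (ln 2)\<^sup>2) * (1 / real (n + 1) ^ 2)" by simp
    qed
    thus ?thesis by (subst (asm) summable_Suc_iff)
  qed
  ultimately have "summable f" by simp
  hence "summable (\<lambda>n. f (n + 2))" by (subst summable_iff_shift)
  thus ?thesis by (simp add: f_def)
qed

text \<open>The integral test by telescoping: the mean value theorem bounds each term by a
  difference of consecutive values of y^(1 - x) / (x - 1).\<close>

lemma zeta_tail_bound:
  fixes x :: real
  assumes "x > 1"
  shows "summable (\<lambda>n. (real n + 2) powr (- x))" "(\<Sum>n. (real n + 2) powr (- x)) \<le> 1 / (x - 1)"
proof -
  define T where "T n = (real n + 1) powr (1 - x) / (x - 1)" for n
  have le: "(real n + 2) powr (- x) \<le> T n - T (Suc n)" for n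
  proof -
    have "((\<lambda>y. y powr (1 - x) / (x - 1)) has_real_derivative - (y powr (- x))) (at y)" if "y > 0" for y :: real
    proof -
      have "1 - x - 1 = - x" by simp
      hence "((\<lambda>y. y powr (1 - x)) has_real_derivative (1 - x) * y powr (- x)) (at y)"
        using has_real_derivative_powr[OF that, of "1 - x"] by simp
      from DERIV_cdivide[OF this, of "x - 1"]
      have "((\<lambda>y. y powr (1 - x) / (x - 1)) has_real_derivative (1 - x) * y powr (- x) / (x - 1)) (at y)" .
      moreover have "(1 - x) * y powr (- x) / (x - 1) = - (y powr (- x))"
        using assms by (simp add: divide_eq_eq) (simp add: algebra_simps)
      ultimately show ?thesis by simp
    qed
    from MVT2[of "real n + 1" "real n + 2", OF _ this] obtain z where
      z: "real n + 1 < z" "z < real n + 2" 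
      "(real n + 2) powr (1 - x) / (x - 1) - (real n + 1) powr (1 - x) / (x - 1) = (real n + 2 - (real n + 1)) * - (z powr (- x))"
      by force
    have "(real n + 2) powr (- x) \<le> z powr (- x)" using z assms by (intro powr_mono2') auto
    thus ?thesis using z(3) by (simp add: T_def add_ac)
  qed
  have "filterlim (\<lambda>n. real n + 1) at_top sequentially" by real_asymp
  hence "(\<lambda>n. (real n + 1) powr (1 - x)) \<longlonglongrightarrow> 0" using assms by (intro tendsto_neg_powr) auto
  hence "T \<longlonglongrightarrow> 0 / (x - 1)" unfolding T_def by (intro tendsto_intros) (use assms in auto)
  hence T: "T \<longlonglongrightarrow> 0" by simp
  have s: "(\<lambda>n. T n - T (Suc n)) sums (T 0 - 0)" by (rule telescope_sums'[OF T])
  show sm: "summable (\<lambda>n. (real n + 2) powr (- x))"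
    by (rule summable_comparison_test'[OF sums_summable[OF s], of 0]) (use le in auto)
  have "(\<Sum>n. (real n + 2) powr (- x)) \<le> (\<Sum>n. T n - T (Suc n))"
    by (rule suminf_le[OF le sm sums_summable[OF s]])
  thus "(\<Sum>n. (real n + 2) powr (- x)) \<le> 1 / (x - 1)" using sums_unique[OF s] by (simp add: T_def)
qed

text \<open>Exponentials are eigenfunctions of the averaging, with an eigenvalue that does not
  depend on s; its decay in l comes from evaluating the oscillating integral.\<close>

lemma vavg_exp:
  fixes l h :: real
  assumes "h > 0"
  obtains m where "\<And>s. vavg h (\<lambda>s. exp (- s * of_real l)) s = m * exp (- s * of_real l)"
    "norm m \<le> 1" "l > 0 \<Longrightarrow> norm m \<le> 2 / (h * l)"
proof -
  define m where "m = integral {0..h} (\<lambda>u. exp (- \<i> * of_real u * of_real l)) / of_real h"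
  have eq: "vavg h (\<lambda>s. exp (- s * of_real l)) s = m * exp (- s * of_real l)" for s
  proof -
    have "exp (- (s + \<i> * of_real u) * of_real l) = exp (- s * of_real l) * exp (- \<i> * of_real u * of_real l)" for u
      by (simp add: ring_distribs flip: exp_add)
    hence "vavg h (\<lambda>s. exp (- s * of_real l)) s =
        integral {0..h} (\<lambda>u. exp (- s * of_real l) * exp (- \<i> * of_real u * of_real l)) / of_real h"
      unfolding vavg_def by (simp only:)
    thus ?thesis by (simp add: m_def)
  qed
  have m1: "norm m \<le> 1"
  proof -
    have "norm (integral {0..h} (\<lambda>u. exp (- \<i> * of_real u * of_real l))) \<le> 1 * (h - 0)"
      using assms by (intro integral_bound continuous_intros) auto
    thus ?thesis using assms by (simp add: m_def norm_divide)
  qed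
  have m2: "norm m \<le> 2 / (h * l)" if l0: "l > 0"
  proof -
    let ?A = "\<lambda>u. exp (- \<i> * of_real u * of_real l) / (- \<i> * of_real l)"
    have "((\<lambda>u. exp (- \<i> * of_real u * of_real l)) has_integral ?A h - ?A 0) {0..h}"
    proof (rule fundamental_theorem_of_calculus)
      fix u :: real assume "u \<in> {0..h}"
      have "((\<lambda>z. exp (- \<i> * z * of_real l) / (- \<i> * of_real l)) has_field_derivative exp (- \<i> * of_real u * of_real l)) (at (of_real u))"
        using l0 by (auto intro!: derivative_eq_intros)
      from has_vector_derivative_real_field[OF this] show "(?A has_vector_derivative exp (- \<i> * of_real u * of_real l)) (at u within {0..h})" .
    qed (use assms in auto)
    hence "integral {0..h} (\<lambda>u. exp (- \<i> * of_real u * of_real l)) = ?A h - ?A 0" by (rule integral_unique)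
    also have "norm \<dots> \<le> norm (?A h) + norm (?A 0)" by (rule norm_triangle_ineq4)
    also have "\<dots> = 2 / l" using l0 by (simp add: norm_divide norm_mult)
    finally have "norm (integral {0..h} (\<lambda>u. exp (- \<i> * of_real u * of_real l))) \<le> 2 / l" .
    hence "norm (integral {0..h} (\<lambda>u. exp (- \<i> * of_real u * of_real l))) / h \<le> 2 / l / h"
      using assms by (intro divide_right_mono) auto
    thus ?thesis using assms by (simp add: m_def norm_divide mult.commute)
  qed
  show ?thesis by (rule that[of m]) (use eq m1 m2 in auto)
qed

text \<open>Uniform convergence on the segment permits averaging term by term. The multipliers enter
  as a hypothesis so that the result can be averaged again.\<close>

lemma vavg_dirichlet_series:
  fixes c :: "nat \<Rightarrow> complex" and l :: "nat \<Rightarrow> real"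
  assumes h: "h > 0" and sm: "summable (\<lambda>n. norm (c n) * exp (- Re s * l n))"
    and g: "\<And>z. Re z = Re s \<Longrightarrow> (\<lambda>n. c n * exp (- z * of_real (l n))) sums g z"
    and m: "\<And>n. vavg h (\<lambda>s. exp (- s * of_real (l n))) s = m n * exp (- s * of_real (l n))"
  shows "(\<lambda>n. (c n * m n) * exp (- s * of_real (l n))) sums vavg h g s"
proof -
  let ?f = "\<lambda>n u. c n * exp (- (s + \<i> * of_real u) * of_real (l n))"
  have nf: "norm (?f n u) \<le> norm (c n) * exp (- Re s * l n)" for n u
    by (simp add: norm_mult)
  have "uniform_limit {0..h} (\<lambda>n u. \<Sum>i<n. ?f i u) (\<lambda>u. \<Sum>i. ?f i u) sequentially"
    by (rule Weierstrass_m_test[OF _ sm]) (use nf in auto)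
  then obtain I J where IJ: "\<And>n. ((\<lambda>u. \<Sum>i<n. ?f i u) has_integral I n) {0..h}"
    "((\<lambda>u. \<Sum>i. ?f i u) has_integral J) {0..h}" "I \<longlonglongrightarrow> J"
    by (rule uniform_limit_integral) (auto intro!: continuous_intros)
  have "(\<Sum>i. ?f i u) = g (s + \<i> * of_real u)" for u
    using g[of "s + \<i> * of_real u"] by (simp add: sums_iff)
  hence J: "J / of_real h = vavg h g s" using IJ(2) by (simp add: vavg_def integral_unique)
  have "I n / of_real h = (\<Sum>i<n. (c i * m i) * exp (- s * of_real (l i)))" for n
  proof -
    have int: "(\<lambda>u. exp (- (s + \<i> * of_real u) * of_real (l i))) integrable_on {0..h}" for i
      by (intro integrable_continuous_interval continuous_intros)
    have "I n = integral {0..h} (\<lambda>u. \<Sum>i<n. ?f i u)" using IJ(1)[of n] by (simp add: integral_unique)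
    also have "\<dots> = (\<Sum>i<n. integral {0..h} (?f i))"
      by (rule Henstock_Kurzweil_Integration.integral_sum) (auto intro!: integrable_continuous_interval continuous_intros)
    also have "\<dots> = (\<Sum>i<n. c i * integral {0..h} (\<lambda>u. exp (- (s + \<i> * of_real u) * of_real (l i))))"
      by simp
    finally have "I n / of_real h = (\<Sum>i<n. c i * vavg h (\<lambda>s. exp (- s * of_real (l i))) s)"
      by (simp only: vavg_def sum_divide_distrib times_divide_eq_right)
    thus ?thesis by (simp only: m mult.assoc)
  qed
  hence "(\<lambda>n. \<Sum>i<n. (c i * m i) * exp (- s * of_real (l i))) \<longlonglongrightarrow> J / of_real h"
    using tendsto_divide[OF IJ(3) tendsto_const[of "of_real h"]] h by simp
  thus ?thesis by (simp add: sums_def J)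
qed

section \<open>The half-plane of absolute convergence\<close>

definition nlerch :: "real \<Rightarrow> real \<Rightarrow> complex \<Rightarrow> complex" where
  "nlerch a \<beta> s = of_real a powr s * lerch_phi a \<beta> s"

definition lfreq :: "real \<Rightarrow> nat \<Rightarrow> real" where
  "lfreq a n = ln ((real n + a) / a)"

lemma lfreq_0 [simp]: "a > 0 \<Longrightarrow> lfreq a 0 = 0"
  by (simp add: lfreq_def)

text \<open>a <= 1 gives (n + a)/a >= n + 1. This is the source of uniformity in a: after
  normalisation the series is dominated by that of the Riemann zeta-function.\<close>

lemma lfreq_ge:
  assumes "0 < a" "a \<le> 1"
  shows "lfreq a n \<ge> ln (real n + 1)"
proof -
  have "real n + 1 \<le> (real n + a) / a"
    using assms mult_left_le[of a "real n"] by (simp add: field_simps)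
  thus ?thesis unfolding lfreq_def by (intro ln_mono) auto
qed

lemma nlerch_holomorphic:
  assumes "0 < a" "a \<le> 1" "0 < \<beta>" "\<beta> \<le> 1"
  shows "nlerch a \<beta> holomorphic_on - {1}"
  unfolding nlerch_def[abs_def] using assms
  by (intro holomorphic_intros lerch_phi_holomorphic) auto

lemma nlerch_sums:
  assumes "0 < a" "a \<le> 1" "0 < \<beta>" "\<beta> \<le> 1" "Re s > 1"
  shows "(\<lambda>n. ee (of_real \<beta>) ^ n * exp (- s * of_real (lfreq a n))) sums nlerch a \<beta> s"
proof -
  have "of_real a powr s * (ee (of_real \<beta>) ^ n * of_real (real n + a) powr (- s)) =
        ee (of_real \<beta>) ^ n * exp (- s * of_real (lfreq a n))" for n
  proof -
    have p: "real n + a > 0" using assms by (simp add: add_nonneg_pos)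
    have "of_real a powr s = exp (s * of_real (ln a))"
      using assms(1) by (simp add: powr_def Ln_of_real)
    moreover have "of_real (real n + a) powr (- s) = exp (- s * of_real (ln (real n + a)))"
    proof -
      have "complex_of_real (real n + a) \<noteq> 0" using p by (simp only: of_real_eq_0_iff)
      thus ?thesis using p by (simp only: powr_def Ln_of_real if_False)
    qed
    moreover have "lfreq a n = ln (real n + a) - ln a"
      unfolding lfreq_def using p assms(1) by (simp add: ln_div)
    hence "exp (- s * of_real (lfreq a n)) = exp (s * of_real (ln a)) * exp (- s * of_real (ln (real n + a)))"
      by (simp add: ring_distribs flip: exp_add)
    ultimately show ?thesis by (simp only: mult_ac)
  qed
  thus ?thesis using sums_mult[OF lerch_phi_sums[OF assms], of "of_real a powr s"]
    unfolding nlerch_def by (simp only:)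
qed

lemma exp_lfreq_le:
  assumes "0 < a" "a \<le> 1" "x \<ge> 0"
  shows "exp (- x * lfreq a n) \<le> (real n + 1) powr (- x)"
proof -
  have "x * ln (real n + 1) \<le> x * lfreq a n" using assms lfreq_ge by (intro mult_left_mono) auto
  thus ?thesis by (simp add: powr_def)
qed

lemma dirichlet_minus_one_le:
  fixes m :: "nat \<Rightarrow> complex"
  assumes a: "0 < a" "a \<le> 1" and s: "Re s > 1"
    and m: "\<And>n. norm (m n) \<le> 1" "m 0 = 1"
    and X: "(\<lambda>n. m n * exp (- s * of_real (lfreq a n))) sums X"
  shows "norm (X - 1) \<le> 1 / (Re s - 1)"
proof -
  have "(\<lambda>n. m (Suc n) * exp (- s * of_real (lfreq a (Suc n)))) sums (X - m 0 * exp (- s * of_real (lfreq a 0)))"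
    using X by (subst sums_Suc_iff) simp
  hence sm: "(\<lambda>n. m (Suc n) * exp (- s * of_real (lfreq a (Suc n)))) sums (X - 1)"
    using m a by simp
  have le: "norm (m (Suc n) * exp (- s * of_real (lfreq a (Suc n)))) \<le> (real n + 2) powr (- Re s)" for n
  proof -
    have "norm (exp (- s * of_real (lfreq a (Suc n)))) = exp (- Re s * lfreq a (Suc n))" by simp
    also have "\<dots> \<le> (real (Suc n) + 1) powr (- Re s)" using a s by (intro exp_lfreq_le) auto
    finally have "norm (exp (- s * of_real (lfreq a (Suc n)))) \<le> (real n + 2) powr (- Re s)" by (simp add: add_ac)
    from mult_mono[OF m(1)[of "Suc n"] this] show ?thesis by (simp add: norm_mult)
  qed
  have "norm (X - 1) \<le> (\<Sum>n. (real n + 2) powr (- Re s))"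
    using norm_suminf_le[OF le zeta_tail_bound(1)[OF s]] sm by (simp add: sums_iff)
  also have "\<dots> \<le> 1 / (Re s - 1)" by (rule zeta_tail_bound(2)[OF s])
  finally show ?thesis .
qed

lemma vavg_nlerch_series:
  assumes a: "0 < a" "a \<le> 1" and \<beta>: "0 < \<beta>" "\<beta> \<le> 1" and h: "h > 0"
  obtains m where "\<And>n. norm (m n) \<le> 1" "m 0 = 1"
    "\<And>n. lfreq a n > 0 \<Longrightarrow> norm (m n) \<le> 2 / (h * lfreq a n)"
    "\<And>s. Re s > 1 \<Longrightarrow> (\<lambda>n. (ee (of_real \<beta>) ^ n * m n) * exp (- s * of_real (lfreq a n))) sums vavg h (nlerch a \<beta>) s"
    "\<And>s. Re s > 1 \<Longrightarrow> (\<lambda>n. (ee (of_real \<beta>) ^ n * m n * m n) * exp (- s * of_real (lfreq a n))) sums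
        vavg h (vavg h (nlerch a \<beta>)) s"
proof -
  have "\<exists>m. \<forall>n. (\<forall>s. vavg h (\<lambda>s. exp (- s * of_real (lfreq a n))) s = m n * exp (- s * of_real (lfreq a n))) \<and>
      norm (m n :: complex) \<le> 1 \<and> (lfreq a n > 0 \<longrightarrow> norm (m n) \<le> 2 / (h * lfreq a n))"
    by (rule choice, rule allI, rule vavg_exp[OF h], blast)
  then obtain m where m: "\<And>n s. vavg h (\<lambda>s. exp (- s * of_real (lfreq a n))) s = m n * exp (- s * of_real (lfreq a n))"
     "\<And>n. norm (m n :: complex) \<le> 1" "\<And>n. lfreq a n > 0 \<Longrightarrow> norm (m n) \<le> 2 / (h * lfreq a n)"
    by blast
  have m0: "m 0 = 1" using m(1)[where n = 0 and s = 0] a h by (simp add: vavg_def scaleR_conv_of_real)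
  have sm: "summable (\<lambda>n. norm (d n) * exp (- Re s * lfreq a n))" if "Re s > 1" "\<And>n. norm (d n :: complex) \<le> 1" for d s
  proof (rule summable_comparison_test'[of "\<lambda>n. (real n + 1) powr (- Re s)" 0])
    have "summable (\<lambda>n. (real (n + 1)) powr (- Re s))"
      using that by (subst summable_iff_shift) (simp add: summable_real_powr_iff)
    thus "summable (\<lambda>n. (real n + 1) powr (- Re s))" by (simp add: add_ac)
    show "norm (norm (d n) * exp (- Re s * lfreq a n)) \<le> (real n + 1) powr (- Re s)" for n
      using mult_mono[OF that(2)[of n] exp_lfreq_le[OF a, of "Re s" n]] that(1) by simp
  qed
  have e: "norm (ee (of_real \<beta>) ^ n) = 1" for n by (simp add: norm_power)
  have em: "norm (ee (of_real \<beta>) ^ n * m n) \<le> 1" for n using m(2)[of n] by (simp add: norm_mult e)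
  have 1: "(\<lambda>n. (ee (of_real \<beta>) ^ n * m n) * exp (- s * of_real (lfreq a n))) sums vavg h (nlerch a \<beta>) s" if s: "Re s > 1" for s
    by (rule vavg_dirichlet_series[OF h sm[OF s] nlerch_sums[OF a \<beta>] m(1)]) (use e s in auto)
  have 2: "(\<lambda>n. (ee (of_real \<beta>) ^ n * m n * m n) * exp (- s * of_real (lfreq a n))) sums vavg h (vavg h (nlerch a \<beta>)) s" if s: "Re s > 1" for s
    by (rule vavg_dirichlet_series[OF h sm[OF s em] 1 m(1)]) (use s in auto)
  show ?thesis by (rule that[OF m(2) m0 m(3) 1 2])
qed

text \<open>The first two bounds compare with the tail of the zeta series and blow up at Re s = 1.
  The third does not: two averages multiply the coefficient of index n + 1 by at most (2 / (h ln (n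
  + 2)))^2, and then the exponent 1 suffices for convergence.\<close>

lemma vavg_nlerch_bounds:
  assumes a: "0 < a" "a \<le> 1" and \<beta>: "0 < \<beta>" "\<beta> \<le> 1" and h: "h > 0" and s: "Re s > 1"
  shows "norm (vavg h (nlerch a \<beta>) s - 1) \<le> 1 / (Re s - 1)"
    and "norm (vavg h (vavg h (nlerch a \<beta>)) s - 1) \<le> 1 / (Re s - 1)"
    and "norm (vavg h (vavg h (nlerch a \<beta>)) s - 1) \<le> 4 / h\<^sup>2 * (\<Sum>n. 1 / (real (n + 2) * (ln (real (n + 2)))\<^sup>2))"
proof -
  obtain m where m: "\<And>n. norm (m n) \<le> 1" "m 0 = 1"
    "\<And>n. lfreq a n > 0 \<Longrightarrow> norm (m n) \<le> 2 / (h * lfreq a n)"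
    "\<And>s. Re s > 1 \<Longrightarrow> (\<lambda>n. (ee (of_real \<beta>) ^ n * m n) * exp (- s * of_real (lfreq a n))) sums vavg h (nlerch a \<beta>) s"
    "\<And>s. Re s > 1 \<Longrightarrow> (\<lambda>n. (ee (of_real \<beta>) ^ n * m n * m n) * exp (- s * of_real (lfreq a n))) sums
        vavg h (vavg h (nlerch a \<beta>)) s"
    using vavg_nlerch_series[OF a \<beta> h] by blast
  have e: "norm (ee (of_real \<beta>) ^ n) = 1" for n by (simp add: norm_power)
  have mm: "norm (m n) * norm (m n) \<le> 1" for n using mult_mono[OF m(1)[of n] m(1)[of n]] by simp
  show "norm (vavg h (nlerch a \<beta>) s - 1) \<le> 1 / (Re s - 1)"
    by (rule dirichlet_minus_one_le[OF a s _ _ m(4)[OF s]]) (use m(1,2) e in \<open>auto simp: norm_mult\<close>)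
  show "norm (vavg h (vavg h (nlerch a \<beta>)) s - 1) \<le> 1 / (Re s - 1)"
    by (rule dirichlet_minus_one_le[OF a s _ _ m(5)[OF s]]) (use mm m(2) e in \<open>auto simp: norm_mult mult.assoc\<close>)
  define X where "X = vavg h (vavg h (nlerch a \<beta>)) s"
  define d where "d n = ee (of_real \<beta>) ^ n * m n * m n" for n
  have "(\<lambda>n. d (Suc n) * exp (- s * of_real (lfreq a (Suc n)))) sums (X - d 0 * exp (- s * of_real (lfreq a 0)))"
    using m(5)[OF s] unfolding X_def d_def by (subst sums_Suc_iff) simp
  hence sm: "(\<lambda>n. d (Suc n) * exp (- s * of_real (lfreq a (Suc n)))) sums (X - 1)"
    using m(2) a by (simp add: d_def)
  define p where "p n = 1 / (real (n + 2) * (ln (real (n + 2)))\<^sup>2)" for n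
  have le: "norm (d (Suc n) * exp (- s * of_real (lfreq a (Suc n)))) \<le> 4 / h\<^sup>2 * p n" for n
  proof -
    define L where "L = ln (real (n + 2))"
    have L: "0 < L" "L \<le> lfreq a (Suc n)"
      using lfreq_ge[OF a, of "Suc n"] by (simp_all add: L_def add_ac)
    have "norm (m (Suc n)) \<le> 2 / (h * lfreq a (Suc n))" using L by (intro m(3)) auto
    also have "\<dots> \<le> 2 / (h * L)" using L h by (intro divide_left_mono mult_left_mono mult_pos_pos) auto
    finally have mL: "norm (m (Suc n)) \<le> 2 / (h * L)" .
    have "norm (d (Suc n)) = norm (m (Suc n)) * norm (m (Suc n))" by (simp add: d_def norm_mult e)
    also have "\<dots> \<le> 2 / (h * L) * (2 / (h * L))" using mL L h by (intro mult_mono) auto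
    also have "\<dots> = 4 / h\<^sup>2 / L\<^sup>2" by (simp add: power2_eq_square)
    finally have dn: "norm (d (Suc n)) \<le> 4 / h\<^sup>2 / L\<^sup>2" .
    have "norm (exp (- s * of_real (lfreq a (Suc n)))) = exp (- Re s * lfreq a (Suc n))" by simp
    also have "\<dots> \<le> (real (Suc n) + 1) powr (- Re s)" using a s by (intro exp_lfreq_le) auto
    also have "\<dots> \<le> (real (Suc n) + 1) powr (- 1)" using s by (intro powr_mono) auto
    also have "\<dots> = 1 / real (n + 2)" by (simp add: powr_minus_divide add_ac)
    finally have en: "norm (exp (- s * of_real (lfreq a (Suc n)))) \<le> 1 / real (n + 2)" .
    have "norm (d (Suc n)) * norm (exp (- s * of_real (lfreq a (Suc n)))) \<le> (4 / h\<^sup>2 / L\<^sup>2) * (1 / real (n + 2))"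
      by (rule mult_mono[OF dn en]) auto
    also have "\<dots> = 4 / h\<^sup>2 * p n" by (simp add: p_def L_def mult.commute)
    finally show ?thesis by (simp only: norm_mult)
  qed
  have ps: "summable p" unfolding p_def[abs_def] by (rule summable_over_n_ln_square)
  have "norm (X - 1) \<le> (\<Sum>n. 4 / h\<^sup>2 * p n)"
    using norm_suminf_le[OF le summable_mult[OF ps]] sm by (simp add: sums_iff)
  also have "\<dots> = 4 / h\<^sup>2 * suminf p" by (rule suminf_mult[OF ps])
  finally show "norm (vavg h (vavg h (nlerch a \<beta>)) s - 1) \<le> 4 / h\<^sup>2 * (\<Sum>n. 1 / (real (n + 2) * (ln (real (n + 2)))\<^sup>2))"
    by (simp only: X_def p_def[abs_def])
qed

lemma norm_ge_of_minus_one: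
  fixes X :: complex
  assumes "norm (X - 1) \<le> e"
  shows "norm X \<le> 1 + e" "norm X \<ge> 1 - e"
  using norm_triangle_ineq[of "X - 1" 1] norm_triangle_ineq[of X "1 - X"] assms by (auto simp: norm_minus_commute)

text \<open>Both half-planes avoid the pole s = 1 and are mapped into themselves by upward
  shifts.\<close>

lemma vavg_nlerch_holomorphic:
  assumes a: "0 < a" "a \<le> 1" and \<beta>: "0 < \<beta>" "\<beta> \<le> 1" and h: "h > 0"
    and V: "V = {s. Re s > 1} \<or> V = {s. Im s > 0}"
  shows "vavg h (nlerch a \<beta>) holomorphic_on V" "vavg h (vavg h (nlerch a \<beta>)) holomorphic_on V"
proof -
  have "open V" "convex V"
    using V by (auto intro: open_halfspace_Re_gt open_halfspace_Im_gt convex_halfspace_Re_gt convex_halfspace_Im_gt)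
  moreover have "nlerch a \<beta> holomorphic_on V"
    by (rule holomorphic_on_subset[OF nlerch_holomorphic[OF a \<beta>]]) (use V in auto)
  moreover have "s + \<i> * of_real u \<in> V" if "s \<in> V" "0 \<le> u" "u \<le> h" for s u using V that by auto
  ultimately show 1: "vavg h (nlerch a \<beta>) holomorphic_on V"
    by (intro vavg_holomorphic[OF h, of _ V]) auto
  show "vavg h (vavg h (nlerch a \<beta>)) holomorphic_on V"
    by (rule vavg_holomorphic[OF h 1]) (use \<open>open V\<close> \<open>convex V\<close> \<open>\<And>s u. s \<in> V \<Longrightarrow> 0 \<le> u \<Longrightarrow> u \<le> h \<Longrightarrow> s + \<i> * of_real u \<in> V\<close> in auto)
qed

text \<open>The comparison is reversed for Re s < 0, where a^(Re s) >= 1; there the functional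
  equation is used instead.\<close>

lemma nlerch_le_lerch:
  assumes a: "0 < a" "a \<le> 1" and \<sigma>: "Re s \<ge> 0"
  shows "norm (nlerch a \<beta> s) \<le> norm (lerch_phi a \<beta> s)"
proof -
  have "norm (of_real a powr s) = a powr Re s" using a by (subst norm_powr_real_powr) auto
  also have "\<dots> \<le> 1" using a \<sigma> by (intro powr_le1) auto
  finally show ?thesis unfolding nlerch_def norm_mult by (simp add: mult_left_le_one_le)
qed

lemma continuous_on_vertical:
  assumes "f holomorphic_on U" "\<And>t. t \<in> A \<Longrightarrow> Complex \<sigma> t \<in> U"
  shows "continuous_on A (\<lambda>t. f (Complex \<sigma> t))"
  by (rule continuous_on_compose2[OF holomorphic_on_imp_continuous_on[OF assms(1)]])
     (use assms(2) in \<open>auto intro!: continuous_intros\<close>)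

text \<open>One average is enough here: its distance from 1 is at most 1 / (Re s - 1), and
  \<open>half_plane_segment_lower_bound\<close> tolerates this pole. It is applied with B = 1 and c0
  = 1/2, which gives the exponent 200 \<pi>.\<close>

lemma lerch_mean_value_right:
  assumes a: "0 < a" "a \<le> 1" and \<beta>: "0 < \<beta>" "\<beta> \<le> 1" and H: "H > 0" and T: "T > 0" and \<sigma>: "\<sigma> > 1"
  shows "integral {T..T + H} (\<lambda>t. norm (lerch_phi a \<beta> (Complex \<sigma> t))) \<ge> H / 200 * exp (- (200 * pi) / (min H 1 / 100))"
proof -
  \<comment> \<open>Averages of this length that start within 2 q <= H/50 of the midpoint stay
    inside [T, T + H].\<close>
  define h where "h = H / 100"
  define q where "q = min H 1 / 100"
  have h: "h > 0" and q: "0 < q" "q \<le> 1" "2 * q \<le> H / 50" using H by (auto simp: h_def q_def)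
  define t0 where "t0 = T + H / 2"
  let ?F = "vavg h (nlerch a \<beta>)"
  have "\<exists>y. \<bar>y\<bar> \<le> 2 * q \<and> norm (?F (Complex \<sigma> (t0 + y))) \<ge> 1/2 * exp (- (100 * 1 / (1/2) * pi) / q)"
  proof (rule half_plane_segment_lower_bound[OF q(1,2) \<sigma>])
    show "?F holomorphic_on {s. 1 < Re s \<and> \<bar>Im s - t0\<bar> < 11}"
      by (rule holomorphic_on_subset[OF vavg_nlerch_holomorphic(1)[OF a \<beta> h, of "{s. Re s > 1}"]]) auto
    show "norm (?F s) \<le> 1 * (1 + 1 / (Re s - 1))" if "1 < Re s" for s
      using norm_ge_of_minus_one(1)[OF vavg_nlerch_bounds(1)[OF a \<beta> h that]] by simp
    show "1/2 \<le> norm (?F s)" if "10 \<le> Re s" for s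
    proof -
      have "1 / (Re s - 1) \<le> 1 / 2" using that by (intro divide_left_mono) auto
      moreover have "norm (?F s) \<ge> 1 - 1 / (Re s - 1)"
        by (rule norm_ge_of_minus_one(2)[OF vavg_nlerch_bounds(1)[OF a \<beta> h]]) (use that in auto)
      ultimately show ?thesis by linarith
    qed
  qed auto
  then obtain y where y: "\<bar>y\<bar> \<le> 2 * q" "norm (?F (Complex \<sigma> (t0 + y))) \<ge> 1/2 * exp (- (200 * pi) / q)" by auto
  have cont: "continuous_on {T..T + H} (\<lambda>t. nlerch a \<beta> (Complex \<sigma> t))"
    by (rule continuous_on_vertical[OF nlerch_holomorphic[OF a \<beta>]]) (use T in \<open>auto simp: complex_eq_iff\<close>)
  have contl: "continuous_on {T..T + H} (\<lambda>t. lerch_phi a \<beta> (Complex \<sigma> t))"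
    by (rule continuous_on_vertical[OF lerch_phi_holomorphic[OF a \<beta>]]) (use T in \<open>auto simp: complex_eq_iff\<close>)
  have "norm (?F (Complex \<sigma> (t0 + y))) \<le> integral {T..T + H} (\<lambda>t. norm (nlerch a \<beta> (Complex \<sigma> t))) / h"
    by (rule norm_vavg_le_integral[OF h cont]) (use y q H in \<open>auto simp: t0_def h_def abs_le_iff\<close>)
  also have "\<dots> \<le> integral {T..T + H} (\<lambda>t. norm (lerch_phi a \<beta> (Complex \<sigma> t))) / h"
    using h \<sigma> cont contl
    by (intro divide_right_mono integral_le integrable_continuous_interval continuous_on_norm nlerch_le_lerch[OF a]) auto
  finally have "1/2 * exp (- (200 * pi) / q) \<le> integral {T..T + H} (\<lambda>t. norm (lerch_phi a \<beta> (Complex \<sigma> t))) / h"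
    using y(2) by linarith
  hence "(1/2 * exp (- (200 * pi) / q)) * h \<le> integral {T..T + H} (\<lambda>t. norm (lerch_phi a \<beta> (Complex \<sigma> t)))"
    using h by (simp add: pos_le_divide_eq)
  moreover have "(1/2 * exp (- (200 * pi) / q)) * h = H / 200 * exp (- (200 * pi) / q)" by (simp add: h_def)
  ultimately show ?thesis unfolding q_def by (simp only:)
qed

section \<open>The critical strip\<close>

text \<open>The size of the dual main terms, with \<open>b = \<beta>\<close> or \<open>b = 1 - \<beta>\<close>. The second term is absent for
  \<open>\<beta> = 1\<close>, in accordance with \<open>0 powr x = 0\<close>.\<close>
definition main_size :: "real \<Rightarrow> real \<Rightarrow> real \<Rightarrow> real" where
  "main_size a b x = a powr x * b powr (x - 1)"

lemma main_size_nonneg: "main_size a b x \<ge> 0"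
  by (simp add: main_size_def)

lemma main_size_antimono:
  assumes "0 < a" "a \<le> 1" "0 \<le> b" "b \<le> 1" "x \<le> y"
  shows "main_size a b y \<le> main_size a b x"
proof (cases "b = 0")
  case False
  thus ?thesis unfolding main_size_def using assms by (intro mult_mono powr_mono') auto
qed (simp add: main_size_def)

lemma main_size_le_2:
  assumes "0 < a" "a \<le> 1" "1/2 \<le> b" "b \<le> 1" "0 \<le> x"
  shows "main_size a b x \<le> 2"
proof -
  have "main_size a b x \<le> main_size a b 0" using assms by (intro main_size_antimono) auto
  also have "\<dots> = 1 / b" using assms by (simp add: main_size_def powr_minus_divide)
  also have "\<dots> \<le> 1 / (1/2)" using assms by (intro divide_left_mono) auto
  finally show ?thesis by simp
qed

text \<open>For Im s >= 1 the decay exp (-\<pi> t/2) of the gamma factor cancels the growth of the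
  upper term and doubles the decay of the lower one. Powers of 2 + t remain, and (2 \<pi>)^(Re s -
  1) goes into the constants.\<close>

lemma norm_Gamma_up_low:
  obtains c C where "c > 0" "C \<ge> 1"
    "\<And>a \<beta> s. 0 < \<beta> \<Longrightarrow> 0 \<le> Re s \<Longrightarrow> Re s \<le> 3/2 \<Longrightarrow> Im s \<ge> 1 \<Longrightarrow>
        c / (2 + Im s) * \<beta> powr (Re s - 1) \<le> norm (Gamma (1 - s) * up_term a \<beta> s) \<and>
        norm (Gamma (1 - s) * up_term a \<beta> s) \<le> C * (2 + Im s)\<^sup>2 * \<beta> powr (Re s - 1)"
    "\<And>a \<beta> s. \<beta> \<le> 1 \<Longrightarrow> 0 \<le> Re s \<Longrightarrow> Re s \<le> 3/2 \<Longrightarrow> Im s \<ge> 1 \<Longrightarrow>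
        c / (2 + Im s) * ((1 - \<beta>) powr (Re s - 1) * exp (- pi * Im s)) \<le> norm (Gamma (1 - s) * low_term a \<beta> s) \<and>
        norm (Gamma (1 - s) * low_term a \<beta> s) \<le> C * (2 + Im s)\<^sup>2 * ((1 - \<beta>) powr (Re s - 1) * exp (- pi * Im s))"
proof -
  obtain c C where c: "c > 0" "C > 0" and b: "\<And>s. -1/2 \<le> Re s \<Longrightarrow> Re s \<le> 3/2 \<Longrightarrow> \<bar>Im s\<bar> \<ge> 1 \<Longrightarrow>
       c / (2 + \<bar>Im s\<bar>) * exp (- pi / 2 * \<bar>Im s\<bar>) \<le> norm (Gamma (1 - s)) \<and>
       norm (Gamma (1 - s)) \<le> C * (2 + \<bar>Im s\<bar>)\<^sup>2 * exp (- pi / 2 * \<bar>Im s\<bar>)"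
    using norm_Gamma_reflected_bounds by blast
  define C1 where "C1 = max 1 (C * (2 * pi))"
  have pw: "1 / (2 * pi) \<le> (2 * pi) powr (x - 1)" "(2 * pi) powr (x - 1) \<le> 2 * pi" if "0 \<le> x" "x \<le> 3/2" for x
  proof -
    have "(2 * pi) powr (- 1) \<le> (2 * pi) powr (x - 1)" using that pi_gt3 by (intro powr_mono) auto
    thus "1 / (2 * pi) \<le> (2 * pi) powr (x - 1)" by (simp add: powr_minus_divide)
    have "(2 * pi) powr (x - 1) \<le> (2 * pi) powr 1" using that pi_gt3 by (intro powr_mono) auto
    thus "(2 * pi) powr (x - 1) \<le> 2 * pi" by simp
  qed
  have key: "c / (2 * pi) / (2 + t) * (b powr (x - 1) * E) \<le> G * (e * (2 * pi * b) powr (x - 1))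
      \<and> G * (e * (2 * pi * b) powr (x - 1)) \<le> C1 * (2 + t)\<^sup>2 * (b powr (x - 1) * E)"
    if x: "0 \<le> x" "x \<le> 3/2" and b: "b > 0" and t: "t \<ge> 1" and e: "e > 0" "E = exp (- pi / 2 * t) * e"
      and G: "c / (2 + t) * exp (- pi / 2 * t) \<le> G" "G \<le> C * (2 + t)\<^sup>2 * exp (- pi / 2 * t)"
    for x b t e E G :: real
  proof
    have sp: "(2 * pi * b) powr (x - 1) = (2 * pi) powr (x - 1) * b powr (x - 1)"
      using b by (simp add: powr_mult)
    define z where "z = exp (- pi / 2 * t)"
    have z: "z > 0" by (simp add: z_def)
    have G0: "G \<ge> 0" using G(1) c t z unfolding z_def[symmetric] by (smt (verit) divide_pos_pos mult_pos_pos)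
    have "(c / (2 + t) * z) * ((1 / (2 * pi)) * (e * b powr (x - 1))) \<le> G * ((2 * pi) powr (x - 1) * (e * b powr (x - 1)))"
      using G(1) pw[OF x] e c t z G0 unfolding z_def[symmetric] by (intro mult_mono) auto
    thus "c / (2 * pi) / (2 + t) * (b powr (x - 1) * E) \<le> G * (e * (2 * pi * b) powr (x - 1))"
      unfolding sp e(2) z_def[symmetric] by (simp add: mult_ac)
    have "G * ((2 * pi) powr (x - 1) * (e * b powr (x - 1))) \<le> (C * (2 + t)\<^sup>2 * z) * ((2 * pi) * (e * b powr (x - 1)))"
      using G(2) pw[OF x] e c t z G0 unfolding z_def[symmetric] by (intro mult_mono) auto
    also have "\<dots> = (C * (2 * pi)) * ((2 + t)\<^sup>2 * z * (e * b powr (x - 1)))" by (simp only: mult_ac)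
    also have "\<dots> \<le> C1 * ((2 + t)\<^sup>2 * z * (e * b powr (x - 1)))"
      using z e t by (intro mult_right_mono) (auto simp: C1_def)
    finally show "G * (e * (2 * pi * b) powr (x - 1)) \<le> C1 * (2 + t)\<^sup>2 * (b powr (x - 1) * E)"
      unfolding sp e(2) z_def[symmetric] by (simp only: mult_ac)
  qed
  show ?thesis
  proof (rule that[of "c / (2 * pi)" C1])
    show "c / (2 * pi) > 0" "C1 \<ge> 1" using c by (auto simp: C1_def)
    fix a \<beta> :: real and s :: complex
    assume s: "0 \<le> Re s" "Re s \<le> 3/2" "Im s \<ge> 1"
    have Gb: "c / (2 + Im s) * exp (- pi / 2 * Im s) \<le> norm (Gamma (1 - s))"
       "norm (Gamma (1 - s)) \<le> C * (2 + Im s)\<^sup>2 * exp (- pi / 2 * Im s)"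
      using b[of s] s by auto
    { assume \<beta>: "0 < \<beta>"
      have "1 = exp (- pi / 2 * Im s) * exp (pi / 2 * Im s)" by (simp flip: exp_add)
      from key[OF s(1,2) \<beta> s(3) _ this Gb]
      show "c / (2 * pi) / (2 + Im s) * \<beta> powr (Re s - 1) \<le> norm (Gamma (1 - s) * up_term a \<beta> s) \<and>
        norm (Gamma (1 - s) * up_term a \<beta> s) \<le> C1 * (2 + Im s)\<^sup>2 * \<beta> powr (Re s - 1)"
        unfolding norm_mult norm_up_term[OF \<beta>] by simp }
    { assume \<beta>: "\<beta> \<le> 1"
      show "c / (2 * pi) / (2 + Im s) * ((1 - \<beta>) powr (Re s - 1) * exp (- pi * Im s)) \<le> norm (Gamma (1 - s) * low_term a \<beta> s) \<and>
        norm (Gamma (1 - s) * low_term a \<beta> s) \<le> C1 * (2 + Im s)\<^sup>2 * ((1 - \<beta>) powr (Re s - 1) * exp (- pi * Im s))"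
      proof (cases "\<beta> = 1")
        case True thus ?thesis by (simp add: low_term_def)
      next
        case False
        hence \<beta>': "\<beta> < 1" "1 - \<beta> > 0" using \<beta> by auto
        have "exp (- pi * Im s) = exp (- pi / 2 * Im s) * exp (- (pi / 2 * Im s))" by (simp flip: exp_add)
        from key[OF s(1,2) \<beta>'(2) s(3) _ this Gb]
        show ?thesis unfolding norm_mult norm_low_term[OF \<beta>'(1)] by simp
      qed }
  qed
qed

text \<open>Multiplying \<open>lerch_phi_strip_bound\<close> by a^s gives \<open>nlerch\<close> = 1
  + U + L + O((2 + t)^2), where \<open>main_size\<close> describes U and L up to powers of 2 + t.
  Each of the two lower bounds isolates one of U and L.\<close>

lemma nlerch_main_terms:
  obtains c C where "c > 0" "C \<ge> 1"
    "\<And>a \<beta> s. 0 < a \<Longrightarrow> a \<le> 1 \<Longrightarrow> 0 < \<beta> \<Longrightarrow> \<beta> \<le> 1 \<Longrightarrow> 0 \<le> Re s \<Longrightarrow> Re s \<le> 3/2 \<Longrightarrow> Im s \<ge> 1 \<Longrightarrow>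
       norm (nlerch a \<beta> s) \<le> C * (2 + Im s)\<^sup>2 * (1 + main_size a \<beta> (Re s) + main_size a (1 - \<beta>) (Re s) * exp (- pi * Im s))"
    "\<And>a \<beta> s. 0 < a \<Longrightarrow> a \<le> 1 \<Longrightarrow> 0 < \<beta> \<Longrightarrow> \<beta> \<le> 1 \<Longrightarrow> 0 \<le> Re s \<Longrightarrow> Re s \<le> 3/2 \<Longrightarrow> Im s \<ge> 1 \<Longrightarrow>
       norm (nlerch a \<beta> s) \<ge> c / (2 + Im s) * main_size a \<beta> (Re s)
          - C * (2 + Im s)\<^sup>2 * (1 + main_size a (1 - \<beta>) (Re s) * exp (- pi * Im s))"
    "\<And>a \<beta> s. 0 < a \<Longrightarrow> a \<le> 1 \<Longrightarrow> 0 < \<beta> \<Longrightarrow> \<beta> \<le> 1 \<Longrightarrow> 0 \<le> Re s \<Longrightarrow> Re s \<le> 3/2 \<Longrightarrow> Im s \<ge> 1 \<Longrightarrow>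
       norm (nlerch a \<beta> s) \<ge> c / (2 + Im s) * (main_size a (1 - \<beta>) (Re s) * exp (- pi * Im s))
          - C * (2 + Im s)\<^sup>2 * (1 + main_size a \<beta> (Re s))"
proof -
  obtain c C where c: "c > 0" "C \<ge> 1" and up:
    "\<And>a \<beta> s. 0 < \<beta> \<Longrightarrow> 0 \<le> Re s \<Longrightarrow> Re s \<le> 3/2 \<Longrightarrow> Im s \<ge> 1 \<Longrightarrow>
        c / (2 + Im s) * \<beta> powr (Re s - 1) \<le> norm (Gamma (1 - s) * up_term a \<beta> s) \<and>
        norm (Gamma (1 - s) * up_term a \<beta> s) \<le> C * (2 + Im s)\<^sup>2 * \<beta> powr (Re s - 1)" and low:
    "\<And>a \<beta> s. \<beta> \<le> 1 \<Longrightarrow> 0 \<le> Re s \<Longrightarrow> Re s \<le> 3/2 \<Longrightarrow> Im s \<ge> 1 \<Longrightarrow>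
        c / (2 + Im s) * ((1 - \<beta>) powr (Re s - 1) * exp (- pi * Im s)) \<le> norm (Gamma (1 - s) * low_term a \<beta> s) \<and>
        norm (Gamma (1 - s) * low_term a \<beta> s) \<le> C * (2 + Im s)\<^sup>2 * ((1 - \<beta>) powr (Re s - 1) * exp (- pi * Im s))"
    using norm_Gamma_up_low by blast
  obtain S where S: "S > 0" "\<And>a \<beta> s. 0 < a \<Longrightarrow> a \<le> 1 \<Longrightarrow> 0 < \<beta> \<Longrightarrow> \<beta> \<le> 1 \<Longrightarrow> -1/2 \<le> Re s \<Longrightarrow> Re s \<le> 3/2 \<Longrightarrow> \<bar>Im s\<bar> \<ge> 1 \<Longrightarrow>
       norm (lerch_phi a \<beta> s - of_real a powr (- s) - Gamma (1 - s) * (up_term a \<beta> s + low_term a \<beta> s)) \<le> S * (2 + \<bar>Im s\<bar>)\<^sup>2"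
    using lerch_phi_strip_bound by blast
  define D where "D = C + S + 1"
  have main: "norm (nlerch a \<beta> s) \<le> D * (2 + Im s)\<^sup>2 * (1 + main_size a \<beta> (Re s) + main_size a (1 - \<beta>) (Re s) * exp (- pi * Im s)) \<and>
       c / (2 + Im s) * main_size a \<beta> (Re s) \<le> norm (nlerch a \<beta> s)
          + D * (2 + Im s)\<^sup>2 * (1 + main_size a (1 - \<beta>) (Re s) * exp (- pi * Im s)) \<and>
       c / (2 + Im s) * (main_size a (1 - \<beta>) (Re s) * exp (- pi * Im s)) \<le> norm (nlerch a \<beta> s)
          + D * (2 + Im s)\<^sup>2 * (1 + main_size a \<beta> (Re s))"
    if a: "0 < a" "a \<le> 1" and \<beta>: "0 < \<beta>" "\<beta> \<le> 1" and s: "0 \<le> Re s" "Re s \<le> 3/2" "Im s \<ge> 1" for a \<beta> s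
  proof -
    define Y where "Y = (2 + Im s)\<^sup>2"
    define V where "V = main_size a \<beta> (Re s)"
    define W where "W = main_size a (1 - \<beta>) (Re s) * exp (- pi * Im s)"
    define U where "U = of_real a powr s * (Gamma (1 - s) * up_term a \<beta> s)"
    define L where "L = of_real a powr s * (Gamma (1 - s) * low_term a \<beta> s)"
    have VW: "V \<ge> 0" "W \<ge> 0" by (simp_all add: V_def W_def main_size_nonneg)
    have Y: "Y \<ge> 1" unfolding Y_def using s by (intro one_le_power) auto
    have na: "norm (of_real a powr s) = a powr Re s" using a by (subst norm_powr_real_powr) auto
    have "a powr Re s \<le> 1" using a s by (intro powr_le1) auto
    hence "norm (of_real a powr s * (lerch_phi a \<beta> s - of_real a powr (- s) - Gamma (1 - s) * (up_term a \<beta> s + low_term a \<beta> s))) \<le> 1 * (S * Y)"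
      unfolding norm_mult na Y_def using S(1) S(2)[OF a \<beta>, of s] s by (intro mult_mono) auto
    moreover have "of_real a powr s * of_real a powr (- s) = (1::complex)" using a by (simp add: powr_minus)
    hence "of_real a powr s * (lerch_phi a \<beta> s - of_real a powr (- s) - Gamma (1 - s) * (up_term a \<beta> s + low_term a \<beta> s)) =
        nlerch a \<beta> s - 1 - U - L"
      by (simp add: nlerch_def U_def L_def ring_distribs)
    ultimately have err: "norm (nlerch a \<beta> s - 1 - U - L) \<le> S * Y" by simp
    have Ub: "c / (2 + Im s) * V \<le> norm U" "norm U \<le> C * Y * V"
      unfolding U_def norm_mult[of "of_real a powr s"] na V_def main_size_def Y_def
      using mult_left_mono[OF conjunct1[OF up[OF \<beta>(1) s, of a]], of "a powr Re s"]
        mult_left_mono[OF conjunct2[OF up[OF \<beta>(1) s, of a]], of "a powr Re s"] by (simp_all add: mult_ac)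
    have Lb: "c / (2 + Im s) * W \<le> norm L" "norm L \<le> C * Y * W"
      unfolding L_def norm_mult[of "of_real a powr s"] na W_def main_size_def Y_def
      using mult_left_mono[OF conjunct1[OF low[OF \<beta>(2) s, of a]], of "a powr Re s"]
        mult_left_mono[OF conjunct2[OF low[OF \<beta>(2) s, of a]], of "a powr Re s"] by (simp_all add: mult_ac)
    define n where "n = norm (nlerch a \<beta> s)"
    have t: "n \<le> 1 + norm U + norm L + S * Y" "norm U \<le> n + 1 + norm L + S * Y" "norm L \<le> n + 1 + norm U + S * Y"
      using err norm_triangle_ineq[of "nlerch a \<beta> s - 1 - U - L" "1 + U + L"] norm_triangle_ineq[of 1 "U + L"] norm_triangle_ineq[of U L]
        norm_triangle_ineq4[of "nlerch a \<beta> s - 1 - L" "nlerch a \<beta> s - 1 - U - L"] norm_triangle_ineq4[of "nlerch a \<beta> s - 1" L]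
        norm_triangle_ineq4[of "nlerch a \<beta> s" 1]
        norm_triangle_ineq4[of "nlerch a \<beta> s - 1 - U" "nlerch a \<beta> s - 1 - U - L"] norm_triangle_ineq4[of "nlerch a \<beta> s - 1" U]
      unfolding n_def by (simp_all add: algebra_simps)
    have D: "D * Y * (1 + v) \<ge> 1 + S * Y + C * Y * v" if "v \<ge> 0" for v
    proof -
      have "D * Y * (1 + v) = (1 * Y + S * Y + C * Y * v) + (C * Y + (S + 1) * Y * v)"
        by (simp add: D_def algebra_simps)
      moreover have "C * Y + (S + 1) * Y * v \<ge> 0" using Y c S(1) that by simp
      ultimately show ?thesis using Y by linarith
    qed
    have "n \<le> D * Y * (1 + (V + W))" using t(1) Ub(2) Lb(2) D[of "V + W"] VW by (simp add: distrib_left)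
    moreover have "c / (2 + Im s) * V \<le> n + D * Y * (1 + W)" using t(2) Ub(1) Lb(2) D[OF VW(2)] by linarith
    moreover have "c / (2 + Im s) * W \<le> n + D * Y * (1 + V)" using t(3) Ub(2) Lb(1) D[OF VW(1)] by linarith
    ultimately show ?thesis unfolding n_def V_def W_def Y_def by (simp add: add.assoc)
  qed
  have "D \<ge> 1" using c S by (simp add: D_def)
  show ?thesis
    by (rule that[OF c(1) \<open>D \<ge> 1\<close>]; drule (6) main; linarith)
qed

text \<open>log log 16 is 1.019...; the value 95/100 is enough for 3.15 <= 2 (42/100) 4 (95/100), by
  which the rectangle is not too wide for its height.\<close>

lemma ln_ln_ge:
  assumes "T \<ge> (16::real)"
  shows "ln (ln T) \<ge> 95/100" "ln T \<ge> 8/3"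
proof -
  have "ln (16::real) = ln (2 ^ 4)" by simp
  hence "ln (16::real) \<ge> 8/3" using ln2_ge_two_thirds by (simp only: ln_realpow)
  moreover have "ln 16 \<le> ln T" using assms by (intro ln_mono) auto
  ultimately show 1: "ln T \<ge> 8/3" by linarith
  have "exp (95/100 :: real) * exp (5/100) = exp 1" by (simp flip: exp_add)
  moreover have "exp (5/100 :: real) \<ge> 1 + 5/100" by (rule exp_ge_add_one_self)
  hence "exp (95/100 :: real) * (1 + 5/100) \<le> exp (95/100) * exp (5/100)" by (intro mult_left_mono) auto
  ultimately have "exp (95/100 :: real) \<le> 8/3" using e_less_272 by simp
  hence "exp (95/100) \<le> ln T" using 1 by linarith
  hence "ln (exp (95/100)) \<le> ln (ln T)" by (intro ln_mono) auto
  thus "ln (ln T) \<ge> 95/100" by simp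
qed

text \<open>That is, \<pi> H / (4 log log T) >= 1 for H = T, so that the condition on \<sigma> holds
  throughout the critical strip. This serves the intervals longer than T.\<close>

lemma ln_ln_le:
  assumes "T \<ge> (16::real)"
  shows "4 * ln (ln T) \<le> pi * T"
proof -
  have L: "ln T > 0" using ln_ln_ge(2)[OF assms] by linarith
  have "ln (ln T) \<le> ln T" using ln_le_minus_one[OF L] by linarith
  also have "ln T = ln (T / 2) + ln 2" using assms by (simp add: ln_div)
  also have "\<dots> \<le> T / 2" using ln_le_minus_one[of "T/2"] ln_le_minus_one[of "2::real"] assms by simp
  finally have "4 * ln (ln T) \<le> 2 * T" by simp
  also have "\<dots> \<le> pi * T" using assms pi_gt3 by (intro mult_right_mono) auto
  finally show ?thesis .
qed

text \<open>The threshold for the dual terms is K T^4. A term above it contributes at least a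
  multiple of T^3, more than the error of order T^2. The lower term decreases with t: if it is large
  at T + H/20, it is large before; if it is small there, it stays small above. This is why the two
  alternatives concern ordinates on different sides of T + H/20. Smallness also persists to the
  right, since \<open>main_size\<close> decreases in the exponent, and gives T^4 T^2 = T^6.\<close>

lemma nlerch_large_or_polynomially_bounded:
  obtains P :: real where "P \<ge> 1"
    "\<And>a \<beta> T H \<sigma>. 0 < a \<Longrightarrow> a \<le> 1 \<Longrightarrow> 0 < \<beta> \<Longrightarrow> \<beta> \<le> 1 \<Longrightarrow> T \<ge> 16 \<Longrightarrow> 0 < H \<Longrightarrow> H \<le> T \<Longrightarrow> 0 \<le> \<sigma> \<Longrightarrow> \<sigma> \<le> 1 \<Longrightarrow>
       (\<forall>t. T \<le> t \<and> t \<le> T + H / 20 \<longrightarrow> norm (nlerch a \<beta> (Complex \<sigma> t)) \<ge> 1) \<or>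
       (\<forall>s. \<sigma> \<le> Re s \<and> Re s \<le> 16/15 \<and> T + H / 20 \<le> Im s \<and> Im s \<le> 2 * T \<longrightarrow> norm (nlerch a \<beta> s) \<le> P * T ^ 6)"
proof -
  obtain c C where c: "c > 0" "C \<ge> 1" and up:
    "\<And>a \<beta> s. 0 < a \<Longrightarrow> a \<le> 1 \<Longrightarrow> 0 < \<beta> \<Longrightarrow> \<beta> \<le> 1 \<Longrightarrow> 0 \<le> Re s \<Longrightarrow> Re s \<le> 3/2 \<Longrightarrow> Im s \<ge> 1 \<Longrightarrow>
       norm (nlerch a \<beta> s) \<le> C * (2 + Im s)\<^sup>2 * (1 + main_size a \<beta> (Re s) + main_size a (1 - \<beta>) (Re s) * exp (- pi * Im s))"
    and lo1: "\<And>a \<beta> s. 0 < a \<Longrightarrow> a \<le> 1 \<Longrightarrow> 0 < \<beta> \<Longrightarrow> \<beta> \<le> 1 \<Longrightarrow> 0 \<le> Re s \<Longrightarrow> Re s \<le> 3/2 \<Longrightarrow> Im s \<ge> 1 \<Longrightarrow>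
       norm (nlerch a \<beta> s) \<ge> c / (2 + Im s) * main_size a \<beta> (Re s)
          - C * (2 + Im s)\<^sup>2 * (1 + main_size a (1 - \<beta>) (Re s) * exp (- pi * Im s))"
    and lo2: "\<And>a \<beta> s. 0 < a \<Longrightarrow> a \<le> 1 \<Longrightarrow> 0 < \<beta> \<Longrightarrow> \<beta> \<le> 1 \<Longrightarrow> 0 \<le> Re s \<Longrightarrow> Re s \<le> 3/2 \<Longrightarrow> Im s \<ge> 1 \<Longrightarrow>
       norm (nlerch a \<beta> s) \<ge> c / (2 + Im s) * (main_size a (1 - \<beta>) (Re s) * exp (- pi * Im s))
          - C * (2 + Im s)\<^sup>2 * (1 + main_size a \<beta> (Re s))"
    using nlerch_main_terms by blast
  \<comment> \<open>Chosen so that c / (3T) times K T^4 is at least (27 C + 1) T^3, which exceeds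
    the error 27 C T^2 by at least 1.\<close>
  define K where "K = max 3 (3 * (27 * C + 1) / c)"
  have K: "K \<ge> 3" "c / 3 * K \<ge> 27 * C + 1"
  proof -
    show "K \<ge> 3" by (simp add: K_def)
    have "c / 3 * (3 * (27 * C + 1) / c) \<le> c / 3 * K" using c by (intro mult_left_mono) (auto simp: K_def)
    thus "c / 3 * K \<ge> 27 * C + 1" using c by simp
  qed
  define P where "P = 9 * C * (1 + 2 * K)"
  show ?thesis
  proof (rule that[of P])
    have "1 * 1 \<le> 9 * C * (1 + 2 * K)" using c K by (intro mult_mono) auto
    thus "P \<ge> 1" by (simp add: P_def)
    fix a \<beta> T H \<sigma> :: real
    assume a: "0 < a" "a \<le> 1" and \<beta>: "0 < \<beta>" "\<beta> \<le> 1" and T: "T \<ge> 16" and H: "0 < H" "H \<le> T" and \<sigma>: "0 \<le> \<sigma>" "\<sigma> \<le> 1"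
    have KT: "K * T ^ 4 \<ge> 3"
      using mult_mono[of 3 K 1 "T^4"] K T one_le_power[of T 4] by simp
    have large: "c / (2 + t) * X - C * (2 + t)\<^sup>2 * (1 + Y) \<ge> 1"
      if t: "T \<le> t" "t \<le> 2 * T" and X: "X \<ge> K * T ^ 4" and Y: "0 \<le> Y" "Y \<le> 2" for t X Y
    proof -
      have "c / (3 * T) * (K * T ^ 4) \<le> c / (2 + t) * X"
        using t X c T KT by (intro mult_mono divide_left_mono) auto
      moreover have "c / (3 * T) * (K * T ^ 4) = (c / 3 * K) * T ^ 3"
        using T by (simp add: power_numeral_reduce)
      moreover have "(27 * C + 1) * T ^ 3 \<le> (c / 3 * K) * T ^ 3" using K T by (intro mult_right_mono) auto
      moreover have "C * (2 + t)\<^sup>2 * (1 + Y) \<le> C * (3 * T)\<^sup>2 * 3"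
        using t c T Y by (intro mult_mono power_mono) auto
      moreover have "C * (3 * T)\<^sup>2 * 3 = 27 * C * T ^ 2" by (simp add: power2_eq_square)
      moreover have "27 * C * T ^ 2 \<le> 27 * C * T ^ 3" using c T by (intro mult_left_mono power_increasing) auto
      moreover have "T ^ 3 \<ge> 1" using T by (intro one_le_power) auto
      moreover have "(27 * C + 1) * T ^ 3 = 27 * C * T ^ 3 + T ^ 3" by (simp add: distrib_right)
      ultimately show ?thesis by linarith
    qed
    \<comment> \<open>For \<beta> <= 1/2 the lower term is at most 2, and for \<beta> >= 1/2 the
      upper one; a large term never meets a large competitor.\<close>
    have W2: "main_size a (1 - \<beta>) \<sigma> * exp (- pi * t) \<le> 2" if "\<beta> \<le> 1/2" "t \<ge> 0" for t
    proof -
      have "main_size a (1 - \<beta>) \<sigma> * exp (- pi * t) \<le> 2 * 1"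
        using that a \<beta> \<sigma> by (intro mult_mono main_size_le_2) auto
      thus ?thesis by simp
    qed
    consider "main_size a \<beta> \<sigma> > K * T ^ 4" | "main_size a (1 - \<beta>) \<sigma> * exp (- pi * (T + H / 20)) > K * T ^ 4"
      | "main_size a \<beta> \<sigma> \<le> K * T ^ 4" "main_size a (1 - \<beta>) \<sigma> * exp (- pi * (T + H / 20)) \<le> K * T ^ 4" by linarith
    thus "(\<forall>t. T \<le> t \<and> t \<le> T + H / 20 \<longrightarrow> norm (nlerch a \<beta> (Complex \<sigma> t)) \<ge> 1) \<or>
       (\<forall>s. \<sigma> \<le> Re s \<and> Re s \<le> 16/15 \<and> T + H / 20 \<le> Im s \<and> Im s \<le> 2 * T \<longrightarrow> norm (nlerch a \<beta> s) \<le> P * T ^ 6)"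
    proof cases
      case 1
      have b2: "\<beta> \<le> 1/2" using main_size_le_2[OF a _ \<beta>(2) \<sigma>(1)] 1 KT by force
      have "norm (nlerch a \<beta> (Complex \<sigma> t)) \<ge> 1" if t: "T \<le> t" "t \<le> T + H / 20" for t
      proof -
        have "1 \<le> c / (2 + t) * main_size a \<beta> \<sigma> - C * (2 + t)\<^sup>2 * (1 + main_size a (1 - \<beta>) \<sigma> * exp (- pi * t))"
          using t H T 1 W2[OF b2] by (intro large) (auto simp: main_size_nonneg)
        also have "\<dots> \<le> norm (nlerch a \<beta> (Complex \<sigma> t))"
          using lo1[OF a \<beta>, of "Complex \<sigma> t"] \<sigma> t T by simp
        finally show ?thesis .
      qed
      thus ?thesis by blast
    next
      case 2
      have b2: "\<not> \<beta> \<le> 1/2" using W2[of "T + H / 20"] 2 KT H T by linarith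
      have "norm (nlerch a \<beta> (Complex \<sigma> t)) \<ge> 1" if t: "T \<le> t" "t \<le> T + H / 20" for t
      proof -
        have "main_size a (1 - \<beta>) \<sigma> * exp (- pi * (T + H / 20)) \<le> main_size a (1 - \<beta>) \<sigma> * exp (- pi * t)"
          using t by (intro mult_left_mono main_size_nonneg) auto
        hence "1 \<le> c / (2 + t) * (main_size a (1 - \<beta>) \<sigma> * exp (- pi * t)) - C * (2 + t)\<^sup>2 * (1 + main_size a \<beta> \<sigma>)"
          using t H T 2 b2 a \<beta> \<sigma> by (intro large main_size_le_2) (auto simp: main_size_nonneg)
        also have "\<dots> \<le> norm (nlerch a \<beta> (Complex \<sigma> t))"
          using lo2[OF a \<beta>, of "Complex \<sigma> t"] \<sigma> t T by simp
        finally show ?thesis .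
      qed
      thus ?thesis by blast
    next
      case 3
      have "norm (nlerch a \<beta> s) \<le> P * T ^ 6" if s: "\<sigma> \<le> Re s" "Re s \<le> 16/15" "T + H / 20 \<le> Im s" "Im s \<le> 2 * T" for s
      proof -
        have V: "main_size a \<beta> (Re s) \<le> K * T ^ 4"
          using main_size_antimono[OF a, of \<beta> \<sigma> "Re s"] \<beta> s 3(1) by auto
        have "main_size a (1 - \<beta>) (Re s) * exp (- pi * Im s) \<le> main_size a (1 - \<beta>) \<sigma> * exp (- pi * (T + H / 20))"
          using a \<beta> s by (intro mult_mono main_size_antimono) (auto simp: main_size_nonneg)
        hence W: "main_size a (1 - \<beta>) (Re s) * exp (- pi * Im s) \<le> K * T ^ 4" using 3(2) by linarith
        have "T ^ 4 \<ge> 1" using T by (intro one_le_power) auto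
        hence VW: "1 + main_size a \<beta> (Re s) + main_size a (1 - \<beta>) (Re s) * exp (- pi * Im s) \<le> (1 + 2 * K) * T ^ 4"
          using V W by (simp add: distrib_right)
        have "norm (nlerch a \<beta> s) \<le> C * (2 + Im s)\<^sup>2 * (1 + main_size a \<beta> (Re s) + main_size a (1 - \<beta>) (Re s) * exp (- pi * Im s))"
          using a \<beta> s \<sigma> T H by (intro up) auto
        also have "\<dots> \<le> C * (3 * T)\<^sup>2 * ((1 + 2 * K) * T ^ 4)"
          using s c T H VW by (intro mult_mono power_mono) (auto simp: main_size_nonneg)
        also have "\<dots> = P * T ^ 6" by (simp add: P_def power_numeral_reduce)
        finally show ?thesis .
      qed
      thus ?thesis by blast
    qed
  qed
qed

text \<open>If \<open>nlerch\<close> is at least 1 on the first twentieth of the interval, that part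
  alone suffices. Otherwise the growth above it is polynomial, and the rectangle is placed there,
  with its left side on Re s = \<sigma>.\<close>

lemma lerch_mean_value_strip_short:
  obtains D where "D > 0"
    "\<And>a \<beta> T H \<sigma>. 0 < a \<Longrightarrow> a \<le> 1 \<Longrightarrow> 0 < \<beta> \<Longrightarrow> \<beta> \<le> 1 \<Longrightarrow> T \<ge> 16 \<Longrightarrow> 0 < H \<Longrightarrow> H \<le> T \<Longrightarrow> 0 \<le> \<sigma> \<Longrightarrow> \<sigma> \<le> 1 \<Longrightarrow>
       \<sigma> \<ge> 1 - pi * H / (4 * ln (ln T)) \<Longrightarrow>
       integral {T..T + H} (\<lambda>t. norm (lerch_phi a \<beta> (Complex \<sigma> t))) \<ge> H / 100 * exp (- D / (min H 1 / 100))"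
proof -
  obtain P :: real where P: "P \<ge> 1" and tri:
    "\<And>a \<beta> T H \<sigma>. 0 < a \<Longrightarrow> a \<le> 1 \<Longrightarrow> 0 < \<beta> \<Longrightarrow> \<beta> \<le> 1 \<Longrightarrow> T \<ge> 16 \<Longrightarrow> 0 < H \<Longrightarrow> H \<le> T \<Longrightarrow> 0 \<le> \<sigma> \<Longrightarrow> \<sigma> \<le> 1 \<Longrightarrow>
       (\<forall>t. T \<le> t \<and> t \<le> T + H / 20 \<longrightarrow> norm (nlerch a \<beta> (Complex \<sigma> t)) \<ge> 1) \<or>
       (\<forall>s. \<sigma> \<le> Re s \<and> Re s \<le> 16/15 \<and> T + H / 20 \<le> Im s \<and> Im s \<le> 2 * T \<longrightarrow> norm (nlerch a \<beta> s) \<le> P * T ^ 6)"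
    using nlerch_large_or_polynomially_bounded by blast
  define S where "S = (\<Sum>n. 1 / (real (n + 2) * (ln (real (n + 2)))\<^sup>2))"
  have S: "S \<ge> 0" unfolding S_def by (rule suminf_nonneg[OF summable_over_n_ln_square]) auto
  define E where "E = 32 * cosh (4::real)"
  have E: "E > 0" by (simp add: E_def)
  define N where "N = 4 * (P + 1 + 4 * S)"
  have N: "N \<ge> 1" using P S by (simp add: N_def)
  \<comment> \<open>24 = 4 * 6 stems from the growth exponent 6, the 2 from ln (1/q^2), and 200
    \<pi> from the starting value e0; N collects the constants in P + B.\<close>
  define D where "D = E * (24 + ln N + 2 + 200 * pi)"
  have lnN: "ln N \<ge> 0" using N by simp
  have D: "D > 0" using E lnN pi_gt3 by (simp add: D_def add_nonneg_pos)
  show ?thesis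
  proof (rule that[OF D])
    fix a \<beta> T H \<sigma> :: real
    assume a: "0 < a" "a \<le> 1" and \<beta>: "0 < \<beta>" "\<beta> \<le> 1" and T: "T \<ge> 16" and H: "0 < H" "H \<le> T" and \<sigma>: "0 \<le> \<sigma>" "\<sigma> \<le> 1"
      and \<sigma>T: "\<sigma> \<ge> 1 - pi * H / (4 * ln (ln T))"
    define h where "h = H / 100"
    define q where "q = min H 1 / 100"
    have h: "h > 0" and q: "0 < q" "q \<le> 1" "q \<le> h" using H by (auto simp: h_def q_def)
    define I where "I = integral {T..T + H} (\<lambda>t. norm (lerch_phi a \<beta> (Complex \<sigma> t)))"
    define J where "J = integral {T..T + H} (\<lambda>t. norm (nlerch a \<beta> (Complex \<sigma> t)))"
    have cont: "continuous_on X (\<lambda>t. nlerch a \<beta> (Complex \<sigma> t))" if "X \<subseteq> {T..}" for X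
      by (rule continuous_on_vertical[OF nlerch_holomorphic[OF a \<beta>]]) (use T that in \<open>auto simp: complex_eq_iff\<close>)
    have contl: "continuous_on {T..T + H} (\<lambda>t. lerch_phi a \<beta> (Complex \<sigma> t))"
      by (rule continuous_on_vertical[OF lerch_phi_holomorphic[OF a \<beta>]]) (use T in \<open>auto simp: complex_eq_iff\<close>)
    have nint: "(\<lambda>t. norm (nlerch a \<beta> (Complex \<sigma> t))) integrable_on {u..v}" if "T \<le> u" for u v
      using that by (intro integrable_continuous_interval continuous_on_norm cont) auto
    have JI: "J \<le> I" unfolding I_def J_def using \<sigma> contl
      by (intro integral_le integrable_continuous_interval continuous_on_norm nlerch_le_lerch[OF a] cont) auto
    have "h * exp (- D / q) \<le> J"
    proof (cases "\<forall>t. T \<le> t \<and> t \<le> T + H / 20 \<longrightarrow> norm (nlerch a \<beta> (Complex \<sigma> t)) \<ge> 1")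
      case True
      have "h * exp (- D / q) \<le> h * 1" using h D q by (intro mult_left_mono) auto
      also have "\<dots> \<le> H / 20" using H by (simp add: h_def)
      also have "\<dots> = integral {T..T + H / 20} (\<lambda>t. 1)" using H by simp
      also have "\<dots> \<le> integral {T..T + H / 20} (\<lambda>t. norm (nlerch a \<beta> (Complex \<sigma> t)))"
        using True by (intro integral_le nint) auto
      also have "\<dots> \<le> J" unfolding J_def
        using H by (intro integral_subset_le nint) auto
      finally show ?thesis .
    next
      case False
      hence bd: "norm (nlerch a \<beta> s) \<le> P * T ^ 6"
        if "\<sigma> \<le> Re s" "Re s \<le> 16/15" "T + H / 20 \<le> Im s" "Im s \<le> 2 * T" for s
        using tri[OF a \<beta> T H \<sigma>] that by blast
      let ?G = "vavg h (nlerch a \<beta>)" and ?F = "vavg h (vavg h (nlerch a \<beta>))"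
      define l where "l = ln (ln T)"
      have l: "l \<ge> 95/100" unfolding l_def by (rule ln_ln_ge(1)[OF T])
      \<comment> \<open>Because of \<sigma> >= 0 the minimum with 1 still gives 1 - x <= \<sigma>.
        It keeps the right side 1 + x/15 inside the range Re s <= 16/15 of the growth bound.\<close>
      define x where "x = min (pi * H / (4 * l)) 1"
      have x: "0 < x" "x \<le> 1" "x \<le> pi * H / (4 * l)" using l H by (auto simp: x_def)
      \<comment> \<open>Since x <= \<pi> H / (4 l), the requirement 5 \<pi> d / (8 x) >= l follows
        from d >= 2H/5. The value 42/100 leaves room around a centre between T + H/2 and T +
        54H/100: the horizontal sides stay above T + H/20, and both averages end before T +
        H.\<close>
      define d where "d = 42/100 * H"
      define t0 where "t0 = T + 52/100 * H"
      have \<sigma>x: "1 - x \<le> \<sigma>" using \<sigma> \<sigma>T by (auto simp: x_def l_def min_def)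
      have xd: "x \<le> 2 * d"
      proof -
        have "pi \<le> 63/20" using pi_less_4 pi_approx by simp
        hence "pi * H \<le> (2 * (42/100) * (4 * l)) * H" using l H by (intro mult_right_mono) auto
        hence "pi * H / (4 * l) \<le> 2 * d" using l by (simp add: d_def divide_le_eq mult_ac)
        thus ?thesis using x by linarith
      qed
      have wd: "5 * pi / (8 * x) * d \<ge> l"
      proof -
        have "x * (4 * l) \<le> pi * H" using x(3) l by (simp add: le_divide_eq)
        moreover have "pi * H > 0" using H by simp
        moreover have "5 * pi * d = 21/10 * (pi * H)" by (simp add: d_def)
        ultimately have "8 * x * l \<le> 5 * pi * d" by linarith
        thus ?thesis using x by (simp add: le_divide_eq mult_ac)
      qed
      have holF: "?F holomorphic_on {s. Im s > 0}"
        by (rule vavg_nlerch_holomorphic(2)[OF a \<beta> h]) simp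
      have contv: "continuous_on {0..h} (\<lambda>u. g (s + \<i> * of_real u))" if "g holomorphic_on {s. Im s > 0}" "Im s > 0" for g s
        by (rule continuous_on_compose2[OF holomorphic_on_imp_continuous_on[OF that(1)]])
           (use that(2) in \<open>auto intro!: continuous_intros\<close>)
      have holn: "nlerch a \<beta> holomorphic_on {s. Im s > 0}"
        by (rule holomorphic_on_subset[OF nlerch_holomorphic[OF a \<beta>]]) auto
      have holG: "?G holomorphic_on {s. Im s > 0}"
        by (rule vavg_nlerch_holomorphic(1)[OF a \<beta> h]) simp
      have "\<exists>y. \<bar>y\<bar> \<le> 2 * q \<and> norm (?F (Complex (1 + x / 30) (t0 + y))) \<ge> 1/2 * exp (- (100 * 1 / (1/2) * pi) / q)"
      proof (rule half_plane_segment_lower_bound[OF q(1,2)])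
        show "?F holomorphic_on {s. 1 < Re s \<and> \<bar>Im s - t0\<bar> < 11}"
          by (rule holomorphic_on_subset[OF vavg_nlerch_holomorphic(2)[OF a \<beta> h, of "{s. Re s > 1}"]]) auto
        show "norm (?F s) \<le> 1 * (1 + 1 / (Re s - 1))" if "1 < Re s" for s
          using norm_ge_of_minus_one(1)[OF vavg_nlerch_bounds(2)[OF a \<beta> h that]] by simp
        show "1/2 \<le> norm (?F s)" if "10 \<le> Re s" for s
        proof -
          have "1 / (Re s - 1) \<le> 1 / 2" using that by (intro divide_left_mono) auto
          moreover have "norm (?F s) \<ge> 1 - 1 / (Re s - 1)"
            by (rule norm_ge_of_minus_one(2)[OF vavg_nlerch_bounds(2)[OF a \<beta> h]]) (use that in auto)
          ultimately show ?thesis by linarith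
        qed
      qed (use x in auto)
      then obtain y where y: "\<bar>y\<bar> \<le> 2 * q" "norm (?F (Complex (1 + x / 30) (t0 + y))) \<ge> 1/2 * exp (- (200 * pi) / q)" by auto
      define y0 where "y0 = t0 + y"
      have y0: "T + 50/100 * H \<le> y0" "y0 \<le> T + 54/100 * H"
        using y(1) q(3) H by (auto simp: y0_def t0_def h_def abs_le_iff)
      define e0 where "e0 = 1/2 * exp (- (200 * pi) / q)"
      have e0: "0 < e0" "e0 \<le> 1" using q by (auto simp: e0_def divide_le_0_iff intro: order_trans[of _ 1])
      \<comment> \<open>In contrast to 1 + 1 / (Re s - 1), this bound does not see how close the
        right side is to Re s = 1.\<close>
      define B where "B = 1 + 4 / h\<^sup>2 * S"
      have B: "B \<ge> 1" using S by (simp add: B_def)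
      have "\<exists>y. \<bar>y - y0\<bar> \<le> d \<and> norm (?F (Complex \<sigma> y)) \<ge> exp (- (32 * cosh 4) * (4 * 6 + ln (2 * (P + B) / e0)))"
      proof (rule rectangle_left_side_lower_bound[OF x(1) xd T _ B P _ \<sigma>x \<sigma>(2) holF])
        show "open {s. 0 < Im s}" by (rule open_halfspace_Im_gt)
        show "cbox (Complex \<sigma> (y0 - d)) (Complex (1 + x / 15) (y0 + d)) \<subseteq> {s. 0 < Im s}"
          using y0 T H by (auto simp: in_cbox_complex_iff d_def)
        show "norm (?F (Complex (1 + x / 15) y)) \<le> B" for y
          using norm_ge_of_minus_one(1)[OF vavg_nlerch_bounds(3)[OF a \<beta> h, of "Complex (1 + x / 15) y"]] x
          by (simp add: B_def S_def)
        show "norm (?F s) \<le> P * T powr 6" if s: "\<sigma> \<le> Re s" "Re s \<le> 1 + x / 15" "\<bar>Im s - y0\<bar> = d" for s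
        proof -
          have im: "T + 5/100 * H \<le> Im s" "Im s \<le> T + 96/100 * H"
            using s(3) y0 H unfolding d_def by linarith+
          have "norm (?F s) \<le> P * T ^ 6"
          proof (rule norm_vavg_le[OF h contv[OF holG]])
            fix u assume u: "0 \<le> u" "u \<le> h"
            show "norm (?G (s + \<i> * of_real u)) \<le> P * T ^ 6"
            proof (rule norm_vavg_le[OF h contv[OF holn]])
              fix v assume v: "0 \<le> v" "v \<le> h"
              show "norm (nlerch a \<beta> (s + \<i> * of_real u + \<i> * of_real v)) \<le> P * T ^ 6"
                using s x u v im H by (intro bd) (auto simp: h_def)
            qed (use im T H u in auto)
          qed (use im T H in auto)
          thus ?thesis using T by (simp add: powr_realpow)
        qed
        show "norm (?F (Complex (1 + x / 30) y0)) \<ge> e0" using y(2) by (simp add: y0_def e0_def)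
      qed (use wd e0 in \<open>simp_all add: l_def\<close>)
      then obtain w where w: "\<bar>w - y0\<bar> \<le> d" "norm (?F (Complex \<sigma> w)) \<ge> exp (- E * (24 + ln (2 * (P + B) / e0)))"
        by (auto simp: E_def)
      have wT: "T \<le> w" "w + 2 * h \<le> T + H" using w(1) y0 H unfolding d_def h_def by linarith+
      have "norm (?F (Complex \<sigma> w)) \<le> J / h"
      proof (rule norm_vavg_le[OF h contv[OF holG]])
        fix u assume u: "0 \<le> u" "u \<le> h"
        have eq: "Complex \<sigma> w + \<i> * of_real u = Complex \<sigma> (w + u)" by (simp add: complex_eq_iff)
        show "norm (?G (Complex \<sigma> w + \<i> * of_real u)) \<le> J / h" unfolding J_def eq
          by (rule norm_vavg_le_integral[OF h cont]) (use wT u in auto)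
      qed (use wT T in auto)
      hence Jw: "exp (- E * (24 + ln (2 * (P + B) / e0))) \<le> J / h" using w(2) by linarith
      \<comment> \<open>1/h^2 and 1/e0 enter through a logarithm only, so the loss is O(1/q), of the
        same order as in the half-plane of convergence.\<close>
      have "ln (2 * (P + B) / e0) \<le> ln N + 2 / q + 200 * pi / q"
      proof -
        have hq: "4 / h\<^sup>2 * S \<le> 4 / q\<^sup>2 * S"
          using q h S by (intro mult_right_mono divide_left_mono power_mono) auto
        have q2: "q\<^sup>2 \<le> 1" using q by (simp add: power_le_one)
        have "P + 1 \<le> (P + 1) / q\<^sup>2" using q q2 P by (simp add: le_divide_eq mult_left_le)
        hence "P + B \<le> (P + 1 + 4 * S) / q\<^sup>2" using hq by (simp add: B_def add_divide_distrib)
        hence "2 * (P + B) / e0 \<le> 2 * ((P + 1 + 4 * S) / q\<^sup>2) / e0" using e0 by (intro divide_right_mono mult_left_mono) auto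
        also have "\<dots> = N * exp (200 * pi / q) / q\<^sup>2" by (simp add: N_def e0_def exp_minus field_simps)
        finally have "ln (2 * (P + B) / e0) \<le> ln (N * exp (200 * pi / q) / q\<^sup>2)"
          using P B e0 by (intro ln_mono) auto
        also have "\<dots> = ln N + 200 * pi / q + 2 * ln (1 / q)" using N q by (simp add: ln_div ln_mult ln_realpow)
        also have "ln (1 / q) \<le> 1 / q" using q ln_le_minus_one[of "1 / q"] by simp
        finally show ?thesis by simp
      qed
      moreover have "24 + ln N + 2 / q + 200 * pi / q \<le> (24 + ln N + 2 + 200 * pi) / q"
      proof -
        have "24 + ln N \<le> (24 + ln N) / q" using q lnN by (simp add: le_divide_eq mult_left_le)
        thus ?thesis by (simp add: add_divide_distrib)
      qed
      ultimately have "24 + ln (2 * (P + B) / e0) \<le> (24 + ln N + 2 + 200 * pi) / q" by linarith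
      hence "E * (24 + ln (2 * (P + B) / e0)) \<le> E * ((24 + ln N + 2 + 200 * pi) / q)"
        using E by (intro mult_left_mono) auto
      hence "- D / q \<le> - E * (24 + ln (2 * (P + B) / e0))" by (simp add: D_def)
      hence "exp (- D / q) \<le> J / h" using Jw order_trans exp_le_cancel_iff by blast
      thus ?thesis using h by (simp add: le_divide_eq mult.commute)
    qed
    thus "I \<ge> H / 100 * exp (- D / (min H 1 / 100))" using JI unfolding h_def q_def by linarith
  qed
qed

text \<open>For H > T the ordinates leave the range Im s <= 2 T of the growth bound. Then the upper
  half [R, 2R] of the interval, R = (T + H)/2, is used with R in the place of both T and H;
  \<open>ln_ln_le\<close> supplies the condition on \<sigma>.\<close>

lemma lerch_mean_value_strip:
  obtains D where "D > 0"
    "\<And>a \<beta> T H \<sigma>. 0 < a \<Longrightarrow> a \<le> 1 \<Longrightarrow> 0 < \<beta> \<Longrightarrow> \<beta> \<le> 1 \<Longrightarrow> T \<ge> 16 \<Longrightarrow> 0 < H \<Longrightarrow> 0 \<le> \<sigma> \<Longrightarrow> \<sigma> \<le> 1 \<Longrightarrow>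
       \<sigma> \<ge> 1 - pi * H / (4 * ln (ln T)) \<Longrightarrow>
       integral {T..T + H} (\<lambda>t. norm (lerch_phi a \<beta> (Complex \<sigma> t))) \<ge> H / 200 * exp (- D / (min H 1 / 100))"
proof -
  obtain D where D: "D > 0" and short:
    "\<And>a \<beta> T H \<sigma>. 0 < a \<Longrightarrow> a \<le> 1 \<Longrightarrow> 0 < \<beta> \<Longrightarrow> \<beta> \<le> 1 \<Longrightarrow> T \<ge> 16 \<Longrightarrow> 0 < H \<Longrightarrow> H \<le> T \<Longrightarrow> 0 \<le> \<sigma> \<Longrightarrow> \<sigma> \<le> 1 \<Longrightarrow>
       \<sigma> \<ge> 1 - pi * H / (4 * ln (ln T)) \<Longrightarrow>
       integral {T..T + H} (\<lambda>t. norm (lerch_phi a \<beta> (Complex \<sigma> t))) \<ge> H / 100 * exp (- D / (min H 1 / 100))"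
    using lerch_mean_value_strip_short by blast
  show ?thesis
  proof (rule that[OF D])
    fix a \<beta> T H \<sigma> :: real
    assume a: "0 < a" "a \<le> 1" and \<beta>: "0 < \<beta>" "\<beta> \<le> 1" and T: "T \<ge> 16" and H: "0 < H" and \<sigma>: "0 \<le> \<sigma>" "\<sigma> \<le> 1"
      and \<sigma>T: "\<sigma> \<ge> 1 - pi * H / (4 * ln (ln T))"
    define I where "I = integral {T..T + H} (\<lambda>t. norm (lerch_phi a \<beta> (Complex \<sigma> t)))"
    show "I \<ge> H / 200 * exp (- D / (min H 1 / 100))"
    proof (cases "H \<le> T")
      case True
      have "H / 200 * exp (- D / (min H 1 / 100)) \<le> H / 100 * exp (- D / (min H 1 / 100))"
        using H by (intro mult_right_mono) auto
      thus ?thesis using short[OF a \<beta> T H True \<sigma> \<sigma>T] unfolding I_def by linarith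
    next
      case False
      define R where "R = (T + H) / 2"
      have R: "R \<ge> 16" "R > 0" "R \<ge> H / 2" "T \<le> R" "R + R = T + H" using False T by (auto simp: R_def)
      have int: "(\<lambda>t. norm (lerch_phi a \<beta> (Complex \<sigma> t))) integrable_on {u..v}" if "u \<ge> T" for u v
        by (intro integrable_continuous_interval continuous_on_norm continuous_on_vertical[OF lerch_phi_holomorphic[OF a \<beta>]])
           (use T that in \<open>auto simp: complex_eq_iff\<close>)
      have "1 \<le> pi * R / (4 * ln (ln R))"
        using ln_ln_le[OF R(1)] ln_ln_ge(1)[OF R(1)] by (simp add: le_divide_eq)
      hence "\<sigma> \<ge> 1 - pi * R / (4 * ln (ln R))" using \<sigma> by linarith
      from short[OF a \<beta> R(1,2) order_refl \<sigma> this]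
      have "R / 100 * exp (- D / (min R 1 / 100)) \<le> integral {R..T + H} (\<lambda>t. norm (lerch_phi a \<beta> (Complex \<sigma> t)))"
        by (simp only: R(5))
      also have "\<dots> \<le> I" unfolding I_def
        using R by (intro integral_subset_le int) auto
      finally have "R / 100 * exp (- D / (min R 1 / 100)) \<le> I" .
      moreover have "H / 200 * exp (- D / (min H 1 / 100)) \<le> R / 100 * exp (- D / (min R 1 / 100))"
        using R False T by (intro mult_mono) auto
      ultimately show ?thesis by linarith
    qed
  qed
qed

section \<open>The left half-plane\<close>

text \<open>With w = 1 - s this divides the functional equation by its gamma factor and by the
  leading term of the first dual series, which then starts with 1.\<close>

definition dual_series :: "real \<Rightarrow> real \<Rightarrow> complex \<Rightarrow> complex" where
  "dual_series a \<beta> w = rGamma w * exp (w * of_real (ln (2 * pi * \<beta>))) * exp (- (\<i> * of_real pi * w / 2)) * ee (of_real (\<beta> * a))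
     * lerch_phi a \<beta> (1 - w)"

text \<open>The second series carries exp (-\<i> \<pi> w), which is small for Im w far below 0.
  However, its first frequency ln (dual_freq \<beta> / \<beta>) may be negative, and then the first
  term has no bound uniform in \<beta> and Re w. This is the term to be cancelled; the others are
  dominated by a zeta series.\<close>

lemma dual_series_sums:
  assumes a: "0 < a" "a \<le> 1" and \<beta>: "0 < \<beta>" "\<beta> \<le> 1" and w: "Re w > 1"
  shows "(\<lambda>j. ee (- of_real (real j * a)) * exp (- w * of_real (ln ((real j + \<beta>) / \<beta>))) +
            exp (- (\<i> * of_real pi * w)) * (ee (of_real ((real j + dual_freq \<beta> + \<beta>) * a)) * exp (- w * of_real (ln ((real j + dual_freq \<beta>) / \<beta>)))))
         sums dual_series a \<beta> w"
proof -
  define \<gamma> where "\<gamma> = dual_freq \<beta>"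
  have \<gamma>: "\<gamma> > 0" using dual_freq_pos[OF \<beta>] by (simp add: \<gamma>_def)
  define E where "E = exp (\<i> * of_real pi * w / 2)"
  define E' where "E' = exp (- (\<i> * of_real pi * w / 2))"
  have EE: "E' * E = 1" "E' * E' = exp (- (\<i> * of_real pi * w))"
    by (simp_all add: E_def E'_def field_simps flip: exp_add)
  define G where "G = rGamma w * exp (w * of_real (ln (2 * pi * \<beta>))) * E' * ee (of_real (\<beta> * a))"
  have RG: "rGamma w * Gamma w = 1"
  proof -
    have "w \<notin> \<int>\<^sub>\<le>\<^sub>0" using w by (auto elim!: nonpos_Ints_cases')
    thus ?thesis by (simp add: rGamma_inverse_Gamma Gamma_eq_zero_iff)
  qed
  have e: "exp (- (\<i> * of_real pi * (1 - w) / 2)) = - \<i> * E" "exp (\<i> * of_real pi * (1 - w) / 2) = \<i> * E'"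
  proof -
    have h: "exp (\<i> * of_real (pi / 2)) = \<i>" "exp (\<i> * of_real (- (pi / 2))) = - \<i>"
      by (simp_all only: exp_Euler cos_of_real sin_of_real cos_minus sin_minus cos_pi_half sin_pi_half) simp_all
    have "- (\<i> * of_real pi * (1 - w) / 2) = \<i> * of_real (- (pi / 2)) + \<i> * of_real pi * w / 2" by (simp add: field_simps)
    thus "exp (- (\<i> * of_real pi * (1 - w) / 2)) = - \<i> * E" by (simp only: E_def exp_add h)
    have "\<i> * of_real pi * (1 - w) / 2 = \<i> * of_real (pi / 2) + - (\<i> * of_real pi * w / 2)" by (simp add: field_simps)
    thus "exp (\<i> * of_real pi * (1 - w) / 2) = \<i> * E'" by (simp only: E'_def exp_add h)
  qed
  have pw: "exp (w * of_real (ln (2 * pi * \<beta>))) * of_real (2 * pi * x) powr (- w) = exp (- w * of_real (ln (x / \<beta>)))" if "x > 0" for x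
  proof -
    have p: "2 * pi * x > 0" using that by simp
    hence "complex_of_real (2 * pi * x) \<noteq> 0" by (simp only: of_real_eq_0_iff)
    hence "of_real (2 * pi * x) powr (- w) = exp (- w * of_real (ln (2 * pi * x)))"
      using p by (simp only: powr_def Ln_of_real if_False)
    moreover have "ln (x / \<beta>) = ln (2 * pi * x) - ln (2 * pi * \<beta>)" using that \<beta> by (simp add: ln_mult ln_div)
    moreover have "exp (w * of_real Q) * exp (- w * of_real P) = exp (- w * of_real (P - Q))" for P Q
      by (simp add: algebra_simps flip: exp_add)
    ultimately show ?thesis by (simp only:)
  qed
  define A where "A j = \<i> * (- \<i> * E) * (of_real (2 * pi * (real j + \<beta>)) powr (- w) * ee (- of_real ((real j + \<beta>) * a)))" for j
  define B where "B j = \<i> * (\<i> * E') * (of_real (2 * pi * (real j + \<gamma>)) powr (- w) * ee (of_real ((real j + \<gamma>) * a)))" for j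
  have "(\<lambda>j. Gamma w * (A j - B j)) sums lerch_phi a \<beta> (1 - w)"
    using lerch_phi_functional_equation[OF a \<beta>, of "1 - w"] w e unfolding A_def B_def \<gamma>_def by simp
  from sums_mult[OF this, of G] have "(\<lambda>j. G * (Gamma w * (A j - B j))) sums dual_series a \<beta> w"
    by (simp only: dual_series_def G_def E'_def)
  moreover have "G * (Gamma w * (A j - B j)) = ee (- of_real (real j * a)) * exp (- w * of_real (ln ((real j + \<beta>) / \<beta>))) +
            exp (- (\<i> * of_real pi * w)) * (ee (of_real ((real j + \<gamma> + \<beta>) * a)) * exp (- w * of_real (ln ((real j + \<gamma>) / \<beta>))))" for j
  proof -
    have 1: "real j + \<beta> > 0" "real j + \<gamma> > 0" using \<beta> \<gamma> by auto
    have ee1: "ee (of_real (\<beta> * a)) * ee (- of_real ((real j + \<beta>) * a)) = ee (- of_real (real j * a))"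
      by (simp add: ring_distribs flip: ee_add)
    have ee2: "ee (of_real (\<beta> * a)) * ee (of_real ((real j + \<gamma>) * a)) = ee (of_real ((real j + \<gamma> + \<beta>) * a))"
      by (simp add: ring_distribs add_ac flip: ee_add)
    have "G * (Gamma w * (A j - B j)) = (rGamma w * Gamma w) * (
        (E' * E) * ((exp (w * of_real (ln (2 * pi * \<beta>))) * of_real (2 * pi * (real j + \<beta>)) powr (- w)) * (ee (of_real (\<beta> * a)) * ee (- of_real ((real j + \<beta>) * a))))
        + (E' * E') * ((exp (w * of_real (ln (2 * pi * \<beta>))) * of_real (2 * pi * (real j + \<gamma>)) powr (- w)) * (ee (of_real (\<beta> * a)) * ee (of_real ((real j + \<gamma>) * a)))))"
      unfolding A_def B_def G_def by (simp add: ring_distribs mult_ac)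
    thus ?thesis unfolding RG EE pw[OF 1(1)] pw[OF 1(2)] ee1 ee2 by (simp add: mult_ac)
  qed
  ultimately show ?thesis by (simp only: \<gamma>_def)
qed

lemma dual_series_holomorphic:
  assumes "0 < a" "a \<le> 1" "0 < \<beta>" "\<beta> \<le> 1"
  shows "dual_series a \<beta> holomorphic_on {w. Re w > 1}"
proof -
  have "(lerch_phi a \<beta> \<circ> (\<lambda>w. 1 - w)) holomorphic_on {w. Re w > 1}"
    by (rule holomorphic_on_compose_gen[OF _ lerch_phi_holomorphic[OF assms]]) (auto intro!: holomorphic_intros)
  hence "(\<lambda>w. lerch_phi a \<beta> (1 - w)) holomorphic_on {w. Re w > 1}" by (simp add: o_def)
  thus ?thesis unfolding dual_series_def[abs_def] by (intro holomorphic_intros) auto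
qed

text \<open>The constant holds for all \<sigma> < 0: with A = 1 - \<sigma>, (2 \<pi> \<beta>)^A <=
  (2 \<pi>)^A, and \<Gamma>(A) (2 \<pi>)^(-A) is bounded below. The factors exp (-\<pi> t/2) cancel
  against each other.\<close>

lemma norm_dual_series_le:
  obtains c where "c > 0"
    "\<And>a \<beta> s. 0 < \<beta> \<Longrightarrow> \<beta> \<le> 1 \<Longrightarrow> Re s < 0 \<Longrightarrow> Im s \<ge> 0 \<Longrightarrow> c * norm (dual_series a \<beta> (1 - s)) \<le> norm (lerch_phi a \<beta> s)"
proof -
  obtain c where c: "c > 0" "\<And>A::real. A \<ge> 1 \<Longrightarrow> Gamma A * (2 * pi) powr (- A) \<ge> c"
    using Gamma_over_power_bounded_below by blast
  show ?thesis
  proof (rule that[OF c(1)])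
    fix a \<beta> :: real and s :: complex assume \<beta>: "0 < \<beta>" "\<beta> \<le> 1" and s: "Re s < 0" "Im s \<ge> 0"
    define A where "A = 1 - Re s"
    have A: "A \<ge> 1" using s by (simp add: A_def)
    define e where "e = exp (- pi / 2 * Im s)"
    have e: "e > 0" by (simp add: e_def)
    have w: "1 - s = Complex A (- Im s)" by (simp add: complex_eq_iff A_def)
    have "1 - s \<notin> \<int>\<^sub>\<le>\<^sub>0" using s by (auto elim!: nonpos_Ints_cases' simp: complex_eq_iff)
    hence G0: "Gamma (1 - s) \<noteq> 0" by (simp add: Gamma_eq_zero_iff)
    have G: "Gamma A * e \<le> norm (Gamma (1 - s))" unfolding w e_def using norm_Gamma_lower[of A "- Im s"] A s by simp
    have GA: "Gamma A > 0" using A by (intro Gamma_real_pos) auto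
    have p: "norm (exp ((1 - s) * of_real (ln (2 * pi * \<beta>)))) \<le> (2 * pi) powr A"
    proof -
      have "norm (exp ((1 - s) * of_real (ln (2 * pi * \<beta>)))) = (2 * pi * \<beta>) powr A" using \<beta> by (simp add: powr_def A_def)
      also have "\<dots> \<le> (2 * pi) powr A" using \<beta> A by (intro powr_mono2) (auto simp: mult_left_le)
      finally show ?thesis .
    qed
    have "norm (dual_series a \<beta> (1 - s)) = norm (exp ((1 - s) * of_real (ln (2 * pi * \<beta>)))) * (e / norm (Gamma (1 - s)) * norm (lerch_phi a \<beta> s))"
    proof -
      have "norm (exp (- (\<i> * of_real pi * (1 - s) / 2))) = e" by (simp add: e_def)
      moreover have "norm (ee (of_real (\<beta> * a))) = 1" by (simp add: norm_ee)
      moreover have "norm (rGamma (1 - s)) = 1 / norm (Gamma (1 - s))"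
        by (simp only: rGamma_inverse_Gamma inverse_eq_divide norm_divide norm_one)
      ultimately show ?thesis unfolding dual_series_def norm_mult by (simp only:) simp
    qed
    also have "\<dots> \<le> (2 * pi) powr A * (e / (Gamma A * e) * norm (lerch_phi a \<beta> s))"
      using p G GA e G0 by (intro mult_mono mult_right_mono divide_left_mono mult_pos_pos) auto
    also have "\<dots> = (2 * pi) powr A / Gamma A * norm (lerch_phi a \<beta> s)" using e by simp
    finally have d: "norm (dual_series a \<beta> (1 - s)) \<le> (2 * pi) powr A / Gamma A * norm (lerch_phi a \<beta> s)" .
    have "c * norm (dual_series a \<beta> (1 - s)) \<le> (Gamma A * (2 * pi) powr (- A)) * ((2 * pi) powr A / Gamma A * norm (lerch_phi a \<beta> s))"
      using c(2)[OF A] c(1) d by (intro mult_mono) auto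
    also have "\<dots> = norm (lerch_phi a \<beta> s)" using GA by (simp add: powr_minus)
    finally show "c * norm (dual_series a \<beta> (1 - s)) \<le> norm (lerch_phi a \<beta> s)" .
  qed
qed

lemma exp_quarter_pi: "exp (pi / 4) \<ge> 7/4" "exp (pi / 4) \<le> 5/2"
proof -
  show "exp (pi / 4) \<ge> 7/4" using exp_ge_add_one_self[of "pi / 4"] pi_gt3 by linarith
  have p: "pi / 4 \<le> 8/10" using pi_less_4 pi_approx by simp
  hence "exp (pi / 4) \<le> exp (8/10)" by simp
  also have "\<dots> \<le> 1 + 8/10 + (8/10)\<^sup>2" by (rule exp_bound) auto
  also have "\<dots> \<le> 5/2" by (simp add: power2_eq_square)
  finally show "exp (pi / 4) \<le> 5/2" .
qed

text \<open>The shift by \<open>\<i>/4\<close> makes the two leading exponentials of the dual series combine with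
  different factors, so a suitable combination cancels the one that can be large.\<close>
lemma dual_series_combination:
  assumes a: "0 < a" "a \<le> 1" and \<beta>: "0 < \<beta>" "\<beta> \<le> 1"
  obtains \<mu> where "norm (\<mu> - 1) \<ge> 3/4" "norm \<mu> \<le> 5/2"
    "\<And>w. Re w > 1 \<Longrightarrow> Im w \<le> 0 \<Longrightarrow>
       norm ((\<mu> * dual_series a \<beta> (w - \<i> / 4) - dual_series a \<beta> w) - (\<mu> - 1)) \<le>
         7/2 / (Re w - 1) + 2 * exp (pi * Im w) * (2 + 1 / (Re w - 1))"
proof -
  define \<gamma> where "\<gamma> = dual_freq \<beta>"
  have \<gamma>: "\<gamma> > 0" using dual_freq_pos[OF \<beta>] by (simp add: \<gamma>_def)
  define p where "p j = ln ((real j + \<beta>) / \<beta>)" for j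
  define r where "r j = ln ((real j + \<gamma>) / \<beta>)" for j
  define L where "L = (if \<beta> = 1 then 0 else r 0)"
  \<comment> \<open>The shift leaves the constant term 1 of the first series unchanged and
    multiplies the leading term of the second by exp (-\<pi>/4) exp (\<i> L/4). \<mu> is the inverse
    of this factor, so the difference kills that term, while |\<mu>| = exp (\<pi>/4) >= 7/4 keeps
    \<mu> - 1 away from 0.\<close>
  define \<mu> where "\<mu> = of_real (exp (pi / 4)) * exp (- (\<i> * of_real (L / 4)))"
  have n\<mu>: "norm \<mu> = exp (pi / 4)" by (simp add: \<mu>_def norm_mult)
  define u where "u j = ee (- of_real (real j * a))" for j
  define v where "v j = ee (of_real ((real j + \<gamma> + \<beta>) * a))" for j
  have uv: "norm (u j) = 1" "norm (v j) = 1" for j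
    using norm_ee[of "- (real j * a)"] norm_ee[of "(real j + \<gamma> + \<beta>) * a"] by (simp_all add: u_def v_def)
  show ?thesis
  proof (rule that[of \<mu>])
    show "norm (\<mu> - 1) \<ge> 3/4" using norm_triangle_ineq2[of \<mu> 1] n\<mu> exp_quarter_pi by simp
    show "norm \<mu> \<le> 5/2" using n\<mu> exp_quarter_pi by simp
    fix w :: complex assume w: "Re w > 1" "Im w \<le> 0"
    define \<Delta> where "\<Delta> = \<mu> * dual_series a \<beta> (w - \<i> / 4) - dual_series a \<beta> w"
    define x where "x j = u j * exp (- w * of_real (p j)) * (\<mu> * exp (\<i> * of_real (p j / 4)) - 1)" for j
    define y where "y j = exp (- (\<i> * of_real pi * w)) * (v j * exp (- w * of_real (r j))) *
        (\<mu> * of_real (exp (- (pi / 4))) * exp (\<i> * of_real (r j / 4)) - 1)" for j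
    have sums: "(\<lambda>j. u j * exp (- z * of_real (p j)) + exp (- (\<i> * of_real pi * z)) * (v j * exp (- z * of_real (r j)))) sums dual_series a \<beta> z"
      if "Re z > 1" for z using dual_series_sums[OF a \<beta> that] unfolding u_def v_def p_def r_def \<gamma>_def .
    have "(\<lambda>j. \<mu> * (u j * exp (- (w - \<i> / 4) * of_real (p j)) + exp (- (\<i> * of_real pi * (w - \<i> / 4))) * (v j * exp (- (w - \<i> / 4) * of_real (r j))))
         - (u j * exp (- w * of_real (p j)) + exp (- (\<i> * of_real pi * w)) * (v j * exp (- w * of_real (r j))))) sums \<Delta>"
      unfolding \<Delta>_def by (intro sums_diff sums_mult sums) (use w in auto)
    moreover have "\<mu> * (u j * exp (- (w - \<i> / 4) * of_real (p j)) + exp (- (\<i> * of_real pi * (w - \<i> / 4))) * (v j * exp (- (w - \<i> / 4) * of_real (r j))))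
         - (u j * exp (- w * of_real (p j)) + exp (- (\<i> * of_real pi * w)) * (v j * exp (- w * of_real (r j)))) = x j + y j" for j
    proof -
      have sh: "exp (- (w - \<i> / 4) * of_real l) = exp (- w * of_real l) * exp (\<i> * of_real (l / 4))" for l
      proof -
        have "- (w - \<i> / 4) * of_real l = - w * of_real l + \<i> * of_real (l / 4)" by (simp add: algebra_simps)
        thus ?thesis by (simp only: exp_add)
      qed
      have "- (\<i> * of_real pi * (w - \<i> / 4)) = - (\<i> * of_real pi * w) + of_real (- (pi / 4))"
        by (simp add: field_simps)
      hence "exp (- (\<i> * of_real pi * (w - \<i> / 4))) = exp (- (\<i> * of_real pi * w)) * of_real (exp (- (pi / 4)))"
        by (simp only: exp_add exp_of_real)
      thus ?thesis unfolding sh x_def y_def by (simp only: ring_distribs mult_ac mult_1_right) (simp add: algebra_simps)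
    qed
    ultimately have S: "(\<lambda>j. x j + y j) sums \<Delta>" by simp
    define A where "A = Re w"
    define e where "e = exp (pi * Im w)"
    have A: "A > 1" using w by (simp add: A_def)
    have e: "e > 0" by (simp add: e_def)
    have x0: "x 0 = \<mu> - 1" using \<beta> by (simp add: x_def p_def u_def ee_def)
    have ub: "exp (- A * ln z) \<le> (real m) powr (- A)" if "real m \<le> z" "m > 0" for z m
    proof -
      have "z powr (- A) \<le> real m powr (- A)" using that A by (intro powr_mono2') auto
      thus ?thesis using that by (simp add: powr_def)
    qed
    have xj: "norm (x (Suc j)) \<le> 7/2 * (real j + 2) powr (- A)" for j
    proof -
      have "real (Suc j) * \<beta> \<le> real (Suc j)" using \<beta> by (intro mult_left_le) auto
      hence "real (j + 2) \<le> (real (Suc j) + \<beta>) / \<beta>" using \<beta> by (simp add: le_divide_eq algebra_simps)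
      hence 1: "exp (- A * p (Suc j)) \<le> real (j + 2) powr (- A)" unfolding p_def by (rule ub) auto
      have 2: "norm (\<mu> * exp (\<i> * of_real (p (Suc j) / 4)) - 1) \<le> 7/2"
        using norm_triangle_ineq4[of "\<mu> * exp (\<i> * of_real (p (Suc j) / 4))" 1] n\<mu> exp_quarter_pi by (simp add: norm_mult)
      have "norm (x (Suc j)) = exp (- A * p (Suc j)) * norm (\<mu> * exp (\<i> * of_real (p (Suc j) / 4)) - 1)"
        unfolding x_def norm_mult uv by (simp add: A_def)
      also have "\<dots> \<le> real (j + 2) powr (- A) * (7/2)" by (intro mult_mono 1 2) auto
      finally show ?thesis by (simp add: mult.commute add_ac)
    qed
    have ny: "norm (y j) \<le> e * exp (- A * r j) * 2" for j
    proof -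
      have "norm (\<mu> * of_real (exp (- (pi / 4))) * exp (\<i> * of_real (r j / 4))) = 1"
        by (simp add: norm_mult n\<mu> flip: exp_add)
      hence "norm (\<mu> * of_real (exp (- (pi / 4))) * exp (\<i> * of_real (r j / 4)) - 1) \<le> 2"
        using norm_triangle_ineq4[of "\<mu> * of_real (exp (- (pi / 4))) * exp (\<i> * of_real (r j / 4))" 1] by simp
      moreover have "norm (y j) = e * exp (- A * r j) * norm (\<mu> * of_real (exp (- (pi / 4))) * exp (\<i> * of_real (r j / 4)) - 1)"
        unfolding y_def norm_mult uv by (simp add: e_def A_def)
      ultimately show ?thesis using e by (simp only:) (intro mult_left_mono, auto)
    qed
    have y0: "norm (y 0) \<le> 2 * e"
    proof (cases "\<beta> = 1")
      case True
      thus ?thesis using ny[of 0] by (simp add: r_def \<gamma>_def dual_freq_def)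
    next
      case False
      have "\<mu> * of_real (exp (- (pi / 4))) * exp (\<i> * of_real (r 0 / 4)) = 
        (of_real (exp (pi / 4)) * of_real (exp (- (pi / 4)))) * (exp (- (\<i> * of_real (L / 4))) * exp (\<i> * of_real (r 0 / 4)))"
        by (simp only: \<mu>_def mult_ac)
      also have "\<dots> = 1" using False by (simp add: L_def flip: of_real_mult exp_add)
      finally show ?thesis using e by (simp add: y_def)
    qed
    have yj: "norm (y (Suc j)) \<le> 2 * e * (real j + 1) powr (- A)" for j
    proof -
      have "real (Suc j) \<le> (real (Suc j) + \<gamma>) / \<beta>"
      proof -
        have "real (Suc j) * \<beta> \<le> real (Suc j)" using \<beta> by (intro mult_left_le) auto
        hence "real (Suc j) * \<beta> \<le> real (Suc j) + \<gamma>" using \<gamma> by linarith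
        thus ?thesis using \<beta> by (simp only: le_divide_eq) simp
      qed
      hence "exp (- A * r (Suc j)) \<le> real (Suc j) powr (- A)" unfolding r_def by (rule ub) auto
      hence "e * exp (- A * r (Suc j)) * 2 \<le> e * real (Suc j) powr (- A) * 2" using e by (intro mult_mono) auto
      thus ?thesis using ny[of "Suc j"] by (simp add: mult_ac add_ac)
    qed
    note z = zeta_tail_bound[OF A]
    define Z where "Z = (\<Sum>n. (real n + 2) powr (- A))"
    have zs: "(\<lambda>n. (real n + 2) powr (- A)) sums Z" using z(1) by (simp add: Z_def summable_sums)
    have "(\<lambda>n. (real (Suc n) + 1) powr (- A)) sums Z" using zs by (simp add: add_ac)
    hence zs1: "(\<lambda>n. (real n + 1) powr (- A)) sums (Z + 1)" by (subst (asm) sums_Suc_iff) simp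
    have "(\<lambda>j. x (Suc j) + y (Suc j)) sums (\<Delta> - (x 0 + y 0))" using S by (subst sums_Suc_iff) simp
    moreover have "(\<lambda>j. 7/2 * (real j + 2) powr (- A) + 2 * e * (real j + 1) powr (- A)) sums (7/2 * Z + 2 * e * (Z + 1))"
      by (intro sums_add sums_mult zs zs1)
    moreover have "norm (x (Suc j) + y (Suc j)) \<le> 7/2 * (real j + 2) powr (- A) + 2 * e * (real j + 1) powr (- A)" for j
      using norm_triangle_le add_mono[OF xj yj] by blast
    ultimately have "norm (\<Delta> - (x 0 + y 0)) \<le> 7/2 * Z + 2 * e * (Z + 1)"
      by (rule norm_sums_le)
    hence "norm (\<Delta> - (\<mu> - 1)) \<le> 7/2 * Z + 2 * e * (Z + 1) + 2 * e"
      using y0 norm_triangle_ineq[of "\<Delta> - (x 0 + y 0)" "y 0"] by (simp add: x0 algebra_simps)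
    also have "\<dots> = 7/2 * Z + 2 * e * (2 + Z)" by (simp add: algebra_simps)
    also have "\<dots> \<le> 7/2 * (1 / (A - 1)) + 2 * e * (2 + 1 / (A - 1))"
      using z(2) e unfolding Z_def by (intro add_mono mult_left_mono) auto
    finally show "norm (\<Delta> - (\<mu> - 1)) \<le> 7/2 / (Re w - 1) + 2 * exp (pi * Im w) * (2 + 1 / (Re w - 1))"
      by (simp add: A_def e_def)
  qed
qed

text \<open>H >= 1 allows the fixed chord parameter q = 1/100, so no exponential loss in 1/H arises.
  The lower bound for the combination F is then split back into averages of
  \<open>dual_series\<close> over two segments 1/4 apart, both inside the reflected
  interval.\<close>

lemma lerch_mean_value_left:
  obtains c where "c > 0"
    "\<And>a \<beta> T H \<sigma>. 0 < a \<Longrightarrow> a \<le> 1 \<Longrightarrow> 0 < \<beta> \<Longrightarrow> \<beta> \<le> 1 \<Longrightarrow> T \<ge> 16 \<Longrightarrow> H \<ge> 1 \<Longrightarrow> \<sigma> < 0 \<Longrightarrow>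
       integral {T..T + H} (\<lambda>t. norm (lerch_phi a \<beta> (Complex \<sigma> t))) \<ge> c * H"
proof -
  obtain c where c: "c > 0"
    "\<And>a \<beta> s. 0 < \<beta> \<Longrightarrow> \<beta> \<le> 1 \<Longrightarrow> Re s < 0 \<Longrightarrow> Im s \<ge> 0 \<Longrightarrow> c * norm (dual_series a \<beta> (1 - s)) \<le> norm (lerch_phi a \<beta> s)"
    using norm_dual_series_le by blast
  define k where "k = 1/4 * exp (- (100 * (11/2) / (1/4) * pi) / (1/100 :: real))"
  have k: "k > 0" by (simp add: k_def)
  show ?thesis
  \<comment> \<open>350 = 100 * 7/2: the averages have length H/100, and their weights add up to
    |\<mu>| + 1 <= 7/2.\<close>
  proof (rule that[of "c * k / 350"])
    show "c * k / 350 > 0" using c k by simp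
    fix a \<beta> T H \<sigma> :: real
    assume a: "0 < a" "a \<le> 1" and \<beta>: "0 < \<beta>" "\<beta> \<le> 1" and T: "T \<ge> 16" and H: "H \<ge> 1" and \<sigma>: "\<sigma> < 0"
    obtain \<mu> where \<mu>: "norm (\<mu> - 1) \<ge> 3/4" "norm \<mu> \<le> 5/2"
      "\<And>w. Re w > 1 \<Longrightarrow> Im w \<le> 0 \<Longrightarrow>
       norm ((\<mu> * dual_series a \<beta> (w - \<i> / 4) - dual_series a \<beta> w) - (\<mu> - 1)) \<le>
         7/2 / (Re w - 1) + 2 * exp (pi * Im w) * (2 + 1 / (Re w - 1))"
      using dual_series_combination[OF a \<beta>] by blast
    let ?D = "dual_series a \<beta>"
    define F where "F w = \<mu> * ?D (w - \<i> / 4) - ?D w" for w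
    define h where "h = H / 100"
    have h: "h > 0" using H by (simp add: h_def)
    \<comment> \<open>The variable w = 1 - s has imaginary part -t, so the interval is
      reflected.\<close>
    define t0 where "t0 = - (T + H / 2)"
    have holD: "?D holomorphic_on {w. Re w > 1}" by (rule dual_series_holomorphic[OF a \<beta>])
    have "(?D \<circ> (\<lambda>w. w - \<i> / 4)) holomorphic_on {w. Re w > 1}"
      by (rule holomorphic_on_compose_gen[OF _ holD]) (auto intro!: holomorphic_intros)
    hence holD': "(\<lambda>w. ?D (w - \<i> / 4)) holomorphic_on {w. Re w > 1}" by (simp add: o_def)
    have holF: "F holomorphic_on {w. Re w > 1}" unfolding F_def[abs_def]
      by (intro holomorphic_intros holD holD')
    have contv: "continuous_on {0..h} (\<lambda>u. g (s + \<i> * of_real u))" if "g holomorphic_on {s. Re s > 1}" "Re s > 1" for g s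
      by (rule continuous_on_compose2[OF holomorphic_on_imp_continuous_on[OF that(1)]])
         (use that(2) in \<open>auto intro!: continuous_intros\<close>)
    \<comment> \<open>T >= 16 and |Im s - t0| < 11 leave an imaginary part of at most -5, even after
      the upward averaging.\<close>
    have E: "exp (pi * y) \<le> 1/200" if "y \<le> -5" for y
    proof -
      have "6 \<le> exp (5::real)" using exp_ge_add_one_self[of "5::real"] by simp
      hence "6 ^ 3 \<le> exp (5::real) ^ 3" by (intro power_mono) auto
      also have "exp (5::real) ^ 3 = exp 15" by (simp flip: exp_of_nat_mult)
      finally have "exp 15 \<ge> (200::real)" by simp
      moreover have "3 * 5 \<le> pi * (- y)" using that pi_gt3 by (intro mult_mono) auto
      hence "exp 15 \<le> exp (- (pi * y))" by simp
      ultimately have "200 \<le> exp (- (pi * y))" by linarith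
      thus ?thesis by (simp add: exp_minus field_simps)
    qed
    have dev: "norm (vavg h F s - (\<mu> - 1)) \<le> 7/2 / (Re s - 1) + 1 / 100 * (2 + 1 / (Re s - 1))"
      if s: "Re s > 1" "\<bar>Im s - t0\<bar> < 11" for s
    proof -
      have "norm (vavg h (\<lambda>w. F w - (\<mu> - 1)) s) \<le> 7/2 / (Re s - 1) + 1 / 100 * (2 + 1 / (Re s - 1))"
      proof (rule norm_vavg_le[OF h])
        show "continuous_on {0..h} (\<lambda>u. F (s + \<i> * of_real u) - (\<mu> - 1))"
          by (intro continuous_intros contv[OF holF s(1)])
        fix u assume u: "0 \<le> u" "u \<le> h"
        have im: "Im s + u \<le> -5" using u s(2) T H unfolding t0_def h_def by linarith
        have "2 * exp (pi * (Im s + u)) \<le> 2 * (1/200)" using E[OF im] by linarith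
        hence E2: "2 * exp (pi * (Im s + u)) * (2 + 1 / (Re s - 1)) \<le> 2 * (1/200) * (2 + 1 / (Re s - 1))"
          using s by (intro mult_right_mono) auto
        have "norm (F (s + \<i> * of_real u) - (\<mu> - 1)) \<le> 7/2 / (Re s - 1) + 2 * exp (pi * (Im s + u)) * (2 + 1 / (Re s - 1))"
          using \<mu>(3)[of "s + \<i> * of_real u"] s im unfolding F_def by simp
        also have "\<dots> \<le> 7/2 / (Re s - 1) + 2 * (1/200) * (2 + 1 / (Re s - 1))" by (rule add_left_mono[OF E2])
        finally show "norm (F (s + \<i> * of_real u) - (\<mu> - 1)) \<le> 7/2 / (Re s - 1) + 1 / 100 * (2 + 1 / (Re s - 1))"
          by simp
      qed
      thus ?thesis by (simp only: vavg_diff_const[OF h contv[OF holF s(1)]])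
    qed
    \<comment> \<open>B = 11/2 and c0 = 1/4 are admissible: 3/4 <= |\<mu> - 1| <= 7/2, and for Re s
      >= 10 the average of F deviates from \<mu> - 1 by at most 7/18 + 1/40.\<close>
    have "\<exists>y. \<bar>y\<bar> \<le> 2 * (1/100) \<and> norm (vavg h F (Complex (1 - \<sigma>) (t0 + y))) \<ge> 1/4 * exp (- (100 * (11/2) / (1/4) * pi) / (1/100))"
    proof (rule half_plane_segment_lower_bound)
      have "vavg h F holomorphic_on {s. Re s > 1}"
        by (rule vavg_holomorphic[OF h holF]) (auto intro: open_halfspace_Re_gt convex_halfspace_Re_gt)
      thus "vavg h F holomorphic_on {s. 1 < Re s \<and> \<bar>Im s - t0\<bar> < 11}" by (rule holomorphic_on_subset) auto
      fix s :: complex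
      { assume s: "1 < Re s" "\<bar>Im s - t0\<bar> < 11"
        have "norm (vavg h F s) \<le> norm (vavg h F s - (\<mu> - 1)) + norm (\<mu> - 1)"
          using norm_triangle_ineq[of "vavg h F s - (\<mu> - 1)" "\<mu> - 1"] by simp
        moreover have "norm (\<mu> - 1) \<le> 7/2" using norm_triangle_ineq4[of \<mu> 1] \<mu>(2) by simp
        moreover have "7/2 / (Re s - 1) = 7/2 * (1 / (Re s - 1))" by simp
        moreover have "1 / (Re s - 1) \<ge> 0" using s by simp
        ultimately show "norm (vavg h F s) \<le> 11/2 * (1 + 1 / (Re s - 1))" using dev[OF s]
          unfolding distrib_left by linarith }
      { assume s: "10 \<le> Re s" "\<bar>Im s - t0\<bar> < 11"
        have "norm (\<mu> - 1) \<le> norm (vavg h F s - (\<mu> - 1)) + norm (vavg h F s)"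
          using norm_triangle_ineq4[of "vavg h F s" "vavg h F s - (\<mu> - 1)"] by simp
        moreover have "7/2 / (Re s - 1) = 7/2 * (1 / (Re s - 1))" by simp
        moreover have "1 / (Re s - 1) \<le> 1/9" using s by (simp add: divide_le_eq)
        ultimately show "1/4 \<le> norm (vavg h F s)" using dev[OF _ s(2)] \<mu>(1) s(1)
          unfolding distrib_left by linarith }
    qed (use \<sigma> in auto)
    then obtain y where y: "\<bar>y\<bar> \<le> 1/50" "norm (vavg h F (Complex (1 - \<sigma>) (t0 + y))) \<ge> k"
      by (auto simp: k_def)
    define I where "I = integral {T..T + H} (\<lambda>t. norm (lerch_phi a \<beta> (Complex \<sigma> t)))"
    define J where "J = integral {- (T + H)..- T} (\<lambda>t. norm (?D (Complex (1 - \<sigma>) t)))"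
    have cD: "continuous_on X (\<lambda>t. ?D (Complex (1 - \<sigma>) t))" for X
      by (rule continuous_on_vertical[OF holD]) (use \<sigma> in auto)
    have le: "norm (vavg h ?D (Complex (1 - \<sigma>) z)) \<le> J / h" if "- (T + H) \<le> z" "z + h \<le> - T" for z
      unfolding J_def by (rule norm_vavg_le_integral[OF h cD that])
    have "k \<le> norm (\<mu> * vavg h ?D (Complex (1 - \<sigma>) (t0 + y - 1/4)) - vavg h ?D (Complex (1 - \<sigma>) (t0 + y)))"
    proof -
      define s where "s = Complex (1 - \<sigma>) (t0 + y)"
      have s: "Re s > 1" "s - \<i> / 4 = Complex (1 - \<sigma>) (t0 + y - 1/4)" using \<sigma> by (auto simp: s_def complex_eq_iff)
      have int: "(\<lambda>u. g (s + \<i> * of_real u)) integrable_on {0..h}" if "g holomorphic_on {s. Re s > 1}" for g :: "complex \<Rightarrow> complex"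
        by (intro integrable_continuous_interval contv[OF that s(1)])
      have "vavg h F s = \<mu> * vavg h ?D (s - \<i> / 4) - vavg h ?D s"
      proof -
        have "integral {0..h} (\<lambda>u. F (s + \<i> * of_real u)) =
            integral {0..h} (\<lambda>u. \<mu> * ?D (s + \<i> * of_real u - \<i> / 4)) - integral {0..h} (\<lambda>u. ?D (s + \<i> * of_real u))"
          unfolding F_def using int[OF holD] int[OF holD'] by (intro Henstock_Kurzweil_Integration.integral_diff integrable_on_mult_right)
        moreover have "s + \<i> * of_real u - \<i> / 4 = s - \<i> / 4 + \<i> * of_real u" for u by simp
        ultimately show ?thesis unfolding vavg_def by (simp add: diff_divide_distrib)
      qed
      thus ?thesis using y(2) s by (simp add: s_def)
    qed
    also have "\<dots> \<le> norm \<mu> * norm (vavg h ?D (Complex (1 - \<sigma>) (t0 + y - 1/4))) + norm (vavg h ?D (Complex (1 - \<sigma>) (t0 + y)))"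
      using norm_triangle_ineq4 by (metis norm_mult)
    also have "\<dots> \<le> 5/2 * (J / h) + J / h"
      using y(1) H \<mu>(2) by (intro add_mono mult_mono le) (auto simp: t0_def h_def abs_le_iff)
    finally have "k * h \<le> 7/2 * J" using h by (simp add: field_simps)
    moreover have "c * J \<le> I"
    proof -
      have "J = integral {T..T + H} (\<lambda>t. norm (?D (Complex (1 - \<sigma>) (- t))))"
        unfolding J_def using Henstock_Kurzweil_Integration.integral_reflect_real[of "T + H" T "\<lambda>t. norm (?D (Complex (1 - \<sigma>) (- t)))"] by simp
      hence "c * J = integral {T..T + H} (\<lambda>t. c * norm (?D (Complex (1 - \<sigma>) (- t))))" by simp
      also have "\<dots> \<le> I" unfolding I_def
      proof (intro integral_le integrable_continuous_interval continuous_intros)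
        show "continuous_on {T..T + H} (\<lambda>t. ?D (Complex (1 - \<sigma>) (- t)))"
          by (rule continuous_on_compose2[OF cD[of UNIV], of _ "\<lambda>t. - t"]) (auto intro!: continuous_intros)
        show "continuous_on {T..T + H} (\<lambda>t. lerch_phi a \<beta> (Complex \<sigma> t))"
          by (rule continuous_on_vertical[OF lerch_phi_holomorphic[OF a \<beta>]]) (use T in \<open>auto simp: complex_eq_iff\<close>)
        fix t assume t: "t \<in> {T..T + H}"
        have "1 - Complex \<sigma> t = Complex (1 - \<sigma>) (- t)" by (simp add: complex_eq_iff)
        thus "c * norm (?D (Complex (1 - \<sigma>) (- t))) \<le> norm (lerch_phi a \<beta> (Complex \<sigma> t))"
          using c(2)[OF \<beta>, of "Complex \<sigma> t" a] \<sigma> t T by simp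
      qed
      finally show ?thesis .
    qed
    moreover have "c * (k * h) \<le> c * (7/2 * J)" using calculation(1) c(1) by (intro mult_left_mono) auto
    moreover have "c * k / 350 * H = 2/7 * (c * (k * h))" by (simp add: h_def)
    ultimately show "I \<ge> c * k / 350 * H" by linarith
  qed
qed

section \<open>The mean value estimate\<close>

lemma lerch_mean_value:
  obtains c C where "c > 0" "C > 0"
    "\<And>a \<beta> T H \<sigma>. 0 < a \<Longrightarrow> a \<le> 1 \<Longrightarrow> 0 < \<beta> \<Longrightarrow> \<beta> \<le> 1 \<Longrightarrow> T \<ge> 16 \<Longrightarrow> 0 < H \<Longrightarrow>
       \<sigma> \<ge> 1 - pi * H / (4 * ln (ln T)) \<Longrightarrow>
       integral {T..T + H} (\<lambda>t. norm (lerch_phi a \<beta> (Complex \<sigma> t))) \<ge> c * (H * exp (- C / min H 1))"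
proof -
  obtain D where D: "D > 0" and strip:
    "\<And>a \<beta> T H \<sigma>. 0 < a \<Longrightarrow> a \<le> 1 \<Longrightarrow> 0 < \<beta> \<Longrightarrow> \<beta> \<le> 1 \<Longrightarrow> T \<ge> 16 \<Longrightarrow> 0 < H \<Longrightarrow> 0 \<le> \<sigma> \<Longrightarrow> \<sigma> \<le> 1 \<Longrightarrow>
       \<sigma> \<ge> 1 - pi * H / (4 * ln (ln T)) \<Longrightarrow>
       integral {T..T + H} (\<lambda>t. norm (lerch_phi a \<beta> (Complex \<sigma> t))) \<ge> H / 200 * exp (- D / (min H 1 / 100))"
    using lerch_mean_value_strip by blast
  obtain k where k: "k > 0" and left:
    "\<And>a \<beta> T H \<sigma>. 0 < a \<Longrightarrow> a \<le> 1 \<Longrightarrow> 0 < \<beta> \<Longrightarrow> \<beta> \<le> 1 \<Longrightarrow> T \<ge> 16 \<Longrightarrow> H \<ge> 1 \<Longrightarrow> \<sigma> < 0 \<Longrightarrow>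
       integral {T..T + H} (\<lambda>t. norm (lerch_phi a \<beta> (Complex \<sigma> t))) \<ge> k * H"
    using lerch_mean_value_left by blast
  define C where "C = 100 * max D (200 * pi)"
  define c where "c = min (1/200) k"
  have C: "C > 0" and c: "c > 0" using D k by (auto simp: C_def c_def)
  show ?thesis
  proof (rule that[OF c C])
    fix a \<beta> T H \<sigma> :: real
    assume a: "0 < a" "a \<le> 1" and \<beta>: "0 < \<beta>" "\<beta> \<le> 1" and T: "T \<ge> 16" and H: "0 < H"
      and \<sigma>: "\<sigma> \<ge> 1 - pi * H / (4 * ln (ln T))"
    define I where "I = integral {T..T + H} (\<lambda>t. norm (lerch_phi a \<beta> (Complex \<sigma> t)))"
    have le: "c * (H * exp (- C / min H 1)) \<le> H / 200 * exp (- D' / (min H 1 / 100))" if "100 * D' \<le> C" for D'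
    proof -
      have "100 * D' / min H 1 \<le> C / min H 1" using that H by (intro divide_right_mono) auto
      hence "exp (- C / min H 1) \<le> exp (- D' / (min H 1 / 100))" by (simp add: mult.commute)
      hence "c * (H * exp (- C / min H 1)) \<le> 1/200 * (H * exp (- D' / (min H 1 / 100)))"
        using c H by (intro mult_mono mult_left_mono) (auto simp: c_def)
      thus ?thesis by simp
    qed
    consider "\<sigma> > 1" | "0 \<le> \<sigma>" "\<sigma> \<le> 1" | "\<sigma> < 0" by linarith
    thus "I \<ge> c * (H * exp (- C / min H 1))"
    proof cases
      case 1
      have "c * (H * exp (- C / min H 1)) \<le> H / 200 * exp (- (200 * pi) / (min H 1 / 100))" by (rule le) (simp add: C_def)
      also have "\<dots> \<le> I" unfolding I_def by (rule lerch_mean_value_right) (use a \<beta> T H 1 in auto)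
      finally show ?thesis .
    next
      case 2
      have "c * (H * exp (- C / min H 1)) \<le> H / 200 * exp (- D / (min H 1 / 100))" by (rule le) (simp add: C_def)
      also have "\<dots> \<le> I" unfolding I_def by (rule strip) (use a \<beta> T H 2 \<sigma> in auto)
      finally show ?thesis .
    next
      case 3
      have l: "ln (ln T) \<ge> 95/100" by (rule ln_ln_ge(1)[OF T])
      \<comment> \<open>\<sigma> < 0 forces \<pi> H > 4 log log T >= 3.8 and so H >= 1; short
        intervals do not occur in this case.\<close>
      have "1 < pi * H / (4 * ln (ln T))" using \<sigma> 3 by linarith
      hence "4 * ln (ln T) < pi * H" using l by (simp add: less_divide_eq)
      moreover have "pi * H \<le> 63/20 * H" using H pi_approx by (intro mult_right_mono) auto
      ultimately have H1: "H \<ge> 1" using l by linarith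
      have "c * (H * exp (- C / min H 1)) \<le> k * (H * 1)" using c k C H by (intro mult_mono) (auto simp: c_def)
      also have "\<dots> \<le> I" unfolding I_def using left[OF a \<beta> T H1 3] by simp
      finally show ?thesis .
    qed
  qed
qed

text \<open>For H < 1 put y = ln (200/H). The power is at most exp (-(7/6) y/H), and H exp (-C/H) is
  at least exp (-y - C/H). Of the 7/6, one unit pays for y <= y/H, and the remaining sixth pays for
  C/H as soon as y >= 6 C. Otherwise 200/H < exp (6 C), so C/H is bounded by C exp (6 C), which is
  where the constant comes from.\<close>

lemma min_powr_le_exp:
  fixes C H \<epsilon> :: real
  assumes C: "C > 0" and H: "H > 0" and \<epsilon>: "0 < \<epsilon>" "\<epsilon> \<le> 1"
  shows "exp (- (C * exp (6 * C))) * min H ((H / 200) powr (7 / (6 * H * \<epsilon>))) \<le> H * exp (- C / min H 1)"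
proof (cases "H \<ge> 1")
  case True
  have "C * 1 \<le> C * exp (6 * C)" using C by (intro mult_left_mono) auto
  hence "exp (- (C * exp (6 * C))) * min H ((H / 200) powr (7 / (6 * H * \<epsilon>))) \<le> exp (- C) * H"
    using H by (intro mult_mono) auto
  thus ?thesis using True by (simp add: mult.commute)
next
  case False
  define y where "y = ln (200 / H)"
  have y: "y > 0" using H False by (simp add: y_def)
  have lnH: "ln H \<ge> - y" "ln (H / 200) = - y"
  proof -
    show 1: "ln (H / 200) = - y" using H by (simp add: y_def ln_div)
    have "ln (H / 200) \<le> ln H" using H by (intro ln_mono) auto
    thus "ln H \<ge> - y" using 1 by simp
  qed
  have "(H / 200) powr (7 / (6 * H * \<epsilon>)) \<le> (H / 200) powr (7 / (6 * H))"
  proof (rule powr_mono')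
    show "7 / (6 * H) \<le> 7 / (6 * H * \<epsilon>)" using H \<epsilon> by (intro divide_left_mono) (auto simp: mult_left_le)
  qed (use H False in auto)
  also have "\<dots> = exp (- (7 / 6 * (y / H)))" using H by (simp add: powr_def lnH(2))
  finally have p: "min H ((H / 200) powr (7 / (6 * H * \<epsilon>))) \<le> exp (- (7 / 6 * (y / H)))" by simp
  have yH: "y \<le> y / H" using y H False by (simp add: le_divide_eq mult_left_le)
  have g: "(y / 6 - C) / H \<ge> - (C * exp (6 * C))"
  proof (cases "y \<ge> 6 * C")
    case True
    hence "(y / 6 - C) / H \<ge> 0" using H by simp
    moreover have "C * exp (6 * C) > 0" using C by simp
    ultimately show ?thesis by linarith
  next
    case False
    have "200 / H = exp y" using H by (simp add: y_def)
    also have "\<dots> \<le> exp (6 * C)" using False by simp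
    finally have "C * (200 / H) \<le> C * exp (6 * C)" using C by (intro mult_left_mono) auto
    moreover have "C / H \<le> C * (200 / H)" using C H by (simp add: divide_right_mono)
    moreover have "(y / 6 - C) / H \<ge> - C / H" using y H by (intro divide_right_mono) auto
    ultimately show ?thesis by simp
  qed
  have "exp (- (C * exp (6 * C))) * min H ((H / 200) powr (7 / (6 * H * \<epsilon>))) \<le>
      exp (- (C * exp (6 * C))) * exp (- (7 / 6 * (y / H)))" by (intro mult_left_mono p) auto
  also have "\<dots> = exp (- (C * exp (6 * C)) - 7 / 6 * (y / H))" by (simp flip: exp_add)
  also have "\<dots> \<le> exp (ln H - C / H)"
  proof -
    have "(y / 6 - C) / H = 1 / 6 * (y / H) - C / H" by (simp add: diff_divide_distrib)
    thus ?thesis using g yH lnH(1) by (simp only: exp_le_cancel_iff)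
  qed
  also have "\<dots> = H * exp (- C / H)" using H by (simp add: exp_diff exp_minus divide_inverse)
  finally show ?thesis using False by simp
qed

theorem theorem3:
  shows "(\<exists>C>0. \<forall>\<alpha> T H \<epsilon> \<sigma> :: real.
            0 < \<alpha> \<longrightarrow> \<alpha> \<le> 1 \<longrightarrow> 16 \<le> T \<longrightarrow> 0 < H \<longrightarrow> 0 < \<epsilon> \<longrightarrow> \<epsilon> \<le> 1 \<longrightarrow>
            \<sigma> \<ge> 1 - pi * H * (1 - \<epsilon>) / (4 * ln (ln T)) \<longrightarrow>
            integral {T..T + H} (\<lambda>t. norm (hurwitz_zeta (Complex \<sigma> t) \<alpha>))
              \<ge> C * min H ((H / 200) powr (7 / (6 * H * \<epsilon>))))
       \<and> (\<exists>C>0. \<forall>\<alpha> \<beta> T H \<epsilon> \<sigma> :: real.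
            0 < \<alpha> \<longrightarrow> \<alpha> \<le> 1 \<longrightarrow> 0 < \<beta> \<longrightarrow> \<beta> \<le> 1 \<longrightarrow>
            16 \<le> T \<longrightarrow> 0 < H \<longrightarrow> 0 < \<epsilon> \<longrightarrow> \<epsilon> \<le> 1 \<longrightarrow>
            \<sigma> \<ge> 1 - pi * H * (1 - \<epsilon>) / (4 * ln (ln T)) \<longrightarrow>
            integral {T..T + H} (\<lambda>t. norm (lerch_phi \<alpha> \<beta> (Complex \<sigma> t)))
              \<ge> C * min H ((H / 200) powr (7 / (6 * H * \<epsilon>))))"
proof -
  obtain c C where c: "c > 0" "C > 0" and mv:
    "\<And>a \<beta> T H \<sigma>. 0 < a \<Longrightarrow> a \<le> 1 \<Longrightarrow> 0 < \<beta> \<Longrightarrow> \<beta> \<le> 1 \<Longrightarrow> T \<ge> 16 \<Longrightarrow> 0 < H \<Longrightarrow>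
       \<sigma> \<ge> 1 - pi * H / (4 * ln (ln T)) \<Longrightarrow>
       integral {T..T + H} (\<lambda>t. norm (lerch_phi a \<beta> (Complex \<sigma> t))) \<ge> c * (H * exp (- C / min H 1))"
    using lerch_mean_value by blast
  define k where "k = c * exp (- (C * exp (6 * C)))"
  have k: "k > 0" using c by (simp add: k_def)
  have main: "k * min H ((H / 200) powr (7 / (6 * H * \<epsilon>))) \<le> integral {T..T + H} (\<lambda>t. norm (lerch_phi \<alpha> \<beta> (Complex \<sigma> t)))"
    if "0 < \<alpha>" "\<alpha> \<le> 1" "0 < \<beta>" "\<beta> \<le> 1" "16 \<le> T" "0 < H" "0 < \<epsilon>" "\<epsilon> \<le> 1"
      "\<sigma> \<ge> 1 - pi * H * (1 - \<epsilon>) / (4 * ln (ln T))" for \<alpha> \<beta> T H \<epsilon> \<sigma>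
  proof -
    have "pi * H * (1 - \<epsilon>) / (4 * ln (ln T)) \<le> pi * H / (4 * ln (ln T))"
      using that ln_ln_ge[OF that(5)] by (intro divide_right_mono mult_left_le) auto
    hence \<sigma>: "\<sigma> \<ge> 1 - pi * H / (4 * ln (ln T))" using that(9) by linarith
    have "k * min H ((H / 200) powr (7 / (6 * H * \<epsilon>))) \<le> c * (H * exp (- C / min H 1))"
      using mult_left_mono[OF min_powr_le_exp[OF c(2) that(6-8)], of c] c(1) by (simp only: k_def mult.assoc less_imp_le)
    also have "\<dots> \<le> integral {T..T + H} (\<lambda>t. norm (lerch_phi \<alpha> \<beta> (Complex \<sigma> t)))"
      by (rule mv[OF that(1-6) \<sigma>])
    finally show ?thesis .
  qed
  show ?thesis
    unfolding hurwitz_zeta_eq_lerch_phi using k main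
    by (intro conjI exI[of _ k] allI impI) auto
qed

end
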